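(* Let $\varepsilon,\delta>0$ be fixed constants, let $u_->u_+$ be real numbers, and assume $\frac14<\frac{\delta(u_--u_+)}{2\varepsilon^2}<\frac12$. Let $\sigma=\frac{u_-+u_+}{2}$, let $\tilde u$ be the associated non-monotone viscous-dispersive shock connecting $u_-$ and $u_+$ with $\tilde u(0)=\frac{u_-+u_+}{2}$, let $\tilde u^\nu(x)=\tilde u(x/\nu)$, and let $\bar u(y)=u_-$ for $y<0$, $\bar u(y)=u_+$ for $y>0$. For $\nu>0$ consider the scaled equation $$(u^\nu)_t+\Big(\frac{(u^\nu)^2}{2}\Big)_x=\nu\varepsilon(u^\nu)_{xx}-\nu^2\delta(u^\nu)_{xxx}.\qquad ( * )$$ (1) Let $u_0$ satisfy $u_0-\tilde u\in H^1(\mathbb R)$ and let $u^\nu$ be the solution to $( * )$ with initial data $u^\nu(0,x)=u_0(x/\nu)$. Then there is a constant $C>0$, independent of $t$ and $\nu$, such that for any $t>0$, $$\|u^\nu(t,\cdot)-\bar u(\cdot-\sigma t-Y_\nu(t))\|_{L^2(\mathbb R)}\le\|u_0-\bar u\|_{L^2(\mathbb R)}+C\sqrt\nu,$$ where $Y_\nu(t)=\nu X(t/\nu)$ and $X$ is the shift function associated with $\tilde u$ and $u_0$ (defined in the context). (2) Let $u^0$ be any initial datum with $\mathcal E_0:=\int_{\mathbb R}(u^0-\bar u)^2dx<\infty$. Then: (i) There exists a sequence of smooth functions $\{u_0^\nu\}_{\nu>0}$ on $\mathbb R$ (with $u_0^\nu-\underline u\in H^1(\mathbb R)$) such that $$\lim_{\nu\to0}u_0^\nu=u^0\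 \text{ a.e.},\qquad \lim_{\nu\to0}\int_{\mathbb R}(u_0^\nu-\tilde u^\nu)^2dx=\mathcal E_0 .$$ (ii) For any given $T>0$ and any $\nu>0$, let $u^\nu$ be the solution in $\mathcal X_T$ to $( * )$ with initial data $u_0^\nu$. Then there exists $u_\infty\in L^\infty(0,T;L^2_{loc}(\mathbb R))$ such that, up to a subsequence, $u^\nu\rightharpoonup u_\infty$ in $L^\infty(0,T;L^2_{loc}(\mathbb R))$ as $\nu\to0$. (iii) There exist a function $X_\infty\in BV(0,T)$ and a constant $C>0$ (which may depend on $u_\pm$ and $T$ but not on $\mathcal E_0$) such that for a.e. $t\in(0,T)$, $$\frac12\int_{\mathbb R}\big(u_\infty(t,x)-\bar u(x-\sigma t-X_\infty(t))\big)^2dx\le C\mathcal E_0 .$$ (iv) Moreover, $X_\infty$ satisfies, for a.e. $t\in(0,T)$, $$|X_\infty(t)|\le\frac{C(T)}{u_--u_+}\big(\mathcal E_0+\sqrt{\mathcal E_0}\big),$$ with $C(T)>0$ independent of $\mathcal E_0$. Therefore, entropy shocks are stable and unique in the class of zero viscosity-dispersion limits of solutions to $( * )$: the estimates in (iii) and (iv) hold, and if $\mathcal E_0=0$ then $u_\infty(t,x)=\bar u(x-\sigma t)$ for a.e. $(t,x)$.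
   Context: Viscous-dispersive shock: a smooth function $\tilde u=\tilde u(\xi)$ solving $-\sigma\tilde u'+(\frac12\tilde u^2)'=\varepsilon\tilde u''-\delta\tilde u'''$ with $\lim_{\xi\to\pm\infty}\tilde u(\xi)=u_\pm$ and $\lim_{\xi\to\pm\infty}\tilde u'(\xi)=0$; it exists and is unique up to translation. Entropy (Riemann) shock: $\bar u(x-\sigma t)$ is the entropy shock of the inviscid Burgers equation $u_t+(u^2/2)_x=0$ connecting $u_-$ and $u_+$. Solution class: let $\underline u$ be a smooth monotone function with $\underline u(x)=u_-$ for $x\le-1$ and $\underline u(x)=u_+$ for $x\ge1$; $\mathcal X_T$ is the set of $u:\mathbb R^+\times\mathbb R\to\mathbb R$ with $u-\underline u\in C([0,T];H^1(\mathbb R))\cap L^2(0,T;H^2(\mathbb R))$. For initial data differing from $\underline u$ by an $H^1(\mathbb R)$ function, the equation (for each $\nu>0$) has a unique global solution lying in $\mathcal X_T$ for every $T>0$; "the solution" refers to it. Shift function in (1): fix a constant $M\ge\frac43$. Let $u$ be the solution of $u_t+(u^2/2)_x=\varepsilon u_{xx}-\delta u_{xxx}$ with $u(0,\cdot)=u_0$. Then $X$ is the Lipschitz function with $X(0)=0$ and $$\dot X(t)=-\frac{2M}{u_--u_+}\int_{\mathbb R}\big(u(t,x+X(t))-\tilde u(x-\sigma t)\big)\tilde u'(x-\sigma t)\,dx .$$ Convergence $u^\nu\rightharpoonup u_\infty$ in $L^\infty(0,T;L^2_{loc}(\mathbb R))$ is weak-$*$ convergence, i.e. $\int_0^T\!\int_K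 u^\nu\varphi\,dx\,dt\to\int_0^T\!\int_K u_\infty\varphi\,dx\,dt$ for every compact $K\subset\mathbb R$ and $\varphi\in L^1(0,T;L^2(K))$. *)

theory Defs
  imports "HOL-Analysis.Analysis"
begin

text \<open>
  Infinite differentiability: all iterated directional derivatives exist and are differentiable
  in the sense of Frechet (on a finite-dimensional space, this is the class of smooth functions).
\<close>

coinductive smooth :: "('a::euclidean_space \<Rightarrow> real) \<Rightarrow> bool" where
  "(\<And>x. (f has_derivative f' x) (at x)) \<Longrightarrow> (\<And>v. smooth (\<lambda>x. f' x v)) \<Longrightarrow> smooth f"

definition test_function :: "'a::euclidean_space set \<Rightarrow> ('a \<Rightarrow> real) \<Rightarrow> bool" where
  "test_function U \<phi> \<longleftrightarrow>
     smooth \<phi> \<and> compact (closure {x. \<phi> x \<noteq> 0}) \<and> closure {x. \<phi> x \<noteq> 0} \<subseteq> U"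

definition in_L2 :: "real set \<Rightarrow> (real \<Rightarrow> real) \<Rightarrow> bool" where
  "in_L2 S f \<longleftrightarrow> f \<in> borel_measurable (lebesgue_on S) \<and> integrable (lebesgue_on S) (\<lambda>x. (f x)\<^sup>2)"

definition L2_norm :: "real set \<Rightarrow> (real \<Rightarrow> real) \<Rightarrow> real" where
  "L2_norm S f = sqrt (integral\<^sup>L (lebesgue_on S) (\<lambda>x. (f x)\<^sup>2))"

definition has_weak_deriv :: "nat \<Rightarrow> (real \<Rightarrow> real) \<Rightarrow> (real \<Rightarrow> real) \<Rightarrow> bool" where
  "has_weak_deriv i f g \<longleftrightarrow>
     (\<forall>K. compact K \<longrightarrow> f absolutely_integrable_on K \<and> g absolutely_integrable_on K) \<and>
     (\<forall>\<phi>. test_function UNIV \<phi> \<longrightarrow>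
        (LINT x|lebesgue. f x * (deriv ^^ i) \<phi> x) = (-1) ^ i * (LINT x|lebesgue. g x * \<phi> x))"

text \<open>The chosen weak derivative is determined almost everywhere whenever one exists.\<close>

definition weak_deriv :: "nat \<Rightarrow> (real \<Rightarrow> real) \<Rightarrow> real \<Rightarrow> real" where
  "weak_deriv i f = (SOME g. has_weak_deriv i f g)"

definition in_H :: "nat \<Rightarrow> (real \<Rightarrow> real) \<Rightarrow> bool" where
  "in_H k f \<longleftrightarrow> (\<forall>i\<le>k. \<exists>g. has_weak_deriv i f g \<and> in_L2 UNIV g)"

definition H_norm :: "nat \<Rightarrow> (real \<Rightarrow> real) \<Rightarrow> real" where
  "H_norm k f = sqrt (\<Sum>i\<le>k. (L2_norm UNIV (weak_deriv i f))\<^sup>2)"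

definition in_C_H :: "real \<Rightarrow> nat \<Rightarrow> (real \<Rightarrow> real \<Rightarrow> real) \<Rightarrow> bool" where
  "in_C_H T k v \<longleftrightarrow>
     (\<forall>t\<in>{0..T}. in_H k (v t)) \<and>
     (\<forall>s\<in>{0..T}. ((\<lambda>t. H_norm k (\<lambda>x. v t x - v s x)) \<longlongrightarrow> 0) (at s within {0..T}))"

text \<open>
  Strong (Bochner) measurability of \<open>v : (0,T) \<rightarrow> H\<^sup>k\<close>: almost everywhere limit of simple functions.
\<close>

definition strongly_measurable_H :: "real \<Rightarrow> nat \<Rightarrow> (real \<Rightarrow> real \<Rightarrow> real) \<Rightarrow> bool" where
  "strongly_measurable_H T k v \<longleftrightarrow>
     (\<exists>s :: nat \<Rightarrow> real \<Rightarrow> real \<Rightarrow> real.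
        (\<forall>n. finite (range (s n)) \<and> (\<forall>w. {t \<in> {0<..<T}. s n t = w} \<in> sets lebesgue) \<and>
             (\<forall>t. in_H k (s n t))) \<and>
        (AE t in lebesgue_on {0<..<T}. (\<lambda>n. H_norm k (\<lambda>x. s n t x - v t x)) \<longlonglongrightarrow> 0))"

definition in_L2_H :: "real \<Rightarrow> nat \<Rightarrow> (real \<Rightarrow> real \<Rightarrow> real) \<Rightarrow> bool" where
  "in_L2_H T k v \<longleftrightarrow>
     strongly_measurable_H T k v \<and>
     (AE t in lebesgue_on {0<..<T}. in_H k (v t)) \<and>
     integrable (lebesgue_on {0<..<T}) (\<lambda>t. (H_norm k (v t))\<^sup>2)"

definition in_Linf_L2loc :: "real \<Rightarrow> (real \<Rightarrow> real \<Rightarrow> real) \<Rightarrow> bool" where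
  "in_Linf_L2loc T u \<longleftrightarrow>
     (\<lambda>(t, x). u t x) \<in> borel_measurable (lebesgue_on ({0<..<T} \<times> UNIV)) \<and>
     (\<forall>K. compact K \<longrightarrow>
        (\<exists>B. AE t in lebesgue_on {0<..<T}. in_L2 K (u t) \<and> L2_norm K (u t) \<le> B))"

definition in_L1_L2 :: "real \<Rightarrow> real set \<Rightarrow> (real \<Rightarrow> real \<Rightarrow> real) \<Rightarrow> bool" where
  "in_L1_L2 T K \<phi> \<longleftrightarrow>
     (\<lambda>(t, x). \<phi> t x) \<in> borel_measurable (lebesgue_on ({0<..<T} \<times> K)) \<and>
     (AE t in lebesgue_on {0<..<T}. in_L2 K (\<phi> t)) \<and>
     integrable (lebesgue_on {0<..<T}) (\<lambda>t. L2_norm K (\<phi> t))"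

text \<open>
  The integrals are iterated because an element of \<open>C([0,T]; H\<^sup>1)\<close> is only given up to a null set
  for each time, so that joint measurability of the chosen representatives is not available.
\<close>

definition weak_star_tendsto ::
  "real \<Rightarrow> (nat \<Rightarrow> real \<Rightarrow> real \<Rightarrow> real) \<Rightarrow> (real \<Rightarrow> real \<Rightarrow> real) \<Rightarrow> bool" where
  "weak_star_tendsto T w v \<longleftrightarrow>
     (\<forall>K \<phi>. compact K \<and> in_L1_L2 T K \<phi> \<longrightarrow>
        (\<lambda>k. LINT t:{0<..<T}|lebesgue. LINT x:K|lebesgue. w k t x * \<phi> t x)
          \<longlonglongrightarrow> (LINT t:{0<..<T}|lebesgue. LINT x:K|lebesgue. v t x * \<phi> t x))"

text \<open>Bounded variation in the sense of distributions: \<open>X\<close> is in \<open>L\<^sup>1(0,T)\<close> and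
  \<open>sup {\<integral> X \<phi>' | \<phi> \<in> C\<^sub>c\<^sup>\<infinity>(0,T), |\<phi>| \<le> 1}\<close> is finite.\<close>

definition in_BV :: "real \<Rightarrow> (real \<Rightarrow> real) \<Rightarrow> bool" where
  "in_BV T X \<longleftrightarrow>
     integrable (lebesgue_on {0<..<T}) X \<and>
     (\<exists>V. \<forall>\<phi>. test_function {0<..<T} \<phi> \<and> (\<forall>t. \<bar>\<phi> t\<bar> \<le> 1) \<longrightarrow>
        (LINT t:{0<..<T}|lebesgue. X t * deriv \<phi> t) \<le> V)"

definition viscous_dispersive_shock ::
  "real \<Rightarrow> real \<Rightarrow> real \<Rightarrow> real \<Rightarrow> real \<Rightarrow> (real \<Rightarrow> real) \<Rightarrow> bool" where
  "viscous_dispersive_shock \<epsilon> \<delta> \<sigma> um up ut \<longleftrightarrow>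
     smooth ut \<and>
     (\<forall>\<xi>. - \<sigma> * deriv ut \<xi> + deriv (\<lambda>y. (ut y)\<^sup>2 / 2) \<xi>
            = \<epsilon> * (deriv ^^ 2) ut \<xi> - \<delta> * (deriv ^^ 3) ut \<xi>) \<and>
     (ut \<longlongrightarrow> um) at_bot \<and> (ut \<longlongrightarrow> up) at_top \<and>
     (deriv ut \<longlongrightarrow> 0) at_bot \<and> (deriv ut \<longlongrightarrow> 0) at_top"

text \<open>The value at \<open>0\<close> is immaterial: all uses are up to null sets.\<close>

definition entropy_shock :: "real \<Rightarrow> real \<Rightarrow> real \<Rightarrow> real" where
  "entropy_shock um up y = (if y < 0 then um else up)"

definition reference_profile :: "real \<Rightarrow> real \<Rightarrow> (real \<Rightarrow> real) \<Rightarrow> bool" where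
  "reference_profile um up ul \<longleftrightarrow>
     smooth ul \<and> (mono ul \<or> antimono ul) \<and> (\<forall>x\<le>-1. ul x = um) \<and> (\<forall>x\<ge>1. ul x = up)"

definition in_X :: "(real \<Rightarrow> real) \<Rightarrow> real \<Rightarrow> (real \<Rightarrow> real \<Rightarrow> real) \<Rightarrow> bool" where
  "in_X ul T u \<longleftrightarrow>
     in_C_H T 1 (\<lambda>t x. u t x - ul x) \<and> in_L2_H T 2 (\<lambda>t x. u t x - ul x)"

text \<open>
  Global solution of \<open>u\<^sub>t + (u\<^sup>2/2)\<^sub>x = a u\<^sub>x\<^sub>x - b u\<^sub>x\<^sub>x\<^sub>x\<close> with initial value \<open>v\<close>. The regularity
  in \<open>in_X\<close> leaves \<open>u\<^sub>x\<^sub>x\<^sub>x\<close> a distribution, so the equation is understood in the sense of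
  distributions on \<open>(0,\<infinity>) \<times> \<real>\<close>; the initial value is attained by continuity in time.
\<close>

definition global_solution ::
  "(real \<Rightarrow> real) \<Rightarrow> real \<Rightarrow> real \<Rightarrow> (real \<Rightarrow> real) \<Rightarrow> (real \<Rightarrow> real \<Rightarrow> real) \<Rightarrow> bool" where
  "global_solution ul a b v u \<longleftrightarrow>
     (\<forall>T>0. in_X ul T u) \<and>
     (AE x in lebesgue. u 0 x = v x) \<and>
     (\<forall>\<phi> :: real \<times> real \<Rightarrow> real. test_function ({0<..} \<times> UNIV) \<phi> \<longrightarrow>
        (LINT t:{0<..}|lebesgue. LINT x|lebesgue.
            u t x * deriv (\<lambda>s. \<phi> (s, x)) t
          + (u t x)\<^sup>2 / 2 * deriv (\<lambda>y. \<phi> (t, y)) x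
          + a * u t x * (deriv ^^ 2) (\<lambda>y. \<phi> (t, y)) x
          + b * u t x * (deriv ^^ 3) (\<lambda>y. \<phi> (t, y)) x) = 0)"

definition scaled_solution ::
  "(real \<Rightarrow> real) \<Rightarrow> real \<Rightarrow> real \<Rightarrow> real \<Rightarrow> (real \<Rightarrow> real) \<Rightarrow> (real \<Rightarrow> real \<Rightarrow> real) \<Rightarrow> bool" where
  "scaled_solution ul \<epsilon> \<delta> \<nu> v u \<longleftrightarrow> global_solution ul (\<nu> * \<epsilon>) (\<nu>\<^sup>2 * \<delta>) v u"

definition shift_function ::
  "real \<Rightarrow> real \<Rightarrow> real \<Rightarrow> real \<Rightarrow> (real \<Rightarrow> real) \<Rightarrow> (real \<Rightarrow> real \<Rightarrow> real) \<Rightarrow> (real \<Rightarrow> real) \<Rightarrow> bool" where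
  "shift_function M \<sigma> um up ut u X \<longleftrightarrow>
     (\<exists>L. L-lipschitz_on {0..} X) \<and> X 0 = 0 \<and>
     (AE t in lebesgue_on {0..}.
        (X has_real_derivative
           - (2 * M / (um - up)) *
             (LINT x|lebesgue. (u t (x + X t) - ut (x - \<sigma> * t)) * deriv ut (x - \<sigma> * t))) (at t))"

definition well_prepared ::
  "real \<Rightarrow> real \<Rightarrow> (real \<Rightarrow> real) \<Rightarrow> (real \<Rightarrow> real) \<Rightarrow> (real \<Rightarrow> real) \<Rightarrow> (real \<Rightarrow> real \<Rightarrow> real) \<Rightarrow> bool" where
  "well_prepared um up ul ut u0 v \<longleftrightarrow>
     (\<forall>\<nu>>0. smooth (v \<nu>) \<and> in_H 1 (\<lambda>x. v \<nu> x - ul x)) \<and>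
     (AE x in lebesgue. ((\<lambda>\<nu>. v \<nu> x) \<longlongrightarrow> u0 x) (at_right 0)) \<and>
     ((\<lambda>\<nu>. LINT x|lebesgue. (v \<nu> x - ut (x / \<nu>))\<^sup>2)
        \<longlongrightarrow> (LINT x|lebesgue. (u0 x - entropy_shock um up x)\<^sup>2)) (at_right 0)"

definition vanishing_limit ::
  "real \<Rightarrow> (real \<Rightarrow> real \<Rightarrow> real \<Rightarrow> real) \<Rightarrow> (real \<Rightarrow> real \<Rightarrow> real) \<Rightarrow> bool" where
  "vanishing_limit T u w \<longleftrightarrow>
     in_Linf_L2loc T w \<and>
     (\<exists>\<nu> :: nat \<Rightarrow> real. (\<forall>k. \<nu> k > 0) \<and> \<nu> \<longlonglongrightarrow> 0 \<and> weak_star_tendsto T (\<lambda>k. u (\<nu> k)) w)"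

end

(* Barriers in the phase plane of the profile make explicit functions satisfy the Riccati inequality of the
   operator linearised at the profile, one function on each half line; completing the square with them gives a
   spectral inequality, in which the dissipation dominates up to a rank-one term in the direction ut'. Moving the
   profile by the shift X, whose velocity is exactly the L^2 pairing with ut', pays for that rank-one term, so the
   L^2 distance of any solution to the shifted profile does not increase and the decrease controls the integral of
   X'^2.

   Solutions are only weak, so the energy identity is proved for their mollifications in space and the mollification
   is removed at the end; the shift exists because its speed is Lipschitz in the shift (Picard iteration). Energy
   estimates also give uniqueness of solutions, which turns the parabolic rescaling into an identity between the
   solution at scale nu and the unscaled one: the profile differs from the entropy shock by O(sqrt nu) in L^2.

   In the limit nu -> 0 the deviations from the shifted shocks and the shift velocities are bounded in L^2, hence
   weakly compact. The shifts converge pointwise, being primitives of the velocities, so the shocks converge strongly,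
   and lower semicontinuity of the norm on time slices gives the bounds for the limit. *)
theory Submission
  imports Defs "HOL-Computational_Algebra.Polynomial" "HOL-Library.Diagonal_Subsequence"
begin

text \<open>With the jump normalised so that \<open>v\<close> runs from 1 to -1, the profile solves
  \<open>v' = p\<close>, \<open>k*p' = p + y\<close>, \<open>y = (1 - v^2)/2\<close>. At
  \<open>v = 1\<close> the characteristic equation is \<open>k*r^2 - r + 1 = 0\<close>: for
  \<open>k > 1/4\<close> the left state is a focus, the profile oscillates around it, and neither
  \<open>p\<close> nor \<open>y\<close> has a sign there. This defeats the Riccati function
  \<open>-y/(2*v)\<close>, whose Riccati expression is \<open>(p^2 - (p + y)^2)/(4*v^2)\<close>. The
  correction \<open>R\<close> in \<open>h1\<close> repairs it, since \<open>R'\<close> contains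
  \<open>2/3*(p + y)^2\<close>, and the energy \<open>E\<close> confines the oscillation so closely
  to \<open>v = 1\<close> that numerical bounds with \<open>k < 1/2\<close> suffice. Both half-line
  estimates require a perturbation vanishing at the zero of \<open>v\<close>, where
  \<open>-y/(2*v)\<close> has its pole; the value of a general perturbation at this point is what
  produces the rank-one term.

  The second obstacle is regularity: third derivatives of solutions are only distributions, so the
  energy is computed for mollified solutions. The commutator of mollification with the quadratic
  flux is O(e) in L2 because the oscillation of an H1 function at scale \<open>e\<close> has L2 norm
  O(e).\<close>

notation (input) tendsto (infixr "--->" 55)
notation (input) LIMSEQ (infixr "---->" 60)
abbreviation (input) aeL (binder "ae " 10) where "aeL P == (AE x in lborel. P x)"
abbreviation (input) "bm f == f \<in> borel_measurable borel"
abbreviation (input) "cont == continuous_on UNIV"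
abbreviation (input) "intg == integrable lborel"
abbreviation (input) "es == entropy_shock"
abbreviation (input) "testf == test_function UNIV"
lemmas bm_cont = borel_measurable_continuous_onI
lemmas int_cong = Bochner_Integration.integral_cong
lemmas int_bound = Bochner_Integration.integrable_bound
lemmas real_vector_deriv = has_real_derivative_iff_has_vector_derivative

section \<open>Last and first zeros, one-sided derivative signs\<close>

lemma DERIV_cont: "(!!x. DERIV f x :> f' x) ==> continuous_on A f"
 by (intro continuous_at_imp_continuous_on ballI) (rule DERIV_isCont)

text \<open>Serves the barrier arguments: a function positive after its last zero has a nonnegative
  derivative there, and this is played against the sign that the differential equation
  prescribes.\<close>

lemma last_zero:
 fixes f :: "real => real"
 assumes "continuous_on {a..b} f" "a <= b" "f a <= 0" "f b > 0"
 shows "EX c. a <= c & c < b & f c = 0 & (ALL t. c < t & t <= b --> f t > 0)"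
proof -
 let ?S = "{t \<in> {a..b}. f t = 0}"
 have cl: "closed ?S"
  using continuous_closed_preimage_constant[OF assms(1), of 0] by simp
 have cS: "compact ?S"
  using compact_Int_closed[OF compact_Icc cl, of a b] by (simp add: Int_absorb1 subset_eq)
 have ne: "?S ~= {}"
  using IVT'[of f a 0 b] assms by auto
 obtain c where c: "c \<in> ?S" "!!t. t \<in> ?S ==> t <= c"
  using compact_attains_sup[OF cS ne] by auto
 show ?thesis
 proof (intro exI conjI allI impI)
  show "a <= c" "f c = 0" using c by auto
  show "c < b" using c assms(4) by (auto simp: less_le)
  fix t assume t: "c < t & t <= b"
  show "f t > 0"
  proof (rule ccontr)
   assume "~ f t > 0"
   moreover have "continuous_on {t..b} f"
    by (rule continuous_on_subset[OF assms(1)]) (use t c in auto)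
   ultimately obtain u where "t <= u" "u <= b" "f u = 0"
    using IVT'[of f t 0 b] assms t by auto
   with c(2)[of u] t c(1) show False by auto
  qed
 qed
qed

lemma first_zero:
 fixes f :: "real => real"
 assumes "continuous_on {a..b} f" "a <= b" "f a > 0" "f b <= 0"
 shows "EX c. a < c & c <= b & f c = 0 & (ALL t. a <= t & t < c --> f t > 0)"
proof -
 have "continuous_on {-b..-a} (%x. f (- x))"
  by (rule continuous_on_compose2[OF assms(1)]) (auto intro!: continuous_intros)
 then obtain c where c: "-b <= c" "c < -a" "f (- c) = 0" "ALL t. c < t & t <= -a --> f (-t) > 0"
  using last_zero[of "-b" "-a" "%x. f (- x)"] assms by auto
 show ?thesis
  by (rule exI[of _ "-c"]) (use c(1-3) c(4)[rule_format, of "- _"] in auto)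
qed

lemma has_real_derivative_nonneg_right:
 fixes f :: "real => real"
 assumes "DERIV f c :> d" "c < b" "!!t. c < t ==> t <= b ==> f c <= f t"
 shows "d >= 0"
proof (rule ccontr)
 assume "~ ?thesis"
 then obtain e where e: "e > 0" "!!h. 0 < h ==> h < e ==> f (c + h) < f c"
  using DERIV_neg_dec_right[OF assms(1)] by auto
 define h where "h = min (e/2) (b - c)"
 have "0 < h" "h < e" "c + h <= b" using e assms by (auto simp: h_def min_def)
 with e(2)[of h] assms(3)[of "c+h"] show False by auto
qed

lemma has_real_derivative_nonpos_left:
 fixes f :: "real => real"
 assumes "DERIV f c :> d" "a < c" "!!t. a <= t ==> t < c ==> f c <= f t"
 shows "d <= 0"
proof (rule ccontr)
 assume "~ ?thesis"
 then obtain e where e: "e > 0" "!!h. 0 < h ==> h < e ==> f (c - h) < f c"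
  using DERIV_pos_inc_left[OF assms(1)] by auto
 define h where "h = min (e/2) (c - a)"
 have "0 < h" "h < e" "a <= c - h" using e assms by (auto simp: h_def min_def)
 with e(2)[of h] assms(3)[of "c-h"] show False by auto
qed

section \<open>Phase plane of the normalised profile\<close>

locale shock_profile =
 fixes k :: real and v p :: "real => real"
 assumes k: "1/4 < k" "k < 1/2"
  and v': "!!s. DERIV v s :> p s"
  and p': "!!s. DERIV p s :> (p s + (1 - (v s)^2) / 2) / k"
  and v_bot: "(v ---> 1) at_bot" and v_top: "(v ---> -1) at_top"
  and p_bot: "(p ---> 0) at_bot" and p_top: "(p ---> 0) at_top"
  and v0: "v 0 = 0"
  and osc: "EX s. p s > 0"
begin

definition "y s = (1 - (v s)^2) / 2"
text \<open>Mechanical energy of the oscillator \<open>k*v'' = v' + y\<close>. The cubic is the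
  potential, a primitive of \<open>-y\<close> with respect to \<open>v\<close> that vanishes at the
  left state; the term \<open>v'\<close> acts as negative friction, whence growth at rate
  \<open>p^2\<close>.\<close>

definition "E s = k*(p s)^2 / 2 + (v s - 1)^2*(v s + 2) / 6"

lemma y': "DERIV y s :> - v s * p s"
 unfolding y_def by (auto intro!: derivative_eq_intros v')

lemma p'y: "DERIV p s :> (p s + y s) / k"
 using p'[of s] by (simp add: y_def)

lemma E': "DERIV E s :> (p s)^2"
 unfolding E_def
 by (rule derivative_eq_intros p'y v' refl | simp)+
  (use k in "simp add: y_def field_simps power2_eq_square")

lemma cont [continuous_intros]: "continuous_on A v" "continuous_on A p" "continuous_on A y"
 using v' p'y y' by (meson DERIV_isCont continuous_at_imp_continuous_on)+

text \<open>Below -1 the slope cannot be positive: going back in time \<open>p\<close> could reach 0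
  only where \<open>y >= 0\<close>, but \<open>v\<close> is still smaller there and
  \<open>y < 0\<close>. So \<open>p\<close> would be positive on a whole left half-line and
  \<open>v\<close> could not come down from 1. Hence \<open>v\<close>, once below -1, keeps
  decreasing and misses its limit.\<close>

lemma v_ge: "v s >= -1"
proof (rule ccontr)
 assume "~ ?thesis"
 hence s: "v s < -1" by simp
 have neg: "p t <= 0" if t: "v t < -1" for t
 proof (rule ccontr)
  assume "~ ?thesis"
  hence pt: "p t > 0" by simp
  have pos: "p r > 0" if r: "r <= t" for r
  proof (rule ccontr)
   assume "~ ?thesis"
   then obtain c where c: "r <= c" "c < t" "p c = 0" "!!q. c < q ==> q <= t ==> p q > 0"
    using last_zero[OF cont(2), of r t] r pt by (meson not_le)
   have "(p c + y c) / k >= 0"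
    by (rule has_real_derivative_nonneg_right[OF p'y c(2)]) (use c in "auto simp: less_imp_le")
   hence "y c >= 0" using c k by (simp add: zero_le_divide_iff)
   moreover have "v c <= v t"
    by (rule deriv_nonneg_imp_mono[OF v']) (use c in "auto simp: le_less")
   moreover have "1 < (v c)^2" if "v c <= v t"
    using one_less_power[of "- v c" 2] that t by simp
   ultimately show False by (simp add: y_def)
  qed
  have "v r <= v t" if "r <= t" for r
   by (rule deriv_nonneg_imp_mono[OF v']) (use that pos in "auto intro!: less_imp_le")
  hence "1 <= v t"
   by (intro tendsto_upperbound[OF v_bot]) (auto simp: eventually_at_bot_linorder)
  with t show False by simp
 qed
 \<comment> \<open>Any level strictly between \<open>v s\<close> and -1 serves: \<open>v\<close>
   never climbs back to it.\<close>
 define l where "l = (v s - 1) / 2"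
 have l: "v s < l" "l < -1" using s by (auto simp: l_def)
 have "v r < l" if r: "r >= s" for r
 proof (rule ccontr)
  assume "~ ?thesis"
  moreover have "continuous_on {s..r} (%t. l - v t)" by (intro continuous_intros)
  ultimately obtain c where c: "s < c" "c <= r" "l - v c = 0" "ALL t. s <= t & t < c --> l - v t > 0"
   using first_zero[of s r "%t. l - v t"] r l by auto
  have "v c <= v s"
   by (rule deriv_nonpos_imp_antimono[OF v']) (use c l in "auto intro!: neg", smt (verit))
  with c l show False by simp
 qed
 hence "-1 <= l"
  by (intro tendsto_upperbound[OF v_top])
   (auto simp: eventually_at_top_linorder intro!: exI[of _ s] less_imp_le)
 with l show False by simp
qed

text \<open>Touching -1 is a minimum, so \<open>p\<close> vanishes too and the orbit would reach the
  equilibrium (-1, 0) in finite time. Gronwall backwards excludes this: \<open>C\<close> exceeds the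
  logarithmic decay rate of the squared distance to the equilibrium, so the weighted distance
  \<open>N\<close> is nondecreasing and cannot drop from a positive value to 0.\<close>

lemma v_gt: "v s > -1"
proof (rule ccontr)
 assume "~ ?thesis"
 hence vs: "v s = -1" using v_ge[of s] by simp
 have ps: "p s = 0"
  by (rule DERIV_local_min[OF v', of 1]) (use v_ge vs in auto)
 have "eventually (%r. v r > 0) at_bot"
  using order_tendstoD(1)[OF v_bot, of 0] by simp
 then obtain r where r: "v r > 0" "r < s"
  unfolding eventually_at_bot_linorder by (metis lt_ex min_less_iff_conj order_less_imp_le)
 have "bounded (v ` {r..s})"
  by (intro compact_imp_bounded compact_continuous_image continuous_intros) auto
 then obtain K where K: "!!t. t \<in> {r..s} ==> abs (v t) <= K"
  unfolding bounded_iff by (metis image_eqI real_norm_def)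
 define C where "C = 1 + 2 / k + (1 + K) / k"
 define N where "N t = ((v t + 1)^2 + (p t)^2)*exp (C*t)" for t
 have "N r <= N s"
 proof (rule DERIV_nonneg_imp_nondecreasing[of r s N])
  fix t assume t: "r <= t" "t <= s"
  let ?d = "2*(v t + 1)*p t + 2*p t*((p t + y t) / k) + C*((v t + 1)^2 + (p t)^2)"
  have 1: "DERIV N t :> ?d*exp (C*t)"
   unfolding N_def
   by (rule derivative_eq_intros v' p'y refl)+ (simp add: algebra_simps)
  have ab: "abs (2*p t*(v t + 1)) <= (v t + 1)^2 + (p t)^2"
   using sum_squares_bound[of "abs (v t + 1)" "abs (p t)"] unfolding abs_mult
   by (simp only: power2_abs mult_ac abs_numeral)
  hence a: "2*(v t + 1)*p t >= - ((v t + 1)^2 + (p t)^2)"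
   by (simp add: abs_le_iff mult_ac)
  have "abs ((1 - v t)*(2*p t*(v t + 1))) <= (1 + K)*((v t + 1)^2 + (p t)^2)"
   unfolding abs_mult[of "1 - v t"]
   by (intro mult_mono) (use K[of t] t ab in "auto simp: abs_le_iff")
  hence b0: "2*p t*y t >= - ((1 + K)*((v t + 1)^2 + (p t)^2))"
   using K[of t] t by (simp add: y_def abs_le_iff power2_eq_square algebra_simps)
  have b: "2*p t*y t / k >= - ((1 + K)*((v t + 1)^2 + (p t)^2)) / k"
   by (rule divide_right_mono[OF b0]) (use k in auto)
  have e: "?d = (2*(v t + 1)*p t + ((v t + 1)^2 + (p t)^2)) +
    (2*p t*y t / k + (1 + K)*((v t + 1)^2 + (p t)^2) / k) + (2*(p t)^2 / k
    + 2*((v t + 1)^2 + (p t)^2)/k)"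
   using k by (simp add: C_def power2_eq_square field_simps)
  have "?d >= 0"
   unfolding e using a b k
   by (intro add_nonneg_nonneg[OF add_nonneg_nonneg]) (linarith, linarith, simp)
  with 1 show "EX d. DERIV N t :> d & d >= 0"
   by (meson exp_ge_zero mult_nonneg_nonneg)
 qed (use r in simp)
 moreover have "N s = 0" using vs ps by (simp add: N_def)
 moreover have "N r > 0" using r by (auto simp: N_def intro!: mult_pos_pos add_pos_nonneg)
 ultimately show False by simp
qed


lemma y_pos: "v s < 1 ==> y s > 0"
proof -
 assume "v s < 1"
 hence "(1 - v s)*(1 + v s) > 0" using v_gt[of s] by (intro mult_pos_pos) auto
 thus "y s > 0" by (simp add: y_def power2_eq_square algebra_simps)
qed

lemma y_le: "y s <= v s + 1"
proof -
 have "v s + 1 - y s = (v s + 1)^2 / 2"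
  by (simp add: y_def power2_eq_square field_simps)
 thus ?thesis by (metis diff_ge_0_iff_ge zero_le_divide_iff zero_le_numeral zero_le_power2)
qed

text \<open>For \<open>-1 < v < 1\<close> the equation gives \<open>p' = y/k > 0\<close> wherever
  \<open>p = 0\<close>, so \<open>p\<close> crosses zero only upwards. From \<open>p s >= 0\<close>
  it would follow that \<open>v\<close> increases from \<open>s\<close> on and stays away from
  -1.\<close>

lemma p_neg_if_below_one:
 assumes "!!t. t >= s ==> v t < 1"
 shows "p s < 0"
proof (rule ccontr)
 assume "~ ?thesis"
 hence ps: "p s >= 0" by simp
 have pos: "p r > 0" if r: "r > s" for r
 proof (rule ccontr)
  assume pr: "~ ?thesis"
  have "EX d>0. ALL h>0. h < d --> p s < p (s + h)"
   by (rule DERIV_pos_inc_right[OF p'y]) (use ps y_pos[of s] assms k in "auto intro!: divide_pos_pos")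
  then obtain d where d: "d > 0" "ALL h>0. h < d --> p s < p (s + h)" by blast
  define h where "h = min (d/2) ((r - s)/2)"
  have h: "0 < h" "h < d" "s + h < r" using d r by (auto simp: h_def min_def field_simps)
  hence "p (s + h) > 0" using d ps by force
  then obtain c where c: "s + h < c" "c <= r" "p c = 0" "ALL t. s + h <= t & t < c --> p t > 0"
   using first_zero[OF cont(2), of "s + h" r] pr h by (meson less_imp_le not_less)
  have "(p c + y c) / k <= 0"
   by (rule has_real_derivative_nonpos_left[OF p'y c(1)]) (use c in "auto simp: less_imp_le")
  moreover have "y c > 0" by (rule y_pos) (use c h assms in auto)
  ultimately show False using c(3) k by (simp add: divide_le_0_iff)
 qed
 have "v s <= v r" if "r > s" for r
  by (rule deriv_nonneg_imp_mono[OF v']) (use that pos ps in "auto simp: le_less")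
 hence "v s <= -1"
  by (intro tendsto_lowerbound[OF v_top]) (auto simp: eventually_at_top_dense)
 with v_gt[of s] show False by simp
qed

text \<open>\<open>2*p + y\<close> is the derivative of \<open>k*p + v\<close>, and at a zero its
  own derivative is \<open>-p*(2/k + v) > 0\<close>. If it were positive at \<open>s\<close> it
  would stay positive, and \<open>k*p + v\<close> would rise to its limit -1.\<close>

lemma two_p_y_le:
 assumes neg: "!!t. t >= s ==> p t < 0"
 shows "2*p s + y s <= 0"
proof (rule ccontr)
 define D where "D t = 2*p t + y t" for t
 assume "~ ?thesis"
 hence Ds: "D s > 0" by (simp add: D_def)
 have D': "DERIV D t :> 2*((p t + y t) / k) - v t*p t" for t
  unfolding D_def by (auto intro!: derivative_eq_intros p'y y')
 have pos: "D r > 0" if r: "r >= s" for r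
 proof (rule ccontr)
  assume "~ ?thesis"
  then obtain c where c: "s < c" "c <= r" "D c = 0" "ALL t. s <= t & t < c --> D t > 0"
   using first_zero[of s r D] r Ds D' by (meson DERIV_isCont continuous_at_imp_continuous_on not_less)
  have "2*((p c + y c) / k) - v c*p c <= 0"
   by (rule has_real_derivative_nonpos_left[OF D' c(1)]) (use c in "auto simp: less_imp_le")
  moreover have "2*((p c + y c) / k) - v c*p c = - p c*(2 / k + v c)"
  proof -
   have "y c = - 2*p c" using c(3) by (simp add: D_def)
   thus ?thesis using k by (simp add: field_simps)
  qed
  moreover have "2 / k + v c > 0"
  proof -
   have "2 / k > 1" using k by (simp add: field_simps)
   thus ?thesis using v_gt[of c] by simp
  qed
  ultimately show False using neg[of c] c by (smt (verit) mult_pos_pos)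
 qed
 have "k*p s + v s <= k*p r + v r" if "r >= s" for r
 proof (rule DERIV_nonneg_imp_nondecreasing[where f="%t. k*p t + v t", OF that], intro exI conjI)
  fix t assume t: "s <= t" "t <= r"
  show "DERIV (%t. k*p t + v t) t :> D t"
   by (rule derivative_eq_intros p'y v' refl)+ (use k in "simp add: D_def")
  show "D t >= 0" using pos t less_imp_le by blast
 qed
 hence "k*p s + v s <= k*0 + -1"
  by (intro tendsto_lowerbound[OF tendsto_add[OF tendsto_mult_left[OF p_top] v_top]])
   (auto simp: eventually_at_top_linorder)
 \<comment> \<open>Together: \<open>v + 1 <= -k*p <= k*y/2 <= (v + 1)/4\<close>, impossible since
   \<open>v > -1\<close>.\<close>
 moreover have "- (k*p s) <= k*(y s / 2)"
  using mult_left_mono[of "- p s" "y s / 2" k] Ds k by (simp add: D_def)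
 moreover have "k*(y s / 2) <= (1/2)*((v s + 1) / 2)"
  by (intro mult_mono) (use y_le[of s] k v_gt[of s] Ds neg[of s] in "auto simp: D_def")
 ultimately show False using v_gt[of s] by simp
qed

text \<open>For the time being the last zero of \<open>v\<close>; that it is the only one, hence 0,
  is seen in \<open>s0_eq\<close> after the oscillating part has been confined near 1.\<close>

definition "s0 = Sup {s. v s = 0}"

lemma s0: "v s0 = 0" "s > s0 ==> v s < 0" "s0 >= 0"
proof -
 have "eventually (%r. v r < 0) at_top"
  using order_tendstoD(2)[OF v_top, of 0] by simp
 then obtain R where R: "!!r. r >= R ==> v r < 0"
  unfolding eventually_at_top_linorder by auto
 have bdd: "bdd_above {s. v s = 0}"
  by (rule bdd_aboveI[of _ R]) (use R linear in force)
 have cl: "closed {s. v s = 0}"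
  using continuous_closed_preimage_constant[OF cont(1), of UNIV 0] by simp
 show "v s0 = 0"
  using closed_contains_Sup[OF _ bdd cl] v0 unfolding s0_def by blast
 show "s0 >= 0"
  unfolding s0_def by (rule cSup_upper) (use v0 bdd in auto)
 assume s: "s > s0"
 show "v s < 0"
 proof (rule ccontr)
  assume "~ ?thesis"
  hence "EX x>=s. x <= max s R & v x = 0"
   by (intro IVT2'[OF _ _ _ cont(1)]) (use R[of "max s R"] in auto)
  then obtain x where "x >= s" "v x = 0" by auto
  hence "x <= s0" unfolding s0_def by (intro cSup_upper bdd) auto
  with \<open>x >= s\<close> s show False by simp
 qed
qed

lemma p_neg_s0: "s >= s0 ==> p s < 0"
 by (rule p_neg_if_below_one) (metis s0(1,2) order.strict_trans le_less less_trans order.trans zero_less_one)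

text \<open>\<open>U = -(p + y)\<close> satisfies \<open>U' = U/k + v*p\<close> with
  \<open>v*p >= 0\<close> here, so once positive it stays positive. Then \<open>p' = -U/k\<close>
  keeps \<open>p\<close> below a negative value, against \<open>p\<close> tending to 0.\<close>

lemma p_y_ge_s0:
 assumes "s >= s0"
 shows "p s + y s >= 0"
proof (rule ccontr)
 define U where "U t = - (p t + y t)" for t
 assume "~ ?thesis"
 hence Us: "U s > 0" by (simp add: U_def)
 have U': "DERIV U t :> U t / k + v t*p t" for t
  unfolding U_def by (rule derivative_eq_intros p'y y' refl)+ (use k in "simp add: field_simps")
 have vp: "v t*p t >= 0" if "t >= s0" for t
  using p_neg_s0[OF that] s0(1) s0(2)[of t] that by (cases "t = s0") (auto simp: mult_nonpos_nonpos less_imp_le)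
 have pos: "U r > 0" if r: "r >= s" for r
 proof (rule ccontr)
  assume "~ ?thesis"
  then obtain c where c: "s < c" "c <= r" "U c = 0" "ALL t. s <= t & t < c --> U t > 0"
   using first_zero[of s r U] r Us U' by (meson DERIV_isCont continuous_at_imp_continuous_on not_less)
  have "U s <= U c"
  proof (rule DERIV_nonneg_imp_nondecreasing[where f=U], use c in simp, intro exI conjI)
   fix t assume t: "s <= t" "t <= c"
   show "DERIV U t :> U t / k + v t*p t" by (rule U')
   have "U t >= 0" using c t by (cases "t = c") (auto simp: less_imp_le)
   thus "U t / k + v t*p t >= 0" using vp[of t] t assms k by simp
  qed
  with c Us show False by simp
 qed
 have "p r <= p s" if "r >= s" for r
 proof (rule DERIV_nonpos_imp_nonincreasing[where f=p, OF that], intro exI conjI)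
  fix t assume t: "s <= t" "t <= r"
  show "DERIV p t :> (p t + y t) / k" by (rule p'y)
  show "(p t + y t) / k <= 0" using pos[of t] t k by (simp add: U_def divide_le_0_iff)
 qed
 hence "0 <= p s"
  by (intro tendsto_upperbound[OF p_top]) (auto simp: eventually_at_top_linorder)
 with p_neg_s0[OF assms] show False by simp
qed

text \<open>Last critical point of \<open>v\<close>, where the final descent to -1 starts. It exists
  because the slope is positive somewhere.\<close>

definition "sm = (SOME c. c < s0 & p c = 0 & (ALL t>c. p t < 0))"

lemma sm: "sm < s0" "p sm = 0" "t > sm ==> p t < 0"
proof -
 obtain s2 where s2: "p s2 > 0" using osc by auto
 hence "s2 < s0" using p_neg_s0[of s2] by force
 have "continuous_on {s2..s0} (%t. - p t)" by (intro continuous_intros)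
 then obtain c where c: "c < s0" "p c = 0" "ALL t. c < t & t <= s0 --> - p t > 0"
  using last_zero[of s2 s0 "%t. - p t"] s2 \<open>s2 < s0\<close> p_neg_s0[of s0] by auto
 have "c < s0 & p c = 0 & (ALL t>c. p t < 0)"
  using c p_neg_s0 by (metis linear neg_0_less_iff_less)
 hence "sm < s0 & p sm = 0 & (ALL t>sm. p t < 0)"
  unfolding sm_def by (rule someI)
 thus "sm < s0" "p sm = 0" "t > sm ==> p t < 0" by auto
qed

lemma two_p_y_le_sm: "t > sm ==> 2*p t + y t <= 0"
 by (rule two_p_y_le) (use sm(3) in auto)

lemma v_anti:
 assumes "sm <= a" "a < b"
 shows "v b < v a"
proof (rule DERIV_neg_imp_decreasing_open[OF assms(2)])
 show "continuous_on {a..b} v" by (rule cont)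
qed (use assms sm(3) v' in force)

text \<open>Letting \<open>t\<close> decrease to \<open>sm\<close> in \<open>2*p + y <= 0\<close>
  leaves \<open>y sm <= 0\<close>.\<close>

lemma v_sm_ge: "v sm >= 1"
proof (rule ccontr)
 assume "~ ?thesis"
 hence "0 < 2*p sm + y sm" using y_pos[of sm] sm(2) by simp
 moreover have "2*p sm + y sm <= 0"
 proof (rule tendsto_upperbound)
  have "isCont (%t. 2*p t + y t) sm"
   using cont[of UNIV] by (auto intro!: continuous_intros simp: continuous_on_eq_continuous_at)
  thus "((%t. 2*p t + y t) ---> 2*p sm + y sm) (at_right sm)"
   by (simp add: isCont_def filterlim_at_split)
  show "\<forall>\<^sub>F t in at_right sm. 2*p t + y t <= 0"
   by (auto simp: eventually_at_filter two_p_y_le_sm)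
 qed auto
 ultimately show False by simp
qed

definition "s1 = (SOME c. sm <= c & c < s0 & v c = 1)"

lemma s1: "sm <= s1" "s1 < s0" "v s1 = 1"
proof -
 have "EX x>=sm. x <= s0 & v x = 1"
  by (rule IVT2') (use v_sm_ge sm s0 cont in auto)
 hence "EX c. sm <= c & c < s0 & v c = 1"
  using s0(1) by (metis le_less zero_neq_one)
 hence "sm <= s1 & s1 < s0 & v s1 = 1"
  unfolding s1_def by (rule someI_ex)
 thus "sm <= s1" "s1 < s0" "v s1 = 1" by auto
qed

lemma v_ge_one_before_s1: "sm <= t ==> t <= s1 ==> v t >= 1"
 using v_anti[of t s1] s1 by (cases "t = s1") auto

lemma v_between:
 assumes "s1 <= t" "t <= s0"
 shows "0 <= v t" "v t <= 1"
 using v_anti[of t s0] v_anti[of s1 t] s1 s0(1) assms by (cases "t = s0"; cases "t = s1"; force)+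

text \<open>Barrier with slope 1/5: \<open>G = -(p + y + v/5)\<close> is nonpositive at
  \<open>s0\<close>, so a positive value would have to come down to 0. At such a zero, with
  \<open>x = v\<close> in [0, 1] and \<open>1/k >= 2\<close>, the derivative of \<open>G\<close> is
  at least a positive multiple of \<open>25*x^3 - 15*x^2 - 3*x + 5\<close>, which the last identity
  shows to be positive.\<close>

lemma p_lower:
 assumes "s1 <= s" "s <= s0"
 shows "p s + y s + v s / 5 >= 0"
proof (rule ccontr)
 define G where "G t = - (p t + y t + v t / 5)" for t
 assume "~ ?thesis"
 hence Gs: "G s > 0" by (simp add: G_def)
 have G': "DERIV G t :> - ((p t + y t) / k - v t*p t + p t / 5)" for t
  unfolding G_def by (auto intro!: derivative_eq_intros p'y y' v')
 have "G s0 <= 0" using p_y_ge_s0[of s0] s0(1) by (simp add: G_def)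
 then obtain c where c: "s < c" "c <= s0" "G c = 0" "ALL t. s <= t & t < c --> G t > 0"
  using first_zero[of s s0 G] assms Gs G' by (meson DERIV_isCont continuous_at_imp_continuous_on)
 have 1: "- ((p c + y c) / k - v c*p c + p c / 5) <= 0"
  by (rule has_real_derivative_nonpos_left[OF G' c(1)]) (use c in "auto simp: less_imp_le")
 define x where "x = v c"
 have x: "0 <= x" "x <= 1" using v_between[of c] c assms by (auto simp: x_def)
 have py: "p c = - (y c + x / 5)" using c(3) by (simp add: G_def x_def)
 have "(p c + y c) / k = - (x / 5) / k" using py by simp
 also have "... <= - (x / 5)*2"
 proof -
  have "2 <= 1 / k" using k by (simp add: field_simps)
  hence "(x / 5)*2 <= (x / 5)*(1 / k)" using x by (intro mult_left_mono) auto
  thus ?thesis by simp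
 qed
 finally have "(p c + y c) / k - v c*p c + p c / 5 <= - (x / 5)*2 - x*p c + p c / 5"
  by (simp add: x_def)
 also have "... = - (1/50)*(25*x^3 - 15*x^2 - 3*x + 5)"
  unfolding py y_def x_def[symmetric] by (simp add: field_simps power2_eq_square power3_eq_cube)
 also have "... < 0"
 proof -
  have "25*x^3 - 15*x^2 - 3*x + 5 = (25*x + 5)*(x - 2/5)^2 + (3*(1 - x) + 6/5)"
   by (simp add: field_simps power2_eq_square power3_eq_cube)
  also have "... > 0" using x by (intro add_nonneg_pos) auto
  finally show ?thesis by simp
 qed
 finally show False using 1 by simp
qed

end

text \<open>In the variables \<open>s = p + y\<close> and \<open>p\<close> the expression is a
  combination of \<open>s^2\<close> and \<open>p^2\<close> without mixed term. The coefficient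
  \<open>4/3*v - 1 - 4/3*k*p\<close> of \<open>s^2\<close> is nonnegative because
  \<open>v >= 4/5\<close>, or, when \<open>p > 0\<close>, because then \<open>v >= 89/100\<close>;
  the coefficient of \<open>p^2\<close> is 1 minus terms made small by \<open>k < 1/2\<close>. The
  numerical hypotheses are exactly what \<open>before_s2\<close> provides.\<close>

lemma riccati1_aux:
 fixes v p y k :: real
 assumes k: "1/4 < k" "k < 1/2" and v: "(4/5) <= v" "v <= (553/500)"
  and p: "-(9/25) <= p" "p <= (21/100)" and s: "abs (p + y) <= (33/100)" and pv: "p > 0 ==> v >= (89/100)"
 defines "R == k / 3*p*(2*y + p)"
 shows "2 * v * (2/3*(y + p)^2 - 2*k/3 * v * p^2) - 2*(y + R)*p - (y + R)^2 >= 0"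
proof -
 define s where "s = p + y"
 have y: "y = s - p" by (simp add: s_def)
 have R: "R = k/3*p*(2 * s - p)" by (simp add: R_def y)
 have s3: "abs s <= (33/100)" using s by (simp add: s_def)
 have eq: "2 * v * (2/3*(y + p)^2 - 2*k/3 * v * p^2) - 2*(y + R)*p - (y + R)^2
   = (4/3 * v - 1 - 4/3*k*p) * s^2
    + (1 - 4/3*k * v^2 + 2/3*k * s - (k/3)^2*(2 * s - p)^2)*p^2"
 proof -
  obtain q where q: "k = 3*q" by (metis mult.commute nonzero_divide_eq_eq zero_neq_numeral)
  show ?thesis unfolding R y q by (simp add: field_simps power2_eq_square)
 qed
 have a: "4/3 * v - 1 - 4/3*k*p >= 0"
 proof (cases "p > 0")
  case True
  hence "k*p <= 1/2*(21/100)" using k p by (intro mult_mono) auto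
  thus ?thesis using pv[OF True] by simp
 next
  case False
  hence "k*p <= 0" using k by (simp add: mult_le_0_iff)
  thus ?thesis using v by simp
 qed
 have "v^2 <= (553/500)^2" using v by (intro power_mono) auto
 hence "k * v^2 <= 1/2*(553/500)^2" using k by (intro mult_mono) auto
 moreover have "k * s >= - (1/2*(33/100))"
 proof -
  have "k*abs s <= 1/2*(33/100)" using k s3 by (intro mult_mono) auto
  moreover have "- (k*abs s) <= k * s" using k by (simp add: abs_if)
  ultimately show ?thesis by simp
 qed
 moreover have "(k/3)^2*(2 * s - p)^2 <= (1/6)^2*(51/50)^2"
 proof (rule mult_mono)
  have "abs (2 * s - p) <= (51/50)" using s3 p by linarith
  hence "(abs (2 * s - p))^2 <= (51/50)^2" by (intro power_mono) auto
  thus "(2 * s - p)^2 <= (51/50)^2" by simp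
  show "(k/3)^2 <= (1/6)^2" using k by (intro power_mono) auto
 qed auto
 ultimately have "1 - 4/3*k * v^2 + 2/3*k * s - (k/3)^2*(2 * s - p)^2 >= 0"
  by (simp add: power2_eq_square)
 with a show ?thesis unfolding eq by (intro add_nonneg_nonneg mult_nonneg_nonneg) auto
qed

context shock_profile begin

text \<open>On \<open>{sm..s1}\<close> the function \<open>k*p - v\<close> has derivative
  \<open>y <= 0\<close>. Comparison with its value at \<open>s1\<close>, where
  \<open>p_lower\<close> gives \<open>p >= -1/5\<close>, bounds \<open>p\<close> from below and the
  overshoot \<open>v - 1\<close> by \<open>k/5\<close> at once.\<close>

lemma p_ge_before_s1:
 assumes "sm <= s" "s <= s1"
 shows "p s >= -1/5" "v s <= (11/10)"
proof -
 have p1: "p s1 >= -1/5" using p_lower[of s1] s1 by (simp add: y_def)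
 have "k*p s1 - v s1 <= k*p s - v s"
 proof (rule deriv_nonpos_imp_antimono[where g="%t. k*p t - v t" and g'=y])
  fix t assume t: "t \<in> {s..s1}"
  show "DERIV (%t. k*p t - v t) t :> y t"
   by (auto intro!: derivative_eq_intros p'y v') (use k in simp)
  have "1^2 <= (v t)^2" using v_ge_one_before_s1[of t] t assms by (intro power_mono) auto
  thus "y t <= 0" by (simp add: y_def)
 qed (use assms in auto)
 moreover have "k*p s1 >= k*(-1/5)" using p1 k by (intro mult_left_mono) auto
 moreover have "k*p s <= 0"
  using sm(2) sm(3)[of s] assms k by (cases "s = sm") (auto simp: mult_le_0_iff)
 moreover have "v s >= 1" "v s1 = 1" using v_ge_one_before_s1[of s] assms s1 by auto
 ultimately have *: "k*p s1 <= k*p s" "v s <= 1 + k / 5" by auto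
 from *(1) have "p s1 <= p s" using k by simp
 with p1 show "p s >= -1/5" by simp
 from *(2) show "v s <= (11/10)" using k by simp
qed

text \<open>The energy is nondecreasing, and at \<open>sm\<close> it is purely potential with
  \<open>0 <= v - 1 <= 1/10\<close>. This one number bounds all oscillations to the left of
  \<open>sm\<close>.\<close>

lemma before_sm:
 assumes "s <= sm"
 shows "abs (v s - 1) <= (53/500)" "abs (p s) <= (21/100)"
proof -
 define z where "z = v s - 1"
 define w where "w = v sm - 1"
 have w: "0 <= w" "w <= (1/10)" using v_sm_ge p_ge_before_s1[of sm] s1 by (auto simp: w_def)
 have z: "z > -2" using v_gt[of s] by (simp add: z_def)
 have "E s <= E sm"
  by (rule deriv_nonneg_imp_mono[OF E']) (use assms in auto)
 moreover have "E s = k*(p s)^2 / 2 + z^2*(z + 3) / 6" by (simp add: E_def z_def)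
 moreover have "E sm = w^2*(w + 3) / 6" using sm(2) by (simp add: E_def w_def)
 moreover have "w^2*(w + 3) <= (1/10)^2*((1/10) + 3)"
  using w by (intro mult_mono power_mono) auto
 ultimately have E: "3*k*(p s)^2 + z^2*(z + 3) <= (31/1000)"
  by (simp add: power2_eq_square[of "(1/10)"])
 have nn: "z^2*(z + 3) >= 0" using z by simp
 have kp: "3*(1/4)*(p s)^2 <= 3*k*(p s)^2" using k by (intro mult_right_mono) auto
 hence "(p s)^2 <= (21/100)^2" using E nn by (simp add: power2_eq_square)
 thus "abs (p s) <= (21/100)" by (simp add: abs_le_square_iff[symmetric])
 \<comment> \<open>Two passes: the crude bound \<open>abs z <= 1/5\<close> improves the factor
   \<open>z + 3\<close> from 1 to 14/5, and this yields 53/500.\<close>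
 have "z^2*1 <= z^2*(z + 3)" using z by (intro mult_left_mono) auto
 moreover have "3*k*(p s)^2 >= 0" using k by simp
 ultimately have "z^2 <= (1/5)^2" using E by (simp add: power_divide)
 hence "abs z <= (1/5)" by (simp add: abs_le_square_iff[symmetric])
 hence "z^2*(14/5) <= z^2*(z + 3)" by (intro mult_left_mono) auto
 moreover have "3*k*(p s)^2 >= 0" using k by simp
 ultimately have "z^2 <= (53/500)^2" using E by (simp add: power_divide)
 thus "abs (v s - 1) <= (53/500)" by (simp add: abs_le_square_iff[symmetric] z_def)
qed

text \<open>Left of \<open>sm\<close> the profile stays near 1 and right of it \<open>v\<close> is
  strictly decreasing, so there is a single zero, and \<open>v 0 = 0\<close>.\<close>

lemma s0_eq: "s0 = 0"
proof -
 have "sm < 0"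
  using before_sm(1)[of 0] v0 by (cases "0 <= sm") auto
 thus ?thesis
  using v_anti[of 0 s0] s0(1,3) v0 by (cases "s0 = 0") auto
qed

text \<open>Matching point of the two Riccati functions. Down to the level 4/5 the quantity
  \<open>4/3*v - 1\<close> is still positive, as \<open>h1\<close> needs; from this point on
  \<open>v < 1\<close>, so that \<open>y > 0\<close>, as \<open>h2\<close> needs.\<close>

definition "s2 = (SOME c. s1 <= c & c < 0 & v c = 4/5)"

lemma s2: "s1 <= s2" "s2 < 0" "v s2 = 4/5"
proof -
 have "EX x>=s1. x <= 0 & v x = 4/5"
  by (rule IVT2') (use s1 s0_eq v0 cont in auto)
 hence "EX c. s1 <= c & c < 0 & v c = 4/5"
  using v0 by (metis le_less divide_eq_0_iff zero_neq_numeral)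
 hence "s1 <= s2 & s2 < 0 & v s2 = 4/5"
  unfolding s2_def by (rule someI_ex)
 thus "s1 <= s2" "s2 < 0" "v s2 = 4/5" by auto
qed

text \<open>Correction for the oscillating region: \<open>R' = 2/3*(y + p)^2 - 2*k/3*v*p^2\<close>.
  Multiplied by \<open>2*v\<close> its first term outweighs the \<open>-(y + p)^2\<close> left over
  by \<open>-y/(2*v)\<close>.\<close>

definition "R s = k / 3*p s * (2*y s + p s)"
definition "h1 s = - (y s + R s) / (2 * v s)"
text \<open>With \<open>p\<close> in place of \<open>-y\<close> this would be the logarithmic
  derivative of \<open>sqrt (abs v)\<close>. It has a pole at 0, the zero of
  \<open>v\<close>.\<close>

definition "h2 s = - y s / (2 * v s)"

text \<open>Assembles the bounds from the three regions: the oscillation up to \<open>sm\<close>,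
  the last overshoot up to \<open>s1\<close>, and the beginning of the descent from 1 to
  4/5.\<close>

lemma before_s2:
 assumes "s <= s2"
 shows "(4/5) <= v s" "v s <= (553/500)" "-(9/25) <= p s" "p s <= (21/100)" "abs (p s + y s) <= (33/100)"
  "p s > 0 ==> v s >= (89/100)"
proof -
 have "(4/5) <= v s & v s <= (553/500) & -(9/25) <= p s & p s <= (21/100) & abs (p s + y s) <= (33/100) &
   (p s > 0 --> v s >= (89/100))"
 proof (cases "s <= sm")
  case True
  note b = before_sm[OF True]
  have "y s = - (v s - 1) - (v s - 1)^2 / 2" by (simp add: y_def power2_eq_square field_simps)
  moreover have "(v s - 1)^2 <= (53/500)^2"
   using power_mono[OF b(1) abs_ge_zero, of 2] by simp
  moreover have "0 <= (v s - 1)^2" by simp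
  moreover have "(53/500::real)^2 <= (3/250)" by (simp add: power2_eq_square)
  moreover have "-(53/500) <= v s - 1" "v s - 1 <= (53/500)" "-(21/100) <= p s" "p s <= (21/100)"
   using b by linarith+
  ultimately show ?thesis by (intro conjI impI abs_leI) linarith+
 next
  case False
  hence p: "p s < 0" by (simp add: sm)
  show ?thesis
  proof (cases "s <= s1")
   case True
   have v: "1 <= v s" "v s <= (11/10)" "p s >= -1/5"
    using v_ge_one_before_s1 p_ge_before_s1 True False by auto
   hence "1^2 <= (v s)^2" "(v s)^2 <= (11/10)^2" by (auto intro!: power_mono)
   hence "0 <= - y s" "- y s <= 21/200" by (auto simp: y_def power_divide field_simps)
   with v p show ?thesis by (intro conjI impI abs_leI) linarith+
  next
   case False
   have v: "v s >= (4/5)" "v s <= 1"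
    using v_anti[of s s2] s2 s1 assms False v_between[of s] s0_eq by (cases "s = s2"; force)+
   have 1: "p s + y s + v s / 5 >= 0" "2*p s + y s <= 0"
    using p_lower[of s] two_p_y_le_sm[of s] False assms s2 s1 s0_eq by auto
   have "(4/5)^2 <= (v s)^2" "(v s)^2 <= 1^2" using v by (intro power_mono; simp)+
   moreover have "v s / 5 + y s <= (9/25)"
   proof -
    have "(9/25) - (v s / 5 + y s) = (v s - (4/5))*(v s + (2/5)) / 2 + (1/50)"
     by (simp add: y_def power2_eq_square field_simps)
    thus ?thesis using v by (smt (verit) divide_nonneg_nonneg mult_nonneg_nonneg zero_le_numeral zero_le_divide_iff)
   qed
   moreover have "y s = 1/2 - (v s)^2 / 2" by (simp add: y_def field_simps)
   moreover have "(4/5::real)^2 = 16/25" by (simp add: power_divide)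
   ultimately show ?thesis using v p 1 by (intro conjI impI abs_leI) linarith+
  qed
 qed
 thus "(4/5) <= v s" "v s <= (553/500)" "-(9/25) <= p s" "p s <= (21/100)" "abs (p s + y s) <= (33/100)"
  "p s > 0 ==> v s >= (89/100)" by auto
qed

lemma sm_s2: "sm < s2"
 using s1(1,3) s2(1,3) by (cases "s1 = s2") auto

lemma riccati1:
 assumes "s <= s2"
 shows "EX d. DERIV h1 s :> d & - d - (h1 s)^2 + p s / 2 >= 0"
proof (intro exI conjI)
 note b = before_s2[OF assms]
 have v: "v s ~= 0" "v s > 0" using b by auto
 define R' where "R' = 2/3*(y s + p s)^2 - 2*k/3 * v s * (p s)^2"
 have R': "DERIV R s :> R'"
 proof -
  define P where "P = (p s + y s) / k"
  have P: "DERIV p s :> P" "k*P = p s + y s"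
   using p'y[of s] k by (auto simp: P_def)
  have "DERIV R s :> (k / 3*P*(2*y s + p s) + k / 3*p s * (2*(- v s * p s) + P))"
   unfolding R_def by (rule derivative_eq_intros P(1) y' refl)+ (simp add: field_simps)
  also have "k / 3*P*(2*y s + p s) + k / 3*p s * (2*(- v s * p s) + P)
    = (k*P)*(2*y s + p s) / 3 + p s * (k*P) / 3 - 2*k/3 * v s * (p s)^2"
   by (simp add: field_simps power2_eq_square)
  also have "... = R'" unfolding P R'_def by (simp add: field_simps power2_eq_square)
  finally show ?thesis .
 qed
 define d where "d = - (- (v s * p s) + R') / (2 * v s) + (y s + R s)*p s / (2*(v s)^2)"
 show "DERIV h1 s :> d"
  unfolding h1_def d_def
  by (rule derivative_eq_intros R' y' v' refl | simp add: v)+ (use v in "simp add: field_simps power2_eq_square")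
 have "- d - (h1 s)^2 + p s / 2 =
  (2 * v s * R' - 2*(y s + R s)*p s - (y s + R s)^2) / (4*(v s)^2)"
  using v unfolding d_def h1_def by (simp add: field_simps power2_eq_square)
 also have "... >= 0"
  using riccati1_aux[OF k b] v unfolding R'_def R_def by (intro divide_nonneg_nonneg) auto
 finally show "- d - (h1 s)^2 + p s / 2 >= 0" .
qed

text \<open>Here the Riccati expression factors as \<open>y*(-(2*p + y))/(4*v^2)\<close>, so the
  signs of \<open>y\<close> and of \<open>2*p + y\<close> decide.\<close>

lemma riccati2:
 assumes "s >= s2" "s ~= 0"
 shows "EX d. DERIV h2 s :> d & - d - (h2 s)^2 + p s / 2 >= 0"
proof (intro exI conjI)
 have sm2: "s > sm" using assms sm_s2 by simp
 have v: "v s ~= 0" using v_anti[of 0 s] v_anti[of s 0] v0 assms sm sm2 s0_eq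
  by (cases "s < 0") auto
 have v1: "v s < 1" using v_anti[of s2 s] s2 s1 assms by (cases "s = s2") auto
 define d where "d = p s / 2 + y s * p s / (2*(v s)^2)"
 show "DERIV h2 s :> d"
  unfolding h2_def d_def
  by (rule derivative_eq_intros y' v' refl | simp add: v)+ (use v in "simp add: field_simps power2_eq_square")
 have "- d - (h2 s)^2 + p s / 2 = y s * (- (2*p s + y s)) / (4*(v s)^2)"
  using v unfolding d_def h2_def by (simp add: field_simps power2_eq_square)
 also have "... >= 0"
  using two_p_y_le_sm[OF sm2] y_pos[OF v1] by (intro divide_nonneg_nonneg mult_nonneg_nonneg) auto
 finally show "- d - (h2 s)^2 + p s / 2 >= 0" .
qed

text \<open>Adding the estimates of the two intervals that meet at \<open>s2\<close> leaves the
  boundary term \<open>(h1 s2 - h2 s2)*Z^2\<close>, which must be nonnegative. It is, because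
  \<open>p < 0\<close> makes \<open>R\<close> nonpositive there.\<close>

lemma h2_le_h1: "h2 s2 <= h1 s2"
proof -
 have b: "p s2 + y s2 + v s2 / 5 >= 0" "p s2 < 0"
  using p_lower[of s2] sm(3)[OF sm_s2] s2 s0_eq by auto
 moreover have "y s2 = (9/50)" unfolding y_def s2(3) by (simp add: power2_eq_square)
 ultimately have "R s2 <= 0"
  unfolding R_def using k s2(3) b(1) by (intro mult_nonpos_nonneg mult_nonneg_nonpos) (use b(2) in auto)
 thus ?thesis unfolding h1_def h2_def s2(3) by simp
qed

lemma h1_bot: "(h1 ---> 0) at_bot"
proof -
 have y: "(y ---> 0) at_bot" unfolding y_def by (auto intro!: tendsto_eq_intros v_bot)
 have "(R ---> 0) at_bot" unfolding R_def by (auto intro!: tendsto_eq_intros p_bot y)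
 thus ?thesis unfolding h1_def by (auto intro!: tendsto_eq_intros y v_bot)
qed

lemma h2_top: "(h2 ---> 0) at_top"
proof -
 have y: "(y ---> 0) at_top" unfolding y_def by (auto intro!: tendsto_eq_intros v_top)
 thus ?thesis unfolding h2_def by (auto intro!: tendsto_eq_intros y v_top)
qed

text \<open>The pole of \<open>h2\<close> at 0 is simple, because \<open>p 0\<close> is nonzero,
  while \<open>Z^2\<close> vanishes to second order.\<close>

lemma h2_square_zero:
 assumes Z: "DERIV Z 0 :> d" "Z 0 = 0"
 shows "((%s. h2 s * (Z s)^2) ---> 0) (at 0)"
proof -
 have "((%s. (v s - v 0) / (s - 0)) ---> p 0) (at 0)"
  using v'[of 0] by (simp add: has_field_derivative_iff)
 moreover have "((%s. (Z s - Z 0) / (s - 0)) ---> d) (at 0)"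
  using Z(1) by (simp add: has_field_derivative_iff)
 moreover have "p 0 ~= 0" using p_neg_s0[of 0] s0_eq by simp
 ultimately have "((%s. (Z s / s) / (v s / s)) ---> d / p 0) (at 0)"
  using v0 Z(2) by (intro tendsto_divide) auto
 moreover have "(y ---> y 0) (at 0)" "(Z ---> Z 0) (at 0)"
  using y'[of 0] Z(1) DERIV_isCont isCont_def by blast+
 ultimately have "((%s. - (y s) / 2*((Z s / s) / (v s / s))*Z s) ---> - (y 0) / 2*(d / p 0)*Z 0) (at 0)"
  by (intro tendsto_mult[OF tendsto_mult[OF tendsto_divide[OF tendsto_minus tendsto_const]]]) auto
 moreover have "\<forall>\<^sub>F s in at 0. - (y s) / 2*((Z s / s) / (v s / s))*Z s = h2 s * (Z s)^2"
  by (auto simp: eventually_at_filter h2_def power2_eq_square)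
 ultimately show ?thesis using Z(2) by (simp add: filterlim_cong)
qed


lemma riccati_interval:
 fixes h Z :: "real => real"
 assumes "a <= b"
  and Z: "!!s. s \<in> {a..b} ==> DERIV Z s :> Z' s" and cZ': "continuous_on {a..b} Z'"
  and h: "!!s. s \<in> {a..b} ==> EX d. DERIV h s :> d & - d - (h s)^2 + p s / 2 >= 0"
 shows "h b*(Z b)^2 - h a*(Z a)^2 <= integral {a..b} (%s. (Z' s)^2 + p s * (Z s)^2 / 2)"
proof -
 obtain d where d: "!!s. s \<in> {a..b} ==> DERIV h s :> d s"
   "!!s. s \<in> {a..b} ==> - d s - (h s)^2 + p s / 2 >= 0"
  using h by metis
 have 1: "((%s. d s * (Z s)^2 + h s * (2*Z s * Z' s)) has_integral (h b*(Z b)^2 - h a*(Z a)^2)) {a..b}"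
 proof (rule fundamental_theorem_of_calculus[OF assms(1)])
  fix s assume s: "s \<in> {a..b}"
  have "DERIV (%s. h s * (Z s)^2) s :> d s * (Z s)^2 + h s * (2*Z s * Z' s)"
   by (rule derivative_eq_intros d(1)[OF s] Z[OF s] refl)+ (simp add: algebra_simps)
  thus "((%s. h s * (Z s)^2) has_vector_derivative d s * (Z s)^2 + h s * (2*Z s * Z' s)) (at s within {a..b})"
   by (simp add: real_vector_deriv has_vector_derivative_at_within)
 qed
 have "continuous_on {a..b} Z" by (meson Z DERIV_isCont continuous_at_imp_continuous_on)
 hence 2: "(%s. (Z' s)^2 + p s * (Z s)^2 / 2) integrable_on {a..b}"
  by (intro integrable_continuous_interval continuous_intros cZ') auto
 have "h b*(Z b)^2 - h a*(Z a)^2 = integral {a..b} (%s. d s * (Z s)^2 + h s * (2*Z s * Z' s))"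
  using 1 by (simp add: integral_unique)
 also have "... <= integral {a..b} (%s. (Z' s)^2 + p s * (Z s)^2 / 2)"
 proof (rule integral_le)
  fix s assume s: "s \<in> {a..b}"
  have "(Z' s)^2 + p s * (Z s)^2 / 2 - (d s * (Z s)^2 + h s * (2*Z s * Z' s))
   = (Z' s - h s * Z s)^2 + (- d s - (h s)^2 + p s / 2)*(Z s)^2"
   by (simp add: power2_eq_square algebra_simps)
  also have "... >= 0" using mult_nonneg_nonneg[OF d(2)[OF s], of "(Z s)^2"] by simp
  finally show "d s * (Z s)^2 + h s * (2*Z s * Z' s) <= (Z' s)^2 + p s * (Z s)^2 / 2" by simp
 qed (use 1 2 in "auto simp: has_integral_integrable")
 finally show ?thesis .
qed

text \<open>The interval is cut at \<open>s2\<close>, where \<open>h1\<close> hands over to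
  \<open>h2\<close>, and stops at some \<open>b < 0\<close> short of the pole; letting
  \<open>b\<close> tend to 0 removes the boundary term there.\<close>

lemma half_line_left:
 fixes Z :: "real => real"
 assumes Z: "!!s. DERIV Z s :> Z' s" and cZ': "cont Z'" and Z0: "Z 0 = 0"
  and a: "a <= s2"
 shows "- h1 a*(Z a)^2 <= integral {a..0} (%s. (Z' s)^2 + p s * (Z s)^2 / 2)" (is "_ <= integral _ ?f")
proof -
 have cf: "continuous_on S ?f" for S
  using Z by (intro continuous_intros continuous_on_subset[OF cZ'])
   (auto intro: DERIV_isCont continuous_at_imp_continuous_on)
 hence int: "?f integrable_on {u..w}" for u w
  by (intro integrable_continuous_interval)
 have 1: "h1 s2*(Z s2)^2 - h1 a*(Z a)^2 <= integral {a..s2} ?f"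
  by (rule riccati_interval[OF a Z]) (auto intro: continuous_on_subset[OF cZ'] riccati1)
 have 2: "h2 b*(Z b)^2 - h2 s2*(Z s2)^2 <= integral {s2..b} ?f" if "s2 <= b" "b < 0" for b
  by (rule riccati_interval[OF that(1) Z])
   (use that in "auto intro: continuous_on_subset[OF cZ'] riccati2")
 have "h2 s2*(Z s2)^2 <= h1 s2*(Z s2)^2" by (intro mult_right_mono h2_le_h1) auto
 with 1 2 int a have 3: "h2 b*(Z b)^2 - h1 a*(Z a)^2 <= integral {a..b} ?f" if "s2 <= b" "b < 0" for b
  using that Henstock_Kurzweil_Integration.integral_combine[of a s2 b, where f="?f"] by fastforce
 have "((%b. h2 b*(Z b)^2 - h1 a*(Z a)^2) ---> 0 - h1 a*(Z a)^2) (at_left 0)"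
  using h2_square_zero[OF Z Z0] by (intro tendsto_intros) (simp add: filterlim_at_split)
 moreover have "((%b. integral {a..b} ?f) ---> integral {a..0} ?f) (at_left 0)"
 proof -
  have "continuous_on {a..0} (%b. integral {a..b} ?f)"
   by (rule indefinite_integral_continuous_1[OF int])
  moreover have "a < 0" using a s2 by simp
  ultimately show ?thesis
   unfolding continuous_on_def by (auto dest: bspec[of _ _ 0] simp: at_within_Icc_at_left)
 qed
 moreover have "\<forall>\<^sub>F b in at_left 0. h2 b*(Z b)^2 - h1 a*(Z a)^2 <= integral {a..b} ?f"
  unfolding eventually_at_left_field by (rule exI[of _ s2]) (use 3 s2 in auto)
 ultimately have "0 - h1 a*(Z a)^2 <= integral {a..0} ?f"
  by (intro tendsto_le[of "at_left 0"]) auto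
 thus ?thesis by simp
qed

lemma half_line_right:
 fixes Z :: "real => real"
 assumes Z: "!!s. DERIV Z s :> Z' s" and cZ': "cont Z'" and Z0: "Z 0 = 0"
  and b: "b > 0"
 shows "h2 b*(Z b)^2 <= integral {0..b} (%s. (Z' s)^2 + p s * (Z s)^2 / 2)" (is "_ <= integral _ ?f")
proof -
 have cf: "continuous_on S ?f" for S
  using Z by (intro continuous_intros continuous_on_subset[OF cZ'])
   (auto intro: DERIV_isCont continuous_at_imp_continuous_on)
 hence int: "?f integrable_on {u..w}" for u w
  by (intro integrable_continuous_interval)
 have 3: "h2 b*(Z b)^2 - h2 a*(Z a)^2 <= integral {0..b} ?f - integral {0..a} ?f" if "a > 0" "a <= b" for a
 proof -
  have "h2 b*(Z b)^2 - h2 a*(Z a)^2 <= integral {a..b} ?f"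
   by (rule riccati_interval[OF that(2) Z])
    (use that s2(2) in "auto intro: continuous_on_subset[OF cZ'] riccati2")
  thus ?thesis using Henstock_Kurzweil_Integration.integral_combine[of 0 a b, where f="?f"] int that by simp
 qed
 have "((%a. h2 b*(Z b)^2 - h2 a*(Z a)^2) ---> h2 b*(Z b)^2 - 0) (at_right 0)"
  using h2_square_zero[OF Z Z0] by (intro tendsto_intros) (simp add: filterlim_at_split)
 moreover have "((%a. integral {0..b} ?f - integral {0..a} ?f) ---> integral {0..b} ?f - integral {0..0} ?f) (at_right 0)"
 proof -
  have "continuous_on {0..b} (%b. integral {0..b} ?f)"
   by (rule indefinite_integral_continuous_1[OF int])
  hence "((%b. integral {0..b} ?f) ---> integral {0..0} ?f) (at_right 0)"
   using b unfolding continuous_on_def by (auto dest: bspec[of _ _ 0] simp: at_within_Icc_at_right)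
  thus ?thesis by (intro tendsto_intros)
 qed
 moreover have "\<forall>\<^sub>F a in at_right 0. h2 b*(Z b)^2 - h2 a*(Z a)^2 <= integral {0..b} ?f - integral {0..a} ?f"
  unfolding eventually_at_right_field by (rule exI[of _ b]) (use 3 b in auto)
 ultimately have "h2 b*(Z b)^2 - 0 <= integral {0..b} ?f - integral {0..0} ?f"
  by (intro tendsto_le[of "at_right 0"]) auto
 thus ?thesis by simp
qed

text \<open>With \<open>W = c + Z\<close>, \<open>c = W 0\<close>, the two half-line estimates leave \<open>- c^2 - c (P + 2c)\<close>,
 where \<open>P = \<integral> p W\<close>; completing the square in \<open>c\<close> produces the rank-one term.\<close>

lemma spectral_inequality:
 fixes W :: "real => real"
 assumes W: "!!s. DERIV W s :> W' s" and cW': "cont W'"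
  and bdd: "!!s. abs (W s) <= K"
  and i1: "((%n. integral {-real n..real n} (%s. (W' s)^2 + p s * (W s)^2 / 2)) ----> I)"
  and i2: "((%n. integral {-real n..real n} (%s. p s * W s)) ----> P)"
 shows "I + P^2 / 4 >= 0"
proof -
 define c where "c = W 0"
 define Z where "Z s = W s - c" for s
 have Z: "DERIV Z s :> W' s" "Z 0 = 0" for s
  unfolding Z_def by (auto intro!: derivative_eq_intros W simp: c_def)
 have cW: "continuous_on S W" for S by (rule DERIV_cont[OF W])
 have cW'S: "continuous_on S W'" for S using cW' continuous_on_subset by blast
 have *: "- h1 (- real n)*(Z (- real n))^2 + h2 (real n)*(Z (real n))^2
   - c^2 / 2*(v (real n) - v (- real n)) + c*integral {-real n..real n} (%s. p s * W s)
   <= integral {-real n..real n} (%s. (W' s)^2 + p s * (W s)^2 / 2)"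
  if n: "real n > - s2" "n > 0" for n
 proof -
  let ?n = "real n"
  have "- h1 (- ?n)*(Z (- ?n))^2 + h2 ?n*(Z ?n)^2 <=
   integral {-?n..0} (%s. (W' s)^2 + p s * (Z s)^2 / 2) + integral {0..?n} (%s. (W' s)^2 + p s * (Z s)^2 / 2)"
   by (intro add_mono half_line_left half_line_right Z cW') (use n in auto)
  also have "... = integral {-?n..?n} (%s. (W' s)^2 + p s * (Z s)^2 / 2)"
   by (rule Henstock_Kurzweil_Integration.integral_combine)
    (auto simp: Z_def intro!: integrable_continuous_interval continuous_intros cW cW'S)
  also have "... = integral {-?n..?n} (%s. ((W' s)^2 + p s * (W s)^2 / 2) - c*(p s * W s) + c^2 / 2*p s)"
   by (intro integral_cong) (simp add: Z_def power2_eq_square field_simps)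
  also have "... = integral {-?n..?n} (%s. ((W' s)^2 + p s * (W s)^2 / 2)) - c*integral {-?n..?n} (%s. p s * W s)
    + c^2 / 2*integral {-?n..?n} p"
   by (subst integral_add integral_diff integral_mult_right;
     (intro integrable_continuous_interval continuous_intros cW'S cW; simp)?)+ simp
  also have "integral {-?n..?n} p = v ?n - v (-?n)"
   by (rule integral_unique, rule fundamental_theorem_of_calculus)
    (use v' in "auto simp: real_vector_deriv[symmetric] intro: has_field_derivative_at_within")
  finally show ?thesis by simp
 qed
 have zb: "abs ((Z s)^2) <= (2*K)^2" for s
 proof -
  have "abs (Z s) <= 2*K" using bdd[of s] bdd[of 0] unfolding Z_def c_def by linarith
  hence "(abs (Z s))^2 <= (2*K)^2" by (intro power_mono) auto
  thus ?thesis by simp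
 qed
 have z1: "((%n. h1 (- real n)*(Z (- real n))^2) ----> 0)"
  using filterlim_compose[OF h1_bot filterlim_compose[OF filterlim_uminus_at_bot_at_top filterlim_real_sequentially]]
  by (rule lim_null_mult_right_bounded[where B="(2*K)^2"]) (use zb in auto)
 have z2: "((%n. h2 (real n)*(Z (real n))^2) ----> 0)"
  using filterlim_compose[OF h2_top filterlim_real_sequentially]
  by (rule lim_null_mult_right_bounded[where B="(2*K)^2"]) (use zb in auto)
 have v1: "((%n. v (real n)) ----> -1)" "((%n. v (- real n)) ----> 1)"
  by (rule filterlim_compose[OF v_top filterlim_real_sequentially]
    filterlim_compose[OF v_bot filterlim_compose[OF filterlim_uminus_at_bot_at_top filterlim_real_sequentially]])+
 have "- 0 + 0 - c^2 / 2*(-1 - 1) + c*P <= I"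
 proof (rule tendsto_le[OF _ i1])
  show "(%n. - (h1 (- real n)*(Z (- real n))^2) + h2 (real n)*(Z (real n))^2
   - c^2 / 2*(v (real n) - v (- real n)) + c*integral {-real n..real n} (%s. p s * W s))
   ----> - 0 + 0 - c^2 / 2*(-1 - 1) + c*P"
   by (intro tendsto_intros z1 z2 v1 i2)
  obtain N where N: "real N > - s2" using reals_Archimedean2 by blast
  show "\<forall>\<^sub>F n in sequentially. - (h1 (- real n)*(Z (- real n))^2) + h2 (real n)*(Z (real n))^2
   - c^2 / 2*(v (real n) - v (- real n)) + c*integral {-real n..real n} (%s. p s * W s)
   <= integral {-real n..real n} (%s. (W' s)^2 + p s * (W s)^2 / 2)"
   using eventually_ge_at_top[of "Suc N"]
  proof eventually_elim
   case (elim n)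
   thus ?case using *[of n] N by auto
  qed
 qed auto
 hence "I + P^2 / 4 >= c^2 + c*P + P^2 / 4" by simp
 also have "c^2 + c*P + P^2 / 4 = (c + P / 2)^2" by (simp add: power2_eq_square algebra_simps)
 finally show ?thesis by (smt (verit) zero_le_power2)
qed

end

section \<open>Closure properties of smooth functions\<close>

lemma smooth_obtain:
 assumes "smooth f"
 obtains f' where "!!x. (f has_derivative f' x) (at x)" "!!v. smooth (%x. f' x v)"
 using assms by (cases rule: smooth.cases) auto

text \<open>Pattern of the closure lemmas: coinduction over the class of all functions of the given
  form, which contains the directional derivatives of its members.\<close>

lemma smooth_const [intro]: "smooth (%x::'a::euclidean_space. c)"
proof -
 have "EX c. f = (%x. c) ==> smooth f" for f :: "'a => real"
 proof (coinduction arbitrary: f rule: smooth.coinduct)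
  case smooth
  thus ?case by (auto intro!: exI[of _ "%x v. 0"])
 qed
 thus ?thesis by blast
qed

lemma smooth_add [intro]:
 fixes f g :: "'a::euclidean_space => real"
 assumes "smooth f" "smooth g" shows "smooth (%x. f x + g x)"
proof -
 have "EX f g. smooth f & smooth g & h = (%x. f x + g x) ==> smooth h" for h :: "'a => real"
 proof (coinduction arbitrary: h rule: smooth.coinduct)
  case smooth
  then obtain f g where fg: "smooth f" "smooth g" "h = (%x. f x + g x)" by blast
  obtain f' where f': "!!x. (f has_derivative f' x) (at x)" "!!v. smooth (%x. f' x v)"
   using smooth_obtain[OF fg(1)] by blast
  obtain g' where g': "!!x. (g has_derivative g' x) (at x)" "!!v. smooth (%x. g' x v)"
   using smooth_obtain[OF fg(2)] by blast
  show ?case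
   unfolding fg(3)
   by (rule exI, rule exI[of _ "%x v. f' x v + g' x v"], intro conjI allI, rule refl,
     intro has_derivative_add f'(1) g'(1), use f'(2) g'(2) in blast)
 qed
 with assms show ?thesis by blast
qed

lemma smooth_cmult [intro]:
 fixes f :: "'a::euclidean_space => real"
 assumes "smooth f" shows "smooth (%x. c*f x)"
proof -
 have "EX f. smooth f & h = (%x. c*f x) ==> smooth h" for h :: "'a => real"
 proof (coinduction arbitrary: h rule: smooth.coinduct)
  case smooth
  then obtain f where fg: "smooth f" "h = (%x. c*f x)" by blast
  obtain f' where f': "!!x. (f has_derivative f' x) (at x)" "!!v. smooth (%x. f' x v)"
   using smooth_obtain[OF fg(1)] by blast
  show ?case
   unfolding fg(2)
   by (rule exI, rule exI[of _ "%x v. c*f' x v"], intro conjI allI, rule refl,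
     intro has_derivative_mult_right f'(1), use f'(2) in blast)
 qed
 with assms show ?thesis by blast
qed

lemma smooth_diff [intro]: "smooth f ==> smooth g ==> smooth (%x. f x - g x)"
 using smooth_add[of f "%x. (-1)*g x"] smooth_cmult[of g "-1"] by auto

lemma smooth_compose_affine:
 fixes f :: "'a::euclidean_space => real" and L :: "'b::euclidean_space => 'a"
 assumes "smooth f" "bounded_linear L" shows "smooth (%x. f (L x + c))"
proof -
 have "EX f. smooth f & h = (%x. f (L x + c)) ==> smooth h" for h :: "'b => real"
 proof (coinduction arbitrary: h rule: smooth.coinduct)
  case smooth
  then obtain f where fg: "smooth f" "h = (%x. f (L x + c))" by blast
  obtain f' where f': "!!x. (f has_derivative f' x) (at x)" "!!v. smooth (%x. f' x v)"
   using smooth_obtain[OF fg(1)] by blast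
  have "((%x. L x + c) has_derivative L) (at x)" for x
   using bounded_linear_imp_has_derivative[OF assms(2)] by (intro has_derivative_add_const)
  hence "((%x. f (L x + c)) has_derivative (%v. f' (L x + c) (L v))) (at x)" for x
   using has_derivative_compose[of "%x. L x + c" L x UNIV f "f' (L x + c)"] f'(1) by simp
  note comp = this
  show ?case
   unfolding fg(2)
   by (rule exI, rule exI[of _ "%x v. f' (L x + c) (L v)"], intro conjI allI, rule refl,
     rule comp, use f'(2) in blast)
 qed
 with assms show ?thesis by blast
qed

lemma smooth_real_affine:
 fixes f :: "real => real"
 assumes "smooth f" shows "smooth (%x. f (a*x + b))"
 using smooth_compose_affine[OF assms bounded_linear_mult_right] .

lemma smooth_realI:
 fixes f :: "real => real"
 assumes "!!x. DERIV f x :> g x" "smooth g" shows "smooth f"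
proof (rule smooth.intros)
 show "(f has_derivative (*) (g x)) (at x)" for x using assms(1) by (simp add: has_field_derivative_def)
 show "smooth (%x. g x * v)" for v using smooth_cmult[OF assms(2), of v] by (simp add: mult.commute)
qed

lemma smooth_realD:
 fixes f :: "real => real"
 assumes "smooth f"
 shows "DERIV f x :> deriv f x" "smooth (deriv f)"
proof -
 obtain f' where f': "!!x. (f has_derivative f' x) (at x)" "!!v. smooth (%x. f' x v)"
  using smooth_obtain[OF assms] by blast
 have 1: "DERIV f x :> f' x 1" for x
 proof -
  obtain c where "f' x = (%v. v * c)"
   using has_derivative_bounded_linear[OF f'(1)[of x]] by (auto simp: real_bounded_linear)
  thus ?thesis using f'(1)[of x] by (simp add: has_field_derivative_def mult_commute_abs)
 qed
 hence "deriv f = (%x. f' x 1)" using DERIV_imp_deriv by blast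
 thus "DERIV f x :> deriv f x" "smooth (deriv f)"
  using 1 f'(2) by auto
qed

lemma smooth_deriv_n: "smooth f ==> smooth ((deriv ^^ n) (f :: real => real))"
 by (induction n) (auto intro: smooth_realD)

lemma smooth_deriv_n_has_derivative:
 "smooth f ==> DERIV ((deriv ^^ n) f) (x::real) :> (deriv ^^ Suc n) f x"
 using smooth_realD(1)[OF smooth_deriv_n] by simp

text \<open>The directional derivative of \<open>D n\<close> along \<open>v\<close> is
  \<open>D (Suc n) x * v\<close>, so the class for the coinduction has to contain constant multiples
  of the \<open>D n\<close>.\<close>

lemma smooth_real_coinduct:
 fixes D :: "nat => real => real"
 assumes "!!n x. DERIV (D n) x :> D (Suc n) x"
 shows "smooth (D 0)"
proof -
 have "EX n c. h = (%x. c*D n x) ==> smooth h" for h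
 proof (coinduction arbitrary: h rule: smooth.coinduct)
  case smooth
  then obtain n c where h: "h = (%x. c*D n x)" by blast
  have "(h has_derivative (%v. c*D (Suc n) x * v)) (at x)" for x
   using DERIV_cmult[OF assms, of c n x] unfolding h by (simp add: has_field_derivative_def)
  moreover have "(%x. c*D (Suc n) x * v) = (%x. (c * v)*D (Suc n) x)" for v by auto
  ultimately show ?case
   by (intro exI[of _ h] exI[of _ "%x v. c*D (Suc n) x * v"]) blast
 qed
 from this[of "%x. 1*D 0 x"] show ?thesis by fastforce
qed

lemma smooth_imp_continuous_on:
 fixes f :: "'a::euclidean_space => real"
 shows "smooth f ==> continuous_on A f"
 by (meson smooth_obtain has_derivative_continuous continuous_at_imp_continuous_on)

lemma smooth_borel: "smooth f ==> bm f"
 by (intro bm_cont smooth_imp_continuous_on)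

text \<open>Invariant for \<open>smooth_tensor\<close>: a single product \<open>f(t)*g(x)\<close> is
  not preserved by differentiation, but finite linear combinations of such products are.\<close>

inductive tensor_span :: "(real \<times> real => real) => bool" where
 "smooth f ==> smooth g ==> tensor_span (%z. f (fst z)*g (snd z))"
| "tensor_span a ==> tensor_span b ==> tensor_span (%z. a z + b z)"
| "tensor_span a ==> tensor_span (%z. c*a z)"

lemma tensor_span_derivative:
 "tensor_span a ==> EX a'. (ALL z. (a has_derivative a' z) (at z)) & (ALL v. tensor_span (%z. a' z v))"
proof (induction rule: tensor_span.induct)
 case (1 f g)
 let ?a' = "%z v. fst v * (deriv f (fst z)*g (snd z)) + snd v * (f (fst z)*deriv g (snd z))"
 have "((%z. f (fst z)*g (snd z)) has_derivative ?a' z) (at z)" for z :: "real \<times> real"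
 proof -
  have f: "((%z. f (fst z)) has_derivative (%v. deriv f (fst z)*fst v)) (at z)"
   using has_derivative_compose[OF bounded_linear_imp_has_derivative[OF bounded_linear_fst], of f "(*) (deriv f (fst z))" z UNIV]
    smooth_realD(1)[OF 1(1)] by (simp add: has_field_derivative_def)
  have g: "((%z. g (snd z)) has_derivative (%v. deriv g (snd z) * snd v)) (at z)"
   using has_derivative_compose[OF bounded_linear_imp_has_derivative[OF bounded_linear_snd], of g "(*) (deriv g (snd z))" z UNIV]
    smooth_realD(1)[OF 1(2)] by (simp add: has_field_derivative_def)
  show ?thesis
   by (rule has_derivative_eq_rhs[OF has_derivative_mult[OF f g]]) (auto simp: algebra_simps)
 qed
 moreover have "tensor_span (%z. ?a' z v)" for v
  by (intro tensor_span.intros 1 smooth_realD)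
 ultimately show ?case by (intro exI[of _ ?a']) blast
next
 case (2 a b)
 then obtain a' b' where "ALL z. (a has_derivative a' z) (at z)" "ALL v. tensor_span (%z. a' z v)"
  "ALL z. (b has_derivative b' z) (at z)" "ALL v. tensor_span (%z. b' z v)" by blast
 thus ?case
  by (intro exI[of _ "%z v. a' z v + b' z v"]) (auto intro!: tensor_span.intros(2) has_derivative_add)
next
 case (3 a c)
 then obtain a' where "ALL z. (a has_derivative a' z) (at z)" "ALL v. tensor_span (%z. a' z v)" by blast
 thus ?case
  by (intro exI[of _ "%z v. c*a' z v"]) (auto intro!: tensor_span.intros(3) has_derivative_mult_right)
qed

lemma smooth_tensor:
 fixes f g :: "real => real"
 assumes "smooth f" "smooth g"
 shows "smooth (%z. f (fst z)*g (snd z))"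
proof -
 have "tensor_span h ==> smooth h" for h
 proof (coinduction arbitrary: h rule: smooth.coinduct)
  case smooth
  thus ?case using tensor_span_derivative[OF smooth] by blast
 qed
 from this[OF tensor_span.intros(1)[OF assms]] show ?thesis .
qed

text \<open>The product of two functions is their tensor product restricted to the diagonal, a
  composition with a linear map.\<close>

lemma smooth_mult [intro]:
 fixes f g :: "real => real"
 assumes "smooth f" "smooth g" shows "smooth (%x. f x*g x)"
 using smooth_compose_affine[OF smooth_tensor[OF assms], of "%x. (x, x)" 0]
 by (simp add: bounded_linear_Pair bounded_linear_ident)

lemma smooth_id [intro]: "smooth (%x::real. x)"
 by (rule smooth_realI[of _ "%x. 1"]) auto

section \<open>Bump functions, smooth steps and mollifiers\<close>

fun flat_poly :: "nat => real poly" where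
 "flat_poly 0 = 1"
| "flat_poly (Suc n) = [:0, 0, 1:]*(flat_poly n - pderiv (flat_poly n))"

text \<open>\<open>flat n\<close> is the n-th derivative of \<open>exp (-1/x)\<close>, extended by 0
  to the left. The recursion of \<open>flat_poly\<close> is the product and chain rule for
  \<open>q(1/x)*exp (-1/x)\<close>.\<close>

definition "flat n x = (if x > 0 then poly (flat_poly n) (1 / x)*exp (- (1 / x)) else 0)" for x :: real


lemma poly_exp_tendsto_0: "((%x. poly q x*exp (- x)) ---> 0) at_top" for q :: "real poly"
proof -
 have "((%x. \<Sum>i\<le>degree q. coeff q i*(x ^ i / exp x)) ---> (\<Sum>i\<le>degree q. coeff q i*0)) at_top"
  by (intro tendsto_intros tendsto_power_div_exp_0)
 moreover have "poly q x*exp (- x) = (\<Sum>i\<le>degree q. coeff q i*(x ^ i / exp x))" for x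
  by (simp add: poly_altdef sum_distrib_right exp_minus divide_inverse mult.assoc)
 ultimately show ?thesis by simp
qed

lemma flat_has_derivative: "DERIV (flat n) x :> flat (Suc n) x"
proof -
 consider "x > 0" | "x < 0" | "x = 0" by linarith
 thus ?thesis
 proof cases
  case 1
  let ?f = "%x. poly (flat_poly n) (1 / x)*exp (- (1 / x))"
  have "DERIV ?f x :> flat (Suc n) x"
  proof -
   have a: "DERIV (%x. 1 / x) x :> - (1 / x^2)"
    using 1 by (auto intro!: derivative_eq_intros simp: power2_eq_square)
   have "(?f has_real_derivative poly (pderiv (flat_poly n)) (1 / x)*- (1 / x^2)*exp (- (1 / x))
     + exp (- (1 / x))*- (- (1 / x^2))*poly (flat_poly n) (1 / x)) (at x)"
    by (intro DERIV_mult DERIV_chain2[OF poly_DERIV a] DERIV_chain2[OF DERIV_exp DERIV_minus[OF a]])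
   also have "poly (pderiv (flat_poly n)) (1 / x)*- (1 / x^2)*exp (- (1 / x))
     + exp (- (1 / x))*- (- (1 / x^2))*poly (flat_poly n) (1 / x) = flat (Suc n) x"
    using 1 by (simp add: flat_def field_simps power2_eq_square)
   finally show ?thesis .
  qed
  thus ?thesis
   by (rule has_field_derivative_transform_within_open[of _ _ _ "{0<..}"]) (use 1 in "auto simp: flat_def")
 next
  case 2
  have "DERIV (%x. 0) x :> flat (Suc n) x" using 2 by (simp add: flat_def)
  thus ?thesis
   by (rule has_field_derivative_transform_within_open[of _ _ _ "{..<0}"]) (use 2 in "auto simp: flat_def")
 next
  case 3
  have "((%h. poly ([:0, 1:]*flat_poly n) (1 / h)*exp (- (1 / h))) ---> 0) (at_right 0)"
   by (rule filterlim_compose[OF poly_exp_tendsto_0])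
    (use filterlim_inverse_at_top_right in "simp add: inverse_eq_divide")
  hence r: "((%h. flat n h / h) ---> 0) (at_right 0)"
   by (rule Lim_transform_eventually) (auto simp: eventually_at_filter flat_def)
  have l: "((%h. flat n h / h) ---> 0) (at_left 0)"
   by (rule Lim_transform_eventually[OF tendsto_const]) (auto simp: eventually_at_filter flat_def)
  have "((%h. flat n h / h) ---> 0) (at 0)" using l r by (simp add: filterlim_at_split)
  thus ?thesis using 3 by (simp add: has_field_derivative_iff flat_def)
 qed
qed

definition "bump x = flat 0 (1 + x)*flat 0 (1 - x)" for x :: real

lemma smooth_bump: "smooth bump"
 unfolding bump_def
 using smooth_real_affine[OF smooth_real_coinduct[of flat, OF flat_has_derivative], of 1 1]
  smooth_real_affine[OF smooth_real_coinduct[of flat, OF flat_has_derivative], of "-1" 1]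
 by (intro smooth_mult) (auto simp: add.commute)

lemma bump: "bump x >= 0" "abs x >= 1 ==> bump x = 0" "abs x < 1 ==> bump x > 0" "bump (- x) = bump x"
 by (auto simp: bump_def flat_def)

text \<open>The lower limit lies strictly left of the support \<open>{-1..1}\<close>, so the two
  cases of the derivative lemma cover the line. \<open>bump_int 1\<close> is the total mass, used
  for normalisation.\<close>

definition "bump_int x = integral {-2..x} bump" for x :: real

lemma bump_int_deriv: "DERIV bump_int x :> bump x"
proof (cases "x > -2")
 case True
 have "((%u. integral {-2..u} bump) has_vector_derivative bump x) (at x within {-2..x+1})"
  by (rule integral_has_vector_derivative) (use True smooth_imp_continuous_on smooth_bump in auto)
 moreover have "at x within {-2..x+1} = at x"
  using True by (intro at_within_interior) (simp add: interior_atLeastAtMost_real)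
 ultimately show ?thesis
  by (simp add: bump_int_def[abs_def] real_vector_deriv)
next
 case False
 have "DERIV (%x. 0) x :> bump x" using False bump(2) by simp
 thus ?thesis
 proof (rule has_field_derivative_transform_within_open[of _ _ _ "{..<-1}"])
  fix u :: real assume "u \<in> {..<-1}"
  hence "integral {-2..u} bump = integral {-2..u} (%x. 0)"
   by (intro integral_cong) (auto intro!: bump(2))
  thus "0 = bump_int u" by (simp add: bump_int_def)
 qed (use False in auto)
qed

lemma bump_int_0: "x <= -1 ==> bump_int x = 0"
proof -
 assume "x <= -1"
 hence "integral {-2..x} bump = integral {-2..x} (%x. 0)"
  by (intro integral_cong) (auto intro!: bump(2))
 thus ?thesis by (simp add: bump_int_def)
qed

lemma bump_int_mono: "x <= y ==> bump_int x <= bump_int y"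
 by (rule deriv_nonneg_imp_mono[OF bump_int_deriv]) (auto intro: bump)

lemma bump_int_ge_1: "x >= 1 ==> bump_int x = bump_int 1"
proof -
 assume "x >= 1"
 hence "bump_int x <= bump_int 1"
  by (intro deriv_nonpos_imp_antimono[OF bump_int_deriv]) (auto simp: bump(2))
 with bump_int_mono[OF \<open>x >= 1\<close>] show ?thesis by simp
qed

lemma bump_int_pos: "bump_int 1 > 0"
proof -
 have "bump_int 0 < bump_int (1/2)"
  by (rule DERIV_pos_imp_increasing[of 0 "1/2" bump_int]) (auto intro!: exI[of _ "bump _"] bump_int_deriv bump)
 moreover have "bump_int 0 >= 0" using bump_int_mono[of "-1" 0] bump_int_0[of "-1"] by simp
 ultimately show ?thesis using bump_int_mono[of "1/2" 1] by simp
qed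

text \<open>The affine substitution moves the transition from \<open>{-1..1}\<close> to
  \<open>{0..1}\<close>.\<close>

definition "step x = bump_int (2*x - 1) / bump_int 1" for x :: real

lemma smooth_step: "smooth step"
proof -
 have "smooth bump_int" by (rule smooth_realI[OF bump_int_deriv smooth_bump])
 from smooth_cmult[OF smooth_real_affine[OF this, of 2 "-1"], of "inverse (bump_int 1)"]
 show ?thesis by (simp add: step_def[abs_def] divide_inverse mult.commute)
qed

lemma step: "x <= 0 ==> step x = 0" "x >= 1 ==> step x = 1" "0 <= step x" "step x <= 1"
proof -
 show "x <= 0 ==> step x = 0" "x >= 1 ==> step x = 1"
  using bump_int_pos bump_int_0[of "2*x - 1"] bump_int_ge_1[of "2*x - 1"] by (auto simp: step_def)
 show "0 <= step x"
  using bump_int_pos bump_int_0[of "min (-1) (2*x - 1)"] bump_int_mono[of "min (-1) (2*x - 1)" "2*x - 1"]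
  by (auto simp: step_def)
 show "step x <= 1"
  using bump_int_pos bump_int_ge_1[of "max 1 (2*x - 1)"] bump_int_mono[of "2*x - 1" "max 1 (2*x - 1)"]
  by (auto simp: step_def)
qed

definition "moll e x = bump (x / e) / (bump_int 1*e)" for e x :: real

lemma moll_smooth: "smooth (moll e)"
 using smooth_cmult[OF smooth_real_affine[OF smooth_bump, of "1 / e" 0], of "1 / (bump_int 1*e)"]
 by (simp add: moll_def[abs_def])

lemma moll:
 assumes "e > 0"
 shows "moll e x >= 0" "abs x >= e ==> moll e x = 0" "moll e (- x) = moll e x"
 using assms bump_int_pos bump(1)[of "x/e"] bump(2)[of "x/e"] bump(4)[of "x/e"] by (auto simp: moll_def)

lemma bump_has_integral: "has_bochner_integral lborel bump (bump_int 1)"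
proof -
 have "has_bochner_integral lborel (%x. bump x*indicator {-1..1} x) (bump_int 1 - bump_int (-1))"
  by (rule has_bochner_integral_FTC_Icc_nonneg)
   (auto intro!: bump bump_int_deriv has_field_derivative_at_within smooth_borel smooth_bump
     simp: real_vector_deriv[symmetric])
 moreover have "bump x*indicator {-1..1} x = bump x" for x
 proof -
  have "bump x = 0" if "x \<notin> {-1..1}" using that by (intro bump(2)) auto
  thus ?thesis by (auto simp: indicator_def)
 qed
 ultimately show ?thesis using bump_int_0[of "-1"] by simp
qed

lemma moll_integral:
 assumes "e > 0"
 shows "intg (moll e)" "(LBINT x. moll e x) = 1"
proof -
 have "intg (%x. bump (0 + (1/e)*x))"
  using bump_has_integral assms
  by (intro lborel_integrable_real_affine) (auto simp: has_bochner_integral_iff)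
 hence i: "intg (%x. bump (x / e))" by simp
 thus "intg (moll e)" unfolding moll_def by simp
 have "bump_int 1 = abs (1/e) *\<^sub>R (LBINT x. bump (0 + (1/e)*x))"
  using bump_has_integral assms lborel_integral_real_affine[of "1/e" bump 0]
  by (auto simp: has_bochner_integral_iff)
 hence "(LBINT x. bump (x / e)) = bump_int 1*e"
  using assms by (simp add: field_simps)
 thus "(LBINT x. moll e x) = 1"
  using assms bump_int_pos by (simp add: moll_def)
qed

lemma test_function_UNIV_I:
 assumes "smooth phi" "!!x::real. abs x > R ==> phi x = 0"
 shows "testf phi"
proof -
 have "{x. phi x ~= 0} \<subseteq> {-R..R}" using assms(2) by (force simp: abs_le_iff not_less[symmetric])
 hence "closure {x. phi x ~= 0} \<subseteq> {-R..R}" by (rule closure_minimal) auto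
 hence "compact (closure {x. phi x ~= 0})"
  by (metis closed_closure compact_Icc compact_Int_closed inf.absorb_iff2)
 thus ?thesis using assms(1) by (simp add: test_function_def)
qed

section \<open>Square integrable functions on a measure space\<close>

definition sqint :: "'a measure => ('a => real) => bool" where
 "sqint M f \<longleftrightarrow> f \<in> borel_measurable M & integrable M (%x. (f x)^2)"

definition nrm :: "'a measure => ('a => real) => real" where
 "nrm M f = sqrt (LINT x|M. (f x)^2)"

lemma nrm_nonneg [simp]: "nrm M f >= 0" by (simp add: nrm_def)

lemma nrm_sq: "(nrm M f)^2 = (LINT x|M. (f x)^2)" by (simp add: nrm_def)

lemma sqint_measurable: "sqint M f ==> f \<in> borel_measurable M" by (simp add: sqint_def)

lemma sqint_bound:
 assumes "sqint M g" "f \<in> borel_measurable M" "AE x in M. abs (f x) <= abs (g x)"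
 shows "sqint M f" "nrm M f <= nrm M g"
proof -
 have 1: "AE x in M. (f x)^2 <= (g x)^2"
  using assms(3) by eventually_elim (simp add: abs_le_square_iff)
 show s: "sqint M f" unfolding sqint_def
  using assms 1 by (auto simp: sqint_def intro!: int_bound[of M "%x. (g x)^2"])
 show "nrm M f <= nrm M g" unfolding nrm_def
  using assms(1) s 1 by (auto simp: sqint_def intro!: integral_mono_AE)
qed

lemma sqint_mult:
 assumes "sqint M f" "sqint M g"
 shows "integrable M (%x. f x*g x)"
proof (rule int_bound[of M "%x. (f x)^2 + (g x)^2"])
 show "AE x in M. norm (f x*g x) <= norm ((f x)^2 + (g x)^2)"
 proof (rule AE_I2)
  fix x
  have "2*(abs (f x)*abs (g x)) <= (f x)^2 + (g x)^2"
   using sum_squares_bound[of "abs (f x)" "abs (g x)"] by (simp add: mult.assoc)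
  moreover have "0 <= abs (f x)*abs (g x)" by simp
  ultimately have "abs (f x)*abs (g x) <= (f x)^2 + (g x)^2" by linarith
  thus "norm (f x*g x) <= norm ((f x)^2 + (g x)^2)" by (simp add: abs_mult)
 qed
qed (use assms in "auto simp: sqint_def")

lemma sqint_add:
 assumes "sqint M f" "sqint M g"
 shows "sqint M (%x. f x + g x)"
proof -
 have "integrable M (%x. (f x)^2 + (g x)^2 + 2*(f x*g x))"
  using assms sqint_mult[OF assms] by (auto simp: sqint_def)
 moreover have "(%x. (f x)^2 + (g x)^2 + 2*(f x*g x)) = (%x. (f x + g x)^2)"
  by (auto simp: power2_eq_square algebra_simps)
 ultimately show ?thesis using assms by (auto simp: sqint_def)
qed

lemma sqint_cmult: "sqint M f ==> sqint M (%x. c*f x)"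
 by (auto simp: sqint_def power_mult_distrib)

lemma sqint_minus: "sqint M f ==> sqint M (%x. - f x)"
 by (auto simp: sqint_def)

lemma sqint_diff: "sqint M f ==> sqint M g ==> sqint M (%x. f x - g x)"
 using sqint_add[of M f "%x. - g x"] sqint_minus by auto

lemma sqint_abs: "sqint M f ==> sqint M (%x. abs (f x))"
 by (auto simp: sqint_def)

lemma sqint_zero [simp]: "sqint M (%x. 0)" by (simp add: sqint_def)

lemma nrm_cmult: "nrm M (%x. c*f x) = abs c*nrm M f"
 by (simp add: nrm_def power_mult_distrib real_sqrt_mult)

lemma nrm_minus [simp]: "nrm M (%x. - f x) = nrm M f" by (simp add: nrm_def)
lemma nrm_abs [simp]: "nrm M (%x. abs (f x)) = nrm M f" by (simp add: nrm_def)

lemma nrm_minus_commute: "nrm M (%x. f x - g x) = nrm M (%x. g x - f x)"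
 by (simp add: nrm_def power2_commute)

lemma cauchy_schwarz:
 assumes "sqint M f" "sqint M g"
 shows "abs (\<integral>x. f x*g x \<partial>M) <= nrm M f*nrm M g"
proof -
 define A B C where "A = (LINT x|M. (f x)^2)" "B = (LINT x|M. (g x)^2)" "C = (LINT x|M. f x*g x)"
 have nn: "A >= 0" "B >= 0" by (auto simp: A_B_C_def)
 have q: "t^2*A + 2*t*C + B >= 0" for t
 proof -
  have "t^2*A + 2*t*C + B = (LINT x|M. t^2*(f x)^2 + 2*t*(f x*g x) + (g x)^2)"
   using assms sqint_mult[OF assms] by (simp add: sqint_def A_B_C_def)
  also have "... = (LINT x|M. (t*f x + g x)^2)"
   by (intro int_cong) (auto simp: power2_eq_square algebra_simps)
  also have "... >= 0" by simp
  finally show ?thesis .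
 qed
 have "C^2 <= A*B"
 proof (cases "A = 0")
  case True
  have "C = 0"
  proof (rule ccontr)
   assume "C ~= 0"
   with q[of "- (B + 1) / (2*C)"] True show False by (simp add: field_simps)
  qed
  thus ?thesis using nn by simp
 next
  case False
  hence "A > 0" using nn by simp
  have "0 <= A*((- C / A)^2*A + 2*(- C / A)*C + B)"
   using q[of "- C / A"] nn by (intro mult_nonneg_nonneg) auto
  also have "... = A*B - C^2" using \<open>A > 0\<close> by (simp add: field_simps power2_eq_square)
  finally show ?thesis by simp
 qed
 hence "sqrt (C^2) <= sqrt (A*B)" by (rule real_sqrt_le_mono)
 thus ?thesis by (simp add: nrm_def A_B_C_def real_sqrt_mult)
qed

lemma nrm_triangle:
 assumes "sqint M f" "sqint M g"
 shows "nrm M (%x. f x + g x) <= nrm M f + nrm M g"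
proof (rule power2_le_imp_le)
 have "(nrm M (%x. f x + g x))^2 = (LINT x|M. (f x)^2 + 2*(f x*g x) + (g x)^2)"
  unfolding nrm_sq by (intro int_cong) (auto simp: power2_eq_square algebra_simps)
 also have "... = (nrm M f)^2 + 2*(LINT x|M. f x*g x) + (nrm M g)^2"
  using assms sqint_mult[OF assms] by (simp add: sqint_def nrm_sq)
 also have "... <= (nrm M f)^2 + 2*(nrm M f*nrm M g) + (nrm M g)^2"
  using cauchy_schwarz[OF assms] by (simp add: abs_le_iff)
 also have "... = (nrm M f + nrm M g)^2" by (simp add: power2_eq_square algebra_simps)
 finally show "(nrm M (%x. f x + g x))^2 <= (nrm M f + nrm M g)^2" .
qed simp

lemma nrm_triangle_diff:
 assumes "sqint M f" "sqint M g"
 shows "nrm M (%x. f x - g x) <= nrm M f + nrm M g"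
 using nrm_triangle[OF assms(1) sqint_minus[OF assms(2)]] by simp

lemma nrm_triangle_ge:
 assumes "sqint M f" "sqint M g"
 shows "abs (nrm M f - nrm M g) <= nrm M (%x. f x - g x)"
 using nrm_triangle[OF sqint_diff[OF assms] assms(2)]
  nrm_triangle[OF sqint_diff[OF assms(2,1)] assms(1)] nrm_minus_commute[of M f g] by simp

section \<open>L2 on the line: translation and integration by parts\<close>

abbreviation "sql == sqint (lborel :: real measure)"
abbreviation "nl == nrm (lborel :: real measure)"

lemma lborel_integral_shift: "(LBINT x. f (x + c)) = (LBINT x. f (x::real) :: real)"
 using lborel_integral_real_affine[of 1 f c] by (simp add: add.commute)

lemma lborel_integrable_shift: "intg f ==> intg (%x::real. f (x + c) :: real)"
 using lborel_integrable_real_affine[of f 1 c] by (simp add: add.commute)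

lemma lborel_integral_reflect: "(LBINT y. f (x - y)) = (LBINT y. f (y::real) :: real)"
 using lborel_integral_real_affine[of "-1" f x] by simp

lemma lborel_integrable_reflect: "intg f ==> intg (%y::real. f (x - y) :: real)"
 using lborel_integrable_real_affine[of f "-1" x] by simp

lemma sql_shift: "sql f ==> sql (%x. f (x + c))"
 using lborel_integrable_shift[of "%x. (f x)^2" c] by (auto simp: sqint_def)

lemma nl_shift: "nl (%x. f (x + c)) = nl f"
 using lborel_integral_shift[of "%x. (f x)^2" c] by (simp add: nrm_def)

text \<open>Integrate \<open>F' (x + s)\<close> over all \<open>x\<close> and \<open>s\<close> in
  [0, 1] in both orders: one order gives the integral of \<open>F'\<close>, the other that of
  \<open>F (x + 1) - F x\<close>, which is 0. Limits of \<open>F\<close> at infinity never have to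
  be discussed.\<close>

lemma integral_deriv_zero:
 fixes F :: "real => real"
 assumes F: "!!x. DERIV F x :> F' x" and c: "cont F'"
  and i: "intg F" "intg F'"
 shows "(LBINT x. F' x) = 0"
proof -
 have [measurable]: "bm F'" using c by (rule bm_cont)
 let ?f = "%(s, x). indicator {0..1} s * F' (x + s) :: real"
 have int: "integrable (lborel \<Otimes>\<^sub>M lborel) ?f"
 proof (rule lborel_pair.Fubini_integrable)
  have "(LBINT x. norm (?f (s, x))) = indicator {0..1} s * (LBINT x. abs (F' x))" for s
   using lborel_integral_shift[of "%x. abs (F' x)" s] by (simp add: abs_mult)
  thus "intg (%s. LBINT x. norm (?f (s, x)))" by simp
  show "ae s. intg (%x. ?f (s, x))"
   using lborel_integrable_shift[OF i(2)] by auto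
 qed measurable
 have "(LBINT x. (LBINT s. ?f (s, x))) = (LBINT s. (LBINT x. ?f (s, x)))"
  using lborel_pair.Fubini_integral[OF int] by simp
 also have "... = (LBINT s. indicator {0..1::real} s * (LBINT x. F' x))"
  using lborel_integral_shift[of F'] by simp
 also have "... = (LBINT x. F' x)" by simp
 also have "(LBINT x. (LBINT s. ?f (s, x))) = (LBINT x. F (x + 1) - F x)"
 proof (rule int_cong[OF refl])
  fix x
  have "has_bochner_integral lborel (%s. indicator {0..1} s *\<^sub>R F' (x + s)) (F (x + 1) - F (x + 0))"
  proof (rule has_bochner_integral_FTC_Icc)
   fix s :: real
   show "((%s. F (x + s)) has_vector_derivative F' (x + s)) (at s within {0..1})"
    using DERIV_shift[of F "F' (x + s)" s x] F[of "x + s"]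
    by (simp add: add.commute real_vector_deriv has_vector_derivative_at_within)
  qed (auto intro!: continuous_intros continuous_on_compose2[OF c])
  thus "(LBINT s. ?f (s, x)) = F (x + 1) - F x"
   by (simp add: has_bochner_integral_iff)
 qed
 also have "... = 0"
  using i(1) lborel_integrable_shift[OF i(1), of 1] lborel_integral_shift[of F 1] by simp
 finally show ?thesis by simp
qed

lemma integral_by_parts_line:
 assumes "!!x. DERIV f x :> f' x" "!!x. DERIV g x :> g' x"
  "cont f'" "cont g'" "sql f" "sql f'" "sql g" "sql g'"
 shows "(LBINT x. f x*g' x) = - (LBINT x. f' x*g x)"
proof -
 have cf: "cont f" "cont g"
  using assms(1,2) by (meson DERIV_isCont continuous_at_imp_continuous_on)+
 have i: "intg (%x. f' x*g x)" "intg (%x. f x*g' x)" "intg (%x. f x*g x)"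
  using assms by (auto intro: sqint_mult)
 have "(LBINT x. f' x*g x + f x*g' x) = 0"
  by (rule integral_deriv_zero[of "%x. f x*g x"])
   (use i cf assms in "auto intro!: derivative_eq_intros continuous_intros")
 thus ?thesis using i by simp
qed

section \<open>Convolution, mollification and H1 functions\<close>

definition conv :: "(real => real) => (real => real) => real => real" where
 "conv f phi x = (LBINT y. f y*phi (x - y))"

text \<open>Bounded and compactly supported, but not necessarily continuous: indicators of intervals
  are kernels as well, which \<open>osc\<close> relies on.\<close>

definition kernel :: "real => (real => real) => bool" where
 "kernel e phi \<longleftrightarrow> bm phi & (EX K. ALL x. abs (phi x) <= K) & (ALL x. abs x > e --> phi x = 0)"

lemma kernel_integrable:
 assumes "kernel e phi"
 shows "intg phi" "sql phi"
proof -
 obtain K where K: "!!x. abs (phi x) <= K" using assms by (auto simp: kernel_def)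
 have m: "bm phi" using assms by (simp add: kernel_def)
 have z: "abs x > e ==> phi x = 0" for x using assms by (simp add: kernel_def)
 have i: "intg (%x. indicator {-e..e} x*c)" for c :: real
  by (intro integrable_mult_left integrable_real_indicator) (auto simp: emeasure_lborel_Icc_eq)
 show "intg phi"
 proof (rule int_bound[OF i[of K]])
  show "ae x. norm (phi x) <= norm (indicator {-e..e} x*K)"
  proof (rule AE_I2)
   fix x show "norm (phi x) <= norm (indicator {-e..e} x*K)"
    using K[of x] z[of x] by (cases "x \<in> {-e..e}") (auto simp: abs_le_iff)
  qed
 qed (use m in auto)
 have "intg (%x. (phi x)^2)"
 proof (rule int_bound[OF i[of "K^2"]])
  show "ae x. norm ((phi x)^2) <= norm (indicator {-e..e} x*K^2)"
  proof (rule AE_I2)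
   fix x
   have "(phi x)^2 <= K^2" using power_mono[OF K[of x], of 2] by simp
   thus "norm ((phi x)^2) <= norm (indicator {-e..e} x*K^2)"
    using z[of x] by (cases "x \<in> {-e..e}") (auto simp: abs_le_iff)
  qed
 qed (use m in auto)
 thus "sql phi" using m by (simp add: sqint_def)
qed

lemma kernel_reflect: "kernel e phi ==> sql (%y. phi (x - y))"
 using lborel_integrable_reflect[of "%x. (phi x)^2" x] kernel_integrable[of e phi]
 by (auto simp: sqint_def)

lemma conv_integrable: "sql f ==> kernel e phi ==> intg (%y. f y*phi (x - y))"
 by (intro sqint_mult kernel_reflect)

lemma conv_measurable [measurable]:
 assumes [measurable]: "bm f" "bm phi"
 shows "bm (conv f phi)"
 unfolding conv_def[abs_def] by measurable

text \<open>Splitting the kernel into two factors of size \<open>sqrt (abs phi)\<close>, one of them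
  carrying the sign, and applying Cauchy-Schwarz gives the pointwise bound \<open>pw\<close>. Fubini
  then integrates it, the mass of the translated kernel being independent of the
  translation.\<close>

lemma young:
 assumes f: "sql f" and k: "kernel e phi"
 shows "sql (conv f phi)" "nl (conv f phi) <= (LBINT x. abs (phi x))*nl f"
proof -
 define C where "C = (LBINT x. abs (phi x))"
 have C: "C >= 0" by (simp add: C_def)
 have [measurable]: "bm f" "bm phi"
  using f k by (auto simp: sqint_def kernel_def)
 have iphi: "intg (%x. abs (phi x))" using kernel_integrable[OF k] by auto
 obtain K where K: "!!x. abs (phi x) <= K" using k by (auto simp: kernel_def)
 have if2: "intg (%y. (f y)^2*abs (phi (x - y)))" for x
  by (rule int_bound[of lborel "%y. (f y)^2*K"])
   (use f K in "auto simp: sqint_def abs_mult intro!: mult_left_mono order_trans[OF K]")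
 have pw: "(conv f phi x)^2 <= C*(LBINT y. (f y)^2*abs (phi (x - y)))" for x
 proof -
  let ?a = "%y. f y * sqrt (abs (phi (x - y)))" and ?b = "%y. sgn (phi (x - y)) * sqrt (abs (phi (x - y)))"
  have 1: "sql ?a" unfolding sqint_def using if2[of x] by (simp add: power_mult_distrib)
  have b2: "(?b y)^2 = abs (phi (x - y))" for y by (simp add: power_mult_distrib sgn_if)
  have 2: "sql ?b" unfolding sqint_def b2 using lborel_integrable_reflect[OF iphi, of x] by simp
  have "?a y*?b y = f y*phi (x - y)" for y
  proof -
   have "?a y*?b y = f y*(sgn (phi (x - y))*(sqrt (abs (phi (x - y))))^2)"
    by (simp only: power2_eq_square mult_ac)
   thus ?thesis by (simp add: sgn_mult_abs mult.commute abs_mult_sgn)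
  qed
  hence eq: "(%y. f y*phi (x - y)) = (%y. ?a y*?b y)" by metis
  have "abs (conv f phi x) <= nl ?a*nl ?b"
   using cauchy_schwarz[OF 1 2] unfolding conv_def eq .
  hence "(abs (conv f phi x))^2 <= (nl ?a*nl ?b)^2" by (intro power_mono) auto
  also have "... = (nl ?a)^2*(nl ?b)^2" by (rule power_mult_distrib)
  also have "(nl ?b)^2 = C"
   unfolding nrm_sq b2 C_def by (rule lborel_integral_reflect)
  also have "(nl ?a)^2 = (LBINT y. (f y)^2*abs (phi (x - y)))"
   unfolding nrm_sq by (simp add: power_mult_distrib)
  finally show ?thesis by (simp add: mult.commute)
 qed
 have int2: "integrable (lborel \<Otimes>\<^sub>M lborel) (%(y, x). (f y)^2*abs (phi (x - y)))"
 proof (rule lborel_pair.Fubini_integrable)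
  have c: "(LBINT x. abs (phi (x - y))) = C" for y
   using lborel_integral_shift[of "%x. abs (phi x)" "-y"] by (simp add: C_def)
  show "intg (%y. LBINT x. norm (case (y, x) of (y, x) => (f y)^2*abs (phi (x - y))))"
   using f by (simp add: sqint_def abs_mult c)
  show "ae y. intg (%x. case (y, x) of (y, x) => (f y)^2*abs (phi (x - y)))"
   using lborel_integrable_shift[OF iphi, of "- _"] by auto
 qed measurable
 have dom: "intg (%x. C*(LBINT y. (f y)^2*abs (phi (x - y))))"
  using lborel_pair.integrable_snd[OF int2] by simp
 have "intg (%x. (conv f phi x)^2)"
  by (rule int_bound[OF dom]) (use pw in "auto intro!: AE_I2 order_trans[OF pw abs_ge_self]")
 thus s: "sql (conv f phi)" by (simp add: sqint_def)
 have "(nl (conv f phi))^2 <= (LBINT x. C*(LBINT y. (f y)^2*abs (phi (x - y))))"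
  unfolding nrm_sq by (rule integral_mono) (use s dom pw in "auto simp: sqint_def")
 also have "... = C*(LBINT x. (LBINT y. (f y)^2*abs (phi (x - y))))" by simp
 also have "(LBINT x. (LBINT y. (f y)^2*abs (phi (x - y)))) = (LBINT y. (LBINT x. (f y)^2*abs (phi (x - y))))"
  using lborel_pair.Fubini_integral[OF int2] by simp
 also have "... = (LBINT y. (f y)^2*C)"
  using lborel_integral_shift[of "%x. abs (phi x)" "- _"] by (simp add: C_def)
 also have "C*(LBINT y. (f y)^2*C) = (C*nl f)^2"
  unfolding power_mult_distrib nrm_sq by (simp add: power2_eq_square[of C])
 finally show "nl (conv f phi) <= (LBINT x. abs (phi x))*nl f"
  unfolding C_def[symmetric] by (rule power2_le_imp_le) (simp add: C)
qed

lemma continuous_kernel: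
 assumes "cont phi" "!!x. abs x > e ==> phi x = 0"
 shows "kernel e phi"
proof -
 have "bounded (phi ` {-e..e})"
  by (intro compact_imp_bounded compact_continuous_image continuous_on_subset[OF assms(1)]) auto
 then obtain K where K: "!!x. x \<in> {-e..e} ==> abs (phi x) <= K"
  unfolding bounded_iff by (metis image_eqI real_norm_def)
 have "abs (phi x) <= abs K" for x
 proof (cases "abs x > e")
  case False
  hence "x \<in> {-e..e}" by auto
  from K[OF this] show ?thesis by simp
 qed (use assms(2) in auto)
 thus ?thesis unfolding kernel_def
  using assms by (auto intro: bm_cont)
qed

lemma conv_eq_integral:
 assumes f: "cont f" and phi: "cont phi" "!!x. abs x > e ==> phi x = 0"
  and ab: "a <= x - e" "x + e <= b"
 shows "conv f phi x = integral {a..b} (%y. f y*phi (x - y))"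
proof -
 let ?h = "%y. f y*phi (x - y)"
 have c: "continuous_on {a..b} ?h"
  by (intro continuous_intros continuous_on_subset[OF f] continuous_on_compose2[OF phi(1)]) auto
 have z: "y \<notin> {a..b} ==> phi (x - y) = 0" for y
  using ab by (intro phi(2)) auto
 have "conv f phi x = (LBINT y:{a..b}. ?h y)"
  unfolding conv_def set_lebesgue_integral_def
  by (rule int_cong) (use z in "auto simp: indicator_def")
 also have "... = integral {a..b} ?h"
  by (rule set_borel_integral_eq_integral(2)[OF borel_integrable_atLeastAtMost'[OF c]])
 finally show ?thesis .
qed

lemma conv_deriv:
 assumes f: "cont f" and phi: "!!x. DERIV phi x :> phi' x"
  and c: "cont phi'" and z: "!!x. abs x > e ==> phi x = 0" "!!x. abs x > e ==> phi' x = 0"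
 shows "DERIV (conv f phi) x :> conv f phi' x"
proof -
 have cphi: "cont phi" by (rule DERIV_cont[OF phi])
 let ?a = "x - e - 1" and ?b = "x + e + 1"
 have "((%u. integral (cbox ?a ?b) (%y. f y*phi (u - y))) has_field_derivative
   integral (cbox ?a ?b) (%y. f y*phi' (x - y))) (at x within ball x 1)"
 proof (rule leibniz_rule_field_derivative)
  fix u y :: real
  have "DERIV (%u. f y*phi (u - y)) u :> f y*(phi' (u - y)*(1 - 0))"
   by (intro DERIV_cmult DERIV_chain2[OF phi] DERIV_diff DERIV_ident DERIV_const)
  thus "((%u. f y*phi (u - y)) has_field_derivative f y*phi' (u - y)) (at u within ball x 1)"
   by (simp add: has_field_derivative_at_within)
 next
  fix u
  show "(%y. f y*phi (u - y)) integrable_on cbox ?a ?b"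
   by (intro integrable_continuous continuous_intros continuous_on_subset[OF f] continuous_on_compose2[OF cphi]) auto
 next
  show "continuous_on (ball x 1 \<times> cbox ?a ?b) (%(u, y). f y*phi' (u - y))"
   unfolding case_prod_beta
   by (intro continuous_intros continuous_on_compose2[OF f] continuous_on_compose2[OF c]) auto
 qed auto
 hence "((%u. integral {?a..?b} (%y. f y*phi (u - y))) has_real_derivative
   integral {?a..?b} (%y. f y*phi' (x - y))) (at x)"
  by (simp add: at_within_open[of x "ball x 1"])
 hence "DERIV (conv f phi) x :> (integral {?a..?b} (%y. f y*phi' (x - y)))"
 proof (rule has_field_derivative_transform_within_open[of _ _ _ "ball x 1"])
  fix u assume "u \<in> ball x 1"
  thus "integral {?a..?b} (%y. f y*phi (u - y)) = conv f phi u"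
   by (intro conv_eq_integral[OF f cphi z(1), symmetric]) (auto simp: dist_real_def abs_diff_less_iff)
 qed auto
 thus ?thesis using conv_eq_integral[OF f c z(2), of e ?a x ?b] by simp
qed

lemma deriv_n_zero_outside:
 fixes f :: "real => real"
 assumes "open S" "!!x. x \<in> S ==> f x = 0" "x \<in> S"
 shows "(deriv ^^ n) f x = 0"
 using assms(3)
proof (induction n arbitrary: x)
 case (Suc n)
 have "DERIV ((deriv ^^ n) f) x :> 0"
  by (rule has_field_derivative_transform_within_open[OF DERIV_const[of 0] assms(1) Suc.prems]) (simp add: Suc.IH)
 thus ?case by (simp add: DERIV_imp_deriv)
qed (use assms(2) in simp)

lemma deriv_n_zero_far:
 fixes f :: "real => real"
 assumes "!!x. abs x > R ==> f x = 0" "abs x > R"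
 shows "(deriv ^^ n) f x = 0"
proof (rule deriv_n_zero_outside)
 show "open {x::real. abs x > R}" by (intro open_Collect_less continuous_intros)
 show "f y = 0" if "y \<in> {x. abs x > R}" for y using that by (intro assms(1)) simp
 show "x \<in> {x. abs x > R}" using assms(2) by simp
qed

lemma test_function_deriv_zero:
 assumes "test_function S (phi :: real => real)" "x \<notin> S" shows "deriv phi x = 0"
proof -
 have x: "x \<in> - closure {x. phi x ~= 0}" using assms by (auto simp: test_function_def)
 have "(deriv ^^ 1) phi x = 0"
 proof (rule deriv_n_zero_outside[OF _ _ x])
  show "phi y = 0" if "y \<in> - closure {x. phi x ~= 0}" for y
   using that closure_subset[of "{x. phi x ~= 0}"] by auto
 qed (rule open_Compl[OF closed_closure])
 thus ?thesis by simp
qed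

lemma moll_kernel:
 assumes "e > 0"
 shows "kernel e ((deriv ^^ n) (moll e))" "abs x > e ==> (deriv ^^ n) (moll e) x = 0"
proof -
 have z: "abs x > e ==> (deriv ^^ n) (moll e) x = 0" for x
  by (rule deriv_n_zero_far[of e]) (simp_all add: moll(2)[OF assms])
 thus "abs x > e ==> (deriv ^^ n) (moll e) x = 0" .
 show "kernel e ((deriv ^^ n) (moll e))"
  by (intro continuous_kernel smooth_imp_continuous_on smooth_deriv_n moll_smooth z)
qed

lemma conv_moll_deriv:
 assumes "e > 0" "cont f"
 shows "DERIV (conv f ((deriv ^^ n) (moll e))) x :> conv f ((deriv ^^ Suc n) (moll e)) x"
proof (rule conv_deriv[OF assms(2), where e=e])
 show "DERIV ((deriv ^^ n) (moll e)) x :> (deriv ^^ Suc n) (moll e) x" for x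
  by (rule smooth_deriv_n_has_derivative[OF moll_smooth])
 show "cont ((deriv ^^ Suc n) (moll e))"
  by (rule smooth_imp_continuous_on[OF smooth_deriv_n[OF moll_smooth]])
qed (rule moll_kernel(2)[OF assms(1)], assumption)+

text \<open>\<open>moll e (x - y)\<close> is a probability density in \<open>y\<close> carried by
  the points within \<open>e\<close> of \<open>x\<close>, so the average is no farther from
  \<open>c\<close> than the values of \<open>f\<close> there.\<close>

lemma moll_osc:
 assumes e: "e > 0" and i2: "intg (%y. f y*moll e (x - y))"
  and m: "!!y. abs (x - y) <= e ==> abs (f y - c) <= m"
 shows "abs (conv f (moll e) x - c) <= m"
proof -
 have i: "intg (%y. moll e (x - y))"
  by (rule lborel_integrable_reflect[OF moll_integral(1)[OF e]])
 have one: "(LBINT y. moll e (x - y)) = 1"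
  using lborel_integral_reflect[of "moll e" x] moll_integral(2)[OF e] by simp
 have "conv f (moll e) x - c = (LBINT y. f y*moll e (x - y) - c*moll e (x - y))"
  using i i2 one by (simp add: conv_def)
 also have "abs ... <= (LBINT y. m*moll e (x - y))"
 proof (rule order_trans[OF integral_abs_bound], rule integral_mono)
  fix y
  show "abs (f y*moll e (x - y) - c*moll e (x - y)) <= m*moll e (x - y)"
  proof (cases "abs (x - y) <= e")
   case True
   have "abs (f y*moll e (x - y) - c*moll e (x - y)) = abs (f y - c)*moll e (x - y)"
    using moll(1)[OF e] by (simp add: left_diff_distrib[symmetric] abs_mult)
   thus ?thesis using m[OF True] moll(1)[OF e] by (simp add: mult_right_mono)
  qed (use moll(2)[OF e] in auto)
 qed (use i i2 in auto)
 also have "... = m" using i one by simp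
 finally show ?thesis .
qed

text \<open>Continuous representative \<open>Z\<close> with square integrable weak derivative
  \<open>D\<close>, encoded by the fundamental theorem of calculus rather than by test functions, so
  that pointwise bounds come directly. \<open>in_H1_rep\<close> and \<open>H1_H_norm\<close> connect
  it with \<open>in_H 1\<close>.\<close>

definition H1 :: "(real => real) => (real => real) => bool" where
 "H1 Z D \<longleftrightarrow> cont Z & sql Z & sql D &
   (ALL x y. x <= y --> Z y - Z x = (LBINT s. D s * indicator {x..y} s))"

lemma H1_diff_le:
 assumes "H1 Z D"
 shows "abs (Z y - Z x) <= (LBINT s. abs (D s)*indicator {min x y..max x y} s)"
proof -
 have le: "abs (Z y - Z x) <= (LBINT s. abs (D s)*indicator {x..y} s)" if "x <= y" for x y
 proof -
  have "Z y - Z x = (LBINT s. D s * indicator {x..y} s)" using assms that by (simp add: H1_def)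
  also have "abs ... <= (LBINT s. abs (D s * indicator {x..y} s))" by (rule integral_abs_bound)
  finally show ?thesis by (simp add: abs_mult)
 qed
 show ?thesis
  using le[of x y] le[of y x] by (cases "x <= y") (auto simp: min_def max_def abs_minus_commute)
qed

lemma H1D:
 assumes "H1 Z D"
 shows "cont Z" "sql Z" "sql D" "x <= y ==> Z y - Z x = (LBINT s. D s * indicator {x..y} s)"
 using assms by (auto simp: H1_def)

text \<open>The integral of \<open>abs D\<close> over \<open>{x - e..x + e}\<close>. It majorises
  the oscillation at scale \<open>e\<close> of any primitive of \<open>D\<close>, and by Young's
  inequality its L2 norm is at most \<open>2*e*nl D\<close>; every mollification error below is
  reduced to it.\<close>

definition osc :: "real => (real => real) => real => real" where
 "osc e D = conv (%x. abs (D x)) (indicator {-e..e})"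

lemma osc:
 assumes e: "e > 0" and D: "sql D"
 shows "sql (osc e D)" "nl (osc e D) <= 2*e*nl D" "osc e D x >= 0"
proof -
 have k: "kernel e (indicator {-e..e})"
  by (auto simp: kernel_def indicator_def intro!: exI[of _ 1])
 have "(LBINT x. abs (indicator {-e..e} x :: real)) = 2*e" using e by simp
 thus "sql (osc e D)" "nl (osc e D) <= 2*e*nl D"
  using young[OF sqint_abs[OF D] k] by (auto simp: osc_def)
 show "osc e D x >= 0" unfolding osc_def conv_def by (intro Bochner_Integration.integral_nonneg) auto
qed

lemma integrable_abs_indicator:
 assumes "sql D" shows "intg (%s. abs (D s)*indicator {a..b} s)"
proof -
 have "(%x. (indicator {a..b} x)^2) = (indicator {a..b} :: real => real)" by (auto simp: indicator_def)
 hence "sql (indicator {a..b})"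
  by (auto simp: sqint_def emeasure_lborel_Icc_eq intro!: integrable_real_indicator)
 thus ?thesis by (intro sqint_mult sqint_abs assms)
qed

lemma H1_osc:
 assumes e: "e > 0" and H: "H1 Z D" and xy: "abs (x - y) <= e"
 shows "abs (Z y - Z x) <= osc e D x"
proof -
 have D: "sql D" using H by (simp add: H1_def)
 have k: "kernel e (indicator {-e..e})"
  by (auto simp: kernel_def indicator_def intro!: exI[of _ 1])
 have "abs (Z y - Z x) <= (LBINT s. abs (D s)*indicator {min x y..max x y} s)"
  by (rule H1_diff_le[OF H])
 also have "... <= (LBINT s. abs (D s)*indicator {-e..e} (x - s))"
  by (rule integral_mono[OF integrable_abs_indicator[OF D] conv_integrable[OF sqint_abs[OF D] k]])
   (use xy in "auto simp: indicator_def abs_le_iff min_def max_def")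
 finally show ?thesis by (simp add: osc_def conv_def)
qed

lemma H1_approx:
 assumes e: "e > 0" and H: "H1 Z D"
 shows "abs (conv Z (moll e) x - Z x) <= osc e D x" "nl (%x. conv Z (moll e) x - Z x) <= 2*e*nl D"
  "sql (conv Z (moll e))" "nl (conv Z (moll e)) <= nl Z"
proof -
 have s: "sql Z" "sql D" using H by (auto simp: H1_def)
 have k: "kernel e (moll e)" using moll_kernel(1)[OF e, of 0] by simp
 show pw: "abs (conv Z (moll e) x - Z x) <= osc e D x" for x
  by (rule moll_osc[OF e conv_integrable[OF s(1) k]]) (rule H1_osc[OF e H])
 show "sql (conv Z (moll e))" by (rule young(1)[OF s(1) k])
 hence "nl (%x. conv Z (moll e) x - Z x) <= nl (osc e D)"
  by (intro sqint_bound(2)[OF osc(1)[OF e s(2)]])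
   (use pw osc(3)[OF e s(2)] sqint_measurable[OF sqint_diff[OF young(1)[OF s(1) k] s(1)]] in auto)
 also have "... <= 2*e*nl D" by (rule osc(2)[OF e s(2)])
 finally show "nl (%x. conv Z (moll e) x - Z x) <= 2*e*nl D" .
 have "(LBINT x. abs (moll e x)) = 1" using moll_integral(2)[OF e] moll(1)[OF e] by simp
 thus "nl (conv Z (moll e)) <= nl Z" using young(2)[OF s(1) k] by simp
qed

lemma moll_translate_test:
 assumes "e > 0"
 shows "testf (%y. moll e (x - y))"
  "(deriv ^^ n) (%y. moll e (x - y)) = (%y. (-1) ^ n*(deriv ^^ n) (moll e) (x - y))"
proof -
 have "smooth (%y. moll e (x - y))"
  using smooth_real_affine[OF moll_smooth, of e "-1" x] by (simp add: algebra_simps)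
 moreover have "moll e (x - y) = 0" if "abs y > abs x + e" for y
  using that by (intro moll(2)[OF assms]) linarith
 ultimately show "testf (%y. moll e (x - y))"
  by (rule test_function_UNIV_I)
 show "(deriv ^^ n) (%y. moll e (x - y)) = (%y. (-1) ^ n*(deriv ^^ n) (moll e) (x - y))"
 proof (induction n)
  case (Suc n)
  show ?case
  proof
   fix y
   have "((%y. (-1) ^ n*(deriv ^^ n) (moll e) (x - y)) has_real_derivative
     (-1) ^ n*((deriv ^^ Suc n) (moll e) (x - y)*(0 - 1))) (at y)"
    by (intro DERIV_cmult DERIV_chain2[OF smooth_deriv_n_has_derivative[OF moll_smooth]] DERIV_diff DERIV_ident DERIV_const)
   thus "(deriv ^^ Suc n) (%y. moll e (x - y)) y = (-1) ^ Suc n*(deriv ^^ Suc n) (moll e) (x - y)"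
    by (simp add: Suc DERIV_imp_deriv)
  qed
 qed auto
qed

section \<open>Borel representatives, test functions and weak derivatives\<close>

lemma lebesgue_rep:
 fixes f :: "'a::euclidean_space => real"
 assumes "f \<in> borel_measurable lebesgue"
 obtains g where "bm g" "ae x. f x = g x"
 using completion_ex_borel_measurable_real[OF assms] by auto

text \<open>The theorem speaks of Lebesgue measure, the calculations use \<open>lborel\<close>,
  where product measures and Fubini are at hand; replacing an integrand by a Borel representative
  moves between the two.\<close>

lemma lebesgue_integral_rep:
 fixes f :: "'a::euclidean_space => real"
 assumes "f \<in> borel_measurable lebesgue" "bm g" "ae x. f x = g x"
 shows "(LINT x|lebesgue. f x) = (LINT x|lborel. g x)"
  "integrable lebesgue f \<longleftrightarrow> intg g"
proof -
 have g: "g \<in> borel_measurable lborel" "g \<in> borel_measurable lebesgue"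
  using assms(2) by (auto intro: measurable_completion)
 have ae: "AE x in lebesgue. f x = g x" using assms(3) by (rule AE_completion)
 show "(LINT x|lebesgue. f x) = (LINT x|lborel. g x)"
  using integral_cong_AE[OF assms(1) g(2) ae] integral_completion[OF g(1)] by simp
 show "integrable lebesgue f \<longleftrightarrow> intg g"
  using integrable_cong_AE[OF assms(1) g(2) ae] integrable_completion[OF g(1)] by simp
qed

definition locint :: "(real => real) => bool" where
 "locint g \<longleftrightarrow> bm g & (ALL a b. intg (%x. g x*indicator {a..b} x))"

lemma locint_rep:
 assumes K: "!!K. compact K ==> f absolutely_integrable_on K"
 obtains g where "f \<in> borel_measurable lebesgue" "locint g" "ae x. f x = g x"
proof -
 have m: "(%x. indicator {a..b} x*f x) \<in> borel_measurable lebesgue"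
   "integrable lebesgue (%x. indicator {a..b} x*f x)" for a b
  using K[of "{a..b}"] by (auto simp: set_integrable_def)
 have f: "f \<in> borel_measurable lebesgue"
 proof (rule borel_measurable_LIMSEQ_real)
  show "(%n. indicator {-real n..real n} x*f x) ----> f x" for x
  proof (rule tendsto_eventually)
   obtain N where "real N >= abs x" using real_arch_simple by blast
   thus "\<forall>\<^sub>F n in sequentially. indicator {-real n..real n} x*f x = f x"
    by (intro eventually_sequentiallyI[of N]) (auto simp: indicator_def abs_le_iff)
  qed
 qed (rule m)
 then obtain g where g: "bm g" "ae x. f x = g x"
  by (rule lebesgue_rep)
 have "intg (%x. g x*indicator {a..b} x)" for a b
 proof -
  have "ae x. indicator {a..b} x*f x = g x*indicator {a..b} x"
   using g(2) by eventually_elim simp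
  thus ?thesis
   using lebesgue_integral_rep(2)[OF m(1), of "%x. g x*indicator {a..b} x" a b] g(1) m(2)[of a b] by simp
 qed
 with f g that show ?thesis by (auto simp: locint_def)
qed

lemma locint_test_integrable:
 assumes g: "locint g" and phi: "bm phi" "!!x. abs (phi x) <= K" "!!x. x \<notin> {a..b} ==> phi x = 0"
 shows "intg (%x. g x*phi x)"
proof (rule int_bound)
 show "intg (%x. K*(g x*indicator {a..b} x))" using g by (simp add: locint_def)
 show "ae x. norm (g x*phi x) <= norm (K*(g x*indicator {a..b} x))"
 proof (rule AE_I2)
  fix x
  have "abs (phi x) <= abs K" using phi(2)[of x] by linarith
  hence "abs (g x)*abs (phi x) <= abs (g x)*abs K" by (intro mult_left_mono) auto
  thus "norm (g x*phi x) <= norm (K*(g x*indicator {a..b} x))"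
   using phi(3)[of x] by (cases "x \<in> {a..b}") (auto simp: abs_mult mult.commute)
 qed
 show "(%x. g x*phi x) \<in> borel_measurable lborel" using g phi(1) by (auto simp: locint_def)
qed

lemma test_function_bounds:
 assumes "test_function (UNIV :: real set) phi"
 obtains K R where "!!x. abs (phi x) <= K" "!!x. abs x > R ==> phi x = 0" "R > 0" "cont phi" "smooth phi"
proof -
 have s: "smooth phi" "compact (closure {x. phi x ~= 0})" using assms by (auto simp: test_function_def)
 obtain R where R: "R > 0" "!!x. x \<in> closure {x. phi x ~= 0} ==> norm x <= R"
  using compact_imp_bounded[OF s(2)] by (auto simp: bounded_pos)
 have z: "phi x = 0" if "abs x > R" for x
  using R(2)[of x] closure_subset[of "{x. phi x ~= 0}"] that by force
 have c: "cont phi" using s(1) by (rule smooth_imp_continuous_on)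
 obtain K where "!!x. abs (phi x) <= K" using continuous_kernel[of phi R] c z unfolding kernel_def by blast
 thus ?thesis using that z R(1) c s(1) by blast
qed

lemma locint_test_integrable':
 assumes g: "locint g" and phi: "testf phi"
 shows "intg (%x. g x*phi x)"
proof -
 obtain K R where b: "!!x. abs (phi x) <= K" "!!x. abs x > R ==> phi x = 0" "cont phi"
  using test_function_bounds[OF phi] by metis
 show ?thesis
  by (rule locint_test_integrable[OF g bm_cont[OF b(3)] b(1), of "-R" R])
   (use b(2) in auto)
qed

text \<open>A rising step times a falling step. As \<open>c\<close> grows these increase to 1 inside
  the interval, so they approximate the indicator of \<open>{a<..<b}\<close>.\<close>

lemma test_function_trapezoid:
 fixes a b c :: real
 assumes "c > 0"
 defines "phi == %x. step (c*(x - a)) * step (c*(b - x))"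
 shows "testf phi" "abs (phi x) <= 1" "x \<notin> {a..b} ==> phi x = 0"
proof -
 have z: "x \<notin> {a..b} ==> phi x = 0" for x
  using assms(1) step(1)[of "c*(x - a)"] step(1)[of "c*(b - x)"]
  by (auto simp: phi_def not_le mult_le_0_iff)
 thus "x \<notin> {a..b} ==> phi x = 0" .
 show "abs (phi x) <= 1"
  using step(3,4)[of "c*(x - a)"] step(3,4)[of "c*(b - x)"] by (auto simp: phi_def abs_mult intro: mult_le_one)
 have "smooth (%x. step (c*x + (- c*a)) * step (- c*x + c*b))"
  by (intro smooth_mult smooth_real_affine smooth_step)
 hence "smooth phi" by (simp add: phi_def algebra_simps)
 thus "testf phi"
 proof (rule test_function_UNIV_I[of _ "max (abs a) (abs b)"])
  fix x assume "abs x > max (abs a) (abs b)"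
  hence "x \<notin> {a..b}" by auto
  thus "phi x = 0" by (rule z)
 qed
qed

text \<open>Trapezoids converge to indicators, so \<open>h\<close> has integral 0 over every bounded
  open interval. After truncation to such an interval, the positive and negative parts of
  \<open>h\<close> are densities of finite measures that agree on all half-lines; hence the
  densities agree almost everywhere.\<close>

lemma fundamental_lemma:
 assumes h: "locint h" and z: "!!phi. testf phi ==> (LBINT x. h x*phi x) = 0"
 shows "ae x. h x = 0"
proof -
 have [measurable]: "bm h" using h by (simp add: locint_def)
 have ab: "(LBINT x. h x*indicator {a<..<b} x) = 0" for a b
 proof -
  let ?phi = "%n x. step (real (Suc n)*(x - a)) * step (real (Suc n)*(b - x))"
  have "(%n. LBINT x. h x*?phi n x) ----> (LBINT x. h x*indicator {a<..<b} x)"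
  proof (rule integral_dominated_convergence[where w="%x. norm (h x*indicator {a..b} x)"])
   show "intg (%x. norm (h x*indicator {a..b} x))"
    using h by (auto simp: locint_def)
   have [measurable]: "bm step" using smooth_borel[OF smooth_step] .
   show "(%x. h x*?phi n x) \<in> borel_measurable lborel" for n by measurable
   show "(%x. h x*indicator {a<..<b} x) \<in> borel_measurable lborel" by measurable
   show "ae x. (%n. h x*?phi n x) ----> h x*indicator {a<..<b} x"
   proof (intro AE_I2 tendsto_mult_left tendsto_eventually)
    fix x
    show "\<forall>\<^sub>F n in sequentially. ?phi n x = indicator {a<..<b} x"
    proof (cases "x \<in> {a<..<b}")
     case True
     obtain N where N: "real N >= 1 / (x - a)" "real N >= 1 / (b - x)"
      using real_arch_simple[of "max (1 / (x - a)) (1 / (b - x))"] by auto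
     show ?thesis
     proof (rule eventually_sequentiallyI[of N])
      fix n assume "N <= n"
      hence "real (Suc n) >= 1 / (x - a)" "real (Suc n) >= 1 / (b - x)" using N by linarith+
      hence "real (Suc n)*(x - a) >= 1" "real (Suc n)*(b - x) >= 1"
       using True by (auto simp: divide_le_eq simp del: of_nat_Suc)
      thus "?phi n x = indicator {a<..<b} x"
       using True by (simp add: step(2) del: of_nat_Suc)
     qed
    next
     case False
     hence "x - a <= 0 | b - x <= 0" by auto
     hence "?phi n x = 0" for n
      using step(1)[of "real (Suc n)*(x - a)"] step(1)[of "real (Suc n)*(b - x)"]
      by (auto simp: mult_le_0_iff simp del: of_nat_Suc)
     thus ?thesis using False by simp
    qed
   qed
   show "ae x. norm (h x*?phi n x) <= norm (h x*indicator {a..b} x)" for n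
   proof (rule AE_I2)
    fix x
    have "abs (h x)*abs (?phi n x) <= abs (h x)*1"
     by (intro mult_left_mono test_function_trapezoid(2)) auto
    thus "norm (h x*?phi n x) <= norm (h x*indicator {a..b} x)"
     using test_function_trapezoid(3)[of "real (Suc n)" x a b]
     by (cases "x \<in> {a..b}") (auto simp: abs_mult simp del: of_nat_Suc)
   qed
  qed
  moreover have "(LBINT x. h x*?phi n x) = 0" for n
   by (rule z[OF test_function_trapezoid(1)]) simp
  ultimately show ?thesis by (simp add: LIMSEQ_const_iff)
 qed
 have n: "ae x. h x*indicator {-real n<..<real n} x = 0" for n
 proof -
  define f where "f x = h x*indicator {-real n<..<real n} x" for x
  have [measurable]: "bm f" unfolding f_def by measurable
  have fi: "intg f"
   by (rule int_bound[of lborel "%x. h x*indicator {-real n..real n} x"])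
    (use h in "auto simp: f_def locint_def indicator_def")
  have fx: "(LBINT x. f x*indicator {c<..} x) = 0" for c
  proof -
   have "f x*indicator {c<..} x = h x*indicator {max c (-real n)<..<real n} x" for x
    by (auto simp: f_def indicator_def)
   thus ?thesis using ab by simp
  qed
  let ?p = "%x. max 0 (f x)" and ?q = "%x. max 0 (- f x)"
  have pi: "intg ?p" "intg ?q" using fi by auto
  have pic: "intg (%x. ?p x*indicator {c<..} x)" "intg (%x. ?q x*indicator {c<..} x)" for c
   using pi by (auto intro: integrable_mult_indicator[where 'b=real, simplified] simp: mult.commute)
  have e: "emeasure (density lborel (%x. ennreal (?p x))) {c<..} = ennreal (LBINT x. ?p x*indicator {c<..} x)"
   "emeasure (density lborel (%x. ennreal (?q x))) {c<..} = ennreal (LBINT x. ?q x*indicator {c<..} x)" for c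
   using pic by (auto simp: emeasure_density nn_integral_eq_integral[symmetric] ennreal_mult'' ennreal_indicator)
  have "density lborel (%x. ennreal (?p x)) = density lborel (%x. ennreal (?q x))"
  proof (rule measure_eqI_lessThan)
   fix c
   have "(LBINT x. ?p x*indicator {c<..} x) - (LBINT x. ?q x*indicator {c<..} x) = (LBINT x. f x*indicator {c<..} x)"
    unfolding Bochner_Integration.integral_diff[OF pic, symmetric]
    by (intro int_cong) (auto simp: indicator_def max_def)
   thus "emeasure (density lborel (%x. ennreal (?p x))) {c<..} = emeasure (density lborel (%x. ennreal (?q x))) {c<..}"
    unfolding e using fx by simp
   show "emeasure (density lborel (%x. ennreal (?p x))) {c<..} < \<infinity>" unfolding e by simp
  qed auto
  hence "ae x. ennreal (?p x) = ennreal (?q x)"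
   by (subst (asm) finite_density_unique) (use pi in "auto simp: nn_integral_eq_integral")
  thus ?thesis
   by eventually_elim (auto simp: f_def max_def split: if_splits)
 qed
 have "ae x. ALL n. h x*indicator {-real n<..<real n} x = 0"
  unfolding AE_all_countable using n by blast
 thus ?thesis
 proof eventually_elim
  case (elim x)
  obtain n where "real n > abs x" using reals_Archimedean2 by blast
  hence "x \<in> {-real n<..<real n}" by (auto simp: abs_less_iff)
  thus ?case using elim[rule_format, of n] by simp
 qed
qed

lemma locint_diff: "locint f ==> locint g ==> locint (%x. f x - g x)"
 by (auto simp: locint_def left_diff_distrib)

lemma locint_const: "locint (%x. c)"
 by (auto simp: locint_def emeasure_lborel_Icc_eq intro!: integrable_mult_right integrable_real_indicator)

lemma locint_continuous: "cont f ==> locint f"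
 using borel_integrable_atLeastAtMost'[of _ _ f]
 by (auto simp: locint_def set_integrable_def mult.commute intro: bm_cont continuous_on_subset)

lemma locint_sql:
 assumes "sql f" shows "locint f"
proof -
 have "kernel (max (abs a) (abs b)) (indicator {a..b})" for a b :: real
  by (auto simp: kernel_def indicator_def intro!: exI[of _ 1])
 thus ?thesis using assms sqint_mult[OF assms kernel_integrable(2)]
  by (auto simp: locint_def sqint_def)
qed

text \<open>With a fixed \<open>eta\<close> of integral 1, \<open>psi\<close> minus its integral
  times \<open>eta\<close> has integral 0 and is therefore the derivative of a test function. So
  \<open>k - c\<close>, where \<open>c\<close> is the integral of \<open>k*eta\<close>, annihilates
  every \<open>psi\<close>.\<close>

lemma dubois_reymond:
 assumes k: "locint k" and z: "!!phi. testf phi ==> (LBINT x. k x*deriv phi x) = 0"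
 obtains c where "ae x. k x = c"
proof -
 define eta where "eta = moll 1"
 define c where "c = (LBINT x. k x*eta x)"
 have teta: "testf eta"
  unfolding eta_def by (rule test_function_UNIV_I[of _ 1]) (auto intro: moll_smooth moll(2))
 have ieta: "intg eta" "(LBINT x. eta x) = 1"
  using moll_integral[of 1] by (auto simp: eta_def)
 have "ae x. k x - c = 0"
 proof (rule fundamental_lemma[OF locint_diff[OF k locint_const]])
  fix psi :: "real => real" assume t: "testf psi"
  have ipsi: "intg psi" using locint_test_integrable'[OF locint_const[of 1] t] by simp
  define I where "I = (LBINT x. psi x)"
  define psi0 where "psi0 x = psi x - I*eta x" for x
  obtain K R where b: "R > 0" "!!x. abs x > R ==> psi x = 0" "smooth psi" using test_function_bounds[OF t] by metis
  define R' where "R' = max R 1"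
  have z0: "psi0 x = 0" if "abs x > R'" for x
   using b(2)[of x] moll(2)[of 1 x] that by (auto simp: psi0_def eta_def R'_def)
  have s0: "smooth psi0" unfolding psi0_def eta_def by (intro smooth_diff smooth_cmult b moll_smooth)
  have c0: "cont psi0" by (rule smooth_imp_continuous_on[OF s0])
  have I0: "(LBINT x. psi0 x) = 0" using ipsi ieta by (simp add: psi0_def I_def)
  define Phi where "Phi x = integral {-R'-1..x} psi0" for x
  have D: "DERIV Phi x :> psi0 x" for x
  proof (cases "x > -R'-1")
   case True
   have "((%u. integral {-R'-1..u} psi0) has_vector_derivative psi0 x) (at x within {-R'-1..x+1})"
    by (rule integral_has_vector_derivative) (use True continuous_on_subset[OF c0] in auto)
   moreover have "at x within {-R'-1..x+1} = at x"
    using True by (intro at_within_interior) (simp add: interior_atLeastAtMost_real)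
   ultimately show ?thesis
    by (simp add: Phi_def[abs_def] real_vector_deriv)
  next
   case False
   have "psi0 x = 0" by (rule z0) (use False in "auto simp: R'_def")
   hence "DERIV (%x. 0) x :> psi0 x" by simp
   thus ?thesis
   proof (rule has_field_derivative_transform_within_open[of _ _ _ "{..<-R'}"])
    fix u :: real assume "u \<in> {..<-R'}"
    hence "integral {-R'-1..u} psi0 = integral {-R'-1..u} (%x. 0)"
     by (intro integral_cong z0) (auto simp: R'_def)
    thus "0 = Phi u" by (simp add: Phi_def)
   qed (use False in auto)
  qed
  have Phi0: "Phi x = 0" if "abs x > R'" for x
  proof (cases "x < 0")
   case True
   have "integral {-R'-1..x} psi0 = integral {-R'-1..x} (%x. 0)"
    by (intro integral_cong z0) (use that True in auto)
   thus ?thesis by (simp add: Phi_def)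
  next
   case False
   have z1: "psi0 y = 0" if "y \<notin> {-R'-1..x}" for y
    by (rule z0) (use that False \<open>\<bar>x\<bar> > R'\<close> in auto)
   have "(LBINT y. psi0 y) = (LBINT y:{-R'-1..x}. psi0 y)"
    unfolding set_lebesgue_integral_def
    by (rule int_cong) (use z1 in "auto simp: indicator_def")
   also have "... = Phi x" unfolding Phi_def
    by (rule set_borel_integral_eq_integral(2)[OF borel_integrable_atLeastAtMost'[OF continuous_on_subset[OF c0]]]) auto
   finally show ?thesis using I0 by simp
  qed
  have "testf Phi"
   by (rule test_function_UNIV_I[OF smooth_realI[OF D s0] Phi0])
  moreover have "deriv Phi = psi0" using DERIV_imp_deriv[OF D] by blast
  ultimately have "(LBINT x. k x*psi0 x) = 0" using z[of Phi] by simp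
  hence "(LBINT x. k x*psi x) - I*c = 0"
   using locint_test_integrable'[OF k t] locint_test_integrable'[OF k teta]
   by (simp add: psi0_def right_diff_distrib mult.left_commute c_def)
  thus "(LBINT x. (k x - c)*psi x) = 0"
   using locint_test_integrable'[OF k t] ipsi by (simp add: left_diff_distrib I_def mult.commute[of c])
 qed
 thus ?thesis by (intro that[of c]) auto
qed


definition prim :: "(real => real) => real => real" where
 "prim D x = (if x >= 0 then (LBINT s. D s * indicator {0..x} s) else - (LBINT s. D s * indicator {x..0} s))"

lemma prim_diff:
 assumes D: "locint D" and xy: "x <= y"
 shows "prim D y - prim D x = (LBINT s. D s * indicator {x..y} s)"
proof -
 have i: "intg (%s. D s * indicator {a..b} s)" for a b using D by (simp add: locint_def)
 have add: "(LBINT s. D s * indicator {a..b} s) + (LBINT s. D s * indicator {b..c} s) = (LBINT s. D s * indicator {a..c} s)"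
  if "a <= b" "b <= c" for a b c
 proof -
  have "ae s. s ~= b" by (rule AE_lborel_singleton)
  hence "ae s. D s * indicator {a..c} s = D s * indicator {a..b} s + D s * indicator {b..c} s"
   by eventually_elim (use that in "auto simp: indicator_def")
  hence "(LBINT s. D s * indicator {a..c} s) = (LBINT s. D s * indicator {a..b} s + D s * indicator {b..c} s)"
   by (intro integral_cong_AE borel_measurable_add borel_measurable_integrable i)
  thus ?thesis using i by simp
 qed
 consider "0 <= x" | "x < 0" "0 <= y" | "y < 0" using xy by linarith
 thus ?thesis
  using add[of 0 x y] add[of x 0 y] add[of x y 0] xy by cases (auto simp: prim_def)
qed

lemma prim_continuous:
 assumes D: "sql D" shows "cont (prim D)"
proof -
 have *: "abs (prim D y - prim D x) <= nl D * sqrt (abs (y - x))" for x y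
 proof -
  have le: "abs (prim D y - prim D x) <= nl D * sqrt (y - x)" if "x <= y" for x y
  proof -
   have "(%s. (indicator {x..y} s)^2) = (indicator {x..y} :: real => real)" by (auto simp: indicator_def)
   hence "sql (indicator {x..y})" "nl (indicator {x..y}) = sqrt (y - x)"
    using that by (auto simp: sqint_def nrm_def)
   thus ?thesis
    using cauchy_schwarz[OF D, of "indicator {x..y}"] prim_diff[OF locint_sql[OF D] that] by simp
  qed
  show ?thesis
   using le[of x y] le[of y x] by (cases "x <= y") (auto simp: abs_minus_commute)
 qed
 show ?thesis
 proof (rule continuous_at_imp_continuous_on, intro ballI)
  fix x
  have "((%y. nl D * sqrt (abs (y - x))) ---> nl D * sqrt (abs (x - x))) (at x)" by (intro tendsto_intros)
  hence "((%y. nl D * sqrt (abs (y - x))) ---> 0) (at x)" by simp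
  hence "((%y. prim D y - prim D x) ---> 0) (at x)"
   by (rule Lim_null_comparison[rotated]) (rule always_eventually, simp add: *)
  thus "isCont (prim D) x" by (simp add: isCont_def LIM_zero_iff)
 qed
qed

text \<open>Fubini for \<open>D s * deriv phi x\<close> on the triangle \<open>s <= x\<close>:
  integration in \<open>x\<close> gives \<open>- D s * phi s\<close>, integration in
  \<open>s\<close> gives an increment of \<open>Z\<close> times \<open>deriv phi x\<close>.\<close>

lemma ac_weak:
 assumes D: "locint D" and c: "cont Z" and t: "testf phi"
  and Z: "!!x y. x <= y ==> Z y - Z x = (LBINT s. D s * indicator {x..y} s)"
 shows "(LBINT x. Z x*deriv phi x) = - (LBINT x. D x*phi x)"
proof -
 obtain K R where b: "R > 0" "!!x. abs x > R ==> phi x = 0" "smooth phi" "cont phi"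
  using test_function_bounds[OF t] by metis
 have d: "DERIV phi x :> deriv phi x" for x using smooth_realD(1)[OF b(3)] .
 have cd: "cont (deriv phi)" using smooth_imp_continuous_on[OF smooth_realD(2)[OF b(3)]] .
 have dz: "deriv phi x = 0" if "abs x > R" for x
  using deriv_n_zero_far[of R phi x 1] b(2) that by simp
 let ?R = "R + 1"
 obtain L where L: "!!x. abs (deriv phi x) <= L" using continuous_kernel[of "deriv phi" R] cd dz unfolding kernel_def by blast
 have [measurable]: "bm D" "bm (deriv phi)" "bm Z"
  using D cd c by (auto simp: locint_def bm_cont)
 define f where "f = (%(s, x). D s * indicator {-?R..?R} s * (deriv phi x*(if s <= x & x <= ?R then 1 else 0)))"
 have FTC: "has_bochner_integral lborel (%x. indicator {a..b} x *\<^sub>R deriv phi x) (phi b - phi a)" if "a <= b" for a b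
 proof (rule has_bochner_integral_FTC_Icc[OF that])
  show "(phi has_vector_derivative deriv phi x) (at x within {a..b})" for x
   using d[of x] by (simp add: real_vector_deriv has_vector_derivative_at_within)
  show "continuous_on {a..b} (deriv phi)" by (rule continuous_on_subset[OF cd]) simp
 qed
 have iD: "intg (%s. D s * indicator {-?R..?R} s)" using D by (simp add: locint_def)
 define d where "d = (%(s, x). (D s * indicator {-?R..?R} s)*(L*indicator {-?R..?R} x))"
 have "integrable (lborel \<Otimes>\<^sub>M lborel) d"
 proof (rule lborel_pair.Fubini_integrable)
  show "d \<in> borel_measurable (lborel \<Otimes>\<^sub>M lborel)" unfolding d_def by measurable
  have "(LBINT x. norm (d (s, x))) = abs (D s * indicator {-?R..?R} s)*(abs L*(2*?R))" for s
   using b(1) by (simp add: d_def abs_mult)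
  thus "intg (%s. LBINT x. norm (d (s, x)))" using iD by simp
  show "ae s. intg (%x. d (s, x))"
   by (auto simp: d_def emeasure_lborel_Icc_eq intro!: integrable_mult_right integrable_real_indicator)
 qed
 hence int: "integrable (lborel \<Otimes>\<^sub>M lborel) f"
 proof (rule int_bound)
  show "f \<in> borel_measurable (lborel \<Otimes>\<^sub>M lborel)" unfolding f_def by measurable
  have "norm (f (s, x)) <= norm (d (s, x))" for s x
  proof (cases "s \<in> {-?R..?R} & s <= x & x <= ?R")
   case True
   hence "norm (f (s, x)) = abs (D s)*abs (deriv phi x)" by (simp add: f_def abs_mult)
   also have "... <= abs (D s)*abs L" using L[of x] by (intro mult_left_mono) auto
   also have "... = norm (d (s, x))" using True by (simp add: d_def abs_mult)
   finally show ?thesis .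
  qed (auto simp: f_def indicator_def)
  thus "AE z in lborel \<Otimes>\<^sub>M lborel. norm (f z) <= norm (d z)" by (intro AE_I2) auto
 qed
 have inner: "(LBINT x. f (s, x)) = - (D s * phi s)" for s
 proof (cases "s \<in> {-?R..?R}")
  case True
  hence "(LBINT x. indicator {s..?R} x*deriv phi x) = phi ?R - phi s"
   using FTC[of s ?R] by (simp add: has_bochner_integral_iff)
  moreover have "phi ?R = 0" using b(1,2) by simp
  moreover have "(LBINT x. f (s, x)) = (LBINT x. D s * (indicator {s..?R} x*deriv phi x))"
   by (rule int_cong) (use True in "auto simp: f_def indicator_def")
  ultimately show ?thesis by simp
 next
  case False
  hence "phi s = 0" by (intro b(2)) auto
  thus ?thesis using False by (simp add: f_def)
 qed
 have "(LBINT x. (LBINT s. f (s, x))) = (LBINT s. (LBINT x. f (s, x)))"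
  using lborel_pair.Fubini_integral[of "%s x. f (s, x)"] int by simp
 also have "... = - (LBINT s. D s * phi s)" by (simp add: inner)
 also have "(LBINT x. (LBINT s. f (s, x))) = (LBINT x. (Z x - Z (-?R))*deriv phi x)"
 proof (rule int_cong[OF refl])
  fix x
  show "(LBINT s. f (s, x)) = (Z x - Z (-?R))*deriv phi x"
  proof (cases "x \<in> {-?R..?R}")
   case True
   have "f (s, x) = (D s * indicator {-?R..x} s)*deriv phi x" for s
    using True by (auto simp: f_def indicator_def)
   thus ?thesis using Z[of "-?R" x] True by simp
  next
   case False
   hence "deriv phi x = 0" by (intro dz) auto
   thus ?thesis by (simp add: f_def)
  qed
 qed
 also have "... = (LBINT x. Z x*deriv phi x) - Z (-?R)*(LBINT x. deriv phi x)"
 proof -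
  have "intg (%x. g x*deriv phi x)" if "locint g" for g
   by (rule locint_test_integrable[OF that _ L, where a="-R" and b=R]) (use dz in auto)
  from this[OF locint_continuous[OF c]] this[OF locint_const[of 1]]
  show ?thesis by (simp add: left_diff_distrib)
 qed
 also have "(LBINT x. deriv phi x) = 0"
  using continuous_kernel[OF b(4,2)] continuous_kernel[OF cd dz] by (intro integral_deriv_zero[OF d cd] kernel_integrable(1))
 finally show ?thesis by simp
qed

lemmas prim_weak = ac_weak[OF _ _ _ prim_diff]

lemma H1_weak:
 assumes "H1 Z D" "testf phi"
 shows "(LBINT x. Z x*deriv phi x) = - (LBINT x. D x*phi x)"
 using assms by (intro ac_weak) (auto simp: H1_def locint_sql)


lemma in_L2_rep:
 assumes "f \<in> borel_measurable lebesgue" "bm g" "ae x. f x = g x"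
 shows "in_L2 UNIV f \<longleftrightarrow> sql g" "L2_norm UNIV f = nl g"
proof -
 have 1: "(%x. (f x)^2) \<in> borel_measurable lebesgue" "bm (%x. (g x)^2)"
  "ae x. (f x)^2 = (g x)^2"
  using assms by auto
 show "in_L2 UNIV f \<longleftrightarrow> sql g" "L2_norm UNIV f = nl g"
  using lebesgue_integral_rep[OF 1] assms
  by (auto simp: in_L2_def L2_norm_def sqint_def nrm_def lebesgue_on_UNIV_eq)
qed

lemma test_function_deriv:
 fixes phi :: "real => real"
 assumes t: "testf phi"
 shows "testf (deriv phi)"
proof -
 obtain R where b: "!!x. abs x > R ==> phi x = 0" "smooth phi"
  using test_function_bounds[OF t] by metis
 have "deriv phi x = 0" if "abs x > R" for x
  using deriv_n_zero_far[of R phi x 1] b(1) that by simp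
 thus ?thesis by (rule test_function_UNIV_I[OF smooth_realD(2)[OF b(2)]])
qed

lemma test_function_deriv_n: "testf phi ==> testf ((deriv ^^ n) (phi :: real => real))"
 by (induction n) (auto intro: test_function_deriv)

lemma test_function_borel: "testf (phi :: real => real) ==> bm phi"
 by (auto simp: test_function_def smooth_borel)

lemma has_weak_deriv_rep:
 assumes h: "has_weak_deriv i f g"
 obtains f1 g1 where "f \<in> borel_measurable lebesgue" "g \<in> borel_measurable lebesgue" "locint f1" "locint g1"
  "ae x. f x = f1 x" "ae x. g x = g1 x"
  "!!phi. testf phi ==> (LBINT x. f1 x*(deriv ^^ i) phi x) = (-1) ^ i*(LBINT x. g1 x*phi x)"
proof -
 obtain f1 where f1: "f \<in> borel_measurable lebesgue" "locint f1" "ae x. f x = f1 x"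
  using locint_rep[of f] h unfolding has_weak_deriv_def by metis
 obtain g1 where g1: "g \<in> borel_measurable lebesgue" "locint g1" "ae x. g x = g1 x"
  using locint_rep[of g] h unfolding has_weak_deriv_def by metis
 have eq: "(LINT x|lebesgue. f x*phi x) = (LBINT x. f1 x*phi x)"
  if "f \<in> borel_measurable lebesgue" "locint f1" "ae x. f x = f1 x" "testf phi"
  for f f1 phi :: "real => real"
 proof (rule lebesgue_integral_rep(1))
  have p: "bm phi" using that(4) by (rule test_function_borel)
  hence "phi \<in> borel_measurable lebesgue" by (auto intro: measurable_completion)
  with that(1) show "(%x. f x*phi x) \<in> borel_measurable lebesgue" by simp
  show "bm (%x. f1 x*phi x)" using p that(2) by (auto simp: locint_def)
  show "ae x. f x*phi x = f1 x*phi x" using that(3) by eventually_elim simp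
 qed
 have "(LBINT x. f1 x*(deriv ^^ i) phi x) = (-1) ^ i*(LBINT x. g1 x*phi x)" if t: "testf phi" for phi
  using h t eq[OF f1 test_function_deriv_n[OF t, of i]] eq[OF g1 t] by (simp add: has_weak_deriv_def)
 thus ?thesis by (rule that[OF f1(1) g1(1) f1(2) g1(2) f1(3) g1(3)])
qed

lemma has_weak_deriv_unique:
 assumes "has_weak_deriv i f g" "has_weak_deriv i f h"
 shows "ae x. g x = h x"
proof -
 obtain f1 g1 where 1: "f \<in> borel_measurable lebesgue" "g \<in> borel_measurable lebesgue" "locint f1" "locint g1" "ae x. f x = f1 x" "ae x. g x = g1 x"
  "!!phi. testf phi ==> (LBINT x. f1 x*(deriv ^^ i) phi x) = (-1) ^ i*(LBINT x. g1 x*phi x)"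
  by (rule has_weak_deriv_rep[OF assms(1)]) blast
 obtain f2 h1 where 2: "f \<in> borel_measurable lebesgue" "h \<in> borel_measurable lebesgue" "locint f2" "locint h1" "ae x. f x = f2 x" "ae x. h x = h1 x"
  "!!phi. testf phi ==> (LBINT x. f2 x*(deriv ^^ i) phi x) = (-1) ^ i*(LBINT x. h1 x*phi x)"
  by (rule has_weak_deriv_rep[OF assms(2)]) blast
 have ff: "ae x. f1 x = f2 x" using 1(5) 2(5) by eventually_elim simp
 have "ae x. g1 x - h1 x = 0"
 proof (rule fundamental_lemma[OF locint_diff[OF 1(4) 2(4)]])
  fix phi :: "real => real" assume t: "testf phi"
  have "(LBINT x. f1 x*(deriv ^^ i) phi x) = (LBINT x. f2 x*(deriv ^^ i) phi x)"
  proof (rule integral_cong_AE)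
   show "ae x. f1 x*(deriv ^^ i) phi x = f2 x*(deriv ^^ i) phi x"
    using ff by eventually_elim simp
  qed (use 1(3) 2(3) test_function_borel[OF test_function_deriv_n[OF t, of i]] in "auto simp: locint_def")
  hence "(LBINT x. g1 x*phi x) = (LBINT x. h1 x*phi x)"
   using 1(7)[OF t] 2(7)[OF t] by simp
  thus "(LBINT x. (g1 x - h1 x)*phi x) = 0"
   using locint_test_integrable'[OF 1(4) t] locint_test_integrable'[OF 2(4) t] by (simp add: left_diff_distrib)
 qed
 with 1(6) 2(6) show ?thesis by eventually_elim simp
qed

lemma weak_deriv_ae: "has_weak_deriv i f g ==> ae x. weak_deriv i f x = g x"
 unfolding weak_deriv_def by (rule has_weak_deriv_unique) (rule someI[of "has_weak_deriv i f"])

lemma weak_deriv_measurable: "has_weak_deriv i f g ==> weak_deriv i f \<in> borel_measurable lebesgue"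
 unfolding weak_deriv_def by (rule has_weak_deriv_rep[OF someI[of "has_weak_deriv i f"]])

text \<open>\<open>f\<close> and the primitive of its weak derivative have the same weak derivative,
  so they differ by a constant almost everywhere; the primitive plus this constant is the continuous
  representative.\<close>

lemma in_H1_rep:
 assumes "in_H 1 f"
 obtains Z D where "H1 Z D" "f \<in> borel_measurable lebesgue" "ae x. f x = Z x"
proof -
 obtain g0 where g0: "has_weak_deriv 0 f g0" "in_L2 UNIV g0" using assms by (auto simp: in_H_def)
 obtain d where d: "has_weak_deriv 1 f d" "in_L2 UNIV d" using assms by (auto simp: in_H_def)
 have f0: "has_weak_deriv 0 f f" using d(1) by (auto simp: has_weak_deriv_def)
 have fg0: "ae x. f x = g0 x" by (rule has_weak_deriv_unique[OF f0 g0(1)])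
 obtain f1 D where fd: "f \<in> borel_measurable lebesgue" "d \<in> borel_measurable lebesgue" "locint f1" "locint D"
  "ae x. f x = f1 x" "ae x. d x = D x"
  and w: "!!phi. testf phi ==> (LBINT x. f1 x*(deriv ^^ 1) phi x) = (-1) ^ 1*(LBINT x. D x*phi x)"
  by (rule has_weak_deriv_rep[OF d(1)]) blast
 have sD: "sql D" using in_L2_rep(1)[OF fd(2) _ fd(6)] d(2) fd(4) by (simp add: locint_def)
 have cp: "cont (prim D)" by (rule prim_continuous[OF sD])
 obtain c where c: "ae x. f1 x - prim D x = c"
 proof (rule dubois_reymond[OF locint_diff[OF fd(3) locint_continuous[OF cp]]])
  fix phi :: "real => real" assume t: "testf phi"
  show "(LBINT x. (f1 x - prim D x)*deriv phi x) = 0"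
   using w[OF t] prim_weak[OF fd(4) cp t fd(4)] locint_test_integrable'[OF fd(3) test_function_deriv[OF t]]
    locint_test_integrable'[OF locint_continuous[OF cp] test_function_deriv[OF t]]
   by (simp add: left_diff_distrib)
 qed
 define Z where "Z x = prim D x + c" for x
 have cZ: "cont Z" unfolding Z_def by (intro continuous_intros cp)
 have fZ: "ae x. f x = Z x" using fd(5) c by eventually_elim (simp add: Z_def)
 have g0m: "g0 \<in> borel_measurable lebesgue" by (rule has_weak_deriv_rep[OF g0(1)])
 have "ae x. g0 x = Z x" using fg0 fZ by eventually_elim simp
 hence sZ: "sql Z"
  using in_L2_rep(1)[OF g0m bm_cont[OF cZ]] g0(2) by simp
 have "H1 Z D"
  unfolding H1_def by (intro conjI allI impI cZ sZ sD) (simp add: Z_def prim_diff[OF fd(4)])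
 thus ?thesis using that fd(1) fZ by blast
qed

lemma locint_abs_int:
 assumes "locint f" "compact K" shows "f absolutely_integrable_on K"
proof -
 obtain R where R: "!!x. x \<in> K ==> abs x <= R"
  using compact_imp_bounded[OF assms(2)] by (auto simp: bounded_iff)
 have "intg (%x. f x*indicator {-R..R} x)" using assms(1) by (simp add: locint_def)
 moreover have "(%x. f x*indicator {-R..R} x) \<in> borel_measurable lborel" using assms(1) by (auto simp: locint_def)
 ultimately have "integrable lebesgue (%x. f x*indicator {-R..R} x)" by (simp add: integrable_completion)
 hence "f absolutely_integrable_on {-R..R}" by (simp add: set_integrable_def mult.commute)
 thus ?thesis
 proof (rule set_integrable_subset)
  show "K \<in> sets lebesgue" using assms(2) by (simp add: lmeasurable_compact fmeasurableD)
  show "K \<subseteq> {-R..R}" using R by (auto simp: abs_le_iff minus_le_iff)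
 qed
qed

lemma smooth_in_H1:
 assumes f: "smooth f" and s: "sql f" "sql (deriv f)"
 shows "in_H 1 f"
proof -
 have bm: "bm f" "bm (deriv f)"
  using s by (auto simp: sqint_def)
 have ai: "f absolutely_integrable_on K" "deriv f absolutely_integrable_on K" if "compact K" for K
  using locint_abs_int[OF locint_sql that] s by auto
 have li: "(LINT x|lebesgue. g x) = (LBINT x. g x)" if "bm g" for g :: "real => real"
  using that by (simp add: integral_completion)
 have L2: "in_L2 UNIV g" if "sql g" for g
 proof -
  have "bm g" "g \<in> borel_measurable lebesgue"
   using that by (auto simp: sqint_def intro: measurable_completion)
  thus ?thesis using in_L2_rep(1)[of g g] that by simp
 qed
 have "has_weak_deriv 0 f f" using ai by (auto simp: has_weak_deriv_def)
 moreover have "has_weak_deriv 1 f (deriv f)"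
  unfolding has_weak_deriv_def
 proof (intro conjI allI impI ai)
  fix phi :: "real => real" assume t: "testf phi"
  obtain K R where b: "!!x. abs (phi x) <= K" "!!x. abs x > R ==> phi x = 0" "smooth phi" using test_function_bounds[OF t] by metis
  obtain K' R' where b': "!!x. abs (deriv phi x) <= K'" "!!x. abs x > R' ==> deriv phi x = 0" "cont (deriv phi)"
   using test_function_bounds[OF test_function_deriv[OF t]] by metis
  have "kernel R phi" "kernel R' (deriv phi)"
   using b b' smooth_imp_continuous_on[OF b(3)] by (auto intro!: continuous_kernel)
  hence sq: "sql phi" "sql (deriv phi)" by (auto intro: kernel_integrable)
  have "(LBINT x. f x*deriv phi x) = - (LBINT x. deriv f x*phi x)"
   by (rule integral_by_parts_line[OF smooth_realD(1)[OF f] smooth_realD(1)[OF b(3)]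
      smooth_imp_continuous_on[OF smooth_realD(2)[OF f]] b'(3) s sq])
  thus "(LINT x|lebesgue. f x*(deriv ^^ 1) phi x) = (-1) ^ 1*(LINT x|lebesgue. deriv f x*phi x)"
   using bm sqint_measurable[OF sq(1)] sqint_measurable[OF sq(2)] by (simp add: li)
 qed
 ultimately show ?thesis using L2 s by (auto simp: in_H_def le_Suc_eq)
qed

lemma H1_locint: "H1 Z D ==> locint Z" "H1 Z D ==> locint D"
 by (auto simp: H1_def intro: locint_sql)

lemma H1_conv_deriv:
 assumes e: "e > 0" and H: "H1 Z D"
 shows "conv Z (deriv (moll e)) = conv D (moll e)" "sql (conv Z (deriv (moll e)))"
  "nl (conv Z (deriv (moll e))) <= nl D"
proof -
 have s: "sql Z" "sql D" using H by (auto simp: H1_def)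
 have k: "kernel e (moll e)" using moll_kernel(1)[OF e, of 0] by simp
 show eq: "conv Z (deriv (moll e)) = conv D (moll e)"
 proof
  fix x
  have "(LBINT y. Z y*deriv (%y. moll e (x - y)) y) = - (LBINT y. D y*moll e (x - y))"
   by (rule H1_weak[OF H moll_translate_test(1)[OF e]])
  thus "conv Z (deriv (moll e)) x = conv D (moll e) x"
   using moll_translate_test(2)[OF e, of 1 x] by (simp add: conv_def)
 qed
 have "(LBINT x. abs (moll e x)) = 1" using moll_integral(2)[OF e] moll(1)[OF e] by simp
 thus "sql (conv Z (deriv (moll e)))" "nl (conv Z (deriv (moll e))) <= nl D"
  unfolding eq using young[OF s(2) k] by auto
qed

lemma H1_linear:
 assumes 1: "H1 Z1 D1" and 2: "H1 Z2 D2"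
 shows "H1 (%x. Z1 x - Z2 x) (%x. D1 x - D2 x)"
 unfolding H1_def
proof (intro conjI allI impI)
 show "cont (%x. Z1 x - Z2 x)" using 1 2 by (intro continuous_intros) (auto simp: H1_def)
 show "sql (%x. Z1 x - Z2 x)" "sql (%x. D1 x - D2 x)" using 1 2 by (auto simp: H1_def intro: sqint_diff)
next
 fix x y :: real assume "x <= y"
 hence "(Z1 y - Z1 x) - (Z2 y - Z2 x) = (LBINT s. (D1 s - D2 s)*indicator {x..y} s)"
  using H1D(4)[OF 1] H1D(4)[OF 2] H1_locint[OF 1] H1_locint[OF 2] by (simp add: left_diff_distrib locint_def)
 thus "Z1 y - Z2 y - (Z1 x - Z2 x) = (LBINT s. (D1 s - D2 s)*indicator {x..y} s)" by simp
qed

lemma C1_H1: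
 assumes f: "!!x. DERIV f x :> f' x" "cont f'" and s: "sql f" "sql f'"
 shows "H1 f f'"
 unfolding H1_def
proof (intro conjI allI impI s)
 show "cont f" by (rule DERIV_cont[OF f(1)])
 fix x y :: real assume xy: "x <= y"
 have "has_bochner_integral lborel (%s. indicator {x..y} s *\<^sub>R f' s) (f y - f x)"
 proof (rule has_bochner_integral_FTC_Icc[OF xy])
  show "(f has_vector_derivative f' s) (at s within {x..y})" for s
   using f(1)[of s] by (simp add: real_vector_deriv has_vector_derivative_at_within)
 qed (rule continuous_on_subset[OF f(2)], simp)
 thus "f y - f x = (LBINT s. f' s * indicator {x..y} s)"
  by (simp add: has_bochner_integral_iff mult.commute)
qed

lemma sql_indicator: "a <= b ==> sql (indicator {a..b})" "a <= b ==> nl (indicator {a..b}) = sqrt (b - a)"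
proof -
 have "(%s. (indicator {a..b} s)^2) = (indicator {a..b} :: real => real)" by (auto simp: indicator_def)
 thus "a <= b ==> sql (indicator {a..b})" "a <= b ==> nl (indicator {a..b}) = sqrt (b - a)"
  by (auto simp: sqint_def nrm_def)
qed

text \<open>Average \<open>abs (Z x) <= abs (Z y) + nl D\<close> over \<open>y\<close> in
  \<open>{x..x+1}\<close>; the unit length makes the Cauchy-Schwarz factors equal to 1.\<close>

lemma H1_sup:
 assumes H: "H1 Z D"
 shows "abs (Z x) <= nl Z + nl D"
proof -
 have s: "sql Z" "sql D" using H by (auto simp: H1_def)
 let ?I = "indicator {x..x+1} :: real => real"
 have l1: "(LBINT s. abs (f s)*?I s) <= nl f" if "sql f" for f
  using cauchy_schwarz[OF sqint_abs[OF that] sql_indicator(1)[of x "x+1"]] sql_indicator(2)[of x "x+1"] by simp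
 have i: "intg (%s. abs (f s)*?I s)" if "sql f" for f
  by (rule integrable_abs_indicator[OF that])
 have "abs (Z x) = (LBINT y. abs (Z x)*?I y)" by simp
 also have "... <= (LBINT y. abs (Z y)*?I y + nl D*?I y)"
 proof (rule integral_mono)
  fix y
  show "abs (Z x)*?I y <= abs (Z y)*?I y + nl D*?I y"
  proof (cases "y \<in> {x..x+1}")
   case True
   have "abs (Z y - Z x) <= (LBINT s. abs (D s)*indicator {min x y..max x y} s)" by (rule H1_diff_le[OF H])
   also have "... <= (LBINT s. abs (D s)*?I s)"
    using True by (intro integral_mono integrable_abs_indicator s) (auto simp: indicator_def)
   also have "... <= nl D" by (rule l1[OF s(2)])
   finally show ?thesis using True by simp
  qed simp
 qed (use i[OF s(1)] in "auto simp: emeasure_lborel_Icc_eq intro!: integrable_add integrable_mult_right integrable_real_indicator")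
 also have "... = (LBINT y. abs (Z y)*?I y) + nl D" using i[OF s(1)] by simp
 also have "... <= nl Z + nl D" using l1[OF s(1)] by simp
 finally show ?thesis .
qed

text \<open>Converse of \<open>in_H1_rep\<close>. The derivative chosen by \<open>weak_deriv\<close>
  is unspecified but unique almost everywhere, so the norm can be read off from \<open>Z\<close> and
  \<open>D\<close>.\<close>

lemma H1_H_norm:
 assumes f: "f \<in> borel_measurable lebesgue" "ae x. f x = Z x" and H: "H1 Z D"
 shows "in_H 1 f" "(H_norm 1 f)^2 = (nl Z)^2 + (nl D)^2"
proof -
 have s: "sql Z" "sql D" using H by (auto simp: H1_def)
 have b: "bm Z" "bm D" using s by (auto simp: sqint_def)
 have bl: "Z \<in> borel_measurable lebesgue" "D \<in> borel_measurable lebesgue" using b by (auto intro: measurable_completion)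
 have ai: "f absolutely_integrable_on K" "D absolutely_integrable_on K" if K: "compact K" for K
 proof -
  show "D absolutely_integrable_on K" by (rule locint_abs_int[OF locint_sql[OF s(2)] K])
  have "Z absolutely_integrable_on K" by (rule locint_abs_int[OF locint_sql[OF s(1)] K])
  moreover have "AE x in lebesgue. indicator K x *\<^sub>R f x = indicator K x *\<^sub>R Z x"
   using AE_completion[OF f(2)] by eventually_elim simp
  moreover have "K \<in> sets lebesgue" using K by (simp add: lmeasurable_compact fmeasurableD)
  ultimately show "f absolutely_integrable_on K"
   unfolding set_integrable_def using f(1) bl(1) by (subst integrable_cong_AE) auto
 qed
 have test: "(LINT x|lebesgue. g x*phi x) = (LBINT x. h x*phi x)"
  if "g \<in> borel_measurable lebesgue" "bm h" "ae x. g x = h x" "testf phi"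
  for g h phi :: "real => real"
 proof (rule lebesgue_integral_rep(1))
  have p: "bm phi" using that(4) by (rule test_function_borel)
  hence "phi \<in> borel_measurable lebesgue" by (auto intro: measurable_completion)
  with that(1) show "(%x. g x*phi x) \<in> borel_measurable lebesgue" by simp
  show "bm (%x. h x*phi x)" using p that(2) by auto
  show "ae x. g x*phi x = h x*phi x" using that(3) by eventually_elim simp
 qed
 have f0: "has_weak_deriv 0 f f" using ai by (auto simp: has_weak_deriv_def)
 have f1: "has_weak_deriv 1 f D"
  unfolding has_weak_deriv_def
 proof (intro conjI allI impI ai)
  fix phi :: "real => real" assume t: "testf phi"
  show "(LINT x|lebesgue. f x*(deriv ^^ 1) phi x) = (-1) ^ 1*(LINT x|lebesgue. D x*phi x)"
   using test[OF f(1) b(1) f(2) test_function_deriv[OF t]] test[OF bl(2) b(2) _ t] H1_weak[OF H t] by simp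
 qed
 have L2: "in_L2 UNIV f" "in_L2 UNIV D"
  using in_L2_rep(1)[OF f(1) b(1) f(2)] in_L2_rep(1)[OF bl(2) b(2)] s by auto
 with f0 f1 show "in_H 1 f" by (auto simp: in_H_def le_Suc_eq)
 have "L2_norm UNIV (weak_deriv 0 f) = nl Z"
 proof (rule in_L2_rep(2)[OF weak_deriv_measurable[OF f0] b(1)])
  show "ae x. weak_deriv 0 f x = Z x" using weak_deriv_ae[OF f0] f(2) by eventually_elim simp
 qed
 moreover have "L2_norm UNIV (weak_deriv 1 f) = nl D"
  by (rule in_L2_rep(2)[OF weak_deriv_measurable[OF f1] b(2) weak_deriv_ae[OF f1]])
 ultimately show "(H_norm 1 f)^2 = (nl Z)^2 + (nl D)^2"
  by (simp add: H_norm_def lessThan_Suc_atMost[symmetric] add_nonneg_nonneg)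
qed

section \<open>Continuous trajectories of weak solutions\<close>

lemma in_C_H_rep:
 assumes "!!T. T > 0 ==> in_C_H T 1 v"
 shows "EX Z D. (ALL t>=0. H1 (Z t) (D t) & v t \<in> borel_measurable lebesgue & (ae x. v t x = Z t x)) &
  (ALL s>=0. ((%t. nl (%x. Z t x - Z s x)) ---> 0) (at s within {0..}) &
     ((%t. nl (%x. D t x - D s x)) ---> 0) (at s within {0..}))"
proof -
 have "EX Z D. H1 Z D & v t \<in> borel_measurable lebesgue & (ae x. v t x = Z x)" if "t >= 0" for t
 proof -
  have "in_H 1 (v t)" using assms[of "t + 1"] that by (simp add: in_C_H_def)
  thus ?thesis using in_H1_rep by metis
 qed
 then obtain Z D where ZD: "!!t. t >= 0 ==> H1 (Z t) (D t) & v t \<in> borel_measurable lebesgue & (ae x. v t x = Z t x)"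
  by metis
 have lim: "((%t. sqrt ((nl (%x. Z t x - Z s x))^2 + (nl (%x. D t x - D s x))^2)) ---> 0) (at s within {0..})" if "s >= 0" for s
 proof -
  have "((%t. H_norm 1 (%x. v t x - v s x)) ---> 0) (at s within {0..s+1})"
   using assms[of "s + 1"] that by (simp add: in_C_H_def)
  moreover have "at s within {0..s+1} = at s within {0..}"
   by (rule at_within_nhd[of _ "{..<s+1}"]) (use that in auto)
  ultimately have 1: "((%t. H_norm 1 (%x. v t x - v s x)) ---> 0) (at s within {0..})" by simp
  have 2: "H_norm 1 (%x. v t x - v s x) = sqrt ((nl (%x. Z t x - Z s x))^2 + (nl (%x. D t x - D s x))^2)" if "t >= 0" for t
  proof -
   have ae: "ae x. v t x - v s x = Z t x - Z s x"
    using ZD[OF that, THEN conjunct2, THEN conjunct2] ZD[OF \<open>s >= 0\<close>, THEN conjunct2, THEN conjunct2]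
    by eventually_elim simp
   have "(H_norm 1 (%x. v t x - v s x))^2 = (nl (%x. Z t x - Z s x))^2 + (nl (%x. D t x - D s x))^2"
    by (rule H1_H_norm(2)[OF _ ae H1_linear]) (use ZD[OF that] ZD[OF \<open>s >= 0\<close>] in auto)
   moreover have "H_norm 1 (%x. v t x - v s x) >= 0" by (simp add: H_norm_def sum_nonneg)
   ultimately show ?thesis by (metis real_sqrt_unique)
  qed
  show ?thesis by (rule Lim_transform_eventually[OF 1]) (use 2 in "auto simp: eventually_at_filter")
 qed
 have "((%t. nl (%x. Z t x - Z s x)) ---> 0) (at s within {0..})" "((%t. nl (%x. D t x - D s x)) ---> 0) (at s within {0..})"
  if "s >= 0" for s
  by (rule Lim_null_comparison[OF _ lim[OF that]]; auto intro!: always_eventually real_le_rsqrt)+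
 with ZD show ?thesis by blast
qed

text \<open>Continuous representative \<open>U\<close> of a weak solution, with \<open>D t\<close> the weak derivative of \<open>U t - ul\<close>;
 the equation is integrated in time and tested in space only.\<close>

definition flux :: "real => real => (real => real) => (real => real) => real" where
 "flux a b u psi = (LBINT x. (u x)^2 / 2*deriv psi x + a*u x*(deriv ^^ 2) psi x + b*u x*(deriv ^^ 3) psi x)"

definition trajectory ::
 "real => real => (real => real) => (real => real => real) => (real => real => real) => bool" where
 "trajectory a b ul U D \<longleftrightarrow>
  (ALL t>=0. H1 (%x. U t x - ul x) (D t)) &
  (ALL s>=0. ((%t. nl (%x. U t x - U s x)) ---> 0) (at s within {0..})) &
  (ALL s>=0. ((%t. nl (%x. D t x - D s x)) ---> 0) (at s within {0..})) &
  (ALL psi s t. testf psi & 0 <= s & s <= t -->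
    ((%tau. flux a b (U tau) psi) has_integral (LBINT x. (U t x - U s x)*psi x)) {s..t})"

text \<open>By \<open>H1_sup\<close>, convergence in H1 as time varies is uniform in
  \<open>x\<close>; with continuity in \<open>x\<close> at the limiting time this is joint
  continuity.\<close>

lemma sup_continuous:
 fixes U D :: "real => real => real"
 assumes H: "!!t. t >= 0 ==> H1 (%x. U t x - ul x) (D t)" and ul: "cont ul"
  and U: "!!s. s >= 0 ==> ((%t. nl (%x. U t x - U s x)) ---> 0) (at s within {0..})"
  and D: "!!s. s >= 0 ==> ((%t. nl (%x. D t x - D s x)) ---> 0) (at s within {0..})"
 shows "continuous_on ({0..} \<times> UNIV) (%(t, x). U t x)"
 unfolding continuous_on_def
proof (intro ballI)
 fix z :: "real \<times> real" assume "z \<in> {0..} \<times> UNIV"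
 then obtain s x where z: "z = (s, x)" "s >= 0" by auto
 have cUs: "cont (U s)"
 proof -
  from continuous_on_add[OF H1D(1)[OF H[OF z(2)]] ul] show ?thesis by simp
 qed
 have H1: "H1 (%x. U t x - U s x) (%x. D t x - D s x)" if "t >= 0" for t
  using H1_linear[OF H[OF that] H[OF z(2)]] by simp
 let ?F = "at z within {0..} \<times> UNIV"
 have n0: "((%t. nl (%x. U t x - U s x) + nl (%x. D t x - D s x)) ---> 0) (at s within {0..})"
  using tendsto_add[OF U[OF z(2)] D[OF z(2)]] by simp
 have "continuous (at s within {0..}) (%t. nl (%x. U t x - U s x) + nl (%x. D t x - D s x))"
  unfolding continuous_within using n0 by (simp add: nrm_def)
 hence "continuous (at (fst z) within fst ` ({0..} \<times> (UNIV :: real set))) (%t. nl (%x. U t x - U s x) + nl (%x. D t x - D s x))"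
  using z by simp
 moreover have "continuous (at z within {0..} \<times> UNIV) fst" by (intro continuous_fst continuous_ident)
 ultimately have "continuous (at z within {0..} \<times> UNIV) (%w. nl (%x. U (fst w) x - U s x) + nl (%x. D (fst w) x - D s x))"
  by (rule continuous_within_compose2[rotated])
 hence n: "((%w. nl (%x. U (fst w) x - U s x) + nl (%x. D (fst w) x - D s x)) ---> 0) ?F"
  using z by (simp add: continuous_within nrm_def)
 have 1: "((%w. U (fst w) (snd w) - U s (snd w)) ---> 0) ?F"
 proof (rule Lim_null_comparison[OF _ n])
  show "\<forall>\<^sub>F w in ?F. norm (U (fst w) (snd w) - U s (snd w)) <= nl (%x. U (fst w) x - U s x) + nl (%x. D (fst w) x - D s x)"
   unfolding eventually_at_filter using H1_sup[OF H1] by (intro always_eventually) auto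
 qed
 have 2: "((%w. U s (snd w)) ---> U s x) ?F"
 proof -
  have "isCont (U s) x" using cUs by (simp add: continuous_on_eq_continuous_at)
  thus ?thesis
   using z by (intro isCont_tendsto_compose[of _ "U s"]) (auto intro!: tendsto_eq_intros)
 qed
 show "((%(t, x). U t x) ---> (case z of (t, x) => U t x)) ?F"
  using tendsto_add[OF 1 2] z by (simp add: case_prod_unfold)
qed


text \<open>The relation \<open>m' = N\<close> is known only as distributions on positive times.
  Mollified in time it holds classically away from 0, uniform continuity removes the mollifier, and
  continuity extends the integrated identity to time 0.\<close>

lemma time_dubois_reymond:
 assumes c: "cont m" "cont N"
  and z: "!!theta. test_function {0<..} theta ==> (LBINT t. deriv theta t*m t + theta t*N t) = 0"
  and st: "0 <= s" "s <= t"
 shows "(N has_integral (m t - m s)) {s..t}"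
proof -
 have int: "N integrable_on {a..b}" for a b
  by (intro integrable_continuous_interval continuous_on_subset[OF c(2)]) auto
 have pos: "m t - m s = integral {s..t} N" if "0 < s" "s <= t" for s t
 proof -
  have "abs (m t - m s - integral {s..t} N) <= (2 + (t - s))*d" if "d > 0" for d
  proof -
   have "EX w>0. \<forall>x\<in>{0..t+1}. \<forall>y\<in>{0..t+1}. abs (y - x) < w --> abs (f y - f x) < d" if "cont f" for f :: "real => real"
    using compact_uniformly_continuous[OF continuous_on_subset[OF that] compact_Icc] \<open>d > 0\<close>
    unfolding uniformly_continuous_on_def dist_real_def by simp
   from this[OF c(1)] this[OF c(2)] obtain w1 w2 where w: "w1 > 0" "w2 > 0"
    "!!x y. x \<in> {0..t+1} ==> y \<in> {0..t+1} ==> abs (y - x) < w1 ==> abs (m y - m x) < d"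
    "!!x y. x \<in> {0..t+1} ==> y \<in> {0..t+1} ==> abs (y - x) < w2 ==> abs (N y - N x) < d" by meson
   \<comment> \<open>Below both moduli of continuity for the tolerance \<open>d\<close>, below
     \<open>s\<close> so that the translated mollifiers live on positive times, and below 1 so that
     they do not leave \<open>{0..t + 1}\<close>.\<close>
   define e where "e = min (min w1 w2) (min s 1) / 2"
   have e: "0 < e" "e < w1" "e < w2" "e < s" "e < 1" using w(1,2) that \<open>0 < s\<close> by (auto simp: e_def min_def)
   note tr = moll_translate_test[OF e(1)]
   have i: "intg (%y. f y*moll e (x - y))" "intg (%y. f y*deriv (moll e) (x - y))"
    if "cont f" for f x
    using locint_test_integrable'[OF locint_continuous[OF that] tr(1)]
     locint_test_integrable'[OF locint_continuous[OF that] test_function_deriv[OF tr(1)]] tr(2)[of 1] by simp_all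
   have o: "abs (conv m (moll e) x - m x) <= d" "abs (conv N (moll e) x - N x) <= d" if "x \<in> {s..t}" for x
   proof -
    have y: "y \<in> {0..t + 1}" "abs (y - x) < w1" "abs (y - x) < w2" if "abs (x - y) <= e" for y
     using that \<open>x \<in> {s..t}\<close> e by (auto simp: abs_le_iff abs_less_iff)
    have x: "x \<in> {0..t + 1}" using that \<open>0 < s\<close> by simp
    show "abs (conv m (moll e) x - m x) <= d"
     by (rule moll_osc[OF e(1) i(1)[OF c(1)] less_imp_le[OF w(3)[OF x y(1,2)]]])
    show "abs (conv N (moll e) x - N x) <= d"
     by (rule moll_osc[OF e(1) i(1)[OF c(2)] less_imp_le[OF w(4)[OF x y(1,3)]]])
   qed
   have "(conv N (moll e) has_integral (conv m (moll e) t - conv m (moll e) s)) {s..t}"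
   proof (rule fundamental_theorem_of_calculus[OF \<open>s <= t\<close>])
    fix x assume x: "x \<in> {s..t}"
    have "closure {y. moll e (x - y) ~= 0} \<subseteq> {x - e..x + e}"
     using moll(2)[OF e(1)] by (intro closure_minimal) (force simp: not_le[symmetric])+
    hence "test_function {0<..} (%y. moll e (x - y))"
     using tr(1)[of x] x e by (auto simp: test_function_def subset_eq)
    from z[OF this] have "conv m (deriv (moll e)) x = conv N (moll e) x"
     using i(1)[OF c(2), of x] i(2)[OF c(1), of x] tr(2)[of 1 x] by (simp add: conv_def mult.commute)
    thus "(conv m (moll e) has_vector_derivative conv N (moll e) x) (at x within {s..t})"
     using conv_moll_deriv[OF e(1) c(1), of 0 x]
     by (simp add: real_vector_deriv has_vector_derivative_at_within)
   qed
   note h = has_integral_diff[OF this integrable_integral[OF int]]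
   have "abs (conv m (moll e) t - conv m (moll e) s - integral {s..t} N) <= d*(t - s)"
    using has_integral_bound[OF less_imp_le[OF \<open>d > 0\<close>] h[folded cbox_interval]] o(2) \<open>s <= t\<close> by simp
   moreover have "(2 + (t - s))*d = 2*d + d*(t - s)" by (simp add: algebra_simps)
   ultimately show ?thesis using o(1)[of s] o(1)[of t] \<open>s <= t\<close> by (simp add: abs_le_iff)
  qed
  from this[of "d / (2 + (t - s))" for d]
  have "abs (m t - m s - integral {s..t} N) <= 0 + d" if "d > 0" for d
   using that \<open>s <= t\<close> by simp
  thus ?thesis using field_le_epsilon[of "abs (m t - m s - integral {s..t} N)" 0] by simp
 qed
 define P where "P x = m x - integral {0..x} N" for x
 have cl: "closure {0<..<t + 1} = {0..t + 1}" using st by simp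
 have "continuous_on (closure {0<..<t + 1}) P"
  unfolding P_def cl by (intro continuous_intros continuous_on_subset[OF c(1)] indefinite_integral_continuous_1 int) auto
 moreover have "P u = P (t + 1)" if "u \<in> {0<..<t + 1}" for u
  using pos[of u "t + 1"] that Henstock_Kurzweil_Integration.integral_combine[of 0 u "t + 1" N] int by (auto simp: P_def)
 ultimately have "P x = P (t + 1)" if "x \<in> {0..t + 1}" for x
  using continuous_constant_on_closure[of "{0<..<t + 1}" P "P (t + 1)" x] that unfolding cl by blast
 from this[of s] this[of t] have "integral {s..t} N = m t - m s"
  using Henstock_Kurzweil_Integration.integral_combine[of 0 s t N] int st by (simp add: P_def)
 thus ?thesis using int by (metis has_integral_integral)
qed


lemma integral_compact_support:
 fixes f :: "real => real"
 assumes "cont f" "!!x. x \<notin> {a..b} ==> f x = (0::real)"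
 shows "(LBINT x. f x) = integral {a..b} f" "intg f"
proof -
 have eq: "(%x. indicator {a..b} x *\<^sub>R f x) = f"
 proof
  fix x show "indicator {a..b} x *\<^sub>R f x = f x" using assms(2)[of x] by (cases "x \<in> {a..b}") auto
 qed
 have "(LBINT x. f x) = (LBINT x:{a..b}. f x)" "intg f \<longleftrightarrow> set_integrable lborel {a..b} f"
  unfolding set_lebesgue_integral_def set_integrable_def eq by auto
 moreover have "continuous_on {a..b} f" by (rule continuous_on_subset[OF assms(1)]) simp
 ultimately show "(LBINT x. f x) = integral {a..b} f" "intg f"
  using set_borel_integral_eq_integral(2)[of "{a..b}" f] borel_integrable_atLeastAtMost'[of a b f] by auto
qed

lemma continuous_on_section:
 assumes "continuous_on (S \<times> T) (%(t, x). f t x)" "t \<in> S"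
 shows "continuous_on T (f t)"
proof -
 have "continuous_on T (%x. (t, x))" by (intro continuous_intros)
 from continuous_on_compose2[OF assms(1) this] show ?thesis using assms(2) by auto
qed

lemma integral_continuous_param:
 fixes f :: "'a::euclidean_space => real => real"
 assumes c: "continuous_on (S \<times> UNIV) (%(t, x). f t x)" and z: "!!t x. t \<in> S ==> x \<notin> {a..b} ==> f t x = 0"
 shows "continuous_on S (%t. LBINT x. f t x)"
proof -
 have "continuous_on S (%t. integral (cbox a b) (f t))"
  by (rule integral_continuous_on_param) (rule continuous_on_subset[OF c], auto)
 moreover have "(LBINT x. f t x) = integral (cbox a b) (f t)" if "t \<in> S" for t
 proof -
  have "cont (f t)"
   by (rule continuous_on_section[OF c that])
  thus ?thesis using integral_compact_support(1)[of "f t" a b] z[OF that] by simp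
 qed
 ultimately show ?thesis by (simp cong: continuous_on_cong)
qed

lemma test_function_product:
 assumes theta: "test_function {0<..} theta" and psi: "testf psi"
 shows "test_function ({0<..} \<times> UNIV) (%z::real \<times> real. theta (fst z)*psi (snd z))"
 unfolding test_function_def
proof (intro conjI)
 let ?C = "closure {x. theta x ~= 0} \<times> closure {x. psi x ~= 0}"
 have sub: "closure {z. theta (fst z)*psi (snd z) ~= 0} \<subseteq> ?C"
  by (rule closure_minimal) (use closure_subset in "force intro!: closed_Times")+
 show "smooth (%z. theta (fst z)*psi (snd z))"
  using theta psi by (intro smooth_tensor) (auto simp: test_function_def)
 have "compact ?C" using theta psi by (intro compact_Times) (auto simp: test_function_def)
 thus "compact (closure {z. theta (fst z)*psi (snd z) ~= 0})"
  using compact_Int_closed[of ?C "closure {z. theta (fst z)*psi (snd z) ~= 0}"] sub by (simp add: inf.absorb2)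
 show "closure {z. theta (fst z)*psi (snd z) ~= 0} \<subseteq> {0<..} \<times> UNIV"
  using sub theta by (auto simp: test_function_def)
qed

text \<open>Product test functions \<open>theta t * psi x\<close> separate the variables: for fixed
  \<open>psi\<close> the pairing \<open>m\<close> of the solution with \<open>psi\<close> has
  distributional derivative \<open>N\<close>, its flux, and \<open>time_dubois_reymond\<close>
  integrates this.\<close>

lemma trajectory_exists:
 assumes sol: "global_solution ul a b v u" and ul: "cont ul"
 obtains U D where "trajectory a b ul U D"
  "!!t. t >= 0 ==> u t \<in> borel_measurable lebesgue" "!!t. t >= 0 ==> ae x. u t x = U t x"
proof -
 have "in_C_H T 1 (%t x. u t x - ul x)" if "T > 0" for T
  using sol that by (simp add: global_solution_def in_X_def)
 from in_C_H_rep[of "%t x. u t x - ul x", OF this] obtain Z D where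
  ZD: "ALL t>=0. H1 (Z t) (D t) & (%x. u t x - ul x) \<in> borel_measurable lebesgue & (ae x. u t x - ul x = Z t x)"
  "ALL s>=0. ((%t. nl (%x. Z t x - Z s x)) ---> 0) (at s within {0..}) &
     ((%t. nl (%x. D t x - D s x)) ---> 0) (at s within {0..})" by blast
 have Z: "!!t. t >= 0 ==> H1 (Z t) (D t)" "!!t. t >= 0 ==> (%x. u t x - ul x) \<in> borel_measurable lebesgue"
  "!!t. t >= 0 ==> ae x. u t x - ul x = Z t x"
  "!!s. s >= 0 ==> ((%t. nl (%x. Z t x - Z s x)) ---> 0) (at s within {0..})"
  "!!s. s >= 0 ==> ((%t. nl (%x. D t x - D s x)) ---> 0) (at s within {0..})"
  using ZD by blast+
 define U where "U t x = Z t x + ul x" for t x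
 have H: "H1 (%x. U t x - ul x) (D t)" if "t >= 0" for t using Z(1)[OF that] by (simp add: U_def)
 have lim: "((%t. nl (%x. U t x - U s x)) ---> 0) (at s within {0..})" if "s >= 0" for s
  using Z(4)[OF that] by (simp add: U_def)
 have cU: "continuous_on ({0..} \<times> UNIV) (%(t, x). U t x)"
  by (rule sup_continuous[OF H ul lim Z(5)])
 have ulm: "ul \<in> borel_measurable lebesgue"
  using bm_cont[OF ul] by (auto intro: measurable_completion)
 have um: "u t \<in> borel_measurable lebesgue" if "t >= 0" for t
  using borel_measurable_add[OF Z(2)[OF that] ulm] by simp
 have ae: "ae x. u t x = U t x" if "t >= 0" for t
  using Z(3)[OF that] by eventually_elim (auto simp: U_def)
 have "((%tau. flux a b (U tau) psi) has_integral (LBINT x. (U t x - U s x)*psi x)) {s..t}"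
  if psi: "testf psi" and st: "0 <= s" "s <= t" for psi s t
 proof -
  \<comment> \<open>Freezing the solution at its initial value for negative times makes
    \<open>m\<close> and \<open>N\<close> continuous on the whole line.\<close>
  let ?U = "%t. U (max 0 t)"
  define m where "m t = (LBINT x. ?U t x*psi x)" for t
  define N where "N t = flux a b (?U t) psi" for t
  obtain R where "!!x. abs x > R ==> psi x = 0" using test_function_bounds[OF psi] by metis
  hence R: "abs x > R ==> (deriv ^^ n) psi x = 0" for n x by (rule deriv_n_zero_far)
  have sm: "smooth psi" using psi by (simp add: test_function_def)
  have cU': "continuous_on (UNIV \<times> UNIV) (%z. ?U (fst z) (snd z))"
  proof -
   have "continuous_on (UNIV \<times> UNIV) (%z::real \<times> real. (max 0 (fst z), snd z))"
    by (intro continuous_intros)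
   moreover have "(%z::real \<times> real. (max 0 (fst z), snd z)) ` (UNIV \<times> UNIV) \<subseteq> {0..} \<times> UNIV" by auto
   ultimately show ?thesis using continuous_on_compose2[OF cU] by fastforce
  qed
  have cpsi: "continuous_on A (%z. (deriv ^^ n) psi (snd z))" for A :: "(real \<times> real) set" and n
   by (rule continuous_on_compose2[OF smooth_imp_continuous_on[OF smooth_deriv_n[OF sm, of n], of UNIV]])
    (auto intro!: continuous_intros)
  have R1: "x \<notin> {-R..R} ==> (deriv ^^ n) psi x = 0" for n x using R[of x n] by auto
  have cm: "cont m" unfolding m_def
   by (rule integral_continuous_param[where a="-R" and b=R])
    (use R1[of _ 0] cpsi[of _ 0] in "auto simp: case_prod_unfold intro!: continuous_intros cU'[simplified]")
  have cN: "cont N" unfolding N_def flux_def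
   by (rule integral_continuous_param[where a="-R" and b=R])
    (use R1[of _ 1] R1[of _ 2] R1[of _ 3] cpsi[of _ 1] cpsi[of _ 2] cpsi[of _ 3]
     in "auto simp: case_prod_unfold intro!: continuous_intros cU'[simplified]")
  have i: "intg (%x. h x*(deriv ^^ n) psi x)" if "cont h" for h n
   by (rule locint_test_integrable'[OF locint_continuous[OF that] test_function_deriv_n[OF psi]])
  have cUt: "cont (U t)" if "t >= 0" for t
   by (rule continuous_on_section[OF cU]) (use that in simp)
  have "(N has_integral (m t - m s)) {s..t}"
  proof (rule time_dubois_reymond[OF cm cN _ st])
   fix theta :: "real => real" assume theta: "test_function {0<..} theta"
   have stheta: "smooth theta" using theta by (simp add: test_function_def)
   have theta0: "theta t = 0" if "t <= 0" for t
    using theta that closure_subset[of "{x. theta x ~= 0}"] by (force simp: test_function_def)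
   have d0: "deriv theta t = 0" if "t <= 0" for t using test_function_deriv_zero[OF theta] that by auto
   have inner: "(LINT x|lebesgue. u t x*deriv (%s. theta s * psi x) t
     + (u t x)^2 / 2*deriv (%y. theta t*psi y) x + a*u t x*(deriv ^^ 2) (%y. theta t*psi y) x
     + b*u t x*(deriv ^^ 3) (%y. theta t*psi y) x) = deriv theta t*m t + theta t*N t" if t: "t >= 0" for t
   proof -
    have dn: "(deriv ^^ n) (%y. theta t*psi y) = (%y. theta t*(deriv ^^ n) psi y)" for n
    proof (induction n)
     case (Suc n)
     show ?case
      unfolding funpow.simps o_def Suc
      using DERIV_imp_deriv[OF DERIV_cmult[OF smooth_deriv_n_has_derivative[OF sm, of n]]] by auto
    qed simp
    have dt: "deriv (%s. theta s * psi x) t = deriv theta t*psi x" for x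
     using DERIV_imp_deriv[OF DERIV_cmult_right[OF smooth_realD(1)[OF stheta]]] .
    let ?g = "%w x. deriv theta t*(w x*psi x) + theta t*((w x)^2 / 2*deriv psi x + a*w x*(deriv ^^ 2) psi x + b*w x*(deriv ^^ 3) psi x)"
    have d1: "deriv (%y. theta t*psi y) = (%y. theta t*deriv psi y)" using dn[of 1] by simp
    have eq: "u t x*deriv (%s. theta s * psi x) t
     + (u t x)^2 / 2*deriv (%y. theta t*psi y) x + a*u t x*(deriv ^^ 2) (%y. theta t*psi y) x
     + b*u t x*(deriv ^^ 3) (%y. theta t*psi y) x = ?g (u t) x" for x
     unfolding dt dn d1 by (simp add: algebra_simps)
    have psim: "bm ((deriv ^^ n) psi)" "(deriv ^^ n) psi \<in> borel_measurable lebesgue" for n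
     using smooth_borel[OF smooth_deriv_n[OF sm]] by (auto intro: measurable_completion)
    note psim' = psim[of 0, simplified] psim[of 1, simplified] psim[of 2] psim[of 3]
    have "(LINT x|lebesgue. ?g (u t) x) = (LBINT x. ?g (U t) x)"
    proof (rule lebesgue_integral_rep(1))
     show "?g (u t) \<in> borel_measurable lebesgue" using um[OF t] psim' by simp
     show "bm (?g (U t))"
      using bm_cont[OF cUt[OF t]] psim' by simp
     show "ae x. ?g (u t) x = ?g (U t) x" using ae[OF t] by eventually_elim simp
    qed
    also have "... = deriv theta t*m t + theta t*N t"
     using i[of "U t" 0] i[of "%x. (U t x)^2 / 2" 1] i[of "%x. a*U t x" 2] i[of "%x. b*U t x" 3] cUt[OF t] t
     by (simp add: m_def N_def flux_def continuous_intros)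
    finally show ?thesis unfolding eq .
   qed
   have "(LINT t:{0<..}|lebesgue. LINT x|lebesgue.
      u t x*deriv (%s. theta s * psi x) t + (u t x)^2 / 2*deriv (%y. theta t*psi y) x
     + a*u t x*(deriv ^^ 2) (%y. theta t*psi y) x + b*u t x*(deriv ^^ 3) (%y. theta t*psi y) x) = 0"
    using sol[unfolded global_solution_def, THEN conjunct2, THEN conjunct2, rule_format, OF test_function_product[OF theta psi]]
    by (simp only: fst_conv snd_conv)
   also have "(LINT t:{0<..}|lebesgue. LINT x|lebesgue.
      u t x*deriv (%s. theta s * psi x) t + (u t x)^2 / 2*deriv (%y. theta t*psi y) x
     + a*u t x*(deriv ^^ 2) (%y. theta t*psi y) x + b*u t x*(deriv ^^ 3) (%y. theta t*psi y) x)
     = (LINT t|lebesgue. deriv theta t*m t + theta t*N t)"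
    unfolding set_lebesgue_integral_def
    by (rule int_cong) (use inner theta0 d0 in "auto simp: indicator_def")
   also have "... = (LBINT t. deriv theta t*m t + theta t*N t)"
    using bm_cont[OF cm] bm_cont[OF cN]
     smooth_borel[OF stheta] smooth_borel[OF smooth_realD(2)[OF stheta]]
    by (intro integral_completion) simp
   finally show "(LBINT t. deriv theta t*m t + theta t*N t) = 0" .
  qed
  moreover have "m t - m s = (LBINT x. (U t x - U s x)*psi x)"
   using i[OF cUt, of t 0] i[OF cUt, of s 0] st by (simp add: m_def left_diff_distrib)
  ultimately have "(N has_integral (LBINT x. (U t x - U s x)*psi x)) {s..t}" by simp
  thus ?thesis
   by (rule has_integral_eq[rotated]) (use st in "auto simp: N_def")
 qed
 hence "trajectory a b ul U D"
  unfolding trajectory_def using H lim Z(5) by blast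
 thus ?thesis using um ae by (rule that)
qed

section \<open>The mollified energy identity\<close>

lemma conv_continuous_joint:
 fixes F :: "real => real => real"
 assumes F: "continuous_on (S \<times> UNIV) (%(t, x). F t x)"
  and phi: "cont phi" "!!x. abs x > e ==> phi x = 0"
 shows "continuous_on (S \<times> UNIV) (%(t, x). conv (F t) phi x)"
proof -
 have "continuous_on (S \<times> UNIV) (%z. LBINT y. F (fst z) (snd z - y)*phi y)"
 proof (rule integral_continuous_param[where a="-e" and b=e])
  have "continuous_on ((S \<times> UNIV) \<times> UNIV) (%w :: (real \<times> real) \<times> real. (fst (fst w), snd (fst w) - snd w))"
   by (intro continuous_intros)
  moreover have "(%w :: (real \<times> real) \<times> real. (fst (fst w), snd (fst w) - snd w)) ` ((S \<times> UNIV) \<times> UNIV) \<subseteq> S \<times> (UNIV :: real set)" by auto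
  ultimately have "continuous_on ((S \<times> UNIV) \<times> UNIV) (%w. F (fst (fst w)) (snd (fst w) - snd w))"
   using continuous_on_compose2[OF F, of "(S \<times> UNIV) \<times> UNIV" "%w. (fst (fst w), snd (fst w) - snd w)"]
   by (simp add: case_prod_unfold)
  thus "continuous_on ((S \<times> UNIV) \<times> UNIV) (%(z, y). F (fst z) (snd z - y)*phi y)"
   unfolding case_prod_unfold
   by (intro continuous_intros continuous_on_compose2[OF phi(1)]) auto
  show "F (fst t) (snd t - x)*phi x = 0" if "x \<notin> {-e..e}" for t x
   using phi(2)[of x] that by (cases "abs x > e") (auto simp: abs_le_iff)
 qed
 moreover have "conv f phi x = (LBINT y. f (x - y)*phi y)" for f x
  using lborel_integral_reflect[of "%y. f y*phi (x - y)" x] by (simp add: conv_def)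
 ultimately show ?thesis by (simp add: case_prod_unfold)
qed

text \<open>\<open>g\<close> is the mollified solution and \<open>G\<close> its time derivative. By
  parts, the second-order term becomes dissipation, the third-order term is antisymmetric and drops
  out, and the flux passes its derivative to \<open>g\<close>.\<close>

lemma energy_terms:
 fixes a b e :: real and Z B q :: "real => real"
 assumes e: "e > 0" and Z: "cont Z" "sql Z" and B: "cont B" "sql B" and q: "sql q"
 defines "rho == moll e"
 defines "g == conv Z rho" and "G == %x. - conv B (deriv rho) x + a*conv Z ((deriv ^^ 2) rho) x
   - b*conv Z ((deriv ^^ 3) rho) x + conv q rho x"
 shows "(LBINT x. g x*G x) = - a*(nl (conv Z (deriv rho)))^2 + (LBINT x. conv Z (deriv rho) x*conv B rho x)
   + (LBINT x. g x*conv q rho x)" "sql g" "sql G"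
proof -
 have k: "kernel e ((deriv ^^ n) rho)" for n unfolding rho_def by (rule moll_kernel(1)[OF e])
 have s: "sql (conv f ((deriv ^^ n) rho))" if "sql f" for f n by (rule young(1)[OF that k])
 have d: "DERIV (conv f ((deriv ^^ n) rho)) x :> conv f ((deriv ^^ Suc n) rho) x"
  if "cont f" for f n x unfolding rho_def by (rule conv_moll_deriv[OF e that])
 have c: "cont (conv f ((deriv ^^ n) rho))" if "cont f" for f n
  by (rule DERIV_cont[OF d[OF that]])
 have ibp: "(LBINT x. conv f ((deriv ^^ n) rho) x*conv h ((deriv ^^ Suc m) rho) x)
  = - (LBINT x. conv f ((deriv ^^ Suc n) rho) x*conv h ((deriv ^^ m) rho) x)"
  if "cont f" "cont h" "sql f" "sql h" for f h n m
  by (rule integral_by_parts_line[OF d d c c s s s s]) (use that in auto)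
 note s0 = s[of _ 0, simplified] and s1 = s[of _ 1, simplified]
 show sg: "sql g" unfolding g_def by (rule s0[OF Z(2)])
 show "sql G" unfolding G_def by (intro sqint_add sqint_diff sqint_minus sqint_cmult s s0 s1 Z B q)
 have i: "intg (%x. g x*h x)" if "sql h" for h by (rule sqint_mult[OF sg that])
 have "(LBINT x. g x*G x) = - (LBINT x. g x*conv B (deriv rho) x) + a*(LBINT x. g x*conv Z ((deriv ^^ 2) rho) x)
   - b*(LBINT x. g x*conv Z ((deriv ^^ 3) rho) x) + (LBINT x. g x*conv q rho x)"
  using i[OF s1[OF B(2)]] i[OF s[OF Z(2), of 2]] i[OF s[OF Z(2), of 3]] i[OF s0[OF q]]
  by (simp add: G_def distrib_left right_diff_distrib mult.left_commute[of "g _"])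
 also have "(LBINT x. g x*conv B (deriv rho) x) = - (LBINT x. conv Z (deriv rho) x*conv B rho x)"
  using ibp[OF Z(1) B(1) Z(2) B(2), of 0 0] by (simp add: g_def)
 also have "(LBINT x. g x*conv Z ((deriv ^^ 2) rho) x) = - ((nl (conv Z (deriv rho)))^2)"
  unfolding nrm_sq using ibp[OF Z(1) Z(1) Z(2) Z(2), of 0 1] by (simp add: g_def power2_eq_square numeral_2_eq_2)
 also have "(LBINT x. g x*conv Z ((deriv ^^ 3) rho) x) = 0"
  using ibp[OF Z(1) Z(1) Z(2) Z(2), of 0 2] ibp[OF Z(1) Z(1) Z(2) Z(2), of 1 1]
  by (simp add: g_def numeral_2_eq_2 numeral_3_eq_3 mult.commute)
 finally show "(LBINT x. g x*G x) = - a*(nl (conv Z (deriv rho)))^2 + (LBINT x. conv Z (deriv rho) x*conv B rho x)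
   + (LBINT x. g x*conv q rho x)" by simp
qed

text \<open>\<open>eq\<close> is the weak form of \<open>Z_t + B_x = a*Z_xx - b*Z_xxx + q\<close>.
  Tested with the translates \<open>rho (x - y)\<close>, it says that for each fixed
  \<open>x\<close> the function \<open>g t x\<close> has the classical time derivative
  \<open>G t x\<close>. So \<open>g^2\<close> can be differentiated pointwise in \<open>x\<close>,
  and Fubini exchanges the time integral with the space integral, the bound \<open>K\<close>
  securing integrability.\<close>

lemma energy_estimate:
 fixes Z B q :: "real => real => real"
 assumes e: "e > 0" and st: "s0 <= t0"
 defines "S == {s0..t0}" and "rho == moll e"
 assumes cont: "continuous_on (S \<times> UNIV) (%(t, x). Z t x)" "continuous_on (S \<times> UNIV) (%(t, x). B t x)"
   "continuous_on (S \<times> UNIV) (%(t, x). q t x)"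
  and sq: "!!t. t \<in> S ==> sql (Z t)" "!!t. t \<in> S ==> sql (B t)" "!!t. t \<in> S ==> sql (q t)"
  and K: "!!t. t \<in> S ==> nl (Z t) <= K" "!!t. t \<in> S ==> nl (B t) <= K" "!!t. t \<in> S ==> nl (q t) <= K"
  and eq: "!!psi s t. testf psi ==> s0 <= s ==> s <= t ==> t <= t0 ==>
   ((%tau. LBINT x. B tau x*deriv psi x + a*Z tau x*(deriv ^^ 2) psi x + b*Z tau x*(deriv ^^ 3) psi x + q tau x*psi x)
    has_integral (LBINT x. (Z t x - Z s x)*psi x)) {s..t}"
  and bound: "!!t. t \<in> S ==> - a*(nl (conv (Z t) (deriv rho)))^2 + (LBINT x. conv (Z t) (deriv rho) x*conv (B t) rho x)
   + (LBINT x. conv (Z t) rho x*conv (q t) rho x) <= c t"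
  and c: "continuous_on S c"
 shows "(nl (conv (Z t0) rho))^2 - (nl (conv (Z s0) rho))^2 <= 2*integral S c"
proof -
 have k: "kernel e ((deriv ^^ n) rho)" for n unfolding rho_def by (rule moll_kernel(1)[OF e])
 have kc: "cont ((deriv ^^ n) rho)" "abs x > e ==> (deriv ^^ n) rho x = 0" for n x
  unfolding rho_def by (auto intro: smooth_imp_continuous_on smooth_deriv_n moll_smooth moll_kernel(2)[OF e])
 define g where "g t = conv (Z t) rho" for t
 define G where "G t x = - conv (B t) (deriv rho) x + a*conv (Z t) ((deriv ^^ 2) rho) x
   - b*conv (Z t) ((deriv ^^ 3) rho) x + conv (q t) rho x" for t x
 have cs: "cont (Z t)" "cont (B t)" if "t \<in> S" for t
  using continuous_on_section[OF cont(1) that] continuous_on_section[OF cont(2) that] by auto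
 have hg: "(LBINT x. g t x*G t x) <= c t" "sql (g t)" "sql (G t)" if "t \<in> S" for t
 proof -
  note A = e cs(1)[OF that] sq(1)[OF that] cs(2)[OF that] sq(2)[OF that] sq(3)[OF that]
  show "(LBINT x. g t x*G t x) <= c t" "sql (g t)" "sql (G t)"
   using bound[OF that] energy_terms(1)[OF A, where a=a and b=b, folded rho_def] energy_terms(2)[OF A, folded rho_def]
    energy_terms(3)[OF A, where a=a and b=b, folded rho_def]
   by (simp_all add: g_def G_def[abs_def])
 qed
 have I: "(G' has_integral (g t x - g s x)) {s..t}" if "s0 <= s" "s <= t" "t <= t0" "G' = (%tau. G tau x)" for s t x G'
 proof -
  let ?psi = "%y. rho (x - y)"
  have t: "testf ?psi" unfolding rho_def by (rule moll_translate_test(1)[OF e])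
  have d: "(deriv ^^ n) ?psi = (%y. (-1) ^ n*(deriv ^^ n) rho (x - y))" for n
   unfolding rho_def by (rule moll_translate_test(2)[OF e])
  have d1: "deriv ?psi = (%y. - deriv rho (x - y))" using d[of 1] by simp
  have i: "intg (%y. f y*(deriv ^^ n) rho (x - y))" if "sql f" for f n
   by (rule conv_integrable[OF that k])
  note i0 = i[of _ 0, simplified] and i1 = i[of _ 1, simplified]
  have S: "tau \<in> S" if "tau \<in> {s..t}" for tau using that \<open>s0 <= s\<close> \<open>t <= t0\<close> by (auto simp: S_def)
  have 1: "(LBINT y. B tau y*deriv ?psi y + a*Z tau y*(deriv ^^ 2) ?psi y + b*Z tau y*(deriv ^^ 3) ?psi y + q tau y*?psi y) = G tau x"
   if "tau \<in> {s..t}" for tau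
   using i1[OF sq(2)[OF S[OF that]]] i[OF sq(1)[OF S[OF that]], of 2] i[OF sq(1)[OF S[OF that]], of 3] i0[OF sq(3)[OF S[OF that]]]
   by (simp add: d d1 G_def conv_def mult.assoc)
  have 2: "(LBINT y. (Z t y - Z s y)*?psi y) = g t x - g s x"
   using i0[OF sq(1)[OF S[of s]]] i0[OF sq(1)[OF S[of t]]] that(2) by (simp add: left_diff_distrib g_def conv_def)
  show ?thesis
   using has_integral_eq[OF 1 eq[OF t that(1-3)]] that(4) by (simp add: 2)
 qed
 have CJ: "continuous_on (S \<times> UNIV) (%(t, x). conv (F t) ((deriv ^^ n) rho) x)"
  if "continuous_on (S \<times> UNIV) (%(t, x). F t x)" for F n
  by (rule conv_continuous_joint[OF that kc(1) kc(2)])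
 have cg: "continuous_on (S \<times> UNIV) (%(t, x). g t x)"
  unfolding g_def using CJ[OF cont(1), of 0] by simp
 have cG: "continuous_on (S \<times> UNIV) (%(t, x). G t x)"
  using CJ[OF cont(2), of 1, simplified] CJ[OF cont(1), of 2] CJ[OF cont(1), of 3] CJ[OF cont(3), of 0, simplified]
  unfolding G_def case_prod_unfold by (intro continuous_intros)
 have slice: "continuous_on S (%t. f t x)" if "continuous_on (S \<times> UNIV) (%(t, x). f t x)" for f :: "real => real => real" and x
 proof -
  have "continuous_on S (%t. (t, x))" by (intro continuous_intros)
  from continuous_on_compose2[OF that this] show ?thesis by auto
 qed
 have cGx: "continuous_on S (%t. G t x)" and cgx: "continuous_on S (%t. g t x)" for x
  by (rule slice[OF cG], rule slice[OF cg])
 have sqr: "(LBINT t. indicator S t*(2*(g t x*G t x))) = (g t0 x)^2 - (g s0 x)^2" for x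
 proof -
  have "((%t. g t x) has_real_derivative G t x) (at t within S)" if "t \<in> S" for t
  proof -
   have "((%t. g s0 x + integral {s0..t} (%t. G t x)) has_real_derivative 0 + G t x) (at t within S)"
    unfolding S_def by (intro DERIV_add DERIV_const integral_has_real_derivative)
     (use cGx that in "auto simp: S_def")
   hence "((%t. g s0 x + integral {s0..t} (%t. G t x)) has_real_derivative G t x) (at t within S)" by simp
   thus ?thesis
   proof (rule has_field_derivative_transform_within[where d=1])
    fix r assume "r \<in> S"
    thus "g s0 x + integral {s0..r} (%t. G t x) = g r x"
     using integral_unique[OF I[OF order_refl _ _ refl]] by (simp add: S_def)
   qed (use that in auto)
  qed
  hence "((%t. (g t x)^2) has_vector_derivative 2*(g t x*G t x)) (at t within S)" if "t \<in> S" for t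
   unfolding real_vector_deriv[symmetric]
   using that by (auto intro!: derivative_eq_intros)
  hence "((%t. 2*(g t x*G t x)) has_integral ((g t0 x)^2 - (g s0 x)^2)) S"
   unfolding S_def by (intro fundamental_theorem_of_calculus st) auto
  moreover have "set_integrable lborel S (%t. 2*(g t x*G t x))"
   using cGx cgx unfolding S_def by (intro borel_integrable_atLeastAtMost' continuous_intros)
  ultimately show ?thesis
   using set_borel_integral_eq_integral(2)[of S "%t. 2*(g t x*G t x)"]
   by (simp only: set_lebesgue_integral_def real_scaleR_def integral_unique)
 qed
 define F where "F = (%z. indicator (S \<times> UNIV) z *\<^sub>R (2*(g (fst z) (snd z)*G (fst z) (snd z))))"
 have Feq: "F (t, x) = indicator S t*(2*(g t x*G t x))" for t x by (simp add: F_def indicator_def)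
 have mF: "F \<in> borel_measurable (lborel \<Otimes>\<^sub>M lborel)"
 proof -
  have "bm F" unfolding F_def
   by (rule borel_measurable_continuous_on_indicator)
    (use cg cG in "auto simp: S_def case_prod_unfold intro!: continuous_intros borel_closed closed_Times")
  thus ?thesis unfolding lborel_prod by simp
 qed
 have KG: "EX C. \<forall>t\<in>S. nl (G t) <= C"
 proof -
  define N where "N n = (LBINT x. abs ((deriv ^^ n) rho x))" for n
  have y: "nl (conv f ((deriv ^^ n) rho)) <= N n*K" "sql (conv f ((deriv ^^ n) rho))" if "sql f" "nl f <= K" for f n
  proof -
   have "nl (conv f ((deriv ^^ n) rho)) <= N n*nl f" unfolding N_def by (rule young(2)[OF that(1) k])
   also have "... <= N n*K" using that(2) by (intro mult_left_mono) (simp_all add: N_def)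
   finally show "nl (conv f ((deriv ^^ n) rho)) <= N n*K" .
  qed (rule young(1)[OF that(1) k])
  have "nl (G t) <= N 1*K + abs a*(N 2*K) + abs b*(N 3*K) + N 0*K" if t: "t \<in> S" for t
  proof -
   note y1 = y[OF sq(2)[OF t] K(2)[OF t], of 1, simplified] and y2 = y[OF sq(1)[OF t] K(1)[OF t], of 2]
    and y3 = y[OF sq(1)[OF t] K(1)[OF t], of 3] and y0 = y[OF sq(3)[OF t] K(3)[OF t], of 0, simplified]
   have "nl (G t) <= nl (%x. - conv (B t) (deriv rho) x + a*conv (Z t) ((deriv ^^ 2) rho) x
     - b*conv (Z t) ((deriv ^^ 3) rho) x) + nl (conv (q t) rho)"
    unfolding G_def by (intro nrm_triangle sqint_add sqint_diff sqint_minus sqint_cmult y1 y2 y3 y0)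
   moreover have "nl (%x. - conv (B t) (deriv rho) x + a*conv (Z t) ((deriv ^^ 2) rho) x - b*conv (Z t) ((deriv ^^ 3) rho) x)
    <= nl (%x. - conv (B t) (deriv rho) x + a*conv (Z t) ((deriv ^^ 2) rho) x) + nl (%x. b*conv (Z t) ((deriv ^^ 3) rho) x)"
    by (intro nrm_triangle_diff sqint_add sqint_minus sqint_cmult y1 y2 y3)
   moreover have "nl (%x. - conv (B t) (deriv rho) x + a*conv (Z t) ((deriv ^^ 2) rho) x)
    <= nl (%x. - conv (B t) (deriv rho) x) + nl (%x. a*conv (Z t) ((deriv ^^ 2) rho) x)"
    by (intro nrm_triangle sqint_minus sqint_cmult y1 y2)
   moreover have "abs a*nl (conv (Z t) ((deriv ^^ 2) rho)) <= abs a*(N 2*K)"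
    "abs b*nl (conv (Z t) ((deriv ^^ 3) rho)) <= abs b*(N 3*K)"
    using y2(1) y3(1) by (auto intro: mult_left_mono)
   ultimately show ?thesis using y1(1) y0(1) by (simp add: nrm_cmult)
  qed
  thus ?thesis by blast
 qed
 then obtain C where C: "!!t. t \<in> S ==> nl (G t) <= C" by blast
 have gK: "nl (g t) <= K" if "t \<in> S" for t
 proof -
  have "(LBINT x. abs (rho x)) = 1" unfolding rho_def using moll_integral(2)[OF e] moll(1)[OF e] by simp
  thus ?thesis using young(2)[OF sq(1)[OF that] k[of 0]] K(1)[OF that] by (simp add: g_def)
 qed
 have int: "integrable (lborel \<Otimes>\<^sub>M lborel) F"
 proof (rule lborel_pair.Fubini_integrable[OF mF])
  have "intg (%t. indicator S t*(2*(K*C)))"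
   unfolding S_def by (intro integrable_mult_left integrable_real_indicator) (auto simp: emeasure_lborel_Icc_eq)
  thus "intg (%t. LBINT x. norm (F (t, x)))"
  proof (rule int_bound)
   show "(%t. LBINT x. norm (F (t, x))) \<in> borel_measurable lborel" using mF by measurable
   show "ae t. norm (LBINT x. norm (F (t, x))) <= norm (indicator S t*(2*(K*C)))"
   proof (rule AE_I2)
    fix t
    show "norm (LBINT x. norm (F (t, x))) <= norm (indicator S t*(2*(K*C)))"
    proof (cases "t \<in> S")
     case True
     have "(LBINT x. norm (F (t, x))) = 2*(LBINT x. abs (g t x)*abs (G t x))"
      using True by (simp add: Feq abs_mult)
     moreover have "(LBINT x. abs (g t x)*abs (G t x)) <= nl (g t)*nl (G t)"
      using cauchy_schwarz[OF sqint_abs[OF hg(2)[OF True]] sqint_abs[OF hg(3)[OF True]]] by (simp add: abs_le_iff)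
     moreover have "nl (g t)*nl (G t) <= K*C"
      by (intro mult_mono gK[OF True] C[OF True] order_trans[OF nrm_nonneg gK[OF True]] nrm_nonneg)
     moreover have "(LBINT x. norm (F (t, x))) >= 0" by (intro Bochner_Integration.integral_nonneg) auto
     ultimately show ?thesis using True by simp
    qed (simp add: Feq)
   qed
  qed
  show "ae t. intg (%x. F (t, x))"
  proof (rule AE_I2)
   fix t show "intg (%x. F (t, x))"
    unfolding Feq using sqint_mult[OF hg(2,3)] by (cases "t \<in> S") auto
  qed
 qed
 have c2: "continuous_on {s0..t0} (%t. 2*c t)" using c by (auto simp: S_def intro!: continuous_intros)
 have Ss: "s0 \<in> S" "t0 \<in> S" using st by (auto simp: S_def)
 have "(nl (g t0))^2 - (nl (g s0))^2 = (LBINT x. (g t0 x)^2 - (g s0 x)^2)"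
  unfolding nrm_sq using hg(2)[OF Ss(1)] hg(2)[OF Ss(2)] by (simp add: sqint_def)
 also have "... = (LBINT x. LBINT t. F (t, x))" by (simp add: Feq sqr)
 also have "... = (LBINT t. LBINT x. F (t, x))"
  using lborel_pair.Fubini_integral[of "%t x. F (t, x)"] int by simp
 also have "... <= (LBINT t. indicator S t*(2*c t))"
 proof (rule integral_mono)
  show "intg (%t. LBINT x. F (t, x))" using lborel_pair.integrable_fst'[OF int] by simp
  show "intg (%t. indicator S t*(2*c t))"
   using borel_integrable_atLeastAtMost'[OF c2] by (simp add: S_def set_integrable_def)
  show "(LBINT x. F (t, x)) <= indicator S t*(2*c t)" for t
   using hg(1)[of t] by (cases "t \<in> S") (auto simp: Feq)
 qed
 also have "... = integral S (%t. 2*c t)"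
  using set_borel_integral_eq_integral(2)[OF borel_integrable_atLeastAtMost'[OF c2]]
  by (simp only: S_def set_lebesgue_integral_def real_scaleR_def)
 finally show ?thesis by (simp add: g_def)
qed

section \<open>Square integrability of the profile and the spectral inequality on the line\<close>

lemma has_bochner_integral_line:
 fixes f F :: "real => real"
 assumes F: "!!x. DERIV F x :> f x" and c: "cont f" and nn: "!!x. f x >= 0"
  and b: "!!x. abs (F x) <= C"
 shows "intg f"
proof -
 let ?f = "%n x. f x*indicator {-real n..real n} x"
 have i: "intg (?f n)" "(LBINT x. ?f n x) = F (real n) - F (- real n)" for n
  using has_bochner_integral_FTC_Icc[of "-real n" "real n" F f] F continuous_on_subset[OF c]
  by (auto simp: has_bochner_integral_iff mult.commute real_vector_deriv has_vector_derivative_at_within)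
 have "incseq (%n. LBINT x. ?f n x)"
  by (rule incseq_SucI, rule integral_mono[OF i(1) i(1)]) (use nn in "auto simp: indicator_def")
 moreover have "F (real n) - F (- real n) <= 2*C" for n
  using b[of "real n"] b[of "- real n"] by linarith
 hence "ALL n. (LBINT x. ?f n x) <= 2*C" unfolding i(2) by blast
 ultimately obtain L where L: "(%n. LBINT x. ?f n x) ----> L" using incseq_convergent by blast
 show ?thesis
 proof (rule integrable_monotone_convergence[OF i(1) _ _ L])
  show "ae x. mono (%n. ?f n x)"
   using nn by (intro AE_I2 monoI) (auto simp: indicator_def)
  show "ae x. (%n. ?f n x) ----> f x"
  proof (intro AE_I2 tendsto_eventually)
   fix x
   obtain N where "real N >= abs x" using real_arch_simple by blast
   thus "\<forall>\<^sub>F n in sequentially. ?f n x = f x"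
    by (intro eventually_sequentiallyI[of N]) (auto simp: indicator_def)
  qed
 qed (use c in "auto intro: bm_cont")
qed

lemma integral_symmetric_limit:
 fixes f :: "real => real"
 assumes i: "intg f" and c: "cont f"
 shows "(%n. integral {-real n..real n} f) ----> (LBINT x. f x)"
proof -
 have "(%n. LBINT x. f x*indicator {-real n..real n} x) ----> (LBINT x. f x)"
 proof (rule integral_dominated_convergence[where w="%x. norm (f x)"])
  show "ae x. (%n. f x*indicator {-real n..real n} x) ----> f x"
  proof (intro AE_I2 tendsto_eventually)
   fix x
   obtain N where "real N >= abs x" using real_arch_simple by blast
   thus "\<forall>\<^sub>F n in sequentially. f x*indicator {-real n..real n} x = f x"
    by (intro eventually_sequentiallyI[of N]) (auto simp: indicator_def)
  qed
 qed (use i in "auto simp: indicator_def")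
 moreover have "(LBINT x. f x*indicator {-real n..real n} x) = integral {-real n..real n} f" for n
  using set_borel_integral_eq_integral(2)[OF borel_integrable_atLeastAtMost'[OF continuous_on_subset[OF c]], of "-real n" "real n"]
  by (simp add: set_lebesgue_integral_def mult.commute)
 ultimately show ?thesis by simp
qed

lemma bounded_of_limits:
 fixes f :: "real => real"
 assumes c: "cont f" and l: "(f ---> a) at_bot" "(f ---> b) at_top"
 shows "EX C. ALL x. abs (f x) <= C"
proof -
 have "\<forall>\<^sub>F x in at_bot. abs (f x) < abs a + 1" "\<forall>\<^sub>F x in at_top. abs (f x) < abs b + 1"
  using order_tendstoD(2)[OF tendsto_rabs[OF l(1)]] order_tendstoD(2)[OF tendsto_rabs[OF l(2)]] by auto
 then obtain A B where AB: "!!x. x <= A ==> abs (f x) < abs a + 1" "!!x. x >= B ==> abs (f x) < abs b + 1"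
  unfolding eventually_at_bot_linorder eventually_at_top_linorder by auto
 have "bounded (f ` {A..B})"
  by (intro compact_imp_bounded compact_continuous_image continuous_on_subset[OF c]) auto
 then obtain K where K: "!!x. x \<in> {A..B} ==> abs (f x) <= K"
  unfolding bounded_iff by (metis image_eqI real_norm_def)
 have "abs (f x) <= abs K + (abs a + 1) + (abs b + 1)" for x
  using AB(1)[of x] AB(2)[of x] K[of x] by (cases "x <= A"; cases "x >= B") auto
 thus ?thesis by blast
qed

lemma sql_affine:
 assumes "sql f" "c ~= 0" shows "sql (%x. f (c*x + d))" "(nl (%x. f (c*x + d)))^2 = (nl f)^2 / abs c"
 using lborel_integrable_real_affine[of "%x. (f x)^2" c d] lborel_integral_real_affine[of c "%x. (f x)^2" d] assms
 by (auto simp: sqint_def nrm_sq add.commute)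

lemma sql_indicator_mult: "sql f ==> A \<in> sets borel ==> sql (%x. indicator A x*f x)"
 by (rule sqint_bound(1)[of lborel f]) (auto simp: sqint_def indicator_def)

context shock_profile begin

text \<open>\<open>p^2\<close> is the derivative of the energy \<open>E\<close>, which is bounded
  because it has limits at both ends.\<close>

lemma pE: "sql p"
proof -
 have "(E ---> k*0^2 / 2 + (1 - 1)^2*(1 + 2) / 6) at_bot" "(E ---> k*0^2 / 2 + (-1 - 1)^2*(-1 + 2) / 6) at_top"
  unfolding E_def by (intro tendsto_intros v_bot p_bot v_top p_top; simp)+
 moreover have "cont E" by (rule DERIV_cont[OF E'])
 ultimately obtain C where "!!x. abs (E x) <= C" using bounded_of_limits by metis
 hence "intg (%s. (p s)^2)"
  by (intro has_bochner_integral_line[OF E']) (auto intro!: continuous_intros cont)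
 thus ?thesis by (auto simp: sqint_def intro: bm_cont cont)
qed

lemma v_sign: "s <= 0 ==> v s >= 0" "s >= 0 ==> v s <= 0"
proof -
 show "s <= 0 ==> v s >= 0"
  using before_s2(1)[of s] v_anti[of s 0] sm_s2 v0 by (cases "s <= s2"; cases "s = 0") force+
 show "s >= 0 ==> v s <= 0"
  using v_anti[of 0 s] sm_s2 s2(2) v0 by (cases "s = 0") auto
qed

text \<open>Each tail is controlled by a bounded function whose derivative dominates the square. On
  the left \<open>F' = (v - 1)^2*(v + 1)/2\<close> with \<open>v >= 0\<close>; on the right
  \<open>Q = k*p - v\<close> has \<open>Q' = y\<close> and \<open>(v + 1)^2 <= 2*y\<close>, because
  \<open>v <= 0\<close> there.\<close>

lemma v_tail: "sql (%s. v s - (if s < 0 then 1 else -1))"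
proof -
 have cE: "cont E" by (rule DERIV_cont[OF E'])
 define F where "F s = (v s - 1)^2 / 2 - k*(v s - 1)*p s + k*E s" for s
 have F': "DERIV F s :> (v s - 1)^2*(v s + 1) / 2" for s
 proof -
  define P where "P = (p s + y s) / k"
  have P: "DERIV p s :> P" "k*P = p s + y s" using p'y[of s] k by (auto simp: P_def)
  have "DERIV F s :> (v s - 1)*p s - (k*p s * p s + (v s - 1)*(k*P)) + k*(p s)^2"
   unfolding F_def by (auto intro!: derivative_eq_intros v' P(1) E' simp: field_simps power2_eq_square)
  also have "(v s - 1)*p s - (k*p s * p s + (v s - 1)*(k*P)) + k*(p s)^2 = (v s - 1)^2*(v s + 1) / 2"
   unfolding P(2) y_def by (simp add: field_simps power2_eq_square)
  finally show ?thesis .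
 qed
 have Fb: "EX C. ALL x. abs (F x) <= C"
 proof (rule bounded_of_limits)
  show "cont F" by (rule DERIV_cont[OF F'])
  show "(F ---> (1-1)^2/2 - k*(1-1)*0 + k*(k*0^2 / 2 + (1 - 1)^2*(1 + 2) / 6)) at_bot"
   unfolding F_def E_def by (intro tendsto_intros v_bot p_bot; simp)
  show "(F ---> (-1-1)^2/2 - k*(-1-1)*0 + k*(k*0^2 / 2 + (-1 - 1)^2*(-1 + 2) / 6)) at_top"
   unfolding F_def E_def by (intro tendsto_intros v_top p_top; simp)
 qed
 from Fb obtain C where C: "!!x. abs (F x) <= C" by blast
 have 1: "intg (%s. (v s - 1)^2*(v s + 1) / 2)"
 proof (rule has_bochner_integral_line[OF F' _ _ C])
  show "cont (%x. (v x - 1)^2*(v x + 1) / 2)" by (intro continuous_intros cont) simp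
  show "0 <= (v x - 1)^2*(v x + 1) / 2" for x using less_imp_le[OF v_gt[of x]] by simp
 qed
 define w where "w s = v s - (if s < 0 then 1 else -1)" for s
 have [measurable]: "bm v" "bm p" by (auto intro: bm_cont cont)
 have wm [measurable]: "bm w" unfolding w_def by measurable
 have L: "intg (%s. indicator {..<0} s * (w s)^2)"
 proof (rule int_bound[OF integrable_mult_right[OF 1, of 2]])
  show "ae s. norm (indicator {..<0} s * (w s)^2) <= norm (2*((v s - 1)^2*(v s + 1) / 2))"
  proof (rule AE_I2)
   fix s
   show "norm (indicator {..<0} s * (w s)^2) <= norm (2*((v s - 1)^2*(v s + 1) / 2))"
   proof (cases "s < 0")
    case True
    have "(v s - 1)^2*1 <= (v s - 1)^2*(v s + 1)" using v_sign(1)[of s] True by (intro mult_left_mono) auto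
    thus ?thesis using True by (simp add: w_def)
   qed simp
  qed
 qed measurable
 have R: "intg (%s. indicator {0..} s * (w s)^2)"
 proof -
  define Q where "Q s = k*p s - v s" for s
  have Q': "DERIV Q s :> y s" for s
   unfolding Q_def by (auto intro!: derivative_eq_intros p'y v') (use k in simp)
  have yn: "0 <= y s" if "0 <= s" for s using y_pos[of s] v_sign(2)[OF that] by simp
  have "(\<integral>\<^sup>+x. ennreal (y x)*indicator {0..} x \<partial>lborel) = (k*0 - (-1)) - Q 0"
  proof (rule nn_integral_FTC_atLeast[OF _ Q' yn])
   show "(Q ---> k*0 - (-1)) at_top" unfolding Q_def by (intro tendsto_intros v_top p_top)
  qed (auto intro: bm_cont cont)
  moreover have "(\<integral>\<^sup>+x. ennreal (y x)*indicator {0..} x \<partial>lborel) = (\<integral>\<^sup>+x. ennreal (indicator {0..} x*y x) \<partial>lborel)"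
   by (intro nn_integral_cong) (auto simp: indicator_def)
  ultimately have "(\<integral>\<^sup>+x. ennreal (indicator {0..} x*y x) \<partial>lborel) = ennreal ((k*0 - (-1)) - Q 0)" by simp
  note nn = this
  have [measurable]: "bm y" by (intro bm_cont cont)
  have "intg (%x. indicator {0..} x*y x)"
  proof (rule integrableI_nn_integral_finite[OF _ _ nn])
   show "ae x. 0 <= indicator {0..} x*y x" using yn by (intro AE_I2) (simp add: indicator_def)
  qed measurable
  hence 2: "set_integrable lborel {0..} y" by (simp only: set_integrable_def real_scaleR_def)
  show ?thesis
  proof (rule int_bound[OF integrable_mult_right[OF 2[unfolded set_integrable_def], of 2]])
   show "ae s. norm (indicator {0..} s * (w s)^2) <= norm (2*(indicator {0..} s *\<^sub>R y s))"
   proof (rule AE_I2)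
    fix s
    show "norm (indicator {0..} s * (w s)^2) <= norm (2*(indicator {0..} s *\<^sub>R y s))"
    proof (cases "s >= 0")
     case True
     have "(v s + 1)*(v s + 1) <= (v s + 1)*(1 - v s)"
      using v_sign(2)[OF True] v_gt[of s] by (intro mult_left_mono) auto
     moreover have "0 <= y s" by (rule yn[OF True])
     moreover have "norm (indicator {0..} s * (w s)^2) = (v s + 1)*(v s + 1)" using True by (simp add: w_def power2_eq_square)
     moreover have "(v s + 1)*(1 - v s) = 2*y s" by (simp add: y_def power2_eq_square field_simps)
     ultimately show ?thesis using True by simp
    qed simp
   qed
  qed measurable
 qed
 have "(w s)^2 = indicator {..<0} s * (w s)^2 + indicator {0..} s * (w s)^2" for s by (auto simp: indicator_def)
 hence "intg (%s. (w s)^2)" using Bochner_Integration.integrable_add[OF L R] by simp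
 thus ?thesis using wm by (simp add: sqint_def w_def[abs_def])
qed

lemma v_bounded: "EX C. ALL s. abs (v s) <= C" by (rule bounded_of_limits[OF cont(1) v_bot v_top])
lemma p_bounded: "EX C. ALL s. abs (p s) <= C" by (rule bounded_of_limits[OF cont(2) p_bot p_top])

lemma y_sq: "sql y"
proof -
 obtain C where C: "!!s. abs (v s) <= C" using v_bounded by blast
 show ?thesis
 proof (rule sqint_bound(1)[OF sqint_cmult[OF v_tail, of "C + 1"]])
  show "ae s. abs (y s) <= abs ((C + 1)*(v s - (if s < 0 then 1 else -1)))"
  proof (rule AE_I2)
   fix s
   have y: "y s = (1 - v s)*(1 + v s) / 2" by (simp add: y_def power2_eq_square field_simps)
   have b: "abs (1 + v s) / 2 <= C + 1" "abs (1 - v s) / 2 <= C + 1" "C >= 0" using C[of s] by (auto simp: abs_le_iff)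
   show "abs (y s) <= abs ((C + 1)*(v s - (if s < 0 then 1 else -1)))"
   proof (cases "s < 0")
    case True
    have "abs (y s) = abs (1 - v s)*(abs (1 + v s) / 2)" by (simp add: y abs_mult)
    also have "... <= abs (1 - v s)*(C + 1)" by (rule mult_left_mono[OF b(1)]) simp
    finally show ?thesis using True b(3) by (simp add: abs_mult abs_minus_commute mult.commute)
   next
    case False
    have "abs (y s) = abs (1 + v s)*(abs (1 - v s) / 2)" by (simp add: y abs_mult)
    also have "... <= abs (1 + v s)*(C + 1)" by (rule mult_left_mono[OF b(2)]) simp
    finally show ?thesis using False b(3) by (simp add: abs_mult add.commute mult.commute)
   qed
  qed
 qed (auto intro: bm_cont cont)
qed

lemma spectral_line:
 assumes W: "!!s. DERIV W s :> W' s" "cont W'" "sql W" "sql W'"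
 shows "(nl W')^2 + (LBINT s. p s * (W s)^2) / 2 + (LBINT s. p s * W s)^2 / 4 >= 0"
proof -
 have bd: "abs (W s) <= nl W + nl W'" for s by (rule H1_sup[OF C1_H1[OF W]])
 have cW: "cont W" by (rule DERIV_cont[OF W(1)])
 obtain C where C: "!!s. abs (p s) <= C" using p_bounded by blast
 have pW2: "intg (%s. p s * (W s)^2)"
 proof (rule int_bound[of lborel "%s. C*(W s)^2"])
  show "ae s. norm (p s * (W s)^2) <= norm (C*(W s)^2)"
   using order_trans[OF C abs_ge_self] by (intro AE_I2) (auto simp: abs_mult intro!: mult_right_mono)
  have "bm p" by (intro bm_cont cont)
  thus "(%s. p s * (W s)^2) \<in> borel_measurable lborel" using W(3) by (auto simp: sqint_def)
 qed (use W(3) in "auto simp: sqint_def")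
 have i1: "intg (%s. (W' s)^2 + p s * (W s)^2 / 2)" using pW2 W(4) by (simp add: sqint_def)
 have "(LBINT s. (W' s)^2 + p s * (W s)^2 / 2) + (LBINT s. p s * W s)^2 / 4 >= 0"
  by (rule spectral_inequality[OF W(1,2) bd]; rule integral_symmetric_limit)
   (use i1 sqint_mult[OF pE W(3)] W(2) cW in "auto intro!: continuous_intros cont")
 thus ?thesis using pW2 W(4) by (simp add: sqint_def nrm_sq)
qed

end

section \<open>The shock in the original variables\<close>

locale shock_wave =
 fixes eps delta um up sgm M :: real and ut u1 u2 ul ul1 :: "real => real"
 assumes eps: "eps > 0" and delta: "delta > 0" and um_up: "um > up"
  and k_range: "1/4 < delta*(um - up) / (2*eps^2)" "delta*(um - up) / (2*eps^2) < 1/2"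
  and sgm: "sgm = (um + up) / 2" and M: "M >= 4/3"
  and ut': "!!x. DERIV ut x :> u1 x"
  and u1': "!!x. DERIV u1 x :> u2 x"
  and ode: "!!x. delta*u2 x = eps * u1 x - (ut x - um)*(ut x - up) / 2"
  and ut_lim: "(ut ---> um) at_bot" "(ut ---> up) at_top"
  and u1_lim: "(u1 ---> 0) at_bot" "(u1 ---> 0) at_top"
  and ut0: "ut 0 = sgm" and rise: "EX x. u1 x > 0"
  and ul': "!!x. DERIV ul x :> ul1 x" "cont ul1" "sql ul1"
   "sql (%x. ul x - es um up x)"

text \<open>The ratio \<open>delta*(um - up)/(2*eps^2)\<close> is invariant under the scaling, so
  everything proved in the locale holds at scale \<open>nu\<close> as well, with the same
  \<open>rate\<close>, which involves only \<open>um\<close>, \<open>up\<close> and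
  \<open>M\<close>.\<close>

lemma shock_wave_scale:
 assumes "shock_wave eps delta um up sgm M ut u1 u2 ul ul1" and n: "nu > 0"
 shows "shock_wave (nu*eps) (nu^2*delta) um up sgm M (%x. ut (x / nu)) (%x. u1 (x / nu) / nu) (%x. u2 (x / nu) / nu^2) ul ul1"
proof -
 interpret shock_wave eps delta um up sgm M ut u1 u2 ul ul1 by fact
 have k: "nu^2*delta*(um - up) / (2*(nu*eps)^2) = delta*(um - up) / (2*eps^2)"
  using n mult_divide_mult_cancel_left[of "nu^2" "delta*(um - up)" "2*eps^2"] by (simp add: power_mult_distrib ac_simps)
 have d: "DERIV (%x. x / nu) x :> 1 / nu" for x
  using n by (auto intro!: derivative_eq_intros)
 have lim: "filterlim (%x. x / nu) at_bot at_bot" "filterlim (%x. x / nu) at_top at_top"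
  using n by (auto intro!: filterlim_tendsto_pos_mult_at_bot[OF tendsto_const, of "1/nu", simplified] filterlim_tendsto_pos_mult_at_top[OF tendsto_const, of "1/nu", simplified] filterlim_ident)
 obtain x0 where "u1 x0 > 0" using rise by blast
 hence osc': "EX x. u1 (x / nu) / nu > 0" using n by (intro exI[of _ "x0*nu"]) simp
 show ?thesis
 proof (unfold_locales, unfold k)
  fix x
  show "DERIV (%x. ut (x / nu)) x :> u1 (x / nu) / nu"
   using DERIV_chain2[OF ut' d] by simp
  show "DERIV (%x. u1 (x / nu) / nu) x :> u2 (x / nu) / nu^2"
   using DERIV_cdivide[OF DERIV_chain2[OF u1' d]] by (simp add: power2_eq_square)
  show "nu^2*delta*(u2 (x / nu) / nu^2) = nu*eps * (u1 (x / nu) / nu) - (ut (x / nu) - um)*(ut (x / nu) - up) / 2"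
   using ode[of "x / nu"] n by (simp add: field_simps)
 next
  show "((%x. u1 (x / nu) / nu) ---> 0) at_bot" "((%x. u1 (x / nu) / nu) ---> 0) at_top"
   using tendsto_divide[OF filterlim_compose[OF u1_lim(1) lim(1)] tendsto_const[of nu]]
    tendsto_divide[OF filterlim_compose[OF u1_lim(2) lim(2)] tendsto_const[of nu]] n by auto
  show "((%x. ut (x / nu)) ---> um) at_bot" "((%x. ut (x / nu)) ---> up) at_top"
   by (rule filterlim_compose[OF ut_lim(1) lim(1)], rule filterlim_compose[OF ut_lim(2) lim(2)])
 qed (use eps delta n um_up k_range sgm M ut0 osc' ul' in auto)
qed

lemma sql_profile_diff:
 assumes "reference_profile um up ul"
 shows "sql (%x. ul x - es um up x)" "sql (deriv ul)"
proof -
 have s: "smooth ul" and o: "x <= -1 ==> ul x = um" "x >= 1 ==> ul x = up" for x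
  using assms by (auto simp: reference_profile_def)
 have c: "cont ul" "cont (deriv ul)"
  using s smooth_realD(2)[OF s] by (auto intro: smooth_imp_continuous_on)
 have *: "sql f" if m: "bm f" and z: "!!x. x \<notin> {-1..1} ==> f x = 0"
  and b: "!!x. x \<in> {-1..1} ==> abs (f x) <= K" for f K
 proof (rule sqint_bound(1)[OF sqint_cmult[OF sql_indicator(1), of "-1" 1 K]])
  show "ae x. abs (f x) <= abs (K*indicator {-1..1} x)"
   using b z by (intro AE_I2) (force simp: indicator_def)
 qed (use m in auto)
 have B: "EX K. \<forall>x\<in>{-1..1}. abs (f x) <= K" if "cont f" for f :: "real => real"
  using compact_imp_bounded[OF compact_continuous_image[OF continuous_on_subset[OF that]], of "{-1..1}"]
  unfolding bounded_iff by force
 obtain K1 K2 where K: "\<forall>x\<in>{-1..1}. abs (ul x) <= K1" "\<forall>x\<in>{-1..1}. abs (deriv ul x) <= K2" using B[OF c(1)] B[OF c(2)] by blast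
 show "sql (%x. ul x - es um up x)"
 proof (rule *)
  have [measurable]: "bm ul" using c by (auto intro: bm_cont)
  show "bm (%x. ul x - es um up x)" unfolding entropy_shock_def by measurable
  show "abs (ul x - es um up x) <= K1 + abs um + abs up" if "x \<in> {-1..1}" for x
   using K(1)[rule_format, OF that] by (auto simp: entropy_shock_def)
 qed (use o in "auto simp: entropy_shock_def")
 show "sql (deriv ul)"
 proof (rule *)
  show "deriv ul x = 0" if "x \<notin> {-1..1}" for x
  proof -
   have "x < -1 | x > 1" using that by auto
   hence "DERIV ul x :> 0"
   proof
    assume "x < -1"
    thus ?thesis
     by (intro has_field_derivative_transform_within_open[OF DERIV_const, of "{..<-1}"]) (auto simp: o)
   next
    assume "x > 1"
    thus ?thesis
     by (intro has_field_derivative_transform_within_open[OF DERIV_const, of "{1<..}"]) (auto simp: o)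
   qed
   thus ?thesis by (rule DERIV_imp_deriv)
  qed
  show "abs (deriv ul x) <= K2" if "x \<in> {-1..1}" for x using K(2) that by blast
 qed (use c in "auto intro: bm_cont")
qed

text \<open>The mean value theorem on \<open>{n..n+1}\<close> finds points tending to infinity at
  which \<open>g\<close> equals an increment of \<open>f\<close>, and these increments tend to
  0.\<close>

lemma deriv_limit_zero:
 fixes f :: "real => real"
 assumes f: "!!x. DERIV f x :> g x" and l: "(f ---> a) at_top" "(g ---> L) at_top"
 shows "L = 0"
proof -
 have "EX z>real n. f (real n + 1) - f (real n) = g z" for n
  using MVT2[of "real n" "real n + 1" f g] f by force
 then obtain z where z: "!!n. z n > real n" "!!n. f (real n + 1) - f (real n) = g (z n)" by metis
 have s: "filterlim (%n. real n) at_top sequentially" by (rule filterlim_real_sequentially)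
 have s1: "filterlim (%n. real n + 1) at_top sequentially"
  by (rule filterlim_at_top_mono[OF s]) auto
 have sz: "filterlim z at_top sequentially"
  by (rule filterlim_at_top_mono[OF s]) (auto intro!: always_eventually less_imp_le z(1))
 have "(%n. f (real n + 1) - f (real n)) ----> a - a"
  by (intro tendsto_diff filterlim_compose[OF l(1) s1] filterlim_compose[OF l(1) s])
 moreover have "(%n. f (real n + 1) - f (real n)) ----> L"
  unfolding z(2) by (rule filterlim_compose[OF l(2) sz])
 ultimately show ?thesis using LIMSEQ_unique by fastforce
qed

text \<open>The third-order equation is integrated once: \<open>Q\<close> is constant. Expressed
  through \<open>Q 0\<close>, the second derivative has a limit at infinity, which must be 0 since
  the first derivative converges; this fixes \<open>Q 0 = -(um*up)/2\<close>.\<close>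

lemma shock_wave_of_shock:
 assumes eps: "eps > 0" and delta: "delta > 0" and um_up: "um > up"
  and k: "1/4 < delta*(um - up) / (2*eps^2)" "delta*(um - up) / (2*eps^2) < 1/2"
  and sgm: "sgm = (um + up) / 2"
  and v: "viscous_dispersive_shock eps delta sgm um up ut"
  and anti: "~ antimono ut" and u0: "ut 0 = (um + up) / 2"
  and ref: "reference_profile um up ul" and M: "M >= 4/3"
 shows "shock_wave eps delta um up sgm M ut (deriv ut) ((deriv ^^ 2) ut) ul (deriv ul)"
proof -
 let ?D = "%n. (deriv ^^ n) ut"
 have s: "smooth ut" and eq: "!!x. - sgm*deriv ut x + deriv (%y. (ut y)^2 / 2) x = eps * ?D 2 x - delta*?D 3 x"
  and lim: "(ut ---> um) at_bot" "(ut ---> up) at_top" "(deriv ut ---> 0) at_bot" "(deriv ut ---> 0) at_top"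
  using v by (auto simp: viscous_dispersive_shock_def)
 have D1: "DERIV ut x :> deriv ut x" and D2: "DERIV (deriv ut) x :> ?D 2 x"
  and D3: "DERIV (?D 2) x :> ?D 3 x" for x
  using smooth_deriv_n_has_derivative[OF s, of 0] smooth_deriv_n_has_derivative[OF s, of 1] smooth_deriv_n_has_derivative[OF s, of 2]
  by (auto simp: numeral_eq_Suc)
 define Q where "Q x = delta*?D 2 x - eps * deriv ut x + (ut x)^2 / 2 - sgm*ut x" for x
 have sq: "DERIV (%y. (ut y)^2 / 2) x :> ut x*deriv ut x" for x
  by (auto intro!: derivative_eq_intros D1)
 have "DERIV Q x :> 0" for x
 proof -
  have "DERIV Q x :> delta*?D 3 x - eps * ?D 2 x + ut x*deriv ut x - sgm*deriv ut x"
   unfolding Q_def by (intro derivative_intros DERIV_cmult D1 D2 D3 sq)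
  moreover have "delta*?D 3 x - eps * ?D 2 x + ut x*deriv ut x - sgm*deriv ut x = 0"
   using eq[of x] DERIV_imp_deriv[OF sq] by simp
  ultimately show ?thesis by (simp only:)
 qed
 hence Q: "Q x = Q 0" for x by (intro DERIV_isconst_all) auto
 have D2e: "?D 2 x = (Q 0 + eps * deriv ut x - (ut x)^2 / 2 + sgm*ut x) / delta" for x
  using Q[of x] delta by (simp add: Q_def field_simps)
 have "(?D 2 ---> (Q 0 + eps * 0 - up^2 / 2 + sgm*up) / delta) at_top"
  unfolding D2e by (intro tendsto_intros lim) (use delta in auto)
 from deriv_limit_zero[OF D2 lim(4) this] delta have "Q 0 = - (um*up) / 2"
  unfolding sgm by (simp add: field_simps power2_eq_square)
 hence ode: "delta*?D 2 x = eps * deriv ut x - (ut x - um)*(ut x - up) / 2" for x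
  using D2e[of x] delta unfolding sgm by (simp add: field_simps power2_eq_square)
 have osc: "EX x. deriv ut x > 0"
 proof (rule ccontr)
  assume "~ ?thesis"
  hence "deriv ut x <= 0" for x by (simp add: not_less)
  hence "ut y <= ut x" if "x <= y" for x y
   using deriv_nonpos_imp_antimono[OF D1, of x y] that by auto
  thus False using anti by (auto simp: monotone_def)
 qed
 have sl: "smooth ul" using ref by (simp add: reference_profile_def)
 show ?thesis
  by unfold_locales (use eps delta um_up k sgm M D1 D2 ode lim u0 osc sql_profile_diff[OF ref] smooth_realD[OF sl]
   smooth_imp_continuous_on[OF smooth_realD(2)[OF sl]] in auto)
qed

context shock_wave begin

definition "amp = (um - up) / 2"

lemma amp: "amp > 0" "um - sgm = amp" "up - sgm = - amp" using um_up sgm by (auto simp: amp_def field_simps)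

lemma char_product: "(x - um)*(x - up) = (x - sgm)^2 - amp^2" unfolding sgm amp_def by (simp add: power2_eq_square field_simps)

text \<open>Amplitude \<open>amp\<close> and length \<open>eps/amp\<close> as units reduce the
  equation to the normal form, with the dimensionless number of the hypotheses as
  \<open>k\<close>.\<close>

sublocale sp: shock_profile "delta*(um - up) / (2*eps^2)" "%s. (ut (eps / amp * s) - sgm) / amp" "%s. eps / amp^2*u1 (eps / amp * s)"
proof
 note p = eps delta amp(1)
 define c where "c = eps / amp"
 have c: "c > 0" using p by (simp add: c_def)
 have d: "DERIV (%s. c * s) s :> c" for s by (auto intro!: derivative_eq_intros)
 have lim: "filterlim (%s. c * s) at_bot at_bot" "filterlim (%s. c * s) at_top at_top"
  using c by (auto intro!: filterlim_tendsto_pos_mult_at_bot[OF tendsto_const] filterlim_tendsto_pos_mult_at_top[OF tendsto_const] filterlim_ident)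
 fix s
 show "DERIV (%s. (ut (eps / amp * s) - sgm) / amp) s :> eps / amp^2*u1 (eps / amp * s)"
  using DERIV_cdivide[OF DERIV_diff[OF DERIV_chain2[OF ut' d[of s]] DERIV_const[of sgm]], of amp]
  by (simp add: c_def power2_eq_square mult.commute)
 have "DERIV (%s. eps / amp^2*u1 (c * s)) s :> eps / amp^2*(u2 (c * s)*c)"
  by (rule DERIV_cmult[OF DERIV_chain2[OF u1' d]])
 moreover have "eps / amp^2*(u2 (c * s)*c) =
  (eps / amp^2*u1 (c * s) + (1 - ((ut (c * s) - sgm) / amp)^2) / 2) / (delta*(um - up) / (2*eps^2))"
 proof -
  have u2: "u2 (c * s) = (eps * u1 (c * s) - (ut (c * s) - um)*(ut (c * s) - up) / 2) / delta"
   using ode[of "c * s"] delta by (simp add: field_simps)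
  have J: "um - up = 2*amp" by (simp add: amp_def)
  show ?thesis unfolding u2 J char_product c_def[symmetric] using p by (simp add: c_def field_simps power2_eq_square)
 qed
 ultimately show "((%s. eps / amp^2*u1 (eps / amp * s)) has_real_derivative
  (eps / amp^2*u1 (eps / amp * s) + (1 - ((ut (eps / amp * s) - sgm) / amp)^2) / 2) / (delta*(um - up) / (2*eps^2))) (at s)"
  by (simp add: c_def)
 have e: "1 = (um - sgm) / amp" "-1 = (up - sgm) / amp" "0 = eps / amp^2*(0::real)" using p by (auto simp: amp(2,3))
 show "((%s. (ut (eps / amp * s) - sgm) / amp) ---> 1) at_bot" "((%s. (ut (eps / amp * s) - sgm) / amp) ---> -1) at_top"
  "((%s. eps / amp^2*u1 (eps / amp * s)) ---> 0) at_bot" "((%s. eps / amp^2*u1 (eps / amp * s)) ---> 0) at_top"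
  unfolding c_def[symmetric] using p
  by (subst e; intro tendsto_divide tendsto_diff tendsto_mult tendsto_const
   filterlim_compose[OF ut_lim(1) lim(1)] filterlim_compose[OF ut_lim(2) lim(2)]
   filterlim_compose[OF u1_lim(1) lim(1)] filterlim_compose[OF u1_lim(2) lim(2)]; simp)+
 obtain x where "u1 x > 0" using rise by blast
 thus "EX s. 0 < eps / amp^2*u1 (eps / amp * s)" using p by (intro exI[of _ "x*amp / eps"]) simp
qed (use k_range ut0 in auto)

lemma ut_scaled: "ut x = sgm + amp*((ut (eps / amp*(amp / eps * x)) - sgm) / amp)"
 "u1 x = amp^2 / eps * (eps / amp^2*u1 (eps / amp*(amp / eps * x)))"
 using eps amp(1) by auto

lemma u2_eq: "u2 x = (eps * u1 x - (ut x - um)*(ut x - up) / 2) / delta"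
 using ode[of x] delta by (simp add: field_simps)

lemma ut_cont: "cont ut" "cont u1" "cont u2"
proof -
 show 1: "cont ut" "cont u1"
  using ut' u1' by (meson DERIV_isCont continuous_at_imp_continuous_on)+
 show "cont u2" unfolding u2_eq[abs_def] by (intro continuous_intros 1) (use delta in auto)
qed

lemma ut_meas [measurable]: "bm ut" "bm u1" "bm u2"
 using ut_cont by (auto intro: bm_cont)

lemma ut_bounded: "EX C>0. ALL x. abs (ut x) <= C & abs (u1 x) <= C"
proof -
 obtain a where a: "!!x. abs (ut x) <= a" using bounded_of_limits[OF ut_cont(1) ut_lim] by blast
 obtain b where b: "!!x. abs (u1 x) <= b" using bounded_of_limits[OF ut_cont(2) u1_lim] by blast
 have "abs (ut x) <= max a b + 1 & abs (u1 x) <= max a b + 1" for x using a[of x] b[of x] by linarith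
 moreover have "max a b + 1 > 0" using a[of 0] by linarith
 ultimately show ?thesis by blast
qed

lemma ut_sq: "sql u1" "sql u2" "sql (%x. ut x - es um up x)"
proof -
 have c: "amp / eps > 0" "amp / eps ~= 0" using amp(1) eps by auto
 show 1: "sql u1"
  using sqint_cmult[OF sql_affine(1)[OF sp.pE c(2), of 0], of "amp^2 / eps"] unfolding add_0_right ut_scaled(2)[symmetric] .
 have "sql (%x. (ut x - um)*(ut x - up) / 2)"
 proof -
  have y: "amp^2*(-1) * sp.y (amp / eps * x) = (ut x - um)*(ut x - up) / 2" for x
  proof -
   define w where "w = (ut x - sgm) / amp"
   have u: "ut x = sgm + amp*w" and "eps / amp*(amp / eps * x) = x" using amp(1) eps by (auto simp: w_def)
   hence "sp.y (amp / eps * x) = (1 - w^2) / 2" unfolding sp.y_def w_def by (simp only:)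
   moreover have "amp^2*(-1)*((1 - w^2) / 2) = (ut x - um)*(ut x - up) / 2"
    unfolding char_product u by (simp add: power2_eq_square field_simps)
   ultimately show ?thesis by (simp only:)
  qed
  show ?thesis
   using sqint_cmult[OF sql_affine(1)[OF sp.y_sq c(2), of 0], of "amp^2*(-1)"] unfolding add_0_right y .
 qed
 from sqint_cmult[OF sqint_diff[OF sqint_cmult[OF 1, of eps] this], of "1 / delta"]
 show "sql u2" unfolding u2_eq[abs_def] by simp
 have t: "amp*((ut (eps / amp*(amp / eps * x)) - sgm) / amp - (if amp / eps * x < 0 then 1 else -1)) = ut x - es um up x" for x
 proof -
  have "amp / eps * x < 0 \<longleftrightarrow> x < 0" using mult_less_cancel_left_pos[OF c(1), of x 0] by (simp only: mult_zero_right)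
  moreover have "um = sgm + amp" "up = sgm - amp" using amp(2,3) by linarith+
  ultimately show ?thesis using amp(1) eps by (auto simp: entropy_shock_def right_diff_distrib diff_divide_distrib)
 qed
 show "sql (%x. ut x - es um up x)"
  using sqint_cmult[OF sql_affine(1)[OF sp.v_tail c(2), of 0], of amp] unfolding add_0_right t .
qed

text \<open>The normalised inequality with the scaling undone; \<open>d\<close> is the displacement
  of the profile. The factor 1/4 of the rank-one term turns into \<open>1/(4*amp)\<close>, which is
  \<open>1/(2*(um - up))\<close>.\<close>

lemma spectral:
 assumes W: "!!s. DERIV W s :> W' s" "cont W'" "sql W" "sql W'"
 shows "- eps * (nl W')^2 - (LBINT x. u1 (x + d)*(W x)^2) / 2 <= (LBINT x. u1 (x + d)*W x)^2 / (2*(um - up))"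
proof -
 define c where "c = eps / amp"
 have c: "c > 0" using eps amp(1) by (simp add: c_def)
 define V where "V s = W (c * s + (- d))" for s
 have d: "DERIV (%s. c * s + (- d)) s :> c" for s by (auto intro!: derivative_eq_intros)
 have V: "DERIV V s :> c*W' (c * s + (- d))" for s
  unfolding V_def mult.commute[of c "W' _"] by (rule DERIV_chain2[OF W(1) d])
 have s: "sql V" "sql (%s. c*W' (c * s + (- d)))" unfolding V_def
  using c by (intro sql_affine(1) sqint_cmult W; simp)+
 have aff: "(LBINT s. f (c * s + (- d))) = (LBINT x. f x) / c" for f :: "real => real"
  using lborel_integral_real_affine[of c f "- d"] c by (simp add: add.commute)
 have p: "eps / amp^2*u1 (eps / amp * s)*w = eps / amp^2*(u1 ((c * s + (- d)) + d)*w)" for s w by (simp add: c_def)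
 have "cont (%s. c*W' (c * s + (- d)))"
  by (intro continuous_intros continuous_on_compose2[OF W(2)]) auto
 from sp.spectral_line[OF V this s]
 have "c^2*((nl W')^2 / c) + eps / amp^2*((LBINT x. u1 (x + d)*(W x)^2) / c) / 2
   + (eps / amp^2*((LBINT x. u1 (x + d)*W x) / c))^2 / 4 >= 0"
  using sql_affine(2)[OF W(4), of c "- d"] c
   aff[of "%x. u1 (x + d)*(W x)^2"] aff[of "%x. u1 (x + d)*W x"]
  unfolding V_def p by (simp add: nrm_cmult power_mult_distrib mult.commute[of "amp^2" c])
 moreover have "eps / amp^2*(I / c) = I / amp" for I using eps amp(1) by (simp add: c_def power2_eq_square)
 moreover have "c^2*((nl W')^2 / c) = eps * (nl W')^2 / amp" using c by (simp add: c_def power2_eq_square)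
 ultimately have "eps * (nl W')^2 / amp + (LBINT x. u1 (x + d)*(W x)^2) / amp / 2 + ((LBINT x. u1 (x + d)*W x) / amp)^2 / 4 >= 0"
  by (simp only:)
 note ge = mult_nonneg_nonneg[OF less_imp_le[OF amp(1)] this]
 have "amp*(x / amp + y / amp / 2 + (z / amp)^2 / 4) = x + y / 2 + z^2 / (4*amp)" for x y z
  using amp(1) by (simp add: field_simps power2_eq_square)
 from ge[unfolded this]
 have "eps * (nl W')^2 + (LBINT x. u1 (x + d)*(W x)^2) / 2 + (LBINT x. u1 (x + d)*W x)^2 / (4*amp) >= 0" .
 moreover have e: "4*amp = 2*(um - up)" by (simp add: amp_def)
 ultimately show ?thesis unfolding e by linarith
qed

lemma ul_cont: "cont ul" by (rule DERIV_cont[OF ul'(1)])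

lemma H1_ut: "H1 (%x. ut x - ul x) (%x. u1 x - ul1 x)"
proof (rule C1_H1)
 show "DERIV (%x. ut x - ul x) x :> u1 x - ul1 x" for x by (intro derivative_intros ut' ul')
 show "cont (%x. u1 x - ul1 x)" by (intro continuous_intros ut_cont ul')
 show "sql (%x. ut x - ul x)" using sqint_diff[OF ut_sq(3) ul'(4)] by simp
 show "sql (%x. u1 x - ul1 x)" by (rule sqint_diff[OF ut_sq(1) ul'(3)])
qed

end

section \<open>Norms along trajectories, and uniqueness\<close>

lemma osc_derivative:
 assumes f: "!!x. DERIV f x :> D x" and D: "cont D" "sql D" and xy: "abs (x - y) <= e" "e > 0"
 shows "abs (f y - f x) <= osc e D x"
proof -
 have i: "intg (%s. abs (D s)*indicator {x - e..x + e} s)" by (rule integrable_abs_indicator[OF D(2)])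
 have *: "abs (f b - f a) <= (LBINT s. abs (D s)*indicator {x - e..x + e} s)"
  if "a <= b" "x - e <= a" "b <= x + e" for a b
 proof -
  have I: "has_bochner_integral lborel (%s. indicator {a..b} s *\<^sub>R D s) (f b - f a)"
   using has_bochner_integral_FTC_Icc[of a b f D] that f continuous_on_subset[OF D(1)]
   by (auto simp: real_vector_deriv has_vector_derivative_at_within)
  have "abs (f b - f a) <= (LBINT s. norm (indicator {a..b} s *\<^sub>R D s))"
   using integral_norm_bound[of lborel "%s. indicator {a..b} s *\<^sub>R D s"] I unfolding has_bochner_integral_iff by (metis real_norm_def)
  also have "... <= (LBINT s. abs (D s)*indicator {x - e..x + e} s)"
   using I i that by (intro integral_mono) (auto simp: has_bochner_integral_iff indicator_def)
  finally show ?thesis .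
 qed
 have "osc e D x = (LBINT s. abs (D s)*indicator {x - e..x + e} s)"
  unfolding osc_def conv_def by (intro int_cong refl) (auto simp: indicator_def)
 moreover have "abs (f y - f x) <= (LBINT s. abs (D s)*indicator {x - e..x + e} s)"
  using *[of x y] *[of y x] xy by (cases "x <= y") auto
 ultimately show ?thesis by simp
qed

lemma sql_bounded_mult:
 assumes g: "sql g" and b: "bm b" "!!x. abs (b x) <= C"
 shows "sql (%x. b x*g x)" "nl (%x. b x*g x) <= C*nl g"
proof -
 have C: "C >= 0" using b(2)[of 0] by linarith
 have m: "(%x. b x*g x) \<in> borel_measurable lborel" using b(1) sqint_measurable[OF g] by simp
 have *: "ae x. abs (b x*g x) <= abs (C*g x)"
  using b(2) C by (intro AE_I2) (auto simp: abs_mult intro!: mult_right_mono)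
 show "sql (%x. b x*g x)" "nl (%x. b x*g x) <= C*nl g"
  using sqint_bound[OF sqint_cmult[OF g] m *] C by (auto simp: nrm_cmult)
qed

lemma moll_young:
 assumes e: "e > 0" and f: "sql f"
 shows "sql (conv f (moll e))" "nl (conv f (moll e)) <= nl f"
proof -
 have k: "kernel e (moll e)" using moll_kernel(1)[OF e, of 0] by simp
 have "(LBINT x. abs (moll e x)) = 1" using moll(1)[OF e] moll_integral[OF e] by simp
 thus "sql (conv f (moll e))" "nl (conv f (moll e)) <= nl f" using young[OF f k] by auto
qed

lemma moll_nl_tendsto:
 assumes H: "H1 Z D"
 shows "((%e. (nl (conv Z (moll e)))^2) ---> (nl Z)^2) (at_right 0)"
proof -
 have "((%e. nl (conv Z (moll e)) - nl Z) ---> 0) (at_right 0)"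
 proof (rule Lim_null_comparison)
  show "\<forall>\<^sub>F e in at_right 0. norm (nl (conv Z (moll e)) - nl Z) <= 2*e*nl D"
  proof (rule eventually_at_right_less[of "0::real", THEN eventually_mono])
   fix e :: real assume e: "0 < e"
   show "norm (nl (conv Z (moll e)) - nl Z) <= 2*e*nl D"
    using nrm_triangle_ge[OF H1_approx(3)[OF e H] H1D(2)[OF H]] H1_approx(2)[OF e H] by simp
  qed
  have "((%e. 2*e*nl D) ---> 2*0*nl D) (at_right 0)" by (intro tendsto_intros)
  thus "((%e. 2*e*nl D) ---> 0) (at_right 0)" by simp
 qed
 hence "((%e. nl (conv Z (moll e)) - nl Z + nl Z) ---> 0 + nl Z) (at_right 0)" by (intro tendsto_intros)
 hence "((%e. nl (conv Z (moll e))) ---> nl Z) (at_right 0)" by simp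
 thus ?thesis by (rule tendsto_power)
qed

lemma nl_continuous:
 fixes f :: "'a::metric_space => real => real"
 assumes s: "!!t. t \<in> S ==> sql (f t)" and l: "!!s. s \<in> S ==> ((%t. nl (%x. f t x - f s x)) ---> 0) (at s within S)"
 shows "continuous_on S (%t. nl (f t))"
 unfolding continuous_on_def
proof
 fix s assume s': "s \<in> S"
 have "((%t. nl (f t) - nl (f s)) ---> 0) (at s within S)"
 proof (rule Lim_null_comparison[OF _ l[OF s']])
  show "\<forall>\<^sub>F t in at s within S. norm (nl (f t) - nl (f s)) <= nl (%x. f t x - f s x)"
   unfolding eventually_at_filter using nrm_triangle_ge[OF s s[OF s']] by (auto intro: always_eventually)
 qed
 thus "((%t. nl (f t)) ---> nl (f s)) (at s within S)" by (rule LIM_zero_cancel)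
qed

lemma trajectoryD:
 assumes "trajectory a b ul U D" "t >= 0"
 shows "H1 (%x. U t x - ul x) (D t)"
  "((%s. nl (%x. U s x - U t x)) ---> 0) (at t within {0..})"
  "((%s. nl (%x. D s x - D t x)) ---> 0) (at t within {0..})"
  "[|testf psi; t <= t'|] ==> ((%tau. flux a b (U tau) psi) has_integral (LBINT x. (U t' x - U t x)*psi x)) {t..t'}"
 using assms unfolding trajectory_def by auto

lemma trajectory_bounds:
 assumes T: "trajectory a b ul U D"
 shows "continuous_on {0..} (%t. nl (%x. U t x - ul x))"
  "EX K. \<forall>s\<in>{0..t}. nl (%x. U s x - ul x) <= K & nl (D s) <= K"
proof -
 show c: "continuous_on {0..} (%t. nl (%x. U t x - ul x))"
  using trajectoryD[OF T] H1D(2)[OF trajectoryD(1)[OF T]] by (intro nl_continuous) auto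
 have d: "continuous_on {0..} (%t. nl (D t))"
  using trajectoryD[OF T] H1D(3)[OF trajectoryD(1)[OF T]] by (intro nl_continuous) auto
 have *: "EX K. \<forall>s\<in>{0..t}. f s <= K" if "continuous_on {0..} f" for f :: "real => real"
  using continuous_attains_sup[OF compact_Icc _ continuous_on_subset[OF that], of 0 t] by (cases "0 <= t") force+
 from *[OF c] obtain K1 where K1: "\<forall>s\<in>{0..t}. nl (%x. U s x - ul x) <= K1" by blast
 from *[OF d] obtain K2 where K2: "\<forall>s\<in>{0..t}. nl (D s) <= K2" by blast
 show "EX K. \<forall>s\<in>{0..t}. nl (%x. U s x - ul x) <= K & nl (D s) <= K"
  using K1 K2 by (intro exI[of _ "max K1 K2"]) (auto simp: le_max_iff_disj)
qed

lemma trajectory_continuous: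
 assumes T: "trajectory a b ul U D" and ul: "cont ul"
 shows "continuous_on ({0..} \<times> UNIV) (%(t, x). U t x)" "t >= 0 ==> cont (U t)"
proof -
 show c: "continuous_on ({0..} \<times> UNIV) (%(t, x). U t x)"
  using trajectoryD[OF T] by (intro sup_continuous[OF _ ul, of U D]) auto
 show "t >= 0 ==> cont (U t)" using continuous_on_section[OF c] by simp
qed

text \<open>Rescaling a solution also rescales its reference profile; this lemma returns to the
  original one.\<close>

lemma trajectory_reference:
 assumes T: "trajectory a b ul U D" and H: "H1 (%x. v x - ul x) E"
 shows "trajectory a b v U (%t x. D t x - E x)"
 using T H1_linear[OF trajectoryD(1)[OF T] H] unfolding trajectory_def by auto

lemma test_integrable:
 assumes "testf (psi :: real => real)" "cont f"
 shows "intg (%x. f x*(deriv ^^ n) psi x)"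
 by (rule locint_test_integrable'[OF locint_continuous test_function_deriv_n]) fact+

lemma flux_diff:
 assumes psi: "testf psi" and c: "cont u" "cont w"
 shows "flux a b u psi - flux a b w psi =
  (LBINT x. ((u x)^2 - (w x)^2) / 2*deriv psi x + a*(u x - w x)*(deriv ^^ 2) psi x + b*(u x - w x)*(deriv ^^ 3) psi x)"
proof -
 have i: "intg (%x. (u x)^2 / 2*deriv psi x + a*u x*(deriv ^^ 2) psi x + b*u x*(deriv ^^ 3) psi x)"
  if "cont u" for u
  by (intro Bochner_Integration.integrable_add test_integrable[OF psi] test_integrable[OF psi, where n=1, simplified] continuous_intros that) auto
 show ?thesis unfolding flux_def Bochner_Integration.integral_diff[OF i[OF c(1)] i[OF c(2)], symmetric]
  by (intro int_cong refl) (simp add: algebra_simps diff_divide_distrib)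
qed

lemma gronwall_zero:
 fixes f :: "real => real"
 assumes c: "continuous_on {0..T} f" and b: "!!t. t \<in> {0..T} ==> f t <= C*integral {0..t} f" and t: "t \<in> {0..T}" "C >= 0"
 shows "f t <= 0"
proof -
 define F where "F t = exp (- C*t)*integral {0..t} f" for t
 have F: "(F has_real_derivative exp (- C * s)*(f s - C*integral {0..s} f)) (at s within {0..T})" if "s \<in> {0..T}" for s
 proof -
  have "((%t. integral {0..t} f) has_real_derivative f s) (at s within {0..T})"
   unfolding real_vector_deriv by (rule integral_has_vector_derivative[OF c that])
  thus ?thesis unfolding F_def by (auto intro!: derivative_eq_intros simp: algebra_simps)
 qed
 have "F t <= F 0"
 proof (rule ccontr)
  assume n: "~ F t <= F 0"
  hence t0: "0 < t" using t by (cases "t = 0") auto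
  have cF: "continuous_on {0..t} F"
   by (rule continuous_on_subset[OF DERIV_continuous_on[OF F]]) (use t in auto)
  have "\<exists>z\<in>{0<..<t}. F t - F 0 = (t - 0)*(exp (- C*z)*(f z - C*integral {0..z} f))"
  proof (rule mvt_simple[OF t0, of F "%s d. d*(exp (- C * s)*(f s - C*integral {0..s} f))"])
   fix s assume "0 <= s" "s <= t"
   hence "(F has_real_derivative exp (- C * s)*(f s - C*integral {0..s} f)) (at s within {0..t})"
    using has_field_derivative_subset[OF F[of s], of "{0..t}"] t by simp
   thus "(F has_derivative (%d. d*(exp (- C * s)*(f s - C*integral {0..s} f)))) (at s within {0..t})"
    unfolding has_field_derivative_def mult.commute[of "exp _*_"] .
  qed
  then obtain z where z: "0 < z" "z < t" "F t - F 0 = (t - 0)*(exp (- C*z)*(f z - C*integral {0..z} f))" by auto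
  have "(t - 0)*(exp (- C*z)*(f z - C*integral {0..z} f)) <= 0"
   using b[of z] z t by (intro mult_nonneg_nonpos) (auto intro!: mult_nonneg_nonpos)
  thus False using z n by linarith
 qed
 hence "integral {0..t} f <= 0" by (simp add: F_def mult_le_0_iff)
 hence "C*integral {0..t} f <= 0" using t(2) by (rule mult_nonneg_nonpos[rotated])
 thus ?thesis using b[OF t(1)] by linarith
qed

text \<open>The difference \<open>Z\<close> has flux \<open>B = (U1 + U2)/2*Z\<close> with a bounded
  factor. In the mollified energy estimate the flux term is absorbed by the dissipation up to
  \<open>k*(nl Z)^2\<close>; with the mollifier removed, Gronwall applies.\<close>

lemma trajectory_unique:
 assumes a: "a > 0" and T1: "trajectory a b ul U1 D1" and T2: "trajectory a b ul U2 D2"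
  and ul: "cont ul" "!!x. abs (ul x) <= L" and init: "!!x. U1 0 x = U2 0 x" and t: "t >= 0"
 shows "U1 t = U2 t"
proof -
 define Z where "Z s x = U1 s x - U2 s x" for s x
 define B where "B s x = ((U1 s x)^2 - (U2 s x)^2) / 2" for s x
 obtain K1 where K1: "!!s. s \<in> {0..t} ==> nl (%x. U1 s x - ul x) <= K1 & nl (D1 s) <= K1"
  using trajectory_bounds(2)[OF T1, of t] by blast
 obtain K2 where K2: "!!s. s \<in> {0..t} ==> nl (%x. U2 s x - ul x) <= K2 & nl (D2 s) <= K2"
  using trajectory_bounds(2)[OF T2, of t] by blast
 define C where "C = K1 + K2 + L"
 have Hz: "H1 (Z s) (%x. D1 s x - D2 s x)" if "s >= 0" for s
  using H1_linear[OF trajectoryD(1)[OF T1 that] trajectoryD(1)[OF T2 that]] by (simp add: Z_def[abs_def])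
 have cU: "continuous_on ({0..t} \<times> UNIV) (%(t, x). U1 t x)" "continuous_on ({0..t} \<times> UNIV) (%(t, x). U2 t x)"
  by (rule continuous_on_subset[OF trajectory_continuous(1)[OF T1 ul(1)]]; force)
    (rule continuous_on_subset[OF trajectory_continuous(1)[OF T2 ul(1)]]; force)
 have cZ: "continuous_on ({0..t} \<times> UNIV) (%(t, x). Z t x)" "continuous_on ({0..t} \<times> UNIV) (%(t, x). B t x)"
  using cU unfolding Z_def B_def by (auto simp: split_beta intro!: continuous_intros)
 have m: "abs ((U1 s x + U2 s x) / 2) <= C" if "s \<in> {0..t}" for s x
  using H1_sup[OF trajectoryD(1)[OF T1], of s x] H1_sup[OF trajectoryD(1)[OF T2], of s x] K1[OF that] K2[OF that] ul(2)[of x] that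
  unfolding C_def by (auto simp: abs_le_iff field_simps)
 have C: "C >= 0" using order_trans[OF abs_ge_zero m[of 0 0]] t by simp
 have Bsq: "sql (B s)" "nl (B s) <= C*nl (Z s)" if "s \<in> {0..t}" for s
 proof -
  have "B s = (%x. (U1 s x + U2 s x) / 2*Z s x)" by (auto simp: B_def Z_def power2_eq_square field_simps)
  moreover have "bm (%x. (U1 s x + U2 s x) / 2)"
   using that by (intro bm_cont continuous_intros trajectory_continuous(2)[OF T1 ul(1)] trajectory_continuous(2)[OF T2 ul(1)]) auto
  ultimately show "sql (B s)" "nl (B s) <= C*nl (Z s)"
   using sql_bounded_mult[OF H1D(2)[OF Hz], of s "%x. (U1 s x + U2 s x) / 2" C] m that by auto
 qed
 have ncont: "continuous_on {0..} (%s. nl (Z s))"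
 proof (rule nl_continuous)
  fix s :: real assume s: "s \<in> {0..}"
  show "((%t. nl (%x. Z t x - Z s x)) ---> 0) (at s within {0..})"
  proof (rule Lim_null_comparison)
   show "((%t. nl (%x. U1 t x - U1 s x) + nl (%x. U2 t x - U2 s x)) ---> 0) (at s within {0..})"
    using tendsto_add[OF trajectoryD(2)[OF T1] trajectoryD(2)[OF T2]] s by fastforce
   show "\<forall>\<^sub>F t in at s within {0..}. norm (nl (%x. Z t x - Z s x)) <= nl (%x. U1 t x - U1 s x) + nl (%x. U2 t x - U2 s x)"
    unfolding eventually_at_filter
   proof (intro always_eventually allI impI)
    fix t :: real assume "t ~= s" and tt: "t \<in> {0..}"
    have d: "sql (%x. U1 t x - U1 s x)" "sql (%x. U2 t x - U2 s x)"
     using sqint_diff[OF H1D(2)[OF trajectoryD(1)[OF T1, of t]] H1D(2)[OF trajectoryD(1)[OF T1, of s]]]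
      sqint_diff[OF H1D(2)[OF trajectoryD(1)[OF T2, of t]] H1D(2)[OF trajectoryD(1)[OF T2, of s]]] s tt by auto
    have "(%x. Z t x - Z s x) = (%x. (U1 t x - U1 s x) - (U2 t x - U2 s x))" by (auto simp: Z_def)
    thus "norm (nl (%x. Z t x - Z s x)) <= nl (%x. U1 t x - U1 s x) + nl (%x. U2 t x - U2 s x)"
     using nrm_triangle_diff[OF d] by simp
   qed
  qed
 qed (use H1D(2)[OF Hz] in auto)
 \<comment> \<open>The constant of Young's inequality \<open>r*(C*z) <= a*r^2 + k*z^2\<close>, whose
   first term the dissipation absorbs.\<close>
 define k where "k = C^2 / (4*a)"
 have k: "k >= 0" using a by (simp add: k_def)
 have est: "(nl (Z s))^2 <= 2*k*integral {0..s} (%tau. (nl (Z tau))^2)" if s: "s \<in> {0..t}" for s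
 proof -
  have sub: "{0..s} \<subseteq> {0..t}" "{0..s} \<times> UNIV \<subseteq> {0..t} \<times> (UNIV :: real set)" using s by auto
  have ec: "continuous_on {0..s} (%tau. k*(nl (Z tau))^2)"
   by (intro continuous_intros continuous_on_subset[OF ncont]) auto
  have "EX K. \<forall>tau\<in>{0..s}. nl (Z tau) <= K"
   using continuous_attains_sup[OF compact_Icc _ continuous_on_subset[OF ncont], of 0 s] s by force
  then obtain K where K: "!!tau. tau \<in> {0..s} ==> nl (Z tau) <= K" by blast
  have Kn: "K >= 0" using order_trans[OF nrm_nonneg K[of 0]] s by simp
  have en: "(nl (conv (Z s) (moll e)))^2 - (nl (conv (Z 0) (moll e)))^2 <= 2*integral {0..s} (%tau. k*(nl (Z tau))^2)" if e: "e > 0" for e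
  proof (rule energy_estimate[OF e, where B=B and q="%_ _. 0" and K="C*K + K" and a=a and b=b])
   show "nl (Z tau) <= C*K + K" if "tau \<in> {0..s}" for tau using K[OF that] C Kn by (simp add: add_increasing)
   show "nl (B tau) <= C*K + K" if "tau \<in> {0..s}" for tau
    using Bsq(2)[of tau] mult_left_mono[OF K[OF that] C] that s Kn by simp
   show "nl (%_. 0) <= C*K + K" using C Kn by (simp add: nrm_def)
  next
   fix psi :: "real => real" and s' t' assume psi: "testf psi" and st: "0 <= s'" "s' <= t'" "t' <= s"
   have i: "intg (%x. (U t' x - U s' x)*psi x)" if "trajectory a b ul U D" for U D
    using st by (intro test_integrable[OF psi, where n=0, simplified] continuous_intros trajectory_continuous(2)[OF that ul(1)]) auto
   have "((%tau. flux a b (U1 tau) psi - flux a b (U2 tau) psi) has_integral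
     ((LBINT x. (U1 t' x - U1 s' x)*psi x) - (LBINT x. (U2 t' x - U2 s' x)*psi x))) {s'..t'}"
    by (intro has_integral_diff trajectoryD(4)[OF T1] trajectoryD(4)[OF T2] psi st)
   also have "(LBINT x. (U1 t' x - U1 s' x)*psi x) - (LBINT x. (U2 t' x - U2 s' x)*psi x) = (LBINT x. (Z t' x - Z s' x)*psi x)"
    unfolding Bochner_Integration.integral_diff[OF i[OF T1] i[OF T2], symmetric] Z_def
    by (intro int_cong refl) (simp add: algebra_simps)
   finally show "((%tau. LBINT x. B tau x*deriv psi x + a*Z tau x*(deriv ^^ 2) psi x + b*Z tau x*(deriv ^^ 3) psi x + 0*psi x)
    has_integral (LBINT x. (Z t' x - Z s' x)*psi x)) {s'..t'}"
   proof (rule has_integral_eq[rotated])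
    fix tau assume "tau \<in> {s'..t'}"
    hence "tau >= 0" using st by simp
    thus "flux a b (U1 tau) psi - flux a b (U2 tau) psi =
     (LBINT x. B tau x*deriv psi x + a*Z tau x*(deriv ^^ 2) psi x + b*Z tau x*(deriv ^^ 3) psi x + 0*psi x)"
     by (simp add: B_def Z_def flux_diff[OF psi] trajectory_continuous(2)[OF T1 ul(1)] trajectory_continuous(2)[OF T2 ul(1)])
   qed
  next
   fix tau assume tau: "tau \<in> {0..s}"
   have c0: "conv (%_. 0) (moll e) = (%_. 0)" by (auto simp: conv_def)
   let ?g = "conv (Z tau) (deriv (moll e))"
   have tau': "tau \<in> {0..t}" "tau >= 0" using tau s by auto
   have "(LBINT x. ?g x*conv (B tau) (moll e) x) <= nl ?g*nl (conv (B tau) (moll e))"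
    using cauchy_schwarz[OF H1_conv_deriv(2)[OF e Hz[OF tau'(2)]] moll_young(1)[OF e Bsq(1)[OF tau'(1)]]] by linarith
   also have "... <= nl ?g*(C*nl (Z tau))"
    by (intro mult_left_mono order_trans[OF moll_young(2)[OF e Bsq(1)[OF tau'(1)]] Bsq(2)[OF tau'(1)]]) simp
   also have "... <= a*(nl ?g)^2 + k*(nl (Z tau))^2"
   proof -
    have "0 <= (2*a*nl ?g - C*nl (Z tau))^2 / (4*a)" using a by simp
    also have "... = a*(nl ?g)^2 + k*(nl (Z tau))^2 - nl ?g*(C*nl (Z tau))"
     using a by (simp add: k_def power2_eq_square field_simps)
    finally show ?thesis by simp
   qed
   finally show "- a*(nl ?g)^2 + (LBINT x. ?g x*conv (B tau) (moll e) x) + (LBINT x. conv (Z tau) (moll e) x*conv (%_. 0) (moll e) x) <= k*(nl (Z tau))^2"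
    by (simp add: c0)
  qed (use s ec cZ sub H1D(2)[OF Hz] Bsq(1) in "auto intro: continuous_on_subset")
  have "(nl (Z s))^2 - (nl (Z 0))^2 <= 2*integral {0..s} (%tau. k*(nl (Z tau))^2)"
  proof (rule tendsto_le[OF _ tendsto_const tendsto_diff[OF moll_nl_tendsto[OF Hz[of s]] moll_nl_tendsto[OF Hz[of 0]]]])
   show "\<forall>\<^sub>F e in at_right 0. (nl (conv (Z s) (moll e)))^2 - (nl (conv (Z 0) (moll e)))^2 <= 2*integral {0..s} (%tau. k*(nl (Z tau))^2)"
    by (rule eventually_at_right_less[of "0::real", THEN eventually_mono]) (rule en)
  qed (use s in auto)
  moreover have "nl (Z 0) = 0" by (simp add: Z_def init nrm_def)
  ultimately show ?thesis by simp
 qed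
 have "(nl (Z t))^2 <= 0"
  using t k by (intro gronwall_zero[of t _ "2*k"] est) (auto intro!: continuous_intros continuous_on_subset[OF ncont])
 hence "nl (Z t) = 0" by simp
 show ?thesis
 proof
  fix x
  show "U1 t x = U2 t x"
  proof (rule ccontr)
   assume "U1 t x ~= U2 t x"
   have "(LINT x|lborel. (Z t x)^2) = 0" using \<open>nl (Z t) = 0\<close> by (simp add: nrm_def)
   hence "ae x. (Z t x)^2 = 0"
    using H1D(2)[OF Hz[OF t]] by (subst (asm) integral_nonneg_eq_0_iff_AE) (auto simp: sqint_def)
   hence "ae x. x \<in> {x. Z t x = 0}" by simp
   moreover have "closed {x. Z t x = 0}" using H1D(1)[OF Hz[OF t]] by (intro closed_Collect_eq continuous_on_const)
   ultimately have "{x. Z t x = 0} = UNIV" using mem_closed_if_AE_lebesgue[of "{x. Z t x = 0}"] AE_completion by blast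
   thus False using \<open>U1 t x ~= U2 t x\<close> by (auto simp: Z_def)
  qed
 qed
qed

section \<open>Shift speed and dissipation\<close>

context shock_wave begin

definition "shift_speed d Z = - (2*M / (um - up))*(LBINT x. Z x*u1 (x + d))"
text \<open>Balance of the rank-one term and the work of the shift: if \<open>J = um - up\<close>
  and \<open>xi = -(2*M/J)*P\<close>, then \<open>P^2/(2*J) + xi*P = - rate*xi^2\<close>.\<close>

definition "rate = (um - up)*(4*M - 1) / (8*M^2)"

lemma rate: "rate > 0" using um_up M by (simp add: rate_def)

lemma shift_speed_bound:
 assumes "sql Z" shows "abs (shift_speed d Z) <= 2*M / (um - up)*nl u1*nl Z"
proof -
 have "abs (LBINT x. Z x*u1 (x + d)) <= nl Z*nl u1"
  using cauchy_schwarz[OF assms sql_shift[OF ut_sq(1), of d]] by (simp add: nl_shift)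
 hence "2*M / (um - up)*abs (LBINT x. Z x*u1 (x + d)) <= 2*M / (um - up)*(nl Z*nl u1)"
  using M um_up by (intro mult_left_mono) auto
 thus ?thesis using M um_up by (simp add: shift_speed_def abs_mult mult_ac)
qed

text \<open>Right-hand side of the mollified energy identity for a perturbation of the displaced
  profile. With the flux \<open>F\<close> of the mollified \<open>g\<close> in place of the
  mollified flux, the cubic part integrates to 0, the profile part leaves \<open>-1/2\<close> times
  the integral of \<open>rx*g^2\<close>, and \<open>spectral\<close> applies to \<open>g\<close>.
  All exchanges cost O(e), with a constant depending on the bound \<open>K\<close> but not on
  \<open>Z\<close> or on the displacement \<open>d\<close>.\<close>

lemma commutator_bound:
 assumes K: "K >= 0"
 shows "EX K'. ALL d Z Zx e. 0 < e & e <= 1 & H1 Z Zx & nl Z <= K & nl Zx <= K -->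
  - eps * (nl (conv Z (deriv (moll e))))^2
  + (LBINT x. conv Z (deriv (moll e)) x*conv (%x. ut (x + d)*Z x + (Z x)^2 / 2) (moll e) x)
  + (LBINT x. conv Z (moll e) x*conv (%x. shift_speed d Z*u1 (x + d)) (moll e) x)
  <= - rate*(shift_speed d Z)^2 + e*K'"
proof -
 obtain C where C: "C > 0" "!!x. abs (ut x) <= C" "!!x. abs (u1 x) <= C" using ut_bounded by blast
 define N1 where "N1 = nl u1"
 define N2 where "N2 = nl u2"
 define \<Xi> where "\<Xi> = 2*M / (um - up)*N1*K"
 define J where "J = um - up"
 have J: "J > 0" using um_up by (simp add: J_def)
 define H where "H = 2*K*(2*N1) + 2*(C + 2*K)*(2*K)"
 define E1 where "E1 = K*H + \<Xi>*(2*K*N2 + 2*K*N1) + 2*K*N1*(2*K*N1) / (2*J)"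
 have N: "N1 >= 0" "N2 >= 0" by (auto simp: N1_def N2_def)
 show ?thesis
 proof (intro exI allI impI)
  fix d e :: real and Z Zx :: "real => real"
  assume "0 < e & e <= 1 & H1 Z Zx & nl Z <= K & nl Zx <= K"
  hence e: "0 < e" "e <= 1" and Hz: "H1 Z Zx" and nK: "nl Z <= K" "nl Zx <= K" by auto
  define r where "r x = ut (x + d)" for x
  define rx where "rx x = u1 (x + d)" for x
  define g where "g = conv Z (moll e)"
  define g' where "g' = conv Z (deriv (moll e))"
  define B where "B x = r x*Z x + (Z x)^2 / 2" for x
  define xi where "xi = shift_speed d Z"
  have mZ [measurable]: "bm Z" using H1D(2)[OF Hz] by (simp add: sqint_def)
  have mr [measurable]: "bm r" "bm rx" unfolding r_def rx_def by measurable
  have sr: "sql rx" "nl rx = N1" using sql_shift[OF ut_sq(1)] nl_shift[of u1] by (auto simp: rx_def[abs_def] N1_def)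
  have s2: "sql (%x. u2 (x + d))" "nl (%x. u2 (x + d)) = N2" using sql_shift[OF ut_sq(2)] nl_shift[of u2] by (auto simp: N2_def)
  have dr: "DERIV r x :> rx x" "DERIV rx x :> u2 (x + d)" for x
   using ut'[of "x + d"] u1'[of "x + d"] unfolding r_def rx_def DERIV_shift by blast+
  have crx: "cont rx" "cont (%x. u2 (x + d))" unfolding rx_def
   by (intro continuous_on_compose2[OF ut_cont(2)] continuous_on_compose2[OF ut_cont(3)] continuous_intros; simp)+
  have sup: "abs (Z x) <= 2*K" for x using H1_sup[OF Hz, of x] nK by simp
  have e2: "2*e*nl Zx <= 2*e*K" by (rule mult_left_mono[OF nK(2)]) (use e in simp)
  have g: "sql g" "nl g <= K" "nl (%x. g x - Z x) <= 2*e*K"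
   unfolding g_def using H1_approx(3)[OF e(1) Hz] order_trans[OF H1_approx(4)[OF e(1) Hz] nK(1)] order_trans[OF H1_approx(2)[OF e(1) Hz] e2] by blast+
  have goz: "abs (g x - Z x) <= osc e Zx x" for x using H1_approx(1)[OF e(1) Hz] unfolding g_def .
  have g's: "sql g'" "nl g' <= K" using H1_conv_deriv[OF e(1) Hz] nK unfolding g'_def by auto
  have ker: "kernel e (moll e)" using moll_kernel(1)[OF e(1), of 0] by simp
  have gsup: "abs (g x) <= 2*K" for x
   using moll_osc[OF e(1) conv_integrable[OF H1D(2)[OF Hz] ker], of x 0 "2*K"] sup unfolding g_def by simp
  have gd: "DERIV g x :> g' x" for x
   using conv_moll_deriv[OF e(1) H1D(1)[OF Hz], of 0 x] by (simp add: g_def g'_def)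
  have "DERIV g' x :> conv Z ((deriv ^^ 2) (moll e)) x" for x
   using conv_moll_deriv[OF e(1) H1D(1)[OF Hz], of 1 x] by (simp add: g'_def numeral_2_eq_2)
  hence cg': "cont g'" by (meson DERIV_isCont continuous_at_imp_continuous_on)
  have cg: "cont g" by (rule DERIV_cont[OF gd])
  have mg [measurable]: "bm g" "bm g'" using g(1) g's(1) by (auto simp: sqint_def)
  have sB: "sql B"
  proof -
   have "B = (%x. (r x + Z x / 2)*Z x)" by (auto simp: B_def power2_eq_square algebra_simps)
   moreover have "abs (r x + Z x / 2) <= C + K" for x
    using C(2)[of "x + d"] sup[of x] unfolding r_def by linarith
   ultimately show ?thesis using sql_bounded_mult(1)[OF H1D(2)[OF Hz], of "%x. r x + Z x / 2" "C + K"] by simp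
  qed
  define F where "F x = r x*g x + (g x)^2 / 2" for x
  have sF: "sql F"
  proof -
   have "F = (%x. (r x + g x / 2)*g x)" by (auto simp: F_def power2_eq_square algebra_simps)
   moreover have "abs (r x + g x / 2) <= C + K" for x
    using C(2)[of "x + d"] gsup[of x] unfolding r_def by linarith
   ultimately show ?thesis using sql_bounded_mult(1)[OF g(1), of "%x. r x + g x / 2" "C + K"] by simp
  qed
  define h where "h x = 2*K * osc e rx x + 2*(C + 2*K) * osc e Zx x" for x
  have sh: "sql h" "nl h <= e*H"
  proof -
   note o = osc[OF e(1) sr(1)] osc[OF e(1) H1D(3)[OF Hz]]
   show "sql h" unfolding h_def by (intro sqint_add sqint_cmult o)
   have "nl h <= nl (%x. 2*K * osc e rx x) + nl (%x. 2*(C + 2*K) * osc e Zx x)"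
    unfolding h_def by (intro nrm_triangle sqint_cmult o)
   also have "... = 2*K*nl (osc e rx) + 2*(C + 2*K)*nl (osc e Zx)"
    using K C(1) by (simp add: nrm_cmult)
   also have "... <= 2*K*(2*e*N1) + 2*(C + 2*K)*(2*e*K)"
    using o(2) order_trans[OF o(5) e2] e(1) K C(1) unfolding sr(2)
    by (intro add_mono mult_left_mono) auto
   also have "... = e*H" by (simp add: H_def algebra_simps)
   finally show "nl h <= e*H" .
  qed
  \<comment> \<open>\<open>conv B\<close> is near \<open>B\<close> because \<open>B\<close>
    oscillates little at scale \<open>e\<close>, and \<open>F\<close> is near \<open>B\<close>
    because \<open>g\<close> is near \<open>Z\<close>. The two errors account for the factor 2
    before \<open>(C + 2*K)\<close> in \<open>h\<close>.\<close>
  have near: "abs (conv B (moll e) x - F x) <= abs (h x)" for x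
  proof -
   have "abs (conv B (moll e) x - B x) <= 2*K * osc e rx x + (C + 2*K) * osc e Zx x"
   proof (rule moll_osc[OF e(1) conv_integrable[OF sB ker]])
    fix y assume xy: "abs (x - y) <= e"
    have 1: "abs (r y - r x) <= osc e rx x" by (rule osc_derivative[OF dr(1) crx(1) sr(1) xy e(1)])
    have 2: "abs (Z y - Z x) <= osc e Zx x" by (rule H1_osc[OF e(1) Hz xy])
    have "B y - B x = Z y*(r y - r x) + (r x + (Z y + Z x) / 2)*(Z y - Z x)"
     by (simp add: B_def power2_eq_square field_simps)
    moreover have "abs (Z y*(r y - r x)) <= 2*K * osc e rx x"
     unfolding abs_mult using 1 sup[of y] K by (intro mult_mono) auto
    moreover have "abs ((r x + (Z y + Z x) / 2)*(Z y - Z x)) <= (C + 2*K) * osc e Zx x"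
     unfolding abs_mult using 2 sup[of y] sup[of x] C(2)[of "x + d"] C(1) K by (intro mult_mono) (auto simp: r_def abs_le_iff field_simps)
    ultimately show "abs (B y - B x) <= 2*K * osc e rx x + (C + 2*K) * osc e Zx x" by linarith
   qed
   moreover have "abs (F x - B x) <= (C + 2*K) * osc e Zx x"
   proof -
    have "F x - B x = (r x + (g x + Z x) / 2)*(g x - Z x)"
     by (simp add: F_def B_def power2_eq_square field_simps)
    moreover have "abs ((r x + (g x + Z x) / 2)*(g x - Z x)) <= (C + 2*K) * osc e Zx x"
     unfolding abs_mult using goz[of x] gsup[of x] sup[of x] C(2)[of "x + d"] C(1) K
     by (intro mult_mono) (auto simp: r_def abs_le_iff field_simps)
    ultimately show ?thesis by simp
   qed
   ultimately show ?thesis unfolding h_def by (simp add: algebra_simps)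
  qed
  have T1: "(LBINT x. g' x*conv B (moll e) x) <= (LBINT x. g' x*F x) + K*(e*H)"
  proof -
   have sc: "sql (conv B (moll e))" by (rule moll_young(1)[OF e(1) sB])
   note sd = sqint_diff[OF sc sF]
   have "nl (%x. conv B (moll e) x - F x) <= nl h"
    using near by (intro sqint_bound(2)[OF sh(1)] sqint_measurable[OF sd]) auto
   hence "abs (LBINT x. g' x*(conv B (moll e) x - F x)) <= K*(e*H)"
    using cauchy_schwarz[OF g's(1) sd] mult_mono[OF g's(2) order_trans[OF _ sh(2)]] K by fastforce
   moreover have "(LBINT x. g' x*(conv B (moll e) x - F x)) = (LBINT x. g' x*conv B (moll e) x) - (LBINT x. g' x*F x)"
    unfolding right_diff_distrib by (intro Bochner_Integration.integral_diff sqint_mult g's sc sF)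
   ultimately show ?thesis by linarith
  qed
  have T2: "(LBINT x. g' x*F x) = - (LBINT x. rx x*(g x)^2) / 2"
  proof -
   define P where "P x = r x*(g x)^2 / 2 + (g x) ^ 3 / 6" for x
   have bm: "intg (%x. b x*(g x*k x))" if "sql k" "bm b" "!!x. abs (b x) <= L" for b k L
    using sqint_mult[OF g(1) sql_bounded_mult(1)[OF that]] by (simp add: mult_ac)
   have ib: "intg (%x. rx x*(g x)^2)"
    using bm[OF g(1), of rx C] C(3) by (simp add: power2_eq_square rx_def)
   have iF: "intg (%x. g' x*F x)" by (rule sqint_mult[OF g's(1) sF])
   have "(LBINT x. rx x*(g x)^2 / 2 + g' x*F x) = 0"
   proof (rule integral_deriv_zero[of P])
    show "DERIV P x :> rx x*(g x)^2 / 2 + g' x*F x" for x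
     unfolding P_def F_def by (auto intro!: derivative_eq_intros dr gd simp: power2_eq_square algebra_simps numeral_3_eq_3)
    have cr: "cont r" by (rule DERIV_cont[OF dr(1)])
    show "cont (%x. rx x*(g x)^2 / 2 + g' x*F x)"
     unfolding F_def by (intro continuous_intros crx cg cg' cr) auto
    have "intg (%x. (r x / 2 + g x / 6)*(g x*g x))"
    proof (rule bm[OF g(1), of _ "C + K"])
     show "abs (r x / 2 + g x / 6) <= C + K" for x
      using C(2)[of "x + d"] gsup[of x] C(1) K unfolding r_def by linarith
    qed measurable
    moreover have "P = (%x. (r x / 2 + g x / 6)*(g x*g x))"
     by (auto simp: P_def power2_eq_square numeral_3_eq_3 algebra_simps)
    ultimately show "intg P" by simp
    show "intg (%x. rx x*(g x)^2 / 2 + g' x*F x)" using ib iF by simp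
   qed
   thus ?thesis using ib iF by simp
  qed
  define P where "P = (LBINT x. g x*rx x)"
  define P0 where "P0 = (LBINT x. Z x*rx x)"
  have PP: "abs (P - P0) <= 2*e*K*N1"
  proof -
   note sd = sqint_diff[OF g(1) H1D(2)[OF Hz]]
   have "P - P0 = (LBINT x. (g x - Z x)*rx x)"
    unfolding P_def P0_def left_diff_distrib
    by (intro Bochner_Integration.integral_diff[symmetric] sqint_mult g H1D(2)[OF Hz] sr)
   also have "abs ... <= nl (%x. g x - Z x)*N1" using cauchy_schwarz[OF sd sr(1)] sr(2) by simp
   also have "... <= 2*e*K*N1" using g(3) N by (intro mult_right_mono) auto
   finally show ?thesis .
  qed
  have Pb: "abs P <= K*N1" "abs P0 <= K*N1"
   using cauchy_schwarz[OF g(1) sr(1)] cauchy_schwarz[OF H1D(2)[OF Hz] sr(1)]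
    mult_right_mono[OF g(2) N(1)] mult_right_mono[OF nK(1) N(1)] sr(2) unfolding P_def P0_def by auto
  have xi: "xi = - (2*M / J)*P0" "abs xi <= \<Xi>"
  proof -
   show "xi = - (2*M / J)*P0" by (simp add: xi_def shift_speed_def P0_def rx_def J_def)
   show "abs xi <= \<Xi>"
    using shift_speed_bound[OF H1D(2)[OF Hz], of d] mult_left_mono[OF nK(1), of "2*M / (um - up)*N1"] M um_up N
    unfolding xi_def \<Xi>_def N1_def by auto
  qed
  have T3: "(LBINT x. g x*conv (%x. xi*rx x) (moll e) x) <= xi*P + \<Xi>*(2*e*K*N2)"
  proof -
   have "conv (%x. xi*rx x) (moll e) = (%x. xi*conv rx (moll e) x)" by (auto simp: conv_def mult.assoc)
   hence 1: "(LBINT x. g x*conv (%x. xi*rx x) (moll e) x) = xi*(LBINT x. g x*conv rx (moll e) x)"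
    by (simp add: mult.left_commute)
   have sc: "sql (conv rx (moll e))" by (rule moll_young(1)[OF e(1) sr(1)])
   note sd = sqint_diff[OF sc sr(1)] and o = osc[OF e(1) s2(1)]
   have "abs (conv rx (moll e) x - rx x) <= osc e (%x. u2 (x + d)) x" for x
    by (rule moll_osc[OF e(1) conv_integrable[OF sr(1) ker]]) (rule osc_derivative[OF dr(2) crx(2) s2(1) _ e(1)])
   hence "nl (%x. conv rx (moll e) x - rx x) <= nl (osc e (%x. u2 (x + d)))"
    by (intro sqint_bound(2)[OF o(1)] sqint_measurable[OF sd]) (auto intro!: AE_I2 order_trans[OF _ abs_ge_self])
   also have "... <= 2*e*N2" using o(2) s2(2) by simp
   finally have "abs (LBINT x. g x*(conv rx (moll e) x - rx x)) <= K*(2*e*N2)"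
    using cauchy_schwarz[OF g(1) sd] mult_mono[OF g(2)] K by fastforce
   moreover have "(LBINT x. g x*(conv rx (moll e) x - rx x)) = (LBINT x. g x*conv rx (moll e) x) - P"
    unfolding right_diff_distrib P_def by (intro Bochner_Integration.integral_diff sqint_mult g sc sr)
   ultimately have "abs ((LBINT x. g x*conv rx (moll e) x) - P) <= K*(2*e*N2)" by simp
   hence "abs xi*abs ((LBINT x. g x*conv rx (moll e) x) - P) <= \<Xi>*(K*(2*e*N2))"
    using xi(2) by (intro mult_mono) auto
   hence "xi*((LBINT x. g x*conv rx (moll e) x) - P) <= \<Xi>*(K*(2*e*N2))"
    using abs_mult[of xi] by (metis abs_ge_self order_trans)
   thus ?thesis unfolding 1 by (simp add: algebra_simps)
  qed
  have T4: "- eps * (nl g')^2 - (LBINT x. rx x*(g x)^2) / 2 <= P^2 / (2*J)"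
   using spectral[OF gd cg' g(1) g's(1), of d] unfolding rx_def P_def J_def by (simp add: mult.commute)
  have "P^2 - P0^2 = (P - P0)*(P + P0)" by (simp add: power2_eq_square algebra_simps)
  also have "... <= abs (P - P0)*abs (P + P0)" by (metis abs_ge_self abs_mult)
  also have "... <= 2*e*K*N1*(2*K*N1)" using PP Pb K N e by (intro mult_mono) auto
  finally have T5: "P^2 / (2*J) <= P0^2 / (2*J) + e*(2*K*N1*(2*K*N1) / (2*J))"
   using J by (simp add: field_simps)
  have "xi*(P - P0) <= abs xi*abs (P - P0)" by (metis abs_ge_self abs_mult)
  also have "... <= \<Xi>*(2*e*K*N1)" using xi(2) PP by (intro mult_mono) auto
  finally have T6: "xi*P <= xi*P0 + e*(\<Xi>*(2*K*N1))" by (simp add: algebra_simps)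
  have T7: "P0^2 / (2*J) + xi*P0 = - rate*xi^2"
   unfolding xi(1) rate_def J_def[symmetric] using J M by (simp add: field_simps power2_eq_square)
  have "- eps * (nl g')^2 + (LBINT x. g' x*conv B (moll e) x) + (LBINT x. g x*conv (%x. xi*rx x) (moll e) x)
   <= - rate*xi^2 + (K*(e*H) + \<Xi>*(2*e*K*N2) + e*(2*K*N1*(2*K*N1) / (2*J)) + e*(\<Xi>*(2*K*N1)))"
   using T1 T2 T3 T4 T5 T6 T7 by linarith
  also have "K*(e*H) + \<Xi>*(2*e*K*N2) + e*(2*K*N1*(2*K*N1) / (2*J)) + e*(\<Xi>*(2*K*N1)) = e*E1"
   by (simp add: E1_def algebra_simps)
  finally show "- eps * (nl (conv Z (deriv (moll e))))^2
   + (LBINT x. conv Z (deriv (moll e)) x*conv (%x. ut (x + d)*Z x + (Z x)^2 / 2) (moll e) x)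
   + (LBINT x. conv Z (moll e) x*conv (%x. shift_speed d Z*u1 (x + d)) (moll e) x)
   <= - rate*(shift_speed d Z)^2 + e*E1"
   unfolding g_def g'_def B_def[abs_def] xi_def r_def rx_def .
 qed
qed

end

section \<open>Contraction up to a shift\<close>

lemma by_parts_test:
 assumes psi: "testf (psi :: real => real)" and f: "!!x. DERIV f x :> f' x" "cont f'"
 shows "(LBINT x. f' x*(deriv ^^ n) psi x) = - (LBINT x. f x*(deriv ^^ Suc n) psi x)"
proof -
 have cf: "cont f" by (rule DERIV_cont[OF f(1)])
 note i = test_integrable[OF psi f(2), of n] test_integrable[OF psi cf, of "Suc n"]
 have s: "smooth psi" using psi by (simp add: test_function_def)
 have "(LBINT x. f' x*(deriv ^^ n) psi x + f x*(deriv ^^ Suc n) psi x) = 0"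
 proof (rule integral_deriv_zero)
  show "DERIV (%x. f x*(deriv ^^ n) psi x) x :> f' x*(deriv ^^ n) psi x + f x*(deriv ^^ Suc n) psi x" for x
   using DERIV_mult[OF f(1) smooth_deriv_n_has_derivative[OF s]] by (simp add: mult.commute add.commute)
  show "cont (%x. f' x*(deriv ^^ n) psi x + f x*(deriv ^^ Suc n) psi x)"
   by (intro continuous_intros f(2) cf smooth_imp_continuous_on smooth_deriv_n s)
 qed (use i test_integrable[OF psi cf, of n] in auto)
 thus ?thesis using i by simp
qed

text \<open>Oscillation at the scale \<open>abs (d - d')\<close>; the case \<open>d = d'\<close> is
  separate because \<open>osc\<close> is estimated for positive radii.\<close>

lemma translate_diff:
 assumes f: "!!x. DERIV f x :> D x" "cont D" "sql D"
 shows "sql (%x. f (x + d) - f (x + d'))" "nl (%x. f (x + d) - f (x + d')) <= 2*abs (d - d')*nl D"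
proof -
 have [measurable]: "bm f"
  using f(1) by (meson DERIV_isCont continuous_at_imp_continuous_on bm_cont)
 have "sql (%x. f (x + d) - f (x + d')) & nl (%x. f (x + d) - f (x + d')) <= 2*abs (d - d')*nl D"
 proof (cases "d = d'")
  case True
  thus ?thesis by (simp add: nrm_def)
 next
  case False
  hence e: "abs (d - d') > 0" by simp
  note o = osc[OF e f(3)]
  have "abs (f (x + d) - f (x + d')) <= abs (osc (abs (d - d')) D (x + d'))" for x
   by (rule order_trans[OF osc_derivative[OF f _ e] abs_ge_self]) simp
  thus ?thesis
   using sqint_bound[OF sql_shift[OF o(1), of d'], of "%x. f (x + d) - f (x + d')"] o(2) by (simp add: nl_shift)
 qed
 thus "sql (%x. f (x + d) - f (x + d'))" "nl (%x. f (x + d) - f (x + d')) <= 2*abs (d - d')*nl D" by auto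
qed

context shock_wave begin

lemma ut_shift_deriv:
 "DERIV (%x. ut (x + d)) x :> u1 (x + d)" "DERIV (%x. u1 (x + d)) x :> u2 (x + d)"
 "cont (%x. ut (x + d))" "cont (%x. u1 (x + d))" "cont (%x. u2 (x + d))"
 using ut'[of "x + d"] u1'[of "x + d"] DERIV_shift[of ut "u1 (x + d)" x d] DERIV_shift[of u1 "u2 (x + d)" x d]
  continuous_on_compose2[OF ut_cont(1), of UNIV "%x. x + d"] continuous_on_compose2[OF ut_cont(2), of UNIV "%x. x + d"]
  continuous_on_compose2[OF ut_cont(3), of UNIV "%x. x + d"] continuous_on_add[OF continuous_on_id continuous_on_const, of UNIV d]
 by auto

lemmas shift_diff = translate_diff[OF ut' ut_cont(2) ut_sq(1)]

lemma H1_ut_shift: "H1 (%x. ut (x + d) - ul x) (%x. u1 (x + d) - ul1 x)"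
proof (rule C1_H1)
 show "DERIV (%x. ut (x + d) - ul x) x :> u1 (x + d) - ul1 x" for x by (intro derivative_intros ut_shift_deriv ul')
 show "cont (%x. u1 (x + d) - ul1 x)" by (intro continuous_intros ut_shift_deriv ul')
 show "sql (%x. ut (x + d) - ul x)" using sqint_add[OF shift_diff(1)[of d 0] H1D(2)[OF H1_ut]] by simp
 show "sql (%x. u1 (x + d) - ul1 x)" by (intro sqint_diff sql_shift ut_sq ul')
qed

lemma H1_perturbation:
 assumes "trajectory eps delta ul U D" "t >= 0"
 shows "H1 (%x. U t x - ut (x + d)) (%x. D t x - (u1 (x + d) - ul1 x))"
  "nl (%x. U t x - ut (x + d)) <= nl (%x. U t x - ul x) + (nl (%x. ut x - ul x) + 2*abs d*nl u1)"
  "nl (%x. D t x - (u1 (x + d) - ul1 x)) <= nl (D t) + (nl u1 + nl ul1)"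
proof -
 note H = trajectoryD(1)[OF assms]
 show H': "H1 (%x. U t x - ut (x + d)) (%x. D t x - (u1 (x + d) - ul1 x))"
  using H1_linear[OF H H1_ut_shift[of d]] by simp
 have "nl (%x. (U t x - ul x) - (ut (x + d) - ul x)) <= nl (%x. U t x - ul x) + nl (%x. ut (x + d) - ul x)"
  by (intro nrm_triangle_diff H1D(2)[OF H] H1D(2)[OF H1_ut_shift])
 moreover have "nl (%x. (ut x - ul x) + (ut (x + d) - ut (x + 0))) <= nl (%x. ut x - ul x) + nl (%x. ut (x + d) - ut (x + 0))"
  by (intro nrm_triangle H1D(2)[OF H1_ut] shift_diff(1))
 ultimately show "nl (%x. U t x - ut (x + d)) <= nl (%x. U t x - ul x) + (nl (%x. ut x - ul x) + 2*abs d*nl u1)"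
  using shift_diff(2)[of d 0] by simp
 have "nl (%x. D t x - (u1 (x + d) - ul1 x)) <= nl (D t) + nl (%x. u1 (x + d) - ul1 x)"
  by (intro nrm_triangle_diff H1D(3)[OF H] H1D(3)[OF H1_ut_shift])
 also have "nl (%x. u1 (x + d) - ul1 x) <= nl (%x. u1 (x + d)) + nl ul1"
  by (intro nrm_triangle_diff sql_shift ut_sq ul')
 finally show "nl (%x. D t x - (u1 (x + d) - ul1 x)) <= nl (D t) + (nl u1 + nl ul1)" by (simp add: nl_shift)
qed

text \<open>Weak form of the travelling wave equation. All derivatives but one are moved back to the
  profile, where the integrated equation leaves \<open>sgm*ut - um*up/2\<close> against
  \<open>deriv psi\<close>; the constant does not contribute.\<close>

lemma ut_flux:
 assumes psi: "testf psi"
 shows "flux eps delta (%x. ut (x + d)) psi = sgm*(LBINT x. ut (x + d)*deriv psi x)"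
proof -
 let ?I = "%f n. LBINT x. f x*(deriv ^^ n) psi x"
 note s = ut_shift_deriv[where d=d]
 note i = test_integrable[OF psi]
 have c: "cont (%x. (ut (x + d))^2 / 2)" by (intro continuous_intros s) auto
 have b1: "?I (%x. ut (x + d)) 2 = - ?I (%x. u1 (x + d)) 1"
  using by_parts_test[OF psi s(1,4), of 1] by (simp add: numeral_2_eq_2)
 have b2: "?I (%x. ut (x + d)) 3 = ?I (%x. u2 (x + d)) 1"
  using by_parts_test[OF psi s(1,4), of 2] by_parts_test[OF psi s(2,5), of 1] by (simp add: numeral_2_eq_2 numeral_3_eq_3)
 have b3: "?I (%x. 1) 1 = 0" using by_parts_test[OF psi DERIV_const[of 1], of 0] by simp
 have "flux eps delta (%x. ut (x + d)) psi = ?I (%x. (ut (x + d))^2 / 2) 1 + eps * ?I (%x. ut (x + d)) 2 + delta*?I (%x. ut (x + d)) 3"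
  unfolding flux_def mult.assoc using i[OF c, of 1] i[OF s(3), of 2] i[OF s(3), of 3] by simp
 also have "... = ?I (%x. (ut (x + d))^2 / 2) 1 - eps * ?I (%x. u1 (x + d)) 1 + delta*?I (%x. u2 (x + d)) 1"
  unfolding b1 b2 by simp
 also have "... = (LBINT x. (ut (x + d))^2 / 2*(deriv ^^ 1) psi x - eps * (u1 (x + d)*(deriv ^^ 1) psi x) + delta*(u2 (x + d)*(deriv ^^ 1) psi x))"
  using i[OF c, of 1] i[OF s(4), of 1] i[OF s(5), of 1] by simp
 also have "... = (LBINT x. sgm*(ut (x + d)*(deriv ^^ 1) psi x) - um*up / 2*(1*(deriv ^^ 1) psi x))"
 proof (rule int_cong[OF refl])
  fix x
  have "(ut (x + d))^2 / 2 - eps * u1 (x + d) + delta*u2 (x + d) = sgm*ut (x + d) - um*up / 2"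
   unfolding ode sgm by (simp add: power2_eq_square field_simps)
  from arg_cong[OF this, of "%z. z*(deriv ^^ 1) psi x"]
  show "(ut (x + d))^2 / 2*(deriv ^^ 1) psi x - eps * (u1 (x + d)*(deriv ^^ 1) psi x) + delta*(u2 (x + d)*(deriv ^^ 1) psi x) =
   sgm*(ut (x + d)*(deriv ^^ 1) psi x) - um*up / 2*(1*(deriv ^^ 1) psi x)"
   by (simp only: left_diff_distrib distrib_right mult.assoc mult_1)
 qed
 also have "... = sgm*?I (%x. ut (x + d)) 1 - um*up / 2*?I (%x. 1) 1"
  using i[OF s(3), of 1] i[OF continuous_on_const[of UNIV 1], of 1] by simp
 finally show ?thesis unfolding b3 by simp
qed

text \<open>As a function of the displacement the pairing is the convolution of \<open>ut\<close>
  with the reflected test function, so the derivative falls on the latter.\<close>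

lemma ut_pairing_deriv:
 assumes psi: "testf psi"
 shows "DERIV (%d. LBINT x. ut (x + d)*psi x) d :> - (LBINT x. ut (x + d)*deriv psi x)"
proof -
 obtain R where R: "!!x. abs x > R ==> psi x = 0" using test_function_bounds[OF psi] by metis
 obtain R' where R': "!!x. abs x > R' ==> deriv psi x = 0" using test_function_bounds[OF test_function_deriv[OF psi]] by metis
 have s: "smooth psi" using psi by (simp add: test_function_def)
 define phi where "phi z = psi (- z)" for z
 have phi: "DERIV phi z :> - deriv psi (- z)" for z
  using DERIV_chain2[OF smooth_realD(1)[OF s] DERIV_minus[OF DERIV_ident], of z] by (simp add: phi_def[abs_def])
 have "DERIV (conv ut phi) d :> (conv ut (%z. - deriv psi (- z)) d)"
 proof (rule conv_deriv[OF ut_cont(1) phi, where e="max R R'"])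
  show "cont (%z. - deriv psi (- z))"
   by (intro continuous_intros continuous_on_compose2[OF smooth_imp_continuous_on[OF smooth_realD(2)[OF s]]]) auto
 qed (auto simp: phi_def R R')
 moreover have "conv ut phi = (%d. LBINT x. ut (x + d)*psi x)"
 proof
  fix d
  show "conv ut phi d = (LBINT x. ut (x + d)*psi x)"
   using lborel_integral_shift[of "%y. ut y*psi (y - d)" d] by (simp add: conv_def phi_def)
 qed
 moreover have "conv ut (%z. - deriv psi (- z)) d = - (LBINT x. ut (x + d)*deriv psi x)"
  using lborel_integral_shift[of "%y. ut y*deriv psi (y - d)" d] by (simp add: conv_def)
 ultimately show ?thesis by simp
qed

text \<open>Relative to the profile displaced by \<open>d t = -sgm*t - X t\<close>, the perturbation
  \<open>Z\<close> has flux \<open>B = ut*Z + Z^2/2\<close> and source \<open>q = Xd*u1\<close>,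
  since the wave speed \<open>sgm\<close> cancels by \<open>ut_flux\<close> and only the shift
  velocity remains. \<open>commutator_bound\<close> supplies the energy balance with an error
  \<open>e*K'\<close>, and \<open>e\<close> tends to 0.\<close>

theorem contraction:
 assumes T: "trajectory eps delta ul U D" and st: "0 <= s0" "s0 <= t0"
 defines "S == {s0..t0}"
 assumes X: "!!t. t \<in> S ==> (X has_real_derivative Xd t) (at t within S)" "continuous_on S Xd"
  and speed: "!!t. t \<in> S ==> Xd t = shift_speed (- sgm*t - X t) (%x. U t x - ut (x + (- sgm*t - X t)))"
 shows "(nl (%x. U t0 x - ut (x + (- sgm*t0 - X t0))))^2 + 2*rate*integral S (%t. (Xd t)^2)
  <= (nl (%x. U s0 x - ut (x + (- sgm * s0 - X s0))))^2"
proof -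
 define d where "d t = - sgm*t - X t" for t
 define Z where "Z t x = U t x - ut (x + d t)" for t x
 define Zx where "Zx t x = D t x - (u1 (x + d t) - ul1 x)" for t x
 define B where "B t x = ut (x + d t)*Z t x + (Z t x)^2 / 2" for t x
 define q where "q t x = Xd t*u1 (x + d t)" for t x
 obtain C where C: "C > 0" "!!x. abs (ut x) <= C" "!!x. abs (u1 x) <= C" using ut_bounded by blast
 have S: "t >= 0" if "t \<in> S" for t using that st by (simp add: S_def)
 have dd: "(d has_real_derivative - sgm - Xd t) (at t within S)" if "t \<in> S" for t
  unfolding d_def by (auto intro!: derivative_eq_intros X that)
 have dc: "continuous_on S d" by (rule DERIV_continuous_on[OF dd])
 have H: "H1 (Z t) (Zx t)" if "t \<in> S" for t
  using H1_perturbation(1)[OF T S[OF that], of "d t"] by (simp add: Z_def[abs_def] Zx_def[abs_def])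
 obtain L where L: "!!s. s \<in> {0..t0} ==> nl (%x. U s x - ul x) <= L & nl (D s) <= L"
  using trajectory_bounds(2)[OF T, of t0] by blast
 have "compact S" by (simp add: S_def)
 have "bounded (d ` S)" by (rule compact_imp_bounded[OF compact_continuous_image[OF dc \<open>compact S\<close>]])
 then obtain R where R: "!!t. t \<in> S ==> abs (d t) <= R" unfolding bounded_iff by (metis image_eqI real_norm_def)
 define K where "K = abs L + nl (%x. ut x - ul x) + 2*abs R*nl u1 + nl u1 + nl ul1"
 have K0: "K >= 0" by (simp add: K_def)
 have K: "nl (Z t) <= K" "nl (Zx t) <= K" if "t \<in> S" for t
 proof -
  have "2*abs (d t)*nl u1 <= 2*abs R*nl u1" using R[OF that] by (intro mult_right_mono) auto
  moreover have "nl (%x. U t x - ul x) <= L" "nl (D t) <= L" using L[of t] that S[OF that] by (auto simp: S_def)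
  moreover have "0 <= 2*abs R*nl u1" "0 <= nl u1" "0 <= nl ul1" "0 <= nl (%x. ut x - ul x)" by simp_all
  ultimately show "nl (Z t) <= K" "nl (Zx t) <= K"
   using H1_perturbation(2,3)[OF T S[OF that], of "d t"] unfolding K_def Z_def Zx_def by linarith+
 qed
 have sup: "abs (Z t x) <= 2*K" if "t \<in> S" for t x using H1_sup[OF H[OF that], of x] K[OF that] by linarith
 have cU: "continuous_on (S \<times> UNIV) (%(t, x). U t x)"
  by (rule continuous_on_subset[OF trajectory_continuous(1)[OF T ul_cont]]) (use S in auto)
 have cfst: "continuous_on (S \<times> UNIV) (%z. f (fst z))" if "continuous_on S f" for f :: "real => real"
  by (rule continuous_on_compose2[OF that]) (auto intro!: continuous_intros)
 have cs: "continuous_on (S \<times> UNIV) (%z. f (snd z + d (fst z)))" if "cont f" for f :: "real => real"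
  by (rule continuous_on_compose2[OF that]) (auto intro!: continuous_intros cfst dc)
 have cZ: "continuous_on (S \<times> UNIV) (%(t, x). Z t x)"
  using cU cs[OF ut_cont(1)] unfolding Z_def split_beta by (intro continuous_intros)
 have cB: "continuous_on (S \<times> UNIV) (%(t, x). B t x)"
  using cZ cs[OF ut_cont(1)] unfolding B_def split_beta by (intro continuous_intros) auto
 have cq: "continuous_on (S \<times> UNIV) (%(t, x). q t x)"
  using cs[OF ut_cont(2)] cfst[OF X(2)] unfolding q_def split_beta by (intro continuous_intros)
 have sB: "sql (B t)" "nl (B t) <= (C + K)*K" if "t \<in> S" for t
 proof -
  have "B t = (%x. (ut (x + d t) + Z t x / 2)*Z t x)" by (auto simp: B_def power2_eq_square algebra_simps)
  moreover have "abs (ut (x + d t) + Z t x / 2) <= C + K" for x using C(2)[of "x + d t"] sup[OF that, of x] by linarith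
  moreover have "bm (%x. ut (x + d t) + Z t x / 2)"
   by (intro bm_cont continuous_intros ut_shift_deriv H1D(1)[OF H[OF that]]) auto
  ultimately have B: "sql (B t)" "nl (B t) <= (C + K)*nl (Z t)"
   using sql_bounded_mult[OF H1D(2)[OF H[OF that]], of "%x. ut (x + d t) + Z t x / 2" "C + K"] by auto
  show "sql (B t)" by (rule B)
  show "nl (B t) <= (C + K)*K"
   by (rule order_trans[OF B(2) mult_left_mono[OF K(1)[OF that]]]) (use C(1) K0 in simp)
 qed
 have speed': "Xd t = shift_speed (d t) (Z t)" if "t \<in> S" for t
  using speed[OF that] by (simp add: d_def Z_def[abs_def])
 have sq: "sql (q t)" "nl (q t) <= 2*M / (um - up)*nl u1*K*nl u1" if "t \<in> S" for t
 proof -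
  show "sql (q t)" unfolding q_def by (intro sqint_cmult sql_shift ut_sq)
  have "0 <= 2*M / (um - up)*nl u1" using M um_up by simp
  hence "abs (Xd t) <= 2*M / (um - up)*nl u1*K"
   using order_trans[OF shift_speed_bound[OF H1D(2)[OF H[OF that]]] mult_left_mono[OF K(1)[OF that]]] unfolding speed'[OF that] by blast
  hence "abs (Xd t)*nl u1 <= 2*M / (um - up)*nl u1*K*nl u1" by (intro mult_right_mono) auto
  thus "nl (q t) <= 2*M / (um - up)*nl u1*K*nl u1" unfolding q_def nrm_cmult nl_shift .
 qed
 define K2 where "K2 = max K (max ((C + K)*K) (2*M / (um - up)*nl u1*K*nl u1))"
 obtain K' where K': "!!d Z Zx e. 0 < e ==> e <= 1 ==> H1 Z Zx ==> nl Z <= K ==> nl Zx <= K ==>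
  - eps * (nl (conv Z (deriv (moll e))))^2
  + (LBINT x. conv Z (deriv (moll e)) x*conv (%x. ut (x + d)*Z x + (Z x)^2 / 2) (moll e) x)
  + (LBINT x. conv Z (moll e) x*conv (%x. shift_speed d Z*u1 (x + d)) (moll e) x)
  <= - rate*(shift_speed d Z)^2 + e*K'"
  using commutator_bound[OF K0] by blast
 have cont_c: "continuous_on S (%t. - rate*(Xd t)^2 + e*K')" for e by (intro continuous_intros X)
 have en: "(nl (conv (Z t0) (moll e)))^2 - (nl (conv (Z s0) (moll e)))^2 <= 2*integral S (%t. - rate*(Xd t)^2 + e*K')"
  if e: "e > 0" "e <= 1" for e
 proof (rule energy_estimate[OF e(1) st(2), where B=B and q=q and K=K2 and a=eps and b=delta, folded S_def])
  fix psi :: "real => real" and s t assume psi: "testf psi" and st': "s0 <= s" "s <= t" "t <= t0"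
  have sub: "{s..t} \<subseteq> S" using st' by (auto simp: S_def)
  let ?h = "%tau. LBINT x. ut (x + d tau)*psi x"
  let ?h' = "%tau. LBINT x. ut (x + d tau)*deriv psi x"
  have i: "intg (%x. (U t x - U s x)*psi x)" "intg (%x. ut (x + d t)*psi x)" "intg (%x. ut (x + d s)*psi x)"
   using S[of s] S[of t] sub st' by (intro test_integrable[OF psi, where n=0, simplified] continuous_intros trajectory_continuous(2)[OF T ul_cont] ut_shift_deriv; auto)+
  have "(?h has_real_derivative (sgm + Xd tau)*?h' tau) (at tau within {s..t})" if "tau \<in> {s..t}" for tau
   using DERIV_chain2[OF ut_pairing_deriv[OF psi] has_field_derivative_subset[OF dd sub]] sub that
   by (auto simp: algebra_simps)
  hence "((%tau. (sgm + Xd tau)*?h' tau) has_integral (?h t - ?h s)) {s..t}"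
   by (intro fundamental_theorem_of_calculus st') (auto simp: real_vector_deriv)
  from has_integral_diff[OF trajectoryD(4)[OF T _ psi st'(2)] this]
  have "((%tau. flux eps delta (U tau) psi - (sgm + Xd tau)*?h' tau) has_integral ((LBINT x. (U t x - U s x)*psi x) - (?h t - ?h s))) {s..t}"
   using st' st by simp
  also have "(LBINT x. (U t x - U s x)*psi x) - (?h t - ?h s) = (LBINT x. (U t x - U s x)*psi x - (ut (x + d t)*psi x - ut (x + d s)*psi x))"
   using i by simp
  also have "... = (LBINT x. (Z t x - Z s x)*psi x)"
   by (intro int_cong refl) (simp add: Z_def algebra_simps)
  finally show "((%tau. LBINT x. B tau x*deriv psi x + eps * Z tau x*(deriv ^^ 2) psi x + delta*Z tau x*(deriv ^^ 3) psi x + q tau x*psi x)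
    has_integral (LBINT x. (Z t x - Z s x)*psi x)) {s..t}"
  proof (rule has_integral_eq[rotated])
   fix tau assume "tau \<in> {s..t}"
   hence tau: "tau \<in> S" "tau >= 0" using sub S by auto
   note c = trajectory_continuous(2)[OF T ul_cont tau(2)] ut_shift_deriv(3)[of "d tau"]
   have "sgm*?h' tau = flux eps delta (%x. ut (x + d tau)) psi" by (rule ut_flux[OF psi, symmetric])
   moreover have "?h' tau = - (LBINT x. u1 (x + d tau)*psi x)"
    using by_parts_test[OF psi ut_shift_deriv(1,4), of "d tau" 0] by simp
   ultimately have "flux eps delta (U tau) psi - (sgm + Xd tau)*?h' tau
    = (flux eps delta (U tau) psi - flux eps delta (%x. ut (x + d tau)) psi) + (LBINT x. q tau x*psi x)"
    by (simp add: q_def algebra_simps)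
   also have "... = (LBINT x. ((U tau x)^2 - (ut (x + d tau))^2) / 2*deriv psi x + eps * (U tau x - ut (x + d tau))*(deriv ^^ 2) psi x
     + delta*(U tau x - ut (x + d tau))*(deriv ^^ 3) psi x + q tau x*psi x)"
    unfolding flux_diff[OF psi c]
   proof (rule Bochner_Integration.integral_add[symmetric])
    show "intg (%x. q tau x*psi x)" unfolding q_def
     by (intro test_integrable[OF psi, where n=0, simplified] continuous_intros ut_shift_deriv)
    show "intg (%x. ((U tau x)^2 - (ut (x + d tau))^2) / 2*deriv psi x + eps * (U tau x - ut (x + d tau))*(deriv ^^ 2) psi x
     + delta*(U tau x - ut (x + d tau))*(deriv ^^ 3) psi x)"
     by (intro Bochner_Integration.integrable_add test_integrable[OF psi] test_integrable[OF psi, where n=1, simplified] continuous_intros c) auto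
   qed
   also have "... = (LBINT x. B tau x*deriv psi x + eps * Z tau x*(deriv ^^ 2) psi x + delta*Z tau x*(deriv ^^ 3) psi x + q tau x*psi x)"
    by (intro int_cong refl) (simp add: B_def Z_def power2_eq_square field_simps)
   finally show "flux eps delta (U tau) psi - (sgm + Xd tau)*?h' tau = ..." .
  qed
 next
  fix t assume t: "t \<in> S"
  show "- eps * (nl (conv (Z t) (deriv (moll e))))^2 + (LBINT x. conv (Z t) (deriv (moll e)) x*conv (B t) (moll e) x)
   + (LBINT x. conv (Z t) (moll e) x*conv (q t) (moll e) x) <= - rate*(Xd t)^2 + e*K'"
   using K'[OF e H[OF t] K[OF t], of "d t"] unfolding B_def[abs_def] q_def[abs_def] speed'[OF t] by simp
  show "nl (Z t) <= K2" "nl (B t) <= K2" "nl (q t) <= K2"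
   using K(1)[OF t] sB(2)[OF t] sq(2)[OF t] unfolding K2_def by linarith+
 qed (use cZ cB cq sB sq H1D(2)[OF H] cont_c in auto)
 have "(nl (Z t0))^2 - (nl (Z s0))^2 <= 2*(- rate*integral S (%t. (Xd t)^2) + 0*K'*(t0 - s0))"
 proof (rule tendsto_le[OF _ _ tendsto_diff[OF moll_nl_tendsto moll_nl_tendsto]])
  have "integral S (%t. - rate*(Xd t)^2 + e*K') = - rate*integral S (%t. (Xd t)^2) + e*K'*(t0 - s0)" for e
  proof -
   have "(%t. - rate*(Xd t)^2) integrable_on S" "(%t. e*K') integrable_on S" unfolding S_def
    by (intro integrable_continuous_real continuous_intros X(2)[unfolded S_def])+
   hence "integral S (%t. - rate*(Xd t)^2 + e*K') = integral S (%t. - rate*(Xd t)^2) + integral S (%t. e*K')"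
    by (rule Henstock_Kurzweil_Integration.integral_add)
   thus ?thesis using st by (simp add: S_def)
  qed
  moreover have "((%e. 2*(- rate*integral S (%t. (Xd t)^2) + e*K'*(t0 - s0))) ---> 2*(- rate*integral S (%t. (Xd t)^2) + 0*K'*(t0 - s0))) (at_right 0)"
   by (intro tendsto_intros)
  ultimately show "((%e. 2*integral S (%t. - rate*(Xd t)^2 + e*K')) ---> 2*(- rate*integral S (%t. (Xd t)^2) + 0*K'*(t0 - s0))) (at_right 0)"
   by simp
  show "\<forall>\<^sub>F e in at_right 0. (nl (conv (Z t0) (moll e)))^2 - (nl (conv (Z s0) (moll e)))^2 <= 2*integral S (%t. - rate*(Xd t)^2 + e*K')"
   unfolding eventually_at_right_field using en by (intro exI[of _ 1]) auto
  show "H1 (Z t0) (Zx t0)" "H1 (Z s0) (Zx s0)" by (rule H, use st in "simp add: S_def")+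
 qed simp
 thus ?thesis unfolding Z_def d_def by simp
qed

end

section \<open>The differential equation of the shift\<close>

lemma picard:
 fixes G :: "real => real => real"
 assumes c: "continuous_on ({0..T} \<times> UNIV) (%(t, x). G t x)" and L: "L >= 0"
  and lip: "!!t x y. t \<in> {0..T} ==> abs (G t x - G t y) <= L*abs (x - y)"
 shows "EX X. continuous_on {0..T} X & (\<forall>t\<in>{0..T}. X t = integral {0..t} (%s. G s (X s)))"
proof -
 define X where "X n = ((%Y t. integral {0..t} (%s. G s (Y s))) ^^ n) (%_. 0)" for n
 have X: "X 0 = (%_. 0)" "X (Suc n) t = integral {0..t} (%s. G s (X n s))" for n t by (auto simp: X_def)
 have cG: "continuous_on {0..T} (%s. G s (Y s))" if "continuous_on {0..T} Y" for Y
  using continuous_on_compose2[OF c continuous_on_Pair[OF continuous_on_id that]] by auto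
 have cX: "continuous_on {0..T} (X n)" for n
 proof (induction n)
  case (Suc n)
  show ?case unfolding X(2)[abs_def] by (rule indefinite_integral_continuous_1[OF integrable_continuous_real[OF cG[OF Suc]]])
 qed (simp add: X)
 have iG: "(%s. G s (Y s)) integrable_on {0..t}" if "continuous_on {0..T} Y" "t \<in> {0..T}" for Y t
  by (rule integrable_continuous_real, rule continuous_on_subset[OF cG[OF that(1)]]) (use that in auto)
 have "bounded ((%s. G s 0) ` {0..T})"
  by (rule compact_imp_bounded[OF compact_continuous_image[OF cG]]) auto
 then obtain C where C: "!!s. s \<in> {0..T} ==> abs (G s 0) <= C" unfolding bounded_iff by (metis image_eqI real_norm_def)
 \<comment> \<open>The factorial makes the increments summable on the whole of
   \<open>{0..T}\<close>, so no subdivision into short intervals is needed.\<close>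
 have step: "abs (X (Suc n) t - X n t) <= C*L ^ n*(t ^ Suc n / fact (Suc n))" if "t \<in> {0..T}" for n t
  using that
 proof (induction n arbitrary: t)
  case 0
  have "norm (integral {0..t} (%s. G s (X 0 s))) <= C*(t - 0)"
   using 0 C by (intro integral_bound continuous_on_subset[OF cG[OF cX]]) (auto simp: X(1))
  thus ?case by (simp add: X)
 next
  case (Suc n)
  have d: "((%s. L*(C*L ^ n)*(s ^ Suc (Suc n) / fact (Suc (Suc n)))) has_real_derivative
    L*(C*L ^ n)*(s ^ Suc n / fact (Suc n))) (at s within {0..t})" for s :: real
  proof -
   have e: "real (Suc k) * s ^ k / fact (Suc k) = s ^ k / fact k" for k by (simp del: of_nat_Suc)
   show ?thesis
    unfolding e[of "Suc n", symmetric]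
    using DERIV_cmult[OF DERIV_cdivide[OF DERIV_pow[of "Suc (Suc n)" s "{0..t}"], of "fact (Suc (Suc n))"], of "L*(C*L ^ n)"]
    by (simp only: diff_Suc_Suc diff_zero)
  qed
  have p: "((%s. L*(C*L ^ n)*(s ^ Suc n / fact (Suc n))) has_integral L*(C*L ^ n)*(t ^ Suc (Suc n) / fact (Suc (Suc n)))) {0..t}"
   using fundamental_theorem_of_calculus[OF _ d[unfolded real_vector_deriv]] Suc.prems by simp
  have "X (Suc (Suc n)) t - X (Suc n) t = integral {0..t} (%s. G s (X (Suc n) s) - G s (X n s))"
   unfolding X(2)[of "Suc n"] X(2)[of n t]
   by (intro Henstock_Kurzweil_Integration.integral_diff[symmetric] iG cX Suc.prems)
  also have "norm ... <= integral {0..t} (%s. L*(C*L ^ n)*(s ^ Suc n / fact (Suc n)))"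
  proof (rule integral_norm_bound_integral)
   show "(%s. G s (X (Suc n) s) - G s (X n s)) integrable_on {0..t}"
    by (intro integrable_diff iG cX Suc.prems)
   fix s assume s: "s \<in> {0..t}"
   hence s': "s \<in> {0..T}" using Suc.prems by auto
   have "abs (G s (X (Suc n) s) - G s (X n s)) <= L*abs (X (Suc n) s - X n s)" by (rule lip[OF s'])
   also have "... <= L*(C*L ^ n*(s ^ Suc n / fact (Suc n)))" by (rule mult_left_mono[OF Suc.IH[OF s'] L])
   finally show "norm (G s (X (Suc n) s) - G s (X n s)) <= L*(C*L ^ n)*(s ^ Suc n / fact (Suc n))" by (simp add: mult.assoc)
  qed (use p in blast)
  also have "... = L*(C*L ^ n)*(t ^ Suc (Suc n) / fact (Suc (Suc n)))" using p by (rule integral_unique)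
  finally show ?case by (simp add: mult_ac)
 qed
 define Y where "Y t = (\<Sum>n. X (Suc n) t - X n t)" for t
 have ul: "uniform_limit {0..T} (%n t. \<Sum>i<n. X (Suc i) t - X i t) Y sequentially"
  unfolding Y_def
 proof (rule Weierstrass_m_test)
  fix n t assume t: "t \<in> {0..T}"
  have C0: "0 <= C" using order_trans[OF abs_ge_zero C[OF t]] .
  have T0: "0 <= T" using t by simp
  have "t ^ Suc n / fact (Suc n) <= T ^ Suc n / fact n"
   using t by (intro frac_le power_mono fact_mono) auto
  hence "C*L ^ n*(t ^ Suc n / fact (Suc n)) <= C*L ^ n*(T ^ Suc n / fact n)"
   using C0 L by (intro mult_left_mono) auto
  also have "... = C*T*(inverse (fact n)*(L*T) ^ n)"
   by (simp add: power_mult_distrib field_simps)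
  finally show "norm (X (Suc n) t - X n t) <= C*T*(inverse (fact n)*(L*T) ^ n)"
   using step[OF t, of n] by simp
 qed (intro summable_mult summable_exp)
 have tel: "(\<Sum>i<n. X (Suc i) t - X i t) = X n t" for n t by (induction n) (auto simp: X(1))
 have ul: "uniform_limit {0..T} X Y sequentially" using ul unfolding tel .
 have cY: "continuous_on {0..T} Y" by (rule uniform_limit_theorem[OF _ ul]) (use cX in auto)
 have "Y t = integral {0..t} (%s. G s (Y s))" if t: "t \<in> {0..T}" for t
 proof -
  have "(%n. X (Suc n) t) ----> Y t" using tendsto_uniform_limitI[OF ul t] by (rule LIMSEQ_Suc)
  moreover have "(%n. X (Suc n) t) ----> integral {0..t} (%s. G s (Y s))"
  proof (rule LIMSEQ_I)
   fix e :: real assume e: "e > 0"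
   define e' where "e' = e / (L*T + 1)"
   have LT: "L*T >= 0" using L t by auto
   have e': "e' > 0" using e LT unfolding e'_def by (intro divide_pos_pos) auto
   obtain N where N: "!!n s. n >= N ==> s \<in> {0..T} ==> abs (X n s - Y s) < e'"
    using uniform_limitD[OF ul e'] unfolding eventually_sequentially dist_real_def by blast
   show "EX no. ALL n>=no. norm (X (Suc n) t - integral {0..t} (%s. G s (Y s))) < e"
   proof (intro exI[of _ N] allI impI)
    fix n assume n: "n >= N"
    have "X (Suc n) t - integral {0..t} (%s. G s (Y s)) = integral {0..t} (%s. G s (X n s) - G s (Y s))"
     unfolding X(2) by (intro Henstock_Kurzweil_Integration.integral_diff[symmetric] iG cX cY t)
    also have "norm ... <= L*e'*(t - 0)"
    proof (rule integral_bound)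
     show "continuous_on {0..t} (%s. G s (X n s) - G s (Y s))"
      by (intro continuous_intros continuous_on_subset[OF cG[OF cX]] continuous_on_subset[OF cG[OF cY]]) (use t in auto)
     fix s assume s: "s \<in> {0..t}"
     hence s': "s \<in> {0..T}" using t by auto
     show "norm (G s (X n s) - G s (Y s)) <= L*e'"
      using lip[OF s', of "X n s" "Y s"] mult_left_mono[OF less_imp_le[OF N[OF n s']] L] by simp
    qed (use t in auto)
    also have "... <= L*T*e'" using L t e' by (simp add: mult_left_mono mult.commute mult.left_commute)
    also have "... < (L*T + 1)*e'" using e' by (simp add: distrib_right)
    also have "... = e" using LT by (simp add: e'_def)
    finally show "norm (X (Suc n) t - integral {0..t} (%s. G s (Y s))) < e" .
   qed
  qed
  ultimately show ?thesis using LIMSEQ_unique by blast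
 qed
 with cY show ?thesis by blast
qed

text \<open>Difference quotients are bounded by \<open>L\<close> and converge almost everywhere to
  \<open>g\<close>, so their integrals converge. The integral of a quotient is a difference of two
  means of \<open>X\<close>, one over \<open>{t..t + h n}\<close> and one over
  \<open>{0..h n}\<close>, and these tend to \<open>X t\<close> and \<open>X 0\<close>.\<close>

lemma lipschitz_ftc:
 fixes X g :: "real => real"
 assumes X: "L-lipschitz_on {0..} X" and g: "continuous_on {0..} g"
  and ae: "AE t in lebesgue_on {0..}. DERIV X t :> g t"
  and t: "t >= 0"
 shows "X t - X 0 = integral {0..t} g"
proof -
 have cX: "continuous_on {0..} X" by (rule lipschitz_on_continuous_on[OF X])
 define h where "h n = 1 / (real n + 1)" for n
 have h: "h n > 0" "h n <= 1" for n by (auto simp: h_def field_simps)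
 have h0: "h ----> 0"
  unfolding h_def using LIMSEQ_inverse_real_of_nat by (simp add: inverse_eq_divide add.commute)
 define F where "F s = integral {0..s} X" for s
 have F: "(F has_real_derivative X s) (at s within {0..t + 1})" if "s \<in> {0..t + 1}" for s
  unfolding F_def real_vector_deriv
  by (rule integral_has_vector_derivative[OF continuous_on_subset[OF cX] that]) auto
 have q: "(%n. (f (s + h n) - f s) / h n) ----> d" if f: "(f has_real_derivative d) (at s within S)" "!!n. s + h n \<in> S" for f d s S
 proof -
  have "filterlim (%n. s + h n) (at s within S) sequentially"
   unfolding filterlim_at using that(2) tendsto_add[OF tendsto_const[of s] h0] less_imp_neq[OF h(1)] by (auto intro!: always_eventually)
  from filterlim_compose[OF f(1)[unfolded has_field_derivative_iff] this] show ?thesis by simp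
 qed
 define Q where "Q n s = indicator {0..t} s * ((X (s + h n) - X s) / h n)" for n s
 have cQ: "continuous_on {0..t} (%s. (X (s + h n) - X s) / h n)" for n
 proof -
  have "continuous_on {0..t} (%s. X (s + h n))"
   by (rule continuous_on_compose2[OF cX]) (use h(1)[of n] in "auto intro!: continuous_intros")
  thus ?thesis using h(1)[of n] by (intro continuous_intros continuous_on_subset[OF cX]) auto
 qed
 have si: "intg (%s. indicator {0..t} s * f s)" "(LBINT s. indicator {0..t} s * f s) = integral {0..t} f"
  if "continuous_on {0..t} f" for f :: "real => real"
  using borel_integrable_atLeastAtMost'[OF that] set_borel_integral_eq_integral(2)[OF borel_integrable_atLeastAtMost'[OF that]]
  unfolding set_integrable_def set_lebesgue_integral_def by simp_all
 have cg: "continuous_on {0..t} g" by (rule continuous_on_subset[OF g]) auto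
 have "(%n. LBINT s. Q n s) ----> (LBINT s. indicator {0..t} s * g s)"
 proof (rule integral_dominated_convergence[where w="%s. indicator {0..t} s * L"])
  show "(%s. indicator {0..t} s * g s) \<in> borel_measurable lborel" "Q n \<in> borel_measurable lborel" for n
   using si(1)[OF cg] si(1)[OF cQ[of n]] unfolding Q_def by (auto simp: integrable_iff_bounded)
  show "intg (%s. indicator {0..t} s * L)" by (rule si(1)) simp
  show "ae s. norm (Q n s) <= indicator {0..t} s * L" for n
  proof (rule AE_I2)
   fix s
   have "abs (X (s + h n) - X s) <= L*h n" if "s \<in> {0..t}"
    using lipschitz_onD[OF X, of "s + h n" s] that h(1)[of n] by (simp add: dist_real_def)
   thus "norm (Q n s) <= indicator {0..t} s * L" using h(1)[of n] by (auto simp: Q_def indicator_def divide_simps abs_divide)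
  qed
  have "AE s in lebesgue. s \<in> {0..} --> DERIV X s :> g s"
   using ae by (simp add: AE_restrict_space_iff)
  hence "ae s. s \<in> {0..} --> DERIV X s :> g s" by (simp add: AE_completion_iff)
  thus "ae s. (%n. Q n s) ----> indicator {0..t} s * g s"
  proof eventually_elim
   case (elim s)
   show ?case
   proof (cases "s \<in> {0..t}")
    case True
    hence "DERIV X s :> g s" using elim by simp
    from q[OF this] True show ?thesis unfolding Q_def by simp
   qed (simp add: Q_def)
  qed
 qed
 moreover have "(LBINT s. Q n s) = (F (t + h n) - F t) / h n - (F (0 + h n) - F 0) / h n" for n
 proof -
  have iX: "X integrable_on {a..b}" if "a >= 0" for a b
   by (rule integrable_continuous_real[OF continuous_on_subset[OF cX]]) (use that in auto)
  have sh: "(X has_integral integral {h n..t + h n} X) {h n..t + h n}" using iX[of "h n"] h(1)[of n] by (simp add: integrable_integral)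
  have "((%s. X (s + h n)) has_integral integral {h n..t + h n} X) {0..t}"
   using has_integral_shift_real_ivl[of X _ "h n" "t + h n" "h n"] sh by (simp add: add.commute)
  hence 1: "integral {0..t} (%s. X (s + h n)) = integral {h n..t + h n} X" "(%s. X (s + h n)) integrable_on {0..t}" by (auto simp: integral_unique)
  have "(LBINT s. Q n s) = integral {0..t} (%s. (X (s + h n) - X s) / h n)" unfolding Q_def by (rule si(2)[OF cQ])
  also have "... = (integral {h n..t + h n} X - integral {0..t} X) / h n"
   using 1 iX[of 0 t] by (simp add: Henstock_Kurzweil_Integration.integral_diff integral_divide)
  also have "integral {h n..t + h n} X = F (t + h n) - F (h n)"
   using Henstock_Kurzweil_Integration.integral_combine[of 0 "h n" "t + h n" X] iX[of 0] h(1)[of n] t by (simp add: F_def)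
  finally show ?thesis by (simp add: F_def diff_divide_distrib)
 qed
 moreover have "(%n. (F (t + h n) - F t) / h n - (F (0 + h n) - F 0) / h n) ----> X t - X 0"
  by (rule tendsto_diff; rule q[OF F]) (use t h(1) h(2) in "auto intro: add_increasing less_imp_le add_mono order_trans[OF h(2)]")
 ultimately show ?thesis using si(2)[OF cg] LIMSEQ_unique by fastforce
qed

lemma AE_affine:
 assumes "ae x. P (x::real)" "c ~= 0"
 shows "ae x. P (d + c*x)"
proof -
 obtain N where N: "{x \<in> space lborel. ~ P x} \<subseteq> N" "emeasure lborel N = 0" "N \<in> sets lborel" using AE_E[OF assms(1)] by blast
 have "(\<integral>\<^sup>+x. indicator N (d + c*x) \<partial>lborel) = 0"
  using nn_integral_real_affine[of "indicator N" c d] N assms(2) by (simp add: ennreal_mult_eq_top_iff)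
 hence "ae x. indicator N (d + c*x) = (0::ennreal)"
  using N(3) by (subst (asm) nn_integral_0_iff_AE) auto
 thus ?thesis by eventually_elim (use N(1) in "auto simp: indicator_def split: if_splits")
qed

lemma lebesgue_of_AE:
 fixes f g :: "'a::euclidean_space => real"
 assumes "ae x. f x = g x" "bm g"
 shows "f \<in> borel_measurable lebesgue"
 by (rule borel_measurable_AE[of g]) (use assms AE_completion[of "%x. g x = f x"] in "auto intro: measurable_completion elim: AE_mp simp: eq_commute")

context shock_wave begin

text \<open>Velocity prescribed for a shift with value \<open>xi\<close> at time \<open>t\<close>,
  in the frame where the solution is at rest and the profile is displaced by
  \<open>-sgm*t - xi\<close>.\<close>

definition "speed U t xi = shift_speed (- sgm*t - xi) (%x. U t x - ut (x + (- sgm*t - xi)))"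
 for U :: "real => real => real"

text \<open>Splitting at \<open>ul\<close> isolates the dependence on time in \<open>U - ul\<close>.
  In the remainder a translation moves the displacement onto \<open>ul\<close>, whose derivative is
  in L2, so that only one factor depends on it.\<close>

lemma pairing_diff:
 assumes T: "trajectory eps delta ul U D" and t: "t >= 0" "s >= 0"
 shows "abs ((LBINT x. (U t x - ut (x + d))*u1 (x + d)) - (LBINT x. (U s x - ut (x + d'))*u1 (x + d')))
  <= nl u1*nl (%x. U t x - U s x) + (2*nl u2*nl (%x. U s x - ul x) + 2*nl u1*nl ul1)*abs (d - d')"
proof -
 note HU = H1D(2)[OF trajectoryD(1)[OF T]]
 have su: "sql (%x. u1 (x + d))" for d by (rule sql_shift[OF ut_sq(1)])
 have sl: "sql (%x. ul (x + (- d)) - ut x)" for d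
  using sql_shift[OF sqint_minus[OF H1D(2)[OF H1_ut_shift[of d]]], of "- d"] by simp
 have P: "(LBINT x. (U t x - ut (x + d))*u1 (x + d)) = (LBINT x. (U t x - ul x)*u1 (x + d)) + (LBINT x. (ul (x + (- d)) - ut x)*u1 x)"
  if "t >= 0" for t d
 proof -
  have "(LBINT x. (ul (x + (- d)) - ut x)*u1 x) = (LBINT x. (ul x - ut (x + d))*u1 (x + d))"
   using lborel_integral_shift[of "%x. (ul (x + (- d)) - ut x)*u1 x" d] by (simp add: add.commute)
  moreover have "sql (%x. ul x - ut (x + d))" using sqint_minus[OF H1D(2)[OF H1_ut_shift[of d]]] by simp
  ultimately show ?thesis
   using Bochner_Integration.integral_add[OF sqint_mult[OF HU[OF that] su[of d]] sqint_mult[OF _ su[of d]], of "%x. ul x - ut (x + d)"]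
   by (simp add: algebra_simps)
 qed
 have sU: "sql (%x. U t x - U s x)" using sqint_diff[OF HU[OF t(1)] HU[OF t(2)]] by simp
 have "(LBINT x. (U t x - ul x)*u1 (x + d)) - (LBINT x. (U s x - ul x)*u1 (x + d')) =
   (LBINT x. (U t x - U s x)*u1 (x + d)) + (LBINT x. (U s x - ul x)*(u1 (x + d) - u1 (x + d')))"
  unfolding Bochner_Integration.integral_diff[OF sqint_mult[OF HU[OF t(1)] su] sqint_mult[OF HU[OF t(2)] su], symmetric]
   Bochner_Integration.integral_add[OF sqint_mult[OF sU su] sqint_mult[OF HU[OF t(2)] sqint_diff[OF su su]], symmetric]
  by (intro int_cong refl) (simp add: algebra_simps)
 moreover have "(LBINT x. (ul (x + (- d)) - ut x)*u1 x) - (LBINT x. (ul (x + (- d')) - ut x)*u1 x) = (LBINT x. (ul (x + (- d)) - ul (x + (- d')))*u1 x)"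
  unfolding Bochner_Integration.integral_diff[OF sqint_mult[OF sl ut_sq(1)] sqint_mult[OF sl ut_sq(1)], symmetric]
  by (intro int_cong refl) (simp add: algebra_simps)
 moreover have "abs (LBINT x. (U t x - U s x)*u1 (x + d)) <= nl (%x. U t x - U s x)*nl u1"
  using cauchy_schwarz[OF sU su[of d]] by (simp add: nl_shift)
 moreover have "abs (LBINT x. (U s x - ul x)*(u1 (x + d) - u1 (x + d'))) <= nl (%x. U s x - ul x)*(2*abs (d - d')*nl u2)"
  by (rule order_trans[OF cauchy_schwarz[OF HU[OF t(2)] sqint_diff[OF su su]] mult_left_mono[OF translate_diff(2)[OF u1' ut_cont(3) ut_sq(2)]]]) simp
 moreover have "abs (LBINT x. (ul (x + (- d)) - ul (x + (- d')))*u1 x) <= 2*abs ((- d) - (- d'))*nl ul1*nl u1"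
  by (rule order_trans[OF cauchy_schwarz[OF translate_diff(1)[OF ul'(1-3)] ut_sq(1)] mult_right_mono[OF translate_diff(2)[OF ul'(1-3)]]]) simp
 moreover have "abs ((- d) - (- d')) = abs (d - d')" by simp
 moreover have "nl u1*a + (2*nl u2*b + 2*nl u1*nl ul1)*r = a*nl u1 + (b*(2*r*nl u2) + 2*r*nl ul1*nl u1)" for a b r
  by (simp add: algebra_simps)
 ultimately show ?thesis unfolding P[OF t(1)] P[OF t(2)] by (smt (verit))
qed

text \<open>One estimate with constants uniform for \<open>s\<close> in \<open>{0..T}\<close> serves
  two purposes: joint continuity of the speed, and its Lipschitz dependence on the shift (take
  \<open>s = t\<close>).\<close>

lemma speed_diff:
 assumes T: "trajectory eps delta ul U D"
 shows "EX A L. A >= 0 & L >= 0 & (ALL t>=0. \<forall>s\<in>{0..T}. ALL xi eta. abs (speed U t xi - speed U s eta) <= A*nl (%x. U t x - U s x) + L*abs ((sgm*t + xi) - (sgm * s + eta)))"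
proof -
 obtain K where K: "!!s. s \<in> {0..T} ==> nl (%x. U s x - ul x) <= K & nl (D s) <= K"
  using trajectory_bounds(2)[OF T, of T] by blast
 define m where "m = 2*M / (um - up)"
 have m: "m >= 0" using M um_up by (simp add: m_def)
 show ?thesis
 proof (intro exI conjI allI ballI impI)
  show "m*nl u1 >= 0" "m*(2*nl u2*abs K + 2*nl u1*nl ul1) >= 0" using m by (intro mult_nonneg_nonneg add_nonneg_nonneg; simp)+
  fix t s xi eta :: real assume t: "t >= 0" and s: "s \<in> {0..T}"
  define d where "d = - sgm*t - xi"
  define d' where "d' = - sgm * s - eta"
  have "abs (speed U t xi - speed U s eta) =
   m*abs ((LBINT x. (U t x - ut (x + d))*u1 (x + d)) - (LBINT x. (U s x - ut (x + d'))*u1 (x + d')))"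
   unfolding speed_def shift_speed_def d_def[symmetric] d'_def[symmetric] m_def[symmetric] using m
   by (simp only: right_diff_distrib[symmetric] abs_mult abs_minus_cancel abs_of_nonneg)
  also have "... <= m*(nl u1*nl (%x. U t x - U s x) + (2*nl u2*nl (%x. U s x - ul x) + 2*nl u1*nl ul1)*abs (d - d'))"
   using s by (intro mult_left_mono[OF pairing_diff[OF T t] m]) auto
  also have "... <= m*(nl u1*nl (%x. U t x - U s x) + (2*nl u2*abs K + 2*nl u1*nl ul1)*abs (d - d'))"
   using K[OF s] m by (intro mult_left_mono add_mono mult_right_mono order_refl) auto
  also have "abs (d - d') = abs ((sgm*t + xi) - (sgm * s + eta))" unfolding d_def d'_def by linarith
  finally show "abs (speed U t xi - speed U s eta) <= m*nl u1*nl (%x. U t x - U s x)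
   + m*(2*nl u2*abs K + 2*nl u1*nl ul1)*abs ((sgm*t + xi) - (sgm * s + eta))"
   by (simp add: algebra_simps)
 qed
qed

lemma speed_continuous:
 assumes T: "trajectory eps delta ul U D"
 shows "continuous_on ({0..} \<times> UNIV) (%(t, xi). speed U t xi)"
 unfolding continuous_on_def
proof
 fix z :: "real \<times> real" assume z: "z \<in> {0..} \<times> UNIV"
 obtain s eta where sz: "z = (s, eta)" by (cases z)
 hence s: "s \<in> {0..s}" "s >= 0" using z by auto
 obtain A L where AL: "A >= 0" "L >= 0" "!!t s' xi eta. t >= 0 ==> s' \<in> {0..s} ==>
   abs (speed U t xi - speed U s' eta) <= A*nl (%x. U t x - U s' x) + L*abs ((sgm*t + xi) - (sgm * s' + eta))"
  using speed_diff[OF T, of s] by blast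
 let ?F = "at z within {0..} \<times> UNIV"
 have f: "(fst ---> s) ?F" "(snd ---> eta) ?F" using tendsto_fst[of id z] tendsto_snd[of id z] by (auto simp: sz id_def intro!: tendsto_eq_intros)
 have "continuous (at s within {0..}) (%t. nl (%x. U t x - U s x))"
  unfolding continuous_within using trajectoryD(2)[OF T s(2)] by (simp add: nrm_def)
 moreover have "\<forall>\<^sub>F w in ?F. fst w \<in> {0..}" unfolding eventually_at_filter by (rule always_eventually) auto
 moreover have "nl (%x. U s x - U s x) = 0" by (simp add: nrm_def)
 ultimately have n: "((%w. nl (%x. U (fst w) x - U s x)) ---> 0) ?F"
  using continuous_within_tendsto_compose[OF _ _ f(1), of "{0..}" "%t. nl (%x. U t x - U s x)"] by simp
 have "((%w. A*nl (%x. U (fst w) x - U s x) + L*abs ((sgm*fst w + snd w) - (sgm * s + eta))) ---> A*0 + L*abs ((sgm * s + eta) - (sgm * s + eta))) ?F"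
  by (intro tendsto_intros n f)
 hence l: "((%w. A*nl (%x. U (fst w) x - U s x) + L*abs ((sgm*fst w + snd w) - (sgm * s + eta))) ---> 0) ?F" by simp
 have "((%w. speed U (fst w) (snd w) - speed U s eta) ---> 0) ?F"
 proof (rule Lim_null_comparison[OF _ l])
  show "\<forall>\<^sub>F w in ?F. norm (speed U (fst w) (snd w) - speed U s eta) <=
    A*nl (%x. U (fst w) x - U s x) + L*abs ((sgm*fst w + snd w) - (sgm * s + eta))"
   unfolding eventually_at_filter using AL(3)[OF _ s(1)] by (auto intro!: always_eventually)
 qed
 hence "((%w. speed U (fst w) (snd w)) ---> speed U s eta) ?F" by (rule LIM_zero_cancel)
 thus "((%(t, xi). speed U t xi) ---> (case z of (t, xi) => speed U t xi)) ?F"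
  by (simp add: sz case_prod_unfold)
qed

text \<open>The equation of the shift in integrated form, which covers both the Picard solution and
  a given Lipschitz function differentiable almost everywhere.\<close>

definition "follows U T X \<longleftrightarrow> X 0 = 0 & continuous_on {0..T} X & (\<forall>t\<in>{0..T}. X t = integral {0..t} (%s. speed U s (X s)))"
 for U :: "real => real => real"

lemma follows_exists:
 assumes Tr: "trajectory eps delta ul U D" and T: "T > 0"
 shows "EX X. follows U T X"
proof -
 obtain A L where AL: "A >= 0" "L >= 0" "!!t s' xi eta. t >= 0 ==> s' \<in> {0..T} ==>
   abs (speed U t xi - speed U s' eta) <= A*nl (%x. U t x - U s' x) + L*abs ((sgm*t + xi) - (sgm * s' + eta))"
  using speed_diff[OF Tr, of T] by blast
 have "EX X. continuous_on {0..T} X & (\<forall>t\<in>{0..T}. X t = integral {0..t} (%s. speed U s (X s)))"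
 proof (rule picard)
  show "continuous_on ({0..T} \<times> UNIV) (%(t, xi). speed U t xi)"
   by (rule continuous_on_subset[OF speed_continuous[OF Tr]]) auto
  show "abs (speed U t xi - speed U t eta) <= L*abs (xi - eta)" if "t \<in> {0..T}" for t xi eta
   using AL(3)[of t t xi eta] that by (simp add: nrm_def)
 qed (rule AL(2))
 then obtain X where X: "continuous_on {0..T} X" "!!t. t \<in> {0..T} ==> X t = integral {0..t} (%s. speed U s (X s))" by blast
 have "X 0 = 0" using X(2)[of 0] T by simp
 thus ?thesis unfolding follows_def using X by (intro exI[of _ X]) simp
qed

lemma follows_continuous:
 assumes Tr: "trajectory eps delta ul U D" and X: "follows U T X"
 shows "continuous_on {0..T} (%s. speed U s (X s))"
proof -
 have "continuous_on {0..T} X" using X by (simp add: follows_def)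
 thus ?thesis
  using continuous_on_compose2[OF speed_continuous[OF Tr] continuous_on_Pair[OF continuous_on_id], of "{0..T}" X]
  by (simp add: image_subset_iff)
qed

lemma follows_contraction:
 assumes Tr: "trajectory eps delta ul U D" and X: "follows U T X" and t: "t \<in> {0..T}"
 shows "(nl (%x. U t x - ut (x - sgm*t - X t)))^2 + 2*rate*integral {0..t} (%s. (speed U s (X s))^2) <= (nl (%x. U 0 x - ut x))^2"
proof -
 note c = follows_continuous[OF Tr X]
 have d: "(X has_real_derivative speed U s (X s)) (at s within {0..t})" if s: "s \<in> {0..t}" for s
 proof (rule has_field_derivative_transform_within[OF _ zero_less_one s])
  have sub: "{0..t} \<subseteq> {0..T}" using t by auto
  show "((%t. integral {0..t} (%s. speed U s (X s))) has_real_derivative speed U s (X s)) (at s within {0..t})"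
   unfolding real_vector_deriv
   by (rule integral_has_vector_derivative[OF continuous_on_subset[OF c sub] s])
  show "integral {0..r} (%s. speed U s (X s)) = X r" if "r \<in> {0..t}" for r
   using X that t by (auto simp: follows_def)
 qed
 have "(nl (%x. U t x - ut (x + (- sgm*t - X t))))^2 + 2*rate*integral {0..t} (%s. (speed U s (X s))^2)
   <= (nl (%x. U 0 x - ut (x + (- sgm*0 - X 0))))^2"
  by (rule contraction[OF Tr]) (use t d c in "auto simp: speed_def intro: continuous_on_subset")
 moreover have "X 0 = 0" using X by (simp add: follows_def)
 moreover have "(%x. U t x - ut (x + (- sgm*t - X t))) = (%x. U t x - ut (x - sgm*t - X t))" by (simp add: algebra_simps)
 ultimately show ?thesis by simp
qed

text \<open>Translating the integration variable by \<open>X t\<close> turns the integral that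
  defines the shift into \<open>speed\<close>; \<open>lipschitz_ftc\<close> then integrates the
  equation, which is given only for almost every time.\<close>

lemma shift_function_follows:
 assumes Tr: "trajectory eps delta ul U D" and X: "shift_function M sgm um up ut u X" and T: "T >= 0"
  and u: "!!t. t >= 0 ==> ae x. u t x = U t x"
 shows "follows U T X"
proof -
 note X = X[unfolded shift_function_def]
 obtain L where L: "L-lipschitz_on {0..} X" using conjunct1[OF X] ..
 note X0 = conjunct1[OF conjunct2[OF X]] and ae = conjunct2[OF conjunct2[OF X]]
 have cX: "continuous_on {0..} X" by (rule lipschitz_on_continuous_on[OF L])
 have c: "continuous_on {0..} (%t. speed U t (X t))"
  using continuous_on_compose2[OF speed_continuous[OF Tr] continuous_on_Pair[OF continuous_on_id cX]] by auto
 have d: "deriv ut x = u1 x" for x by (rule DERIV_imp_deriv[OF ut'])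
 have e: "- (2*M / (um - up))*(LINT x|lebesgue. (u t (x + X t) - ut (x - sgm*t))*deriv ut (x - sgm*t)) = speed U t (X t)" if t: "t >= 0" for t
 proof -
  let ?g = "%x. (U t (x + X t) - ut (x - sgm*t))*u1 (x - sgm*t)"
  have cU: "cont (%x. U t (x + X t))"
   by (rule continuous_on_compose2[OF trajectory_continuous(2)[OF Tr ul_cont t]]) (auto intro!: continuous_intros)
  have m: "bm ?g"
   using bm_cont[OF cU] by measurable
  have a: "ae x. (u t (x + X t) - ut (x - sgm*t))*deriv ut (x - sgm*t) = ?g x"
   using AE_affine[where P="%x. u t x = U t x" and c=1 and d="X t", OF u[OF t] one_neq_zero] by eventually_elim (simp add: d add.commute)
  have "(LINT x|lebesgue. (u t (x + X t) - ut (x - sgm*t))*deriv ut (x - sgm*t)) = (LBINT x. ?g x)"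
   by (rule lebesgue_integral_rep(1)[OF lebesgue_of_AE[OF a m] m a])
  also have "... = (LBINT x. (U t x - ut (x + (- sgm*t - X t)))*u1 (x + (- sgm*t - X t)))"
   using lborel_integral_shift[of ?g "- X t"] by (simp add: algebra_simps)
  finally show ?thesis by (simp only: speed_def shift_speed_def)
 qed
 have "AE t in lebesgue_on {0..}. DERIV X t :> speed U t (X t)"
  by (rule AE_mp[OF ae], rule AE_I2, rule impI, subst e[symmetric]) (simp, assumption)
 hence "X t = integral {0..t} (%s. speed U s (X s))" if "t >= 0" for t
  using lipschitz_ftc[OF L c _ that] X0 by simp
 thus ?thesis unfolding follows_def using X0 continuous_on_subset[OF cX] by auto
qed

end

section \<open>Rescaling and the stability estimate\<close>

lemma deriv_n_scale:
 assumes "smooth (phi :: real => real)"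
 shows "(deriv ^^ n) (%x. phi (c*x)) = (%x. c ^ n*(deriv ^^ n) phi (c*x))"
proof (induction n)
 case (Suc n)
 have "DERIV (%x. c ^ n*(deriv ^^ n) phi (c*x)) x :> c ^ n*((deriv ^^ Suc n) phi (c*x)*c)" for x
  by (rule DERIV_cmult[OF DERIV_chain2[OF smooth_deriv_n_has_derivative[OF assms]]]) (auto intro!: derivative_eq_intros)
 from DERIV_imp_deriv[OF this]
 have "deriv (%x. c ^ n*(deriv ^^ n) phi (c*x)) x = c ^ Suc n*(deriv ^^ Suc n) phi (c*x)" for x
  by (simp add: mult_ac)
 thus ?case by (auto simp: Suc)
qed simp

lemma test_function_scale:
 assumes phi: "testf (phi :: real => real)" and c: "c > 0"
 shows "testf (%x. phi (c*x))"
proof -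
 obtain R where R: "!!x. abs x > R ==> phi x = 0" using test_function_bounds[OF phi] by metis
 show ?thesis
 proof (rule test_function_UNIV_I[of _ "R / c"])
  show "smooth (%x. phi (c*x))" using smooth_real_affine[of phi c 0] phi by (simp add: test_function_def)
  show "phi (c*x) = 0" if "abs x > R / c" for x
   using that c by (intro R) (simp add: field_simps abs_mult)
 qed
qed

lemma lborel_scale: "c > 0 ==> (LBINT x. f (c*x)) = (LBINT x. f x) / c" for f :: "real => real"
 using lborel_integral_real_affine[of c f 0] by simp

lemma sql_scale:
 assumes "sql f" "c > 0" shows "sql (%x. f (c*x))" "nl (%x. f (c*x)) = nl f / sqrt c"
proof -
 show "sql (%x. f (c*x))" using sql_affine(1)[OF assms(1), of c 0] assms(2) by simp
 show "nl (%x. f (c*x)) = nl f / sqrt c"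
  unfolding nrm_def lborel_scale[OF assms(2), of "%x. (f x)^2"] by (rule real_sqrt_divide)
qed

lemma H1_scale:
 assumes H: "H1 Z D" and c: "c > 0"
 shows "H1 (%x. Z (c*x)) (%x. c*D (c*x))"
 unfolding H1_def
proof (intro conjI allI impI)
 show "cont (%x. Z (c*x))"
  by (rule continuous_on_compose2[OF H1D(1)[OF H]]) (auto intro!: continuous_intros)
 show "sql (%x. Z (c*x))" "sql (%x. c*D (c*x))" using H1D(2,3)[OF H] c by (intro sqint_cmult sql_scale; simp)+
 fix x y :: real assume "x <= y"
 hence "Z (c*y) - Z (c*x) = (LBINT s. D s * indicator {c*x..c*y} s)" using c by (intro H1D(4)[OF H]) simp
 also have "... = c*(LBINT s. D (c * s)*indicator {c*x..c*y} (c * s))" using lborel_scale[OF c, of "%s. D s * indicator {c*x..c*y} s"] c by simp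
 also have "... = (LBINT s. c*D (c * s)*indicator {x..y} s)"
  using c by (simp add: indicator_def mult.assoc)
 finally show "Z (c*y) - Z (c*x) = (LBINT s. c*D (c * s)*indicator {x..y} s)" .
qed

text \<open>Test functions are scaled the other way, to \<open>psi (x/c)\<close>. Each space
  derivative then yields \<open>1/c\<close>, which cancels against \<open>c*a\<close>,
  \<open>c^2*b\<close> and the Jacobian.\<close>

lemma trajectory_scale:
 assumes T: "trajectory (c*a) (c^2*b) ul U D" and c: "c > 0"
 shows "trajectory a b (%x. ul (c*x)) (%t x. U (c*t) (c*x)) (%t x. c*D (c*t) (c*x))"
 unfolding trajectory_def
proof (intro conjI allI impI; (elim conjE)?)
 have c0: "c*t >= 0" if "t >= 0" for t using that c by simp
 fix t :: real assume t: "t >= 0"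
 show "H1 (%x. U (c*t) (c*x) - ul (c*x)) (%x. c*D (c*t) (c*x))"
  by (rule H1_scale[OF trajectoryD(1)[OF T c0[OF t]] c])
next
 have c0: "c*t >= 0" if "t >= 0" for t using that c by simp
 have lim: "((%t. f (c*t)) ---> 0) (at s within {0..})" if "(f ---> 0) (at (c * s) within {0..})" for f :: "real => real" and s
 proof -
  have "filterlim (%t. c*t) (at (c * s) within {0..}) (at s within {0..})"
   unfolding filterlim_at using c by (auto simp: eventually_at_filter intro!: tendsto_intros always_eventually)
  from filterlim_compose[OF that this] show ?thesis .
 qed
 fix s :: real assume s: "s >= 0"
 have U: "sql (%x. U (c*t) x - U (c * s) x)" "sql (%x. D (c*t) x - D (c * s) x)" if "t >= 0" for t
  using sqint_diff[OF H1D(2)[OF trajectoryD(1)[OF T c0[OF that]]] H1D(2)[OF trajectoryD(1)[OF T c0[OF s]]]]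
   sqint_diff[OF H1D(3)[OF trajectoryD(1)[OF T c0[OF that]]] H1D(3)[OF trajectoryD(1)[OF T c0[OF s]]]] by simp_all
 show "((%t. nl (%x. U (c*t) (c*x) - U (c * s) (c*x))) ---> 0) (at s within {0..})"
 proof (rule Lim_transform_eventually)
  show "((%t. nl (%x. U (c*t) x - U (c * s) x) / sqrt c) ---> 0) (at s within {0..})"
   using tendsto_divide[OF lim[OF trajectoryD(2)[OF T c0[OF s]]] tendsto_const[of "sqrt c"]] c by simp
  show "\<forall>\<^sub>F t in at s within {0..}. nl (%x. U (c*t) x - U (c * s) x) / sqrt c = nl (%x. U (c*t) (c*x) - U (c * s) (c*x))"
   unfolding eventually_at_filter using sql_scale(2)[OF U(1) c] by (intro always_eventually) auto
 qed
 show "((%t. nl (%x. c*D (c*t) (c*x) - c*D (c * s) (c*x))) ---> 0) (at s within {0..})"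
 proof (rule Lim_transform_eventually)
  show "((%t. c*(nl (%x. D (c*t) x - D (c * s) x) / sqrt c)) ---> 0) (at s within {0..})"
   using tendsto_mult[OF tendsto_const[of c] tendsto_divide[OF lim[OF trajectoryD(3)[OF T c0[OF s]]] tendsto_const[of "sqrt c"]]] c by simp
  show "\<forall>\<^sub>F t in at s within {0..}. c*(nl (%x. D (c*t) x - D (c * s) x) / sqrt c) = nl (%x. c*D (c*t) (c*x) - c*D (c * s) (c*x))"
   unfolding eventually_at_filter right_diff_distrib[symmetric] nrm_cmult using sql_scale(2)[OF U(2) c] c by (intro always_eventually) auto
 qed
next
 fix psi :: "real => real" and s t :: real assume psi: "testf psi" and s: "0 <= s" and st: "s <= t"
 define phi where "phi x = psi (1 / c*x)" for x
 have spsi: "smooth psi" using psi by (simp add: test_function_def)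
 have phi: "testf phi" "(deriv ^^ n) phi x = (deriv ^^ n) psi (1 / c*x) / c ^ n" for n x
  using test_function_scale[OF psi, of "1 / c"] deriv_n_scale[OF spsi, of n "1 / c"] c by (auto simp: phi_def[abs_def] power_one_over)
 have fl: "flux (c*a) (c^2*b) w phi = flux a b (%x. w (c*x)) psi" for w
 proof -
  have "flux (c*a) (c^2*b) w phi = c*(LBINT x. (w (c*x))^2 / 2*deriv phi (c*x) + c*a*w (c*x)*(deriv ^^ 2) phi (c*x)
    + c^2*b*w (c*x)*(deriv ^^ 3) phi (c*x))"
   unfolding flux_def using lborel_scale[OF c, of "%x. (w x)^2 / 2*deriv phi x + c*a*w x*(deriv ^^ 2) phi x + c^2*b*w x*(deriv ^^ 3) phi x"] c by simp
  also have "... = (LBINT x. c*((w (c*x))^2 / 2*deriv phi (c*x) + c*a*w (c*x)*(deriv ^^ 2) phi (c*x)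
    + c^2*b*w (c*x)*(deriv ^^ 3) phi (c*x)))" by simp
  also have "... = flux a b (%x. w (c*x)) psi"
   unfolding flux_def phi(2) phi(2)[of 1, simplified] using c
   by (intro int_cong refl) (simp add: field_simps power2_eq_square power3_eq_cube)
  finally show ?thesis .
 qed
 have "((%tau. flux (c*a) (c^2*b) (U tau) phi) has_integral (LBINT x. (U (c*t) x - U (c * s) x)*phi x)) {c * s..c*t}"
  by (rule trajectoryD(4)[OF T _ phi(1)]) (use s st c in auto)
 note I = has_integral_affinity'[OF this[folded cbox_interval], of c 0]
 have k: "inverse c*(c*r) = r" for r using c by simp
 have "((%tau. flux (c*a) (c^2*b) (U (c*tau)) phi) has_integral (LBINT x. (U (c*t) x - U (c * s) x)*phi x) / c) {s..t}"
  using I c by (simp add: k divide_inverse mult.commute)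
 moreover have "(LBINT x. (U (c*t) x - U (c * s) x)*phi x) / c = (LBINT x. (U (c*t) (c*x) - U (c * s) (c*x))*psi x)"
  using lborel_scale[OF c, of "%x. (U (c*t) x - U (c * s) x)*phi x"] c by (simp add: phi_def)
 ultimately show "((%tau. flux a b (%x. U (c*tau) (c*x)) psi) has_integral (LBINT x. (U (c*t) (c*x) - U (c * s) (c*x))*psi x)) {s..t}"
  by (simp add: fl)
qed

lemma continuous_AE_eq:
 fixes f g :: "real => real"
 assumes c: "cont f" "cont g" and ae: "ae x. f x = g x"
 shows "f = g"
proof -
 have "closed {x. f x = g x}" by (intro closed_Collect_eq c)
 moreover have "AE x in lebesgue. x \<in> {x. f x = g x}" using AE_completion[OF ae] by simp
 ultimately have "{x. f x = g x} = UNIV" using mem_closed_if_AE_lebesgue by blast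
 thus ?thesis by auto
qed

context shock_wave begin

lemma ul_bounded: "EX L. ALL x. abs (ul x) <= L"
proof -
 obtain C where C: "!!x. abs (ut x) <= C" using ut_bounded by blast
 have "abs (ul x) <= C + (nl (%x. ut x - ul x) + nl (%x. u1 x - ul1 x))" for x
  using H1_sup[OF H1_ut, of x] C[of x] by linarith
 thus ?thesis by blast
qed

text \<open>Both sides solve the equation with \<open>eps\<close> and \<open>delta\<close> and the
  same initial values. The rescaled solution comes with the reference \<open>ul (nu*x)\<close>, so
  the reference is changed before uniqueness is applied.\<close>

lemma scaled_trajectory:
 assumes U: "trajectory eps delta ul U D" and W: "trajectory (nu*eps) (nu^2*delta) ul W E" and nu: "nu > 0"
  and init: "ae x. U 0 x = u0 x" "ae x. W 0 x = u0 (x / nu)" and t: "t >= 0"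
 shows "W (nu*t) (nu*x) = U t x"
proof -
 have c: "cont (%x. ul (nu*x))" by (rule continuous_on_compose2[OF ul_cont]) (auto intro!: continuous_intros)
 \<comment> \<open>The entropy shock is invariant under scaling, so both \<open>ul x\<close> and
   \<open>ul (nu*x)\<close> are square integrable perturbations of it.\<close>
 have s: "sql (%x. ul x - ul (nu*x))"
 proof -
  have "es um up (nu*x) = es um up x" for x using nu by (simp add: entropy_shock_def mult_less_0_iff)
  thus ?thesis using sqint_diff[OF ul'(4) sql_scale(1)[OF ul'(4) nu]] by simp
 qed
 have "H1 (%x. ul x - ul (nu*x)) (%x. ul1 x - ul1 (nu*x)*nu)"
 proof (rule C1_H1)
  show "DERIV (%x. ul x - ul (nu*x)) x :> ul1 x - ul1 (nu*x)*nu" for x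
   by (intro DERIV_diff ul'(1) DERIV_chain2[OF ul'(1)]) (auto intro!: derivative_eq_intros)
  show "cont (%x. ul1 x - ul1 (nu*x)*nu)"
   by (intro continuous_intros ul'(2) continuous_on_compose2[OF ul'(2)]) auto
  show "sql (%x. ul1 x - ul1 (nu*x)*nu)"
   using sqint_diff[OF ul'(3) sqint_cmult[OF sql_scale(1)[OF ul'(3) nu], of nu]] by (simp add: mult.commute)
 qed (rule s)
 note W' = trajectory_reference[OF trajectory_scale[OF W nu] this]
 have "(%x. W (nu*0) (nu*x)) = U 0"
 proof (rule continuous_AE_eq)
  show "cont (%x. W (nu*0) (nu*x))" "cont (U 0)"
   using trajectory_continuous(2)[OF W' ul_cont, of 0] trajectory_continuous(2)[OF U ul_cont, of 0] by simp_all
  have "ae x. W 0 (0 + nu*x) = u0 ((0 + nu*x) / nu)"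
   by (rule AE_affine[where P="%x. W 0 x = u0 (x / nu)", OF init(2)]) (use nu in simp)
  thus "ae x. W (nu*0) (nu*x) = U 0 x"
   using init(1) by eventually_elim (use nu in simp)
 qed
 hence i: "W (nu*0) (nu*x) = U 0 x" for x by (rule fun_cong)
 obtain L where L: "!!x. abs (ul x) <= L" using ul_bounded by blast
 show ?thesis
  by (rule fun_cong[OF trajectory_unique[OF eps W' U ul_cont L i t]])
qed

text \<open>In unscaled variables the deviation from the shifted shock is at most \<open>C\<close>:
  the contraction bounds the distance to the shifted profile by the initial one, and the distance
  from profile to shock is fixed. Scaling in \<open>x\<close> multiplies an L2 norm by
  \<open>sqrt nu\<close>.\<close>

theorem shock_stability:
 assumes u0: "in_H 1 (%x. u0 x - ut x)"
 shows "EX C>0. ALL u X. scaled_solution ul eps delta 1 u0 u & shift_function M sgm um up ut u X -->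
      (ALL nu>0. ALL w. scaled_solution ul eps delta nu (%x. u0 (x / nu)) w -->
       (ALL t>0.
         in_L2 UNIV (%x. w t x - es um up (x - sgm*t - nu*X (t / nu))) &
         L2_norm UNIV (%x. w t x - es um up (x - sgm*t - nu*X (t / nu)))
          <= L2_norm UNIV (%x. u0 x - es um up x) + C * sqrt nu))"
proof -
 obtain Z0 D0 where Z0: "H1 Z0 D0" "ae x. u0 x - ut x = Z0 x" using in_H1_rep[OF u0] by metis
 define C where "C = nl Z0 + nl (%x. ut x - es um up x) + 1"
 have C: "C > 0" unfolding C_def by (intro add_nonneg_pos) auto
 have em [measurable]: "bm (es um up)" unfolding entropy_shock_def[abs_def] by measurable
 show ?thesis
 proof (intro exI conjI allI impI; (elim conjE)?)
  show "C > 0" by (rule C)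
 next
  fix u X nu w and t :: real
  assume u: "scaled_solution ul eps delta 1 u0 u" and X: "shift_function M sgm um up ut u X" and nu: "nu > 0"
   and w: "scaled_solution ul eps delta nu (%x. u0 (x / nu)) w" and t: "t > 0"
  obtain U D where U: "trajectory eps delta ul U D" "!!t. t >= 0 ==> ae x. u t x = U t x"
   using trajectory_exists[OF u[unfolded scaled_solution_def] ul_cont] by (metis mult_1 one_power2)
  obtain W E where W: "trajectory (nu*eps) (nu^2*delta) ul W E" "!!t. t >= 0 ==> ae x. w t x = W t x"
   using trajectory_exists[OF w[unfolded scaled_solution_def] ul_cont] by metis
  have "ae x. u 0 x = u0 x" "ae x. w 0 x = u0 (x / nu)"
   using u w by (auto simp: scaled_solution_def global_solution_def AE_completion_iff)
  with U(2)[of 0] W(2)[of 0] have i: "ae x. U 0 x = u0 x" "ae x. W 0 x = u0 (x / nu)"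
   by (auto elim: eventually_elim2)
  define s where "s = t / nu"
  have s: "s >= 0" "t = nu * s" using t nu by (auto simp: s_def)
  have Wt: "W t x = U s (1 / nu*x)" for x
   using scaled_trajectory[OF U(1) W(1) nu i s(1), of "1 / nu*x"] nu by (simp add: s)
  let ?e = "%x. es um up (x - sgm*t - nu*X (t / nu))"
  let ?f = "%y. U s y - es um up (y - sgm * s - X s)"
  let ?d = "- sgm * s - X s"
  note F = shift_function_follows[OF U(1) X s(1) U(2)]
  have "0 <= 2*rate*integral {0..s} (%r. (speed U r (X r))^2)"
   using rate follows_continuous[OF U(1) F] by (intro mult_nonneg_nonneg Henstock_Kurzweil_Integration.integral_nonneg integrable_continuous_real continuous_intros) auto
  moreover have "s \<in> {0..s}" using s(1) by simp
  ultimately have "(nl (%x. U s x - ut (x - sgm * s - X s)))^2 <= (nl (%x. U 0 x - ut x))^2"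
   using follows_contraction[OF U(1) F, of s] by linarith
  hence 1: "nl (%x. U s x - ut (x - sgm * s - X s)) <= nl (%x. U 0 x - ut x)" by simp
  have H: "sql (%x. U r x - ut (x + d))" if "r >= 0" for r d by (rule H1D(2)[OF H1_perturbation(1)[OF U(1) that]])
  have "ae x. abs (U 0 x - ut x) <= abs (Z0 x)" using i(1) Z0(2) by eventually_elim simp
  hence 2: "nl (%x. U 0 x - ut x) <= nl Z0"
   using sqint_measurable[OF H[of 0 0]] by (intro sqint_bound(2)[OF H1D(2)[OF Z0(1)]]) auto
  have f: "sql ?f" "nl ?f <= C"
  proof -
   have H': "sql (%x. U s x - ut (x - sgm * s - X s))" using H[OF s(1), of ?d] by (simp add: algebra_simps)
   have t: "sql (%x. ut (x - sgm * s - X s) - es um up (x - sgm * s - X s))"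
    "nl (%x. ut (x - sgm * s - X s) - es um up (x - sgm * s - X s)) = nl (%x. ut x - es um up x)"
    using sql_shift[OF ut_sq(3), of ?d] nl_shift[of "%x. ut x - es um up x" ?d] by (simp_all add: algebra_simps)
   show "sql ?f" using sqint_add[OF H' t(1)] by simp
   show "nl ?f <= C" using nrm_triangle[OF H' t(1)] 1 2 t(2) by (simp add: C_def)
  qed
  have e: "?e x = es um up (1 / nu*x - sgm * s - X s)" for x
  proof -
   have "x - sgm*t - nu*X (t / nu) = nu*(1 / nu*x - sgm * s - X s)" using nu by (simp add: s(2) s_def[symmetric] right_diff_distrib)
   thus ?thesis using nu by (simp add: entropy_shock_def mult_less_0_iff)
  qed
  have g: "sql (%x. ?f (1 / nu*x))" "nl (%x. ?f (1 / nu*x)) = nl ?f / sqrt (1 / nu)"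
   using sql_scale[OF f(1), of "1 / nu"] nu by simp_all
  have ae: "ae x. w t x - ?e x = ?f (1 / nu*x)"
   using W(2)[of t] t unfolding e by (auto simp: Wt)
  note r = in_L2_rep[OF lebesgue_of_AE[OF ae] _ ae]
  have "nl ?f / sqrt (1 / nu) <= C * sqrt nu" using f(2) nu by (simp add: real_sqrt_divide)
  moreover have "L2_norm UNIV (%x. u0 x - es um up x) >= 0" by (simp add: L2_norm_def)
  ultimately show "in_L2 UNIV (%x. w t x - ?e x)"
   "L2_norm UNIV (%x. w t x - ?e x) <= L2_norm UNIV (%x. u0 x - es um up x) + C * sqrt nu"
   using r g sqint_measurable[OF g(1)] by simp_all
 qed
qed

end

section \<open>Density of test functions and well-prepared data\<close>

lemma L2_dominated:
 assumes w: "sqint M w" and F: "!!n. F n \<in> borel_measurable M" "f \<in> borel_measurable M"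
  and b: "!!n. AE x in M. abs (F n x) <= abs (w x)" and l: "AE x in M. (%n. F n x) ----> f x"
 shows "(%n. nrm M (%x. F n x - f x)) ----> 0" "sqint M f" "!!n. sqint M (F n)"
proof -
 have fw: "AE x in M. abs (f x) <= abs (w x)"
 proof -
  have "AE x in M. ALL n. abs (F n x) <= abs (w x)" using b by (simp add: AE_all_countable)
  with l show ?thesis by eventually_elim (rule LIMSEQ_le_const2[OF tendsto_rabs], auto)
 qed
 show "sqint M f" "!!n. sqint M (F n)" using sqint_bound(1)[OF w] F fw b by auto
 have "(%n. \<integral>x. (F n x - f x)^2 \<partial>M) ----> (LINT x|M. 0)"
 proof (rule integral_dominated_convergence[where w="%x. 4*(w x)^2"])
  show "AE x in M. (%n. (F n x - f x)^2) ----> 0"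
   using l by eventually_elim (auto intro!: tendsto_eq_intros)
  show "AE x in M. norm ((F n x - f x)^2) <= 4*(w x)^2" for n
   using b[of n] fw
  proof eventually_elim
   case (elim x)
   have "abs (F n x - f x) <= 2*abs (w x)" using elim by linarith
   from power_mono[OF this, of 2] show ?case by (simp add: power_mult_distrib)
  qed
 qed (use w F in "auto simp: sqint_def")
 thus "(%n. nrm M (%x. F n x - f x)) ----> 0" unfolding nrm_def using tendsto_real_sqrt by fastforce
qed

lemma real_polynomial_smooth: "real_polynomial_function (p :: real => real) ==> smooth p"
proof (induction rule: real_polynomial_function.induct)
 case (linear f)
 then obtain c where "f = (%x. x*c)" unfolding real_bounded_linear by blast
 moreover have "smooth (%x. c*x)" by (intro smooth_cmult smooth_id)
 ultimately show ?case by (simp add: mult.commute)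
qed auto

lemma smooth_cutoff:
 assumes "R > 0"
 defines "kap == %x. step (x + R + 1) * step (R + 1 - x)"
 shows "smooth kap" "abs x <= R ==> kap x = 1" "abs x >= R + 1 ==> kap x = 0" "0 <= kap x" "kap x <= 1"
proof -
 have "smooth (%x. step (1*x + (R + 1)) * step (-1*x + (R + 1)))" by (intro smooth_mult smooth_real_affine smooth_step)
 thus "smooth kap" by (simp add: kap_def add.assoc)
 show "abs x <= R ==> kap x = 1" "abs x >= R + 1 ==> kap x = 0" unfolding kap_def by (auto simp: step abs_if split: if_splits)
 show "0 <= kap x" "kap x <= 1" unfolding kap_def by (auto intro!: mult_nonneg_nonneg mult_le_one step)
qed

text \<open>Three approximations within \<open>e/3\<close> each: truncation in height and in space;
  continuous functions converging almost everywhere, under the same truncation; and a polynomial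
  from Stone-Weierstrass times a smooth cutoff.\<close>

lemma test_function_dense:
 assumes f: "sql f" and e: "e > 0"
 shows "EX g. testf g & sql g & nl (%x. g x - f x) < e"
proof -
 define clamp where "clamp R y = max (- R) (min R y)" for R y :: real
 have clamp: "abs (clamp R y) <= abs y" "abs (clamp R y) <= R" "abs y <= R ==> clamp R y = y" if "R >= 0" for R y
  using that by (auto simp: clamp_def)
 define kap where "kap R x = step (x + R + 1) * step (R + 1 - x)" for R x
 note kap = smooth_cutoff[folded kap_def]
 have mkap [measurable]: "bm (kap R)" if "R > 0" for R using kap(1)[OF that] by (rule smooth_borel)
 have mf [measurable]: "bm f" using f by (simp add: sqint_def)
 have "(%n. nl (%x. clamp (real (Suc n)) (f x)*kap (real (Suc n)) x - f x)) ----> 0"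
 proof (rule L2_dominated(1)[OF f])
  show "(%x. clamp (real (Suc n)) (f x)*kap (real (Suc n)) x) \<in> borel_measurable lborel" for n
   using mkap[of "real (Suc n)"] unfolding clamp_def by simp
  show "ae x. abs (clamp (real (Suc n)) (f x)*kap (real (Suc n)) x) <= abs (f x)" for n
   unfolding abs_mult
  proof (rule AE_I2)
   fix x
   show "abs (clamp (real (Suc n)) (f x))*abs (kap (real (Suc n)) x) <= abs (f x)"
    using mult_mono[OF clamp(1)[of "real (Suc n)" "f x"], of "abs (kap (real (Suc n)) x)" 1] kap(4,5)[of "real (Suc n)" x] by simp
  qed
  show "ae x. (%n. clamp (real (Suc n)) (f x)*kap (real (Suc n)) x) ----> f x"
  proof (intro AE_I2 tendsto_eventually)
   fix x
   obtain N where N: "real N >= abs x + abs (f x)" using real_arch_simple by blast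
   have "clamp (real (Suc n)) (f x)*kap (real (Suc n)) x = f x" if "n >= N" for n
   proof -
    have "real n >= real N" using that by simp
    hence "abs x <= real (Suc n)" "abs (f x) <= real (Suc n)" using N by simp_all
    thus ?thesis using clamp(3)[of "real (Suc n)" "f x"] kap(2)[of "real (Suc n)" x] by simp
   qed
   thus "\<forall>\<^sub>F n in sequentially. clamp (real (Suc n)) (f x)*kap (real (Suc n)) x = f x"
    unfolding eventually_sequentially by blast
  qed
 qed (use mf in simp)
 then obtain N where N: "nl (%x. clamp (real (Suc N)) (f x)*kap (real (Suc N)) x - f x) < e / 3"
  using LIMSEQ_D[of _ 0 "e/3"] e by fastforce
 define R where "R = real (Suc N)"
 have R: "R > 0" by (simp add: R_def)
 define F where "F x = clamp R (f x)*kap R x" for x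
 have F: "nl (%x. F x - f x) < e / 3" using N by (simp add: F_def R_def)
 have "f measurable_on UNIV"
  using lebesgue_measurable_imp_measurable_on[of f UNIV] measurable_completion[of f lborel borel] mf by simp
 then obtain A h where A: "negligible A" and h: "!!n. cont (h n :: real => real)" "!!x. x \<notin> A ==> (%n. h n x) ----> f x"
  unfolding measurable_on_def by auto
 have i: "sql (%x. R*indicator {-(R+1)..R+1} x)" using sql_indicator(1)[of "-(R+1)" "R+1"] R by (intro sqint_cmult) simp
 have cut: "abs (clamp R y*kap R x) <= abs (R*indicator {-(R+1)..R+1} x)" for x y
 proof (cases "abs x >= R + 1")
  case False
  thus ?thesis
   using mult_mono[OF clamp(2)[of R y], of "abs (kap R x)" 1] kap(4,5)[OF R, of x] R by (auto simp: abs_mult indicator_def)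
 qed (use kap(3)[OF R] in simp)
 have ch: "cont (%x. clamp R (h n x)*kap R x)" for n
  unfolding clamp_def by (intro continuous_intros h smooth_imp_continuous_on[OF kap(1)[OF R]])
 have H: "(%n. nl (%x. clamp R (h n x)*kap R x - F x)) ----> 0" "sql F" "!!n. sql (%x. clamp R (h n x)*kap R x)"
 proof -
  have ae: "ae x. (%n. clamp R (h n x)*kap R x) ----> F x"
  proof -
   have "AE x in lebesgue. (%n. h n x) ----> f x" using A h(2) unfolding eventually_ae_filter_negligible by auto
   hence "ae x. (%n. h n x) ----> f x" by (simp add: AE_completion_iff)
   thus ?thesis unfolding F_def clamp_def by eventually_elim (intro tendsto_intros)
  qed
  have m: "(%x. clamp R (h n x)*kap R x) \<in> borel_measurable lborel" "F \<in> borel_measurable lborel" for n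
   using bm_cont[OF ch] mkap[OF R] unfolding F_def clamp_def by auto
  note D = L2_dominated[OF i m AE_I2[OF cut] ae]
  show "(%n. nl (%x. clamp R (h n x)*kap R x - F x)) ----> 0" "sql F" "!!n. sql (%x. clamp R (h n x)*kap R x)"
   by (fact D)+
 qed
 then obtain n where n: "nl (%x. clamp R (h n x)*kap R x - F x) < e / 3"
  using LIMSEQ_D[OF H(1), of "e/3"] e by fastforce
 define H0 where "H0 x = clamp R (h n x)*kap R x" for x
 define S where "S = R + 1"
 have S: "S > 0" using R by (simp add: S_def)
 \<comment> \<open>\<open>sqrt (2*S + 2)\<close> is the L2 norm of the indicator of
   \<open>{-(S+1)..S+1}\<close>, so uniform accuracy \<open>eta = e/(3*r)\<close> becomes L2
   accuracy \<open>e/3\<close>.\<close>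
 define r where "r = sqrt (2*S + 2) + 1"
 define eta where "eta = e / (3*r)"
 have r: "r > 0" unfolding r_def using S by (intro add_nonneg_pos) auto
 hence eta: "eta > 0" using e by (simp add: eta_def)
 obtain p where p: "real_polynomial_function p" "!!x. x \<in> {-(S+1)..S+1} ==> abs (H0 x - p x) < eta"
  using Stone_Weierstrass_real_polynomial_function[of "{-(S+1)..S+1}" H0 eta] eta continuous_on_subset[OF ch[of n]]
  unfolding H0_def by auto
 define g where "g x = p x*kap S x" for x
 have sg: "smooth g" unfolding g_def by (intro smooth_mult real_polynomial_smooth p kap S)
 have z: "H0 x = H0 x*kap S x" for x using kap(2)[OF S, of x] kap(3)[OF R, of x] by (cases "abs x <= S") (auto simp: H0_def S_def)
 have near: "abs (g x - H0 x) <= abs (eta*indicator {-(S+1)..S+1} x)" for x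
 proof (cases "abs x >= S + 1")
  case True
  thus ?thesis using z[of x] kap(3)[OF S, of x] by (simp add: g_def)
 next
  case False
  hence x: "x \<in> {-(S+1)..S+1}" by auto
  have "g x - H0 x = (p x - H0 x)*kap S x" using z[of x] by (simp add: g_def algebra_simps)
  hence "abs (g x - H0 x) <= eta*1" unfolding abs_mult
   using p(2)[OF x] kap(4,5)[OF S, of x] eta by (simp add: abs_mult) (intro mult_mono[of _ eta _ 1, simplified]; auto)
  thus ?thesis using x eta by simp
 qed
 have si: "sql (%x. eta*indicator {-(S+1)..S+1} x)" "nl (%x. eta*indicator {-(S+1)..S+1} x) = eta * sqrt (2*S + 2)"
  using sql_indicator[of "-(S+1)" "S+1"] S eta by (simp_all add: sqint_cmult nrm_cmult)
 have mg: "bm g" by (rule smooth_borel[OF sg])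
 have sH: "sql H0" using H(3)[of n] by (simp add: H0_def[abs_def])
 have d: "sql (%x. g x - H0 x)" "nl (%x. g x - H0 x) <= eta * sqrt (2*S + 2)"
  using sqint_bound[OF si(1) _ AE_I2[OF near]] mg sqint_measurable[OF sH] si(2) by auto
 have "eta * sqrt (2*S + 2) <= eta*r" unfolding r_def using eta by (intro mult_left_mono) auto
 also have "... = e / 3" using r by (simp add: eta_def)
 finally have d3: "nl (%x. g x - H0 x) <= e / 3" using d(2) by linarith
 have sgq: "sql g" using sqint_add[OF d(1) sH] by simp
 have "nl (%x. (g x - H0 x) + ((H0 x - F x) + (F x - f x))) <= nl (%x. g x - H0 x) + (nl (%x. H0 x - F x) + nl (%x. F x - f x))"
  by (intro order_trans[OF nrm_triangle] add_left_mono nrm_triangle d sqint_add sqint_diff sH H f)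
 also have "... < e" using d3 n F unfolding H0_def by linarith
 finally have "nl (%x. g x - f x) < e" by simp
 moreover have "testf g"
  by (rule test_function_UNIV_I[OF sg, of "S + 1"]) (use kap(3)[OF S] in "simp add: g_def")
 ultimately show ?thesis using sgq by blast
qed

lemma test_function_approx:
 assumes f: "sql f"
 shows "EX g. (ALL n. testf (g n) & sql (g n)) & (%n. nl (%x. g n x - f x)) ----> 0 & (ae x. (%n. g n x) ----> f x)"
proof -
 have "EX g. testf g & sql g & nl (%x. g x - f x) < 1 / real (Suc n)" for n
  by (rule test_function_dense[OF f]) simp
 then obtain g where g: "!!n. testf (g n)" "!!n. sql (g n)" "!!n. nl (%x. g n x - f x) < 1 / real (Suc n)" by metis
 have l: "(%n. nl (%x. g n x - f x)) ----> 0"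
  by (rule tendsto_sandwich[OF _ _ tendsto_const LIMSEQ_inverse_real_of_nat])
   (use less_imp_le[OF g(3)] in "auto intro!: always_eventually simp: inverse_eq_divide")
 have i: "intg (%x. (g n x - f x)^2)" for n using sqint_diff[OF g(2) f] by (simp add: sqint_def)
 have "(%n. LBINT x. norm ((g n x - f x)^2)) ----> 0"
  using tendsto_power[OF l, of 2] by (simp add: nrm_sq)
 from tendsto_L1_AE_subseq[OF i this] obtain r where r: "strict_mono r" "ae x. (%n. (g (r n) x - f x)^2) ----> 0" by blast
 have "ae x. (%n. g (r n) x) ----> f x"
  using r(2)
 proof eventually_elim
  case (elim x)
  from tendsto_real_sqrt[OF this] have "(%n. abs (g (r n) x - f x)) ----> 0" by simp
  thus ?case by (simp add: tendsto_rabs_zero_iff LIM_zero_iff)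
 qed
 thus ?thesis using g(1,2) LIMSEQ_subseq_LIMSEQ[OF l r(1)] by (intro exI[of _ "%n. g (r n)"]) (auto simp: o_def)
qed

context shock_wave begin

text \<open>The data are \<open>ul (x/nu)\<close> plus a test function. The former tends to the
  entropy shock away from 0 and is O(sqrt nu) from the scaled profile in L2; the test functions
  converge to \<open>u0\<close> minus the shock, both in L2 and almost everywhere, with index
  \<open>N nu\<close> tending to infinity as \<open>nu\<close> tends to 0.\<close>

theorem well_prepared_exists:
 assumes ref: "reference_profile um up ul" and u0: "in_L2 UNIV (%x. u0 x - es um up x)"
 shows "EX v. well_prepared um up ul ut u0 v"
proof -
 let ?e = "es um up"
 have em [measurable]: "bm ?e" unfolding entropy_shock_def[abs_def] by measurable
 have lm: "(%x. u0 x - ?e x) \<in> borel_measurable lebesgue" using u0 by (simp add: in_L2_def lebesgue_on_UNIV_eq)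
 obtain f where f: "bm f" "ae x. u0 x - ?e x = f x" using lebesgue_rep[OF lm] by metis
 have sf: "sql f" using in_L2_rep(1)[OF lm f] u0 by simp
 obtain g where g: "!!n. testf (g n)" "!!n. sql (g n)" and gl: "(%n. nl (%x. g n x - f x)) ----> 0"
  and ga: "ae x. (%n. g n x) ----> f x" using test_function_approx[OF sf] by blast
 define N where "N nu = nat \<lfloor>1 / nu\<rfloor>" for nu :: real
 have N: "filterlim N sequentially (at_right 0)"
  unfolding filterlim_at_top eventually_at_right_field
 proof (intro allI exI conjI impI)
  fix Z and nu :: real assume nu: "0 < nu" "nu < 1 / (real Z + 1)"
  hence "real Z <= 1 / nu" by (simp add: field_simps)
  thus "Z <= N nu" unfolding N_def by (rule le_nat_floor)
 qed simp
 define v where "v nu x = ul (x / nu) + g (N nu) x" for nu x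
 have sl: "smooth ul" using ref by (simp add: reference_profile_def)
 have ul_d: "deriv ul = ul1" using ul'(1) by (auto intro: DERIV_imp_deriv)
 have sg: "smooth (g n)" for n using g(1)[of n] by (simp add: test_function_def)
 have eh: "?e (1 / nu*x) = ?e x" if "nu > 0" for nu x using that by (simp add: entropy_shock_def divide_less_0_iff)
 have H1: "smooth (v nu) & in_H 1 (%x. v nu x - ul x)" if nu: "nu > 0" for nu
 proof
  have "smooth (%x. ul (1 / nu*x + 0) + g (N nu) x)" by (intro smooth_add smooth_real_affine sl sg)
  thus s: "smooth (v nu)" by (simp add: v_def[abs_def])
  have "in_H 1 (%x. (ul (1 / nu*x) - ul x) + g (N nu) x)"
  proof (rule smooth_in_H1)
   have "smooth (%x. ul (1 / nu*x + 0) - ul x + g (N nu) x)" by (intro smooth_add smooth_diff smooth_real_affine sl sg)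
   thus "smooth (%x. (ul (1 / nu*x) - ul x) + g (N nu) x)" by simp
   show "sql (%x. (ul (1 / nu*x) - ul x) + g (N nu) x)"
    using sqint_add[OF sqint_diff[OF sql_scale(1)[OF ul'(4), of "1/nu"] ul'(4)] g(2)[of "N nu"]] nu by (simp add: eh[simplified])
   have "DERIV (%x. (ul (1 / nu*x) - ul x) + g (N nu) x) x :> (ul1 (1 / nu*x)*(1 / nu) - ul1 x) + deriv (g (N nu)) x" for x
    by (intro DERIV_add DERIV_diff ul'(1) DERIV_chain2[OF ul'(1)] smooth_realD(1) sg) (use nu in "auto intro!: derivative_eq_intros")
   hence d: "deriv (%x. (ul (1 / nu*x) - ul x) + g (N nu) x) = (%x. ((1 / nu)*ul1 (1 / nu*x) - ul1 x) + deriv (g (N nu)) x)"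
    by (auto intro!: DERIV_imp_deriv simp: mult.commute)
   have "sql (deriv (g (N nu)))"
   proof -
    obtain K R where KR: "!!x. abs (deriv (g (N nu)) x) <= K" "!!x. abs x > R ==> deriv (g (N nu)) x = 0"
     using test_function_bounds[OF test_function_deriv[OF g(1)[of "N nu"]]] by metis
    have "kernel R (deriv (g (N nu)))" unfolding kernel_def using KR smooth_borel[OF smooth_realD(2)[OF sg]] by blast
    thus ?thesis by (rule kernel_integrable(2))
   qed
   thus "sql (deriv (%x. (ul (1 / nu*x) - ul x) + g (N nu) x))" unfolding d
    by (intro sqint_add sqint_diff sqint_cmult sql_scale ul') (use nu in simp)
  qed
  thus "in_H 1 (%x. v nu x - ul x)" by (simp add: v_def algebra_simps)
 qed
 have pt: "AE x in lebesgue. ((%nu. v nu x) ---> u0 x) (at_right 0)"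
 proof -
  have "ae x. x ~= (0::real)" by (rule AE_lborel_singleton)
  hence "ae x. ((%nu. v nu x) ---> u0 x) (at_right 0)"
   using ga f(2)
  proof eventually_elim
   case (elim x)
   have "\<forall>\<^sub>F nu in at_right 0. ?e x = ul (x / nu)"
    unfolding eventually_at_right_field
   proof (intro exI[of _ "abs x"] conjI allI impI)
    show "0 < abs x" using elim by simp
    fix nu :: real assume "0 < nu" "nu < abs x"
    hence "x < 0 ==> x / nu <= -1" "x > 0 ==> x / nu >= 1" by (auto simp: field_simps)
    thus "?e x = ul (x / nu)" using elim(1) ref by (cases "x < 0") (auto simp: reference_profile_def entropy_shock_def)
   qed
   hence "((%nu. ul (x / nu)) ---> ?e x) (at_right 0)" by (rule Lim_transform_eventually[OF tendsto_const])
   note tendsto_add[OF this filterlim_compose[OF elim(2) N]]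
   moreover have "?e x + f x = u0 x" using elim(3) by linarith
   ultimately show ?case by (simp add: v_def)
  qed
  thus ?thesis by (rule AE_completion)
 qed
 have en: "((%nu. LINT x|lebesgue. (v nu x - ut (x / nu))^2) ---> (LINT x|lebesgue. (u0 x - ?e x)^2)) (at_right 0)"
 proof -
  have fi: "(LINT x|lebesgue. (u0 x - ?e x)^2) = (nl f)^2"
   unfolding nrm_sq by (rule lebesgue_integral_rep(1)) (use lm f in "auto elim: eventually_mono")
  have s: "sql (%x. ul x - ut x)" using sqint_minus[OF H1D(2)[OF H1_ut]] by simp
  have eq: "(LINT x|lebesgue. (v nu x - ut (x / nu))^2) = (nl (%x. v nu x - ut (x / nu)))^2"
   and sv: "sql (%x. v nu x - ut (x / nu))"
   and bd: "abs (nl (%x. v nu x - ut (x / nu)) - nl f) <= sqrt nu*nl (%x. ul x - ut x) + nl (%x. g (N nu) x - f x)" if nu: "nu > 0" for nu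
  proof -
   have sc: "sql (%x. ul (x / nu) - ut (x / nu))" "nl (%x. ul (x / nu) - ut (x / nu)) = sqrt nu*nl (%x. ul x - ut x)"
    using sql_scale[OF s, of "1/nu"] nu by (simp_all add: real_sqrt_divide)
   show sv: "sql (%x. v nu x - ut (x / nu))" using sqint_add[OF sc(1) g(2)[of "N nu"]] by (simp add: v_def algebra_simps)
   show "(LINT x|lebesgue. (v nu x - ut (x / nu))^2) = (nl (%x. v nu x - ut (x / nu)))^2"
    unfolding nrm_sq by (rule integral_completion[OF borel_measurable_power[OF sqint_measurable[OF sv]]])
   have "abs (nl (%x. v nu x - ut (x / nu)) - nl f) <= nl (%x. (v nu x - ut (x / nu)) - f x)" by (rule nrm_triangle_ge[OF sv sf])
   also have "(%x. (v nu x - ut (x / nu)) - f x) = (%x. (ul (x / nu) - ut (x / nu)) + (g (N nu) x - f x))" by (auto simp: v_def)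
   also have "nl ... <= nl (%x. ul (x / nu) - ut (x / nu)) + nl (%x. g (N nu) x - f x)" by (intro nrm_triangle sc sqint_diff g sf)
   finally show "abs (nl (%x. v nu x - ut (x / nu)) - nl f) <= sqrt nu*nl (%x. ul x - ut x) + nl (%x. g (N nu) x - f x)" using sc(2) by simp
  qed
  have "((%nu. nl (%x. v nu x - ut (x / nu)) - nl f) ---> 0) (at_right 0)"
  proof (rule Lim_null_comparison)
   show "\<forall>\<^sub>F nu in at_right 0. norm (nl (%x. v nu x - ut (x / nu)) - nl f) <= sqrt nu*nl (%x. ul x - ut x) + nl (%x. g (N nu) x - f x)"
    by (rule eventually_at_right_less[of "0::real", THEN eventually_mono]) (use bd in simp)
   have "((%nu. sqrt nu*nl (%x. ul x - ut x) + nl (%x. g (N nu) x - f x)) ---> sqrt 0*nl (%x. ul x - ut x) + 0) (at_right 0)"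
    by (intro tendsto_intros filterlim_compose[OF gl N])
   thus "((%nu. sqrt nu*nl (%x. ul x - ut x) + nl (%x. g (N nu) x - f x)) ---> 0) (at_right 0)" by simp
  qed
  hence "((%nu. (nl (%x. v nu x - ut (x / nu)))^2) ---> (nl f)^2) (at_right 0)"
   by (intro tendsto_power) (simp add: LIM_zero_iff)
  thus ?thesis unfolding fi
   by (rule Lim_transform_eventually) (rule eventually_at_right_less[of "0::real", THEN eventually_mono], simp add: eq)
 qed
 show ?thesis unfolding well_prepared_def using H1 pt en by blast
qed

end

section \<open>Weak compactness in L2\<close>

lemma L2_complete:
 assumes "sigma_finite_measure M" and g: "!!n. sqint M (g n)"
  and C: "!!e. e > 0 ==> EX N. ALL m>=N. ALL n>=N. nrm M (%x. g m x - g n x) < e"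
 shows "EX f. sqint M f & (%n. nrm M (%x. g n x - f x)) ----> 0"
proof -
 interpret sigma_finite_measure M by fact
 \<comment> \<open>A positive weight that is integrable and bounded by 1, hence square integrable:
   it makes the weighted sequence Cauchy in L1, so that a subsequence converges almost everywhere,
   and division by \<open>omega\<close> recovers the limit.\<close>
 obtain omega :: "'a => real" where omega: "omega \<in> borel_measurable M" "!!x. omega x > 0" "!!x. omega x <= 1" "integrable M omega"
  using obtain_positive_integrable_function by blast
 have gm [measurable]: "g n \<in> borel_measurable M" for n using g by (simp add: sqint_def)
 note omega(1) [measurable]
 have "integrable M (%x. (omega x)^2)"
  by (rule int_bound[OF omega(4)])
   (use omega(2,3) in "auto simp: power2_eq_square less_imp_le intro!: AE_I2 mult_left_le")
 hence somega: "sqint M omega" by (simp add: sqint_def omega(1))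
 define c where "c = nrm M omega + 1"
 have c: "c > 0" "nrm M omega <= c" by (auto simp: c_def intro: add_nonneg_pos)
 obtain r where r: "strict_mono r" "AE x in M. Cauchy (%i. omega x*g (r i) x)"
 proof (rule cauchy_L1_AE_cauchy_subseq[of M "%n x. omega x*g n x"])
  show "integrable M (%x. omega x*g n x)" for n by (rule sqint_mult[OF somega g])
  fix e :: real assume e: "e > 0"
  obtain N where N: "ALL m>=N. ALL n>=N. nrm M (%x. g m x - g n x) < e / c" using C[of "e / c"] e c by auto
  have "LINT x|M. norm (omega x*g i x - omega x*g j x) < e" if "i >= N" "j >= N" for i j
  proof -
   have "(LINT x|M. norm (omega x*g i x - omega x*g j x)) = (LINT x|M. omega x*abs (g i x - g j x))"
    by (intro int_cong refl) (use omega(2) in "simp add: right_diff_distrib[symmetric] abs_mult less_imp_le")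
   also have "... <= nrm M omega*nrm M (%x. g i x - g j x)"
    using cauchy_schwarz[OF somega sqint_abs[OF sqint_diff[OF g g]], of i j] by simp
   also have "... <= c*nrm M (%x. g i x - g j x)" by (intro mult_right_mono c) simp
   also have "... < e" using N that c(1) by (simp add: field_simps)
   finally show ?thesis .
  qed
  thus "EX N. ALL i>=N. ALL j>=N. LINT x|M. norm (omega x*g i x - omega x*g j x) < e" by blast
 qed
 define f where "f x = lim (%i. omega x*g (r i) x) / omega x" for x
 have fm [measurable]: "f \<in> borel_measurable M" unfolding f_def by measurable
 have ae: "AE x in M. (%i. g (r i) x) ----> f x"
  using r(2)
 proof eventually_elim
  case (elim x)
  hence "(%i. omega x*g (r i) x) ----> lim (%i. omega x*g (r i) x)" by (simp add: Cauchy_convergent_iff convergent_LIMSEQ_iff)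
  from tendsto_divide[OF this tendsto_const[of "omega x"]] omega(2)[of x] show ?case by (simp add: f_def)
 qed
 have nn: "(\<integral>\<^sup>+x. ennreal ((h x)^2) \<partial>M) = ennreal ((nrm M h)^2)" if "sqint M h" for h
  using that unfolding nrm_sq sqint_def by (intro nn_integral_eq_integral) auto
 \<comment> \<open>Fatou's lemma along the subsequence: the norm bound on \<open>g n - g m\<close>
   for large \<open>m\<close> passes to the almost everywhere limit \<open>f\<close>.\<close>
 have bound: "sqint M (%x. g n x - f x) & nrm M (%x. g n x - f x) <= e"
  if N: "!!m. m >= N ==> nrm M (%x. g n x - g m x) <= e" for n N e
 proof -
  have e: "e >= 0" using order_trans[OF nrm_nonneg N[of N]] by simp
  have "(\<integral>\<^sup>+x. ennreal ((g n x - f x)^2) \<partial>M) = (\<integral>\<^sup>+x. liminf (%i. ennreal ((g n x - g (r i) x)^2)) \<partial>M)"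
  proof (rule nn_integral_cong_AE, use ae in eventually_elim)
   case (elim x)
   have "(%i. ennreal ((g n x - g (r i) x)^2)) ----> ennreal ((g n x - f x)^2)"
    by (intro tendsto_intros elim)
   thus ?case using lim_imp_Liminf by force
  qed
  also have "... <= liminf (%i. \<integral>\<^sup>+x. ennreal ((g n x - g (r i) x)^2) \<partial>M)" by (rule nn_integral_liminf) measurable
  also have "... <= ennreal (e^2)"
  proof (rule Liminf_le)
   show "\<forall>\<^sub>F i in sequentially. (\<integral>\<^sup>+x. ennreal ((g n x - g (r i) x)^2) \<partial>M) <= ennreal (e^2)"
   proof (rule eventually_sequentiallyI[of N])
    fix i assume "i >= N"
    hence "r i >= N" using seq_suble[OF r(1), of i] by simp
    thus "(\<integral>\<^sup>+x. ennreal ((g n x - g (r i) x)^2) \<partial>M) <= ennreal (e^2)"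
     unfolding nn[OF sqint_diff[OF g g]] by (intro ennreal_leI power_mono N) auto
   qed
  qed simp
  finally have le: "(\<integral>\<^sup>+x. ennreal ((g n x - f x)^2) \<partial>M) <= ennreal (e^2)" .
  hence s: "sqint M (%x. g n x - f x)"
   unfolding sqint_def by (auto intro!: integrableI_bounded simp: le_less_trans)
  hence "(nrm M (%x. g n x - f x))^2 <= e^2" using le unfolding nn[OF s] by (simp add: ennreal_le_iff)
  thus ?thesis using s e by (auto intro: power2_le_imp_le)
 qed
 obtain N where "ALL m>=N. ALL n>=N. nrm M (%x. g m x - g n x) < 1" using C[of 1] by auto
 hence "sqint M (%x. g N x - f x)" using bound[of N N 1] by (auto intro: less_imp_le)
 from sqint_diff[OF g[of N] this] have sf: "sqint M f" by simp
 have "(%n. nrm M (%x. g n x - f x)) ----> 0"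
 proof (rule LIMSEQ_I)
  fix e :: real assume e: "0 < e"
  obtain N where N: "ALL m>=N. ALL n>=N. nrm M (%x. g m x - g n x) < e / 2" using C[of "e / 2"] e by auto
  have "nrm M (%x. g n x - f x) <= e / 2" if "n >= N" for n
   using bound[of N n "e / 2"] N that by (auto intro: less_imp_le)
  thus "EX no. ALL n>=no. norm (nrm M (%x. g n x - f x) - 0) < e" using e by (intro exI[of _ N]) force
 qed
 with sf show ?thesis by blast
qed

lemma parallelogram:
 assumes "sqint M f" "sqint M g"
 shows "(nrm M (%x. f x - g x))^2 = 2*(nrm M f)^2 + 2*(nrm M g)^2 - 4*(nrm M (%x. (f x + g x) / 2))^2"
proof -
 have i: "integrable M (%x. (f x)^2)" "integrable M (%x. (g x)^2)" "integrable M (%x. f x*g x)"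
  using assms sqint_mult by (auto simp: sqint_def)
 have "(LINT x|M. (f x - g x)^2) = (LINT x|M. (f x)^2 + (g x)^2 - 2*(f x*g x))"
  "(LINT x|M. ((f x + g x) / 2)^2) = (LINT x|M. ((f x)^2 + (g x)^2 + 2*(f x*g x)) / 4)"
  by (intro int_cong refl; simp add: power2_eq_square field_simps)+
 thus ?thesis unfolding nrm_sq using i by simp
qed

text \<open>Closure under midpoints rather than all convex combinations, since the parallelogram
  identity only ever forms \<open>(f + g)/2\<close>.\<close>

inductive_set midpoints :: "('a => real) set => ('a => real) set" for A where
 base: "a \<in> A ==> a \<in> midpoints A"
| mid: "a \<in> midpoints A ==> b \<in> midpoints A ==> (%x. (a x + b x) / 2) \<in> midpoints A"

text \<open>A near-minimal element of the midpoint-convex hull of each tail gives a strongly convergent sequence, whose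
 limit has every inner product that the original sequence determines.\<close>

lemma weak_cluster_point:
 assumes M: "sigma_finite_measure M" and f: "!!n. sqint M (f n)" "!!n. nrm M (f n) <= B"
 shows "EX g. sqint M g & (ALL h beta. sqint M h & (%n. \<integral>x. h x*f n x \<partial>M) ----> beta --> (LINT x|M. h x*g x) = beta)"
proof -
 define K where "K n = midpoints (f ` {n..})" for n
 have Ks: "sqint M a" if "a \<in> K n" for a n
  using that unfolding K_def
 proof (induction rule: midpoints.induct)
  case (mid a b)
  thus ?case using sqint_cmult[OF sqint_add[of M a b], of "1/2"] by simp
 qed (use f in auto)
 have Ki: "abs ((LINT x|M. h x*a x) - beta) <= e"
  if "a \<in> K n" "sqint M h" "!!k. k >= n ==> abs ((LINT x|M. h x*f k x) - beta) <= e" for a n h beta e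
  using that(1) unfolding K_def
 proof (induction rule: midpoints.induct)
  case (mid a b)
  have "(LINT x|M. h x*((a x + b x) / 2)) = ((LINT x|M. h x*a x) + (LINT x|M. h x*b x)) / 2"
   using sqint_mult[OF that(2) Ks[unfolded K_def, OF mid(1)]] sqint_mult[OF that(2) Ks[unfolded K_def, OF mid(2)]]
   by (simp add: distrib_left)
  thus ?case using mid.IH by (simp add: abs_le_iff) argo
 qed (use that(3) in auto)
 have Kmono: "K n \<subseteq> K m" if "m <= n" for m n
 proof
  fix a assume "a \<in> K n"
  thus "a \<in> K m" unfolding K_def
   by (induction rule: midpoints.induct) (use that in "auto intro: midpoints.intros")
 qed
 have Kb: "f n \<in> K n" for n unfolding K_def by (intro midpoints.base) auto
 define d where "d n = (INF a\<in>K n. (nrm M a)^2)" for n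
 have bdd: "bdd_below ((%a. (nrm M a)^2) ` K n)" for n by (intro bdd_belowI2[of _ 0]) simp
 have d_le: "d n <= (nrm M a)^2" if "a \<in> K n" for a n unfolding d_def by (rule cINF_lower[OF bdd that])
 have d_mono: "d m <= d n" if "m <= n" for m n
  unfolding d_def by (rule cINF_superset_mono[OF _ bdd Kmono[OF that]]) (use Kb in auto)
 have d_bound: "d n <= B^2" for n
  using d_le[OF Kb[of n]] power_mono[OF f(2)[of n] nrm_nonneg, of 2] by linarith
 have "incseq d" using d_mono by (simp add: incseq_def)
 then obtain L where L: "d ----> L" "!!n. d n <= L" using incseq_convergent[of d "B^2"] d_bound by metis
 have "\<exists>a\<in>K n. (nrm M a)^2 < d n + 1 / real (Suc n)" for n
  using cINF_less_iff[OF _ bdd, of n "d n + 1 / real (Suc n)"] Kb[of n] unfolding d_def by auto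
 then obtain a where a: "!!n. a n \<in> K n" "!!n. (nrm M (a n))^2 < d n + 1 / real (Suc n)" by metis
 have sa: "sqint M (a n)" for n by (rule Ks[OF a(1)])
 have "EX g. sqint M g & (%n. nrm M (%x. a n x - g x)) ----> 0"
 proof (rule L2_complete[OF M sa])
  fix e :: real assume e: "e > 0"
  have "\<forall>\<^sub>F n in sequentially. L - d n < e^2 / 8"
   using order_tendstoD(1)[OF L(1), of "L - e^2 / 8"] e by (auto elim: eventually_mono)
  moreover have "\<forall>\<^sub>F n in sequentially. inverse (real (Suc n)) < e^2 / 8"
   using order_tendstoD(2)[OF LIMSEQ_inverse_real_of_nat, of "e^2 / 8"] e by simp
  ultimately obtain N where N: "!!n. n >= N ==> L - d n < e^2 / 8 & inverse (real (Suc n)) < e^2 / 8"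
   unfolding eventually_sequentially by (metis nat_le_linear order_trans)
  have "nrm M (%x. a m x - a n x) < e" if mn: "m >= N" "n >= N" for m n
  proof -
   have "(%x. (a m x + a n x) / 2) \<in> K N"
    using a(1) Kmono[OF mn(1)] Kmono[OF mn(2)] unfolding K_def by (intro midpoints.mid) blast+
   from d_le[OF this] have "(nrm M (%x. a m x - a n x))^2 <= 2*(nrm M (a m))^2 + 2*(nrm M (a n))^2 - 4*d N"
    unfolding parallelogram[OF sa sa] by simp
   moreover have lt: "(nrm M (a i))^2 < d N + e^2 / 4" if "i >= N" for i
    using a(2)[of i] N[OF that] N[of N] L(2)[of i] by (simp add: inverse_eq_divide)
   ultimately have "(nrm M (%x. a m x - a n x))^2 < e^2" using lt[OF mn(1)] lt[OF mn(2)] by linarith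
   thus ?thesis using e by (auto intro: power_less_imp_less_base)
  qed
  thus "EX N. ALL m>=N. ALL n>=N. nrm M (%x. a m x - a n x) < e" by blast
 qed
 then obtain g where g: "sqint M g" "(%n. nrm M (%x. a n x - g x)) ----> 0" by blast
 have "(LINT x|M. h x*g x) = beta" if h: "sqint M h" and l: "(%n. \<integral>x. h x*f n x \<partial>M) ----> beta" for h beta
 proof -
  have "(%n. \<integral>x. h x*a n x \<partial>M) ----> beta"
  proof (rule LIMSEQ_I)
   fix e :: real assume e: "e > 0"
   obtain N where N: "!!k. k >= N ==> abs ((LINT x|M. h x*f k x) - beta) < e / 2" using LIMSEQ_D[OF l, of "e/2"] e by auto
   have "abs ((LINT x|M. h x*a n x) - beta) <= e / 2" if "n >= N" for n
    by (rule Ki[OF a(1) h]) (use N that in "auto intro: less_imp_le")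
   thus "EX no. ALL n>=no. norm ((LINT x|M. h x*a n x) - beta) < e" using e by (intro exI[of _ N]) force
  qed
  moreover have "(%n. \<integral>x. h x*a n x \<partial>M) ----> (LINT x|M. h x*g x)"
  proof (rule LIM_zero_cancel, rule Lim_null_comparison)
   show "\<forall>\<^sub>F n in sequentially. norm ((LINT x|M. h x*a n x) - (LINT x|M. h x*g x)) <= nrm M h*nrm M (%x. a n x - g x)"
   proof (rule always_eventually, rule allI)
    fix n
    have "(LINT x|M. h x*a n x) - (LINT x|M. h x*g x) = (LINT x|M. h x*(a n x - g x))"
     using sqint_mult[OF h sa[of n]] sqint_mult[OF h g(1)] by (simp add: right_diff_distrib)
    thus "norm ((LINT x|M. h x*a n x) - (LINT x|M. h x*g x)) <= nrm M h*nrm M (%x. a n x - g x)"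
     using cauchy_schwarz[OF h sqint_diff[OF sa[of n] g(1)]] by simp
   qed
   show "(%n. nrm M h*nrm M (%x. a n x - g x)) ----> 0" using tendsto_mult[OF tendsto_const g(2), of "nrm M h"] by simp
  qed
  ultimately show ?thesis using LIMSEQ_unique by blast
 qed
 with g(1) show ?thesis by blast
qed

lemma bounded_convergent_subseq:
 fixes x :: "nat => real"
 assumes "!!n. abs (x n) <= B"
 shows "EX l r. strict_mono (r :: nat => nat) & (%n. x (r n)) ----> l"
proof -
 have "bounded (range x)" using assms by (auto simp: bounded_iff)
 from bounded_imp_convergent_subsequence[OF this] show ?thesis by (auto simp: o_def)
qed

lemma diagonal_subseq:
 fixes x :: "nat => nat => real"
 assumes "!!j n. abs (x j n) <= B j"
 shows "EX r. strict_mono (r :: nat => nat) & (ALL j. EX l. (%n. x j (r n)) ----> l)"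
proof -
 interpret subseqs "%j s. EX l. (%n. x j (s n)) ----> l"
 proof
  fix j and s :: "nat => nat" assume "strict_mono s"
  show "EX r'. strict_mono r' & (EX l. (%n. x j ((s \<circ> r') n)) ----> l)"
   using bounded_convergent_subseq[of "%n. x j (s n)" "B j"] assms by (auto simp: o_def)
 qed
 have "EX l. (%n. x j (diagseq n)) ----> l" for j
 proof -
  have "EX l. (%n. x j ((diagseq \<circ> ((+) (Suc j))) n)) ----> l"
  proof (rule diagseq_holds)
   fix r s :: "nat => nat" and n assume r: "strict_mono r" and "EX l. (%m. x n (s m)) ----> l"
   thus "EX l. (%m. x n ((s \<circ> r) m)) ----> l"
    using LIMSEQ_subseq_LIMSEQ[OF _ r, of "%m. x n (s m)"] by (auto simp: o_def)
  qed
  then obtain l where "(%n. x j (diagseq (n + Suc j))) ----> l" by (auto simp: add.commute)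
  hence "(%n. x j (diagseq n)) ----> l" by (rule LIMSEQ_offset)
  thus ?thesis by blast
 qed
 thus ?thesis using subseq_diagseq by blast
qed

text \<open>The functions \<open>f j\<close> themselves take the place of a dense set: diagonal
  extraction makes the pairings with each of them converge. If some pairing failed to converge to
  that with \<open>g\<close>, a further subsequence would have another cluster point
  \<open>g'\<close>. Then \<open>g - g'\<close> is orthogonal to every \<open>f j\<close>, hence to
  \<open>g\<close> and \<open>g'\<close>, which are limits of pairings with the \<open>f j\<close>,
  and so it vanishes.\<close>

theorem weak_compactness:
 assumes M: "sigma_finite_measure M" and f: "!!n. sqint M (f n)" "!!n. nrm M (f n) <= B"
 shows "EX r g. strict_mono (r :: nat => nat) & sqint M g & (ALL h. sqint M h --> (%n. \<integral>x. h x*f (r n) x \<partial>M) ----> (LINT x|M. h x*g x))"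
proof -
 have ip: "abs (\<integral>x. h x*f n x \<partial>M) <= nrm M h*B" if "sqint M h" for h n
  using order_trans[OF cauchy_schwarz[OF that f(1)] mult_left_mono[OF f(2) nrm_nonneg]] .
 obtain r where r: "strict_mono r" "!!j. EX l. (%n. \<integral>x. f j x*f (r n) x \<partial>M) ----> l"
  using diagonal_subseq[of "%j n. \<integral>x. f j x*f n x \<partial>M" "%j. nrm M (f j)*B"] ip[OF f(1)] by blast
 obtain g where g: "sqint M g" "!!h beta. sqint M h ==> (%n. \<integral>x. h x*f (r n) x \<partial>M) ----> beta ==> (LINT x|M. h x*g x) = beta"
  using weak_cluster_point[OF M, of "%n. f (r n)" B] f by blast
 have "(%n. \<integral>x. h x*f (r n) x \<partial>M) ----> (LINT x|M. h x*g x)" if h: "sqint M h" for h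
 proof (rule ccontr)
  let ?x = "%n. \<integral>x. h x*f (r n) x \<partial>M" and ?l = "\<integral>x. h x*g x \<partial>M"
  assume "~ ?x ----> ?l"
  hence "EX e>0. ALL N. EX n>=N. dist (?x n) ?l >= e" unfolding lim_sequentially by (simp add: not_less)
  then obtain e where e: "e > 0" "!!N. EX n>=N. dist (?x n) ?l >= e" by meson
  have "infinite {n. dist (?x n) ?l >= e}" unfolding infinite_nat_iff_unbounded_le using e(2) by simp
  from infinite_enumerate[OF this] obtain s :: "nat => nat" where "strict_mono s & (ALL n. s n \<in> {n. dist (?x n) ?l >= e})" ..
  hence s: "strict_mono s" "!!n. dist (?x (s n)) ?l >= e" by simp_all
  obtain beta q where q: "strict_mono q" "(%n. ?x (s (q n))) ----> beta"
   using bounded_convergent_subseq[of "%n. ?x (s n)"] ip[OF h] by blast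
  have "e <= dist beta ?l" by (rule LIMSEQ_le_const[OF tendsto_dist[OF q(2) tendsto_const]]) (use s(2) in auto)
  obtain g' where g': "sqint M g'" "!!h beta. sqint M h ==> (%n. \<integral>x. h x*f (r (s (q n))) x \<partial>M) ----> beta ==> (LINT x|M. h x*g' x) = beta"
   using weak_cluster_point[OF M, of "%n. f (r (s (q n)))" B] f by blast
  define k where "k x = g x - g' x" for x
  have k: "sqint M k" unfolding k_def by (rule sqint_diff[OF g(1) g'(1)])
  have z: "(LINT x|M. k x*f j x) = 0" for j
  proof -
   obtain l where l: "(%n. \<integral>x. f j x*f (r n) x \<partial>M) ----> l" using r(2) by blast
   have l': "(%n. \<integral>x. f j x*f (r (s (q n))) x \<partial>M) ----> l"
    using LIMSEQ_subseq_LIMSEQ[OF l strict_mono_o[OF s(1) q(1)]] by (simp add: o_def)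
   have "(LINT x|M. f j x*g x) = (LINT x|M. f j x*g' x)" using g(2)[OF f(1) l] g'(2)[OF f(1) l'] by simp
   thus ?thesis unfolding k_def left_diff_distrib
    using sqint_mult[OF f(1)[of j] g(1)] sqint_mult[OF f(1)[of j] g'(1)] by (simp add: mult.commute)
  qed
  have "(LINT x|M. k x*g x) = 0" "(LINT x|M. k x*g' x) = 0"
   using g(2)[OF k, of 0] g'(2)[OF k, of 0] z by auto
  hence "(LINT x|M. k x*g x - k x*g' x) = 0"
   using sqint_mult[OF k g(1)] sqint_mult[OF k g'(1)] by simp
  moreover have "(%x. (k x)^2) = (%x. k x*g x - k x*g' x)" by (auto simp: k_def power2_eq_square algebra_simps)
  ultimately have "(nrm M k)^2 = 0" unfolding nrm_sq by simp
  hence "nrm M k = 0" by simp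
  moreover have "?l - (LINT x|M. h x*g' x) = (LINT x|M. h x*k x)"
   unfolding k_def using sqint_mult[OF h g(1)] sqint_mult[OF h g'(1)] by (simp add: right_diff_distrib)
  moreover have "(LINT x|M. h x*g' x) = beta" by (rule g'(2)[OF h q(2)])
  ultimately have "beta = ?l" using cauchy_schwarz[OF h k] by simp
  thus False using \<open>e <= dist beta ?l\<close> e(1) by simp
 qed
 thus ?thesis using r(1) g(1) by blast
qed

section \<open>Functions on the space-time plane and their time slices\<close>

lemma sqint_sections:
 fixes g :: "real \<times> real => real"
 assumes g: "sqint lborel g"
 shows "ae t. sql (%x. g (t, x))" "sql (%t. nl (%x. g (t, x)))"
  "(LINT z|lborel. (g z)^2) = (LBINT t. (nl (%x. g (t, x)))^2)"
proof -
 have m: "g \<in> borel_measurable (lborel \<Otimes>\<^sub>M lborel)" and i: "integrable (lborel \<Otimes>\<^sub>M lborel) (%z. (g z)^2)"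
  using g by (simp_all add: sqint_def lborel_prod)
 note [measurable] = m
 have "ae t. intg (%x. (g (t, x))^2)" by (rule lborel_pair.AE_integrable_fst'[OF i])
 thus "ae t. sql (%x. g (t, x))" by eventually_elim (simp add: sqint_def)
 have "intg (%t. LBINT x. (g (t, x))^2)" by (rule lborel_pair.integrable_fst'[OF i])
 thus "sql (%t. nl (%x. g (t, x)))" unfolding sqint_def nrm_sq by (simp add: nrm_def)
 show "(LINT z|lborel. (g z)^2) = (LBINT t. (nl (%x. g (t, x)))^2)"
  using lborel_pair.integral_fst'[OF i] by (simp add: nrm_sq lborel_prod)
qed

lemma sqint_product:
 fixes phi :: "real \<times> real => real"
 assumes m: "bm phi" and s: "ae t. sql (%x. phi (t, x))"
  and n: "intg (%t. (nl (%x. phi (t, x)))^2)"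
 shows "sqint lborel phi"
proof -
 have [measurable]: "phi \<in> borel_measurable (lborel \<Otimes>\<^sub>M lborel)" using m by (simp add: lborel_prod)
 have "integrable (lborel \<Otimes>\<^sub>M lborel) (%z. (phi z)^2)"
 proof (rule lborel_pair.Fubini_integrable)
  show "intg (%t. LBINT x. norm ((phi (t, x))^2))" using n by (simp add: nrm_sq)
  show "ae t. intg (%x. (phi (t, x))^2)" using s by eventually_elim (simp add: sqint_def)
 qed measurable
 thus ?thesis using m by (simp add: sqint_def lborel_prod)
qed

lemma product_pairing:
 fixes f g :: "real \<times> real => real"
 assumes "sqint lborel f" "sqint lborel g"
 shows "(LINT z|lborel. f z*g z) = (LBINT t. LBINT x. f (t, x)*g (t, x))"
  "intg (%t. LBINT x. f (t, x)*g (t, x))"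
proof -
 have i: "integrable (lborel \<Otimes>\<^sub>M lborel) (%z. f z*g z)"
  using sqint_mult[OF assms] by (simp add: lborel_prod)
 show "(LINT z|lborel. f z*g z) = (LBINT t. LBINT x. f (t, x)*g (t, x))"
  using lborel_pair.integral_fst'[OF i] by (simp add: lborel_prod)
 show "intg (%t. LBINT x. f (t, x)*g (t, x))" using lborel_pair.integrable_fst'[OF i] by simp
qed

lemma sections_measurable:
 fixes phi psi :: "real \<times> real => real"
 assumes "bm phi" "bm psi"
 shows "bm (%t. nl (%x. phi (t, x)))" "bm (%t. LBINT x. psi (t, x)*phi (t, x))"
  "bm (%x. phi (t, x))"
proof -
 have [measurable]: "phi \<in> borel_measurable (lborel \<Otimes>\<^sub>M lborel)" "psi \<in> borel_measurable (lborel \<Otimes>\<^sub>M lborel)"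
  using assms by (simp_all add: lborel_prod)
 show "bm (%t. nl (%x. phi (t, x)))" "bm (%t. LBINT x. psi (t, x)*phi (t, x))"
  unfolding nrm_def by (measurable; simp)+
 show "bm (%x. phi (t, x))" using assms(1) by measurable
qed

text \<open>An integrand in L1 in time with values in L2 need not be square integrable on the plane,
  but it is after discarding the times with \<open>N t > n\<close>. Since the slices of
  \<open>F k\<close> and \<open>G\<close> are bounded by \<open>E\<close>, this costs at most
  \<open>rho n\<close>, uniformly in \<open>k\<close>.\<close>

lemma weak_limit_L1_L2:
 fixes F :: "nat => real \<times> real => real" and G phi :: "real \<times> real => real"
 assumes F: "!!k. sqint lborel (F k)" "!!k. ae t. sql (%x. F k (t, x)) & nl (%x. F k (t, x)) <= E"
  and G: "sqint lborel G" "ae t. sql (%x. G (t, x)) & nl (%x. G (t, x)) <= E"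
  and weak: "!!h. sqint lborel h ==> (%k. \<integral>z. h z*F k z \<partial>lborel) ----> (LINT z|lborel. h z*G z)"
  and phi: "bm phi" "ae t. sql (%x. phi (t, x))" "intg (%t. nl (%x. phi (t, x)))"
 shows "(%k. LBINT t. LBINT x. F k (t, x)*phi (t, x)) ----> (LBINT t. LBINT x. G (t, x)*phi (t, x))"
proof -
 define N where "N t = nl (%x. phi (t, x))" for t
 have N0: "N t >= 0" for t by (simp add: N_def)
 have Nm [measurable]: "bm N" unfolding N_def by (rule sections_measurable(1)[OF phi(1) phi(1)])
 have Ni: "intg N" using phi(3) by (simp add: N_def[abs_def])
 define phin where "phin n z = indicator {t. N t <= real n} (fst z)*phi z" for n and z :: "real \<times> real"
 have set [measurable]: "{t. N t <= real n} \<in> sets borel" for n by measurable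
 have [measurable]: "phi \<in> borel_measurable (borel \<Otimes>\<^sub>M borel)" using phi(1) by (simp add: borel_prod)
 have phinm: "bm (phin n)" for n
 proof -
  have "phin n \<in> borel_measurable (borel \<Otimes>\<^sub>M borel)" unfolding phin_def by measurable
  thus ?thesis by (simp add: borel_prod)
 qed
 have sphi: "sqint lborel (phin n)" for n
 proof (rule sqint_product[OF phinm])
  show "ae t. sql (%x. phin n (t, x))" using phi(2) by eventually_elim (simp add: phin_def sqint_cmult)
  have e: "nl (%x. phin n (t, x)) = indicator {t. N t <= real n} t*N t" for t
   by (simp add: phin_def nrm_cmult N_def)
  show "intg (%t. (nl (%x. phin n (t, x)))^2)" unfolding e
   by (rule int_bound[OF integrable_mult_right[OF Ni, of "real n"]])
    (auto intro!: AE_I2 simp: indicator_def power2_eq_square N0 mult_right_mono)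
 qed
 define rho where "rho n = (LBINT t. E*(N t*indicator {t. ~ N t <= real n} t))" for n :: nat
 have rho: "rho ----> 0"
 proof -
  have "(%n. LBINT t. E*(N t*indicator {t. ~ N t <= real n} t)) ----> integral\<^sup>L (lborel :: real measure) (%_. 0)"
  proof (rule integral_dominated_convergence[where w="%t. abs E*N t" and f="%_. 0"])
   show "ae t. (%n. E*(N t*indicator {t. ~ N t <= real n} t)) ----> 0"
   proof (intro AE_I2 tendsto_eventually)
    fix t
    obtain m where "N t <= real m" using real_arch_simple by blast
    thus "\<forall>\<^sub>F n in sequentially. E*(N t*indicator {t. ~ N t <= real n} t) = 0"
     by (intro eventually_sequentiallyI[of m]) auto
   qed
   show "ae t. norm (E*(N t*indicator {t. ~ N t <= real n} t)) <= abs E*N t" for n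
    by (auto intro!: AE_I2 simp: indicator_def abs_mult N0 mult_left_mono)
  qed (use Ni in auto)
  thus ?thesis by (simp add: rho_def[abs_def])
 qed
 have cut: "abs ((LBINT t. LBINT x. H (t, x)*phi (t, x)) - (LINT z|lborel. phin n z*H z)) <= rho n"
  if H: "sqint lborel H" "ae t. sql (%x. H (t, x)) & nl (%x. H (t, x)) <= E" for H n
 proof -
  have mH: "bm H" using H(1) by (simp add: sqint_def)
  have I: "ae t. abs (LBINT x. H (t, x)*phi (t, x)) <= E*N t"
   using H(2) phi(2)
  proof eventually_elim
   case (elim t)
   have "abs (LBINT x. H (t, x)*phi (t, x)) <= nl (%x. H (t, x))*N t"
    unfolding N_def by (rule cauchy_schwarz) (use elim in auto)
   also have "... <= E*N t" using elim N0 by (intro mult_right_mono) auto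
   finally show ?case .
  qed
  have Em: "intg (%t. E*N t)" using Ni by simp
  have i1: "intg (%t. LBINT x. H (t, x)*phi (t, x))"
   by (rule int_bound[OF Em])
    (use I sections_measurable(2)[OF phi(1) mH] in "auto elim!: eventually_mono intro: order_trans[OF _ abs_ge_self]")
  have P: "(LINT z|lborel. phin n z*H z) = (LBINT t. indicator {t. N t <= real n} t*(LBINT x. H (t, x)*phi (t, x)))"
   "intg (%t. indicator {t. N t <= real n} t*(LBINT x. H (t, x)*phi (t, x)))"
  proof -
   have e: "(LBINT x. phin n (t, x)*H (t, x)) = indicator {t. N t <= real n} t*(LBINT x. H (t, x)*phi (t, x))" for t
   proof -
    have "(LBINT x. phin n (t, x)*H (t, x)) = (LBINT x. indicator {t. N t <= real n} t*(H (t, x)*phi (t, x)))"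
     by (intro int_cong refl) (simp add: phin_def)
    thus ?thesis by simp
   qed
   from product_pairing[OF sphi[of n] H(1)]
   show "(LINT z|lborel. phin n z*H z) = (LBINT t. indicator {t. N t <= real n} t*(LBINT x. H (t, x)*phi (t, x)))"
    "intg (%t. indicator {t. N t <= real n} t*(LBINT x. H (t, x)*phi (t, x)))"
    unfolding e .
  qed
  define D where "D t = (LBINT x. H (t, x)*phi (t, x)) - indicator {t. N t <= real n} t*(LBINT x. H (t, x)*phi (t, x))" for t
  have D: "intg D" unfolding D_def by (rule Bochner_Integration.integrable_diff[OF i1 P(2)])
  have "(LBINT t. LBINT x. H (t, x)*phi (t, x)) - (LINT z|lborel. phin n z*H z) = (LBINT t. D t)"
   unfolding P(1) D_def by (rule Bochner_Integration.integral_diff[OF i1 P(2), symmetric])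
  also have "abs ... <= (LBINT t. abs (D t))" using integral_norm_bound[of lborel D] by simp
  also have "... <= rho n" unfolding rho_def
  proof (rule integral_mono_AE)
   show "intg (%t. abs (D t))" using D by simp
   show "intg (%t. E*(N t*indicator {t. ~ N t <= real n} t))"
    by (rule int_bound[OF Em]) (auto intro!: AE_I2 simp: indicator_def)
   show "ae t. abs (D t) <= E*(N t*indicator {t. ~ N t <= real n} t)"
    using I by eventually_elim (auto simp: indicator_def D_def)
  qed
  finally show ?thesis .
 qed
 show ?thesis
 proof (rule LIMSEQ_I)
  fix r :: real assume r: "0 < r"
  obtain n where n: "rho n < r / 3" using order_tendstoD(2)[OF rho, of "r / 3"] r by (auto dest: eventually_happens)
  obtain k0 where k0: "!!k. k >= k0 ==> abs ((LINT z|lborel. phin n z*F k z) - (LINT z|lborel. phin n z*G z)) < r / 3"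
   using LIMSEQ_D[OF weak[OF sphi[of n]], of "r / 3"] r by auto
  show "EX no. ALL k>=no. norm ((LBINT t. LBINT x. F k (t, x)*phi (t, x)) - (LBINT t. LBINT x. G (t, x)*phi (t, x))) < r"
  proof (intro exI[of _ k0] allI impI)
   fix k assume "k >= k0"
   from k0[OF this] cut[OF F(1)[of k] F(2), of n] cut[OF G, of n] n
   show "norm ((LBINT t. LBINT x. F k (t, x)*phi (t, x)) - (LBINT t. LBINT x. G (t, x)*phi (t, x))) < r"
    unfolding real_norm_def by linarith
  qed
 qed
qed

text \<open>Lower semicontinuity of the slice norms, tested against \<open>g\<close> itself on the bad set of times.\<close>

lemma weak_limit_section_bound:
 fixes f :: "nat => real \<times> real => real" and g :: "real \<times> real => real"
 assumes f: "!!k. sqint lborel (f k)" "!!k t. t \<in> {0<..<T} ==> sql (%x. f k (t, x)) & nl (%x. f k (t, x)) <= e k" "e ----> e0"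
  and g: "sqint lborel g"
  and weak: "!!h. sqint lborel h ==> (%k. \<integral>z. h z*f k z \<partial>lborel) ----> (LINT z|lborel. h z*g z)"
  and T: "T > 0"
 shows "ae t. t \<in> {0<..<T} --> sql (%x. g (t, x)) & nl (%x. g (t, x)) <= e0"
proof -
 note S = sqint_sections[OF g]
 have ek: "e k >= 0" for k using order_trans[OF nrm_nonneg, of lborel "%x. f k (T/2, x)" "e k"] f(2)[of "T/2" k] T by simp
 have e0: "e0 >= 0" by (rule LIMSEQ_le_const[OF f(3)]) (use ek in auto)
 define G where "G t = nl (%x. g (t, x))" for t
 have mg: "bm g" using g by (simp add: sqint_def)
 have Gm [measurable]: "bm G" unfolding G_def by (rule sections_measurable(1)[OF mg mg])
 have G0: "G t >= 0" for t by (simp add: G_def)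
 have sG: "sql G" using S(2) by (simp add: G_def[abs_def])
 define A where "A = {t. t \<in> {0<..<T} & G t > e0}"
 have Am [measurable]: "A \<in> sets borel" unfolding A_def by measurable
 define h where "h z = indicator A (fst z)*g z" for z :: "real \<times> real"
 have [measurable]: "g \<in> borel_measurable (borel \<Otimes>\<^sub>M borel)" using mg by (simp add: borel_prod)
 have hm: "bm h"
 proof -
  have "h \<in> borel_measurable (borel \<Otimes>\<^sub>M borel)" unfolding h_def by measurable
  thus ?thesis by (simp add: borel_prod)
 qed
 have sh: "sqint lborel h"
  by (rule sqint_bound(1)[OF g]) (use hm in "auto simp: h_def indicator_def")
 have AG: "intg (%t. indicator A t*G t)" "intg (%t. indicator A t*(G t)^2)"
 proof -
  have "sql (%t. indicator A t*indicator {0..T} t)" by (intro sql_indicator_mult sql_indicator) (use T in auto)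
  hence "sql (indicator A)" by (rule sqint_bound(1)) (auto simp: indicator_def A_def)
  thus "intg (%t. indicator A t*G t)" using sG by (rule sqint_mult)
  show "intg (%t. indicator A t*(G t)^2)"
   by (rule int_bound[of lborel "%t. (G t)^2"]) (use sG in "auto simp: sqint_def indicator_def")
 qed
 have hf: "(LINT z|lborel. h z*f k z) <= e k*(LBINT t. indicator A t*G t)" for k
 proof -
  have "(LINT z|lborel. h z*f k z) = (LBINT t. LBINT x. h (t, x)*f k (t, x))" by (rule product_pairing(1)[OF sh f(1)])
  also have "... <= (LBINT t. e k*(indicator A t*G t))"
  proof (rule integral_mono_AE[OF product_pairing(2)[OF sh f(1)]])
   show "intg (%t. e k*(indicator A t*G t))" using AG(1) by simp
   show "ae t. (LBINT x. h (t, x)*f k (t, x)) <= e k*(indicator A t*G t)"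
    using S(1)
   proof eventually_elim
    case (elim t)
    show ?case
    proof (cases "t \<in> A")
     case True
     hence t: "t \<in> {0<..<T}" by (simp add: A_def)
     have "(LBINT x. g (t, x)*f k (t, x)) <= G t*nl (%x. f k (t, x))"
      using cauchy_schwarz[OF elim conjunct1[OF f(2)[OF t]], of k] by (simp add: G_def)
     also have "... <= G t*e k" using conjunct2[OF f(2)[OF t]] G0 by (intro mult_left_mono) auto
     finally show ?thesis using True by (simp add: h_def mult.commute)
    qed (simp add: h_def)
   qed
  qed
  finally show ?thesis by simp
 qed
 have "(LINT z|lborel. h z*g z) <= e0*(LBINT t. indicator A t*G t)"
  by (rule LIMSEQ_le[OF weak[OF sh] tendsto_mult[OF f(3) tendsto_const]]) (use hf in auto)
 also have "(LINT z|lborel. h z*g z) = (LBINT t. indicator A t*(G t)^2)"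
 proof -
  have e: "(LBINT x. h (t, x)*g (t, x)) = indicator A t*(G t)^2" for t
   unfolding G_def nrm_sq by (simp add: h_def power2_eq_square mult.assoc)
  show ?thesis unfolding product_pairing(1)[OF sh g] e ..
 qed
 finally have "(LBINT t. indicator A t*(G t)^2 - e0*(indicator A t*G t)) <= 0" using AG by simp
 moreover have nn: "0 <= indicator A t*(G t)^2 - e0*(indicator A t*G t)" for t
  using G0[of t] by (auto simp: indicator_def A_def power2_eq_square intro!: mult_right_mono)
 ultimately have "(LBINT t. indicator A t*(G t)^2 - e0*(indicator A t*G t)) = 0"
  by (intro antisym Bochner_Integration.integral_nonneg) auto
 hence "ae t. indicator A t*(G t)^2 - e0*(indicator A t*G t) = 0"
  using AG nn by (subst (asm) integral_nonneg_eq_0_iff_AE) auto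
 thus ?thesis using S(1)
 proof eventually_elim
  case (elim t)
  have "G t <= e0" if t: "t \<in> {0<..<T}"
  proof (rule ccontr)
   assume "~ G t <= e0"
   hence "t \<in> A" and G: "G t > e0" using t by (auto simp: A_def)
   hence "G t*G t = e0*G t" using elim(1) by (simp add: power2_eq_square)
   thus False using G e0 by simp
  qed
  thus ?case using elim(2) by (simp add: G_def)
 qed
qed

text \<open>Here \<open>b\<close> equals the Borel function \<open>H\<close> only slice by slice and
  need not be jointly measurable; the iterated integrals agree all the same.\<close>

lemma double_integral_rep:
 fixes H :: "real \<times> real => real"
 assumes H: "bm H" and z: "!!t x. t \<notin> {0<..<T} | x \<notin> K ==> H (t, x) = 0"
  and ae: "ae t. t \<in> {0<..<T} --> (ae x. x \<in> K --> b t x = H (t, x))"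
 shows "(LINT t:{0<..<T}|lebesgue. LINT x:K|lebesgue. b t x) = (LBINT t. LBINT x. H (t, x))"
proof -
 have a: "ae t. indicator {0<..<T} t*(LINT x|lebesgue. indicator K x*b t x) = (LBINT x. H (t, x))"
  using ae
 proof eventually_elim
  case (elim t)
  show ?case
  proof (cases "t \<in> {0<..<T}")
   case True
   have ax: "ae x. indicator K x*b t x = H (t, x)"
    using elim[rule_format, OF True] by eventually_elim (use z in "auto simp: indicator_def")
   have m: "bm (%x. H (t, x))" by (rule sections_measurable(3)[OF H H])
   show ?thesis using True lebesgue_integral_rep(1)[OF lebesgue_of_AE[OF ax m] m ax] by simp
  qed (simp add: z)
 qed
 have m: "bm (%t. LBINT x. H (t, x))"
  using sections_measurable(2)[OF H, of "%_. 1"] by simp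
 show ?thesis unfolding set_lebesgue_integral_def real_scaleR_def
  by (rule lebesgue_integral_rep(1)[OF lebesgue_of_AE[OF a m] m a])
qed

lemma in_L2_on_rep:
 assumes K: "K \<in> sets borel" and h: "bm h" and ae: "ae x. indicator K x*f x = h x"
 shows "in_L2 K f \<longleftrightarrow> sql h" "L2_norm K f = nl h"
proof -
 have K': "K \<inter> space lebesgue \<in> sets lebesgue" using K by simp
 have sq: "(%x. indicator K x *\<^sub>R (f x)^2) = (%x. (indicator K x*f x)^2)" by (auto simp: indicator_def)
 have "in_L2 K f \<longleftrightarrow> in_L2 UNIV (%x. indicator K x*f x)" "L2_norm K f = L2_norm UNIV (%x. indicator K x*f x)"
  unfolding in_L2_def L2_norm_def borel_measurable_restrict_space_iff[OF K'] integrable_restrict_space[OF K'] integral_restrict_space[OF K'] sq lebesgue_on_UNIV_eq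
  by simp_all
 thus "in_L2 K f \<longleftrightarrow> sql h" "L2_norm K f = nl h" using in_L2_rep[OF lebesgue_of_AE[OF ae h] h ae] by simp_all
qed

lemma AE_lebesgue_on_iff:
 assumes "S \<in> sets borel"
 shows "(AE x in lebesgue_on S. P x) \<longleftrightarrow> (ae x. x \<in> S --> P x)"
 using assms by (subst AE_restrict_space_iff) (auto simp: AE_completion_iff)

lemma AE_product_sections:
 assumes "AE z in (lborel :: (real \<times> real) measure). P z"
 shows "ae t. ae x. P (t, x)"
proof -
 have "AE z in (lborel :: real measure) \<Otimes>\<^sub>M (lborel :: real measure). P z" unfolding lborel_prod by (rule assms)
 from lborel_pair.AE_pair[OF this] show ?thesis .
qed

lemma slab_rep:
 fixes w :: "real => real => real"
 assumes K: "K \<in> sets borel" and w: "(%(t, x). w t x) \<in> borel_measurable (lebesgue_on ({0<..<T} \<times> K))"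
 shows "EX h. bm h & (ALL t x. t \<notin> {0<..<T} | x \<notin> K --> h (t, x) = (0::real)) &
  (ae z. indicator ({0<..<T} \<times> K) z*w (fst z) (snd z) = h z) &
  (ae t. t \<in> {0<..<T} --> (ae x. indicator K x*w t x = h (t, x)))"
proof -
 let ?S = "{0<..<T} \<times> K"
 have S: "?S \<in> sets borel" using K by (intro borel_Times) auto
 have S': "?S \<inter> space lebesgue \<in> sets lebesgue" using S by simp
 have "(%z. indicator ?S z *\<^sub>R (case z of (t, x) => w t x)) \<in> borel_measurable lebesgue"
  using w unfolding borel_measurable_restrict_space_iff[OF S'] .
 then obtain g where g: "bm g" "ae z. indicator ?S z *\<^sub>R (case z of (t, x) => w t x) = g z"
  using lebesgue_rep by metis
 define h where "h z = indicator ?S z*g z" for z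
 have hm: "bm h" unfolding h_def using g(1) S by simp
 have hz: "ae z. indicator ?S z*w (fst z) (snd z) = h z"
  using g(2)
 proof eventually_elim
  case (elim z)
  thus ?case by (cases "z \<in> ?S") (simp_all add: h_def case_prod_unfold)
 qed
 from AE_product_sections[OF this]
 have "ae t. t \<in> {0<..<T} --> (ae x. indicator K x*w t x = h (t, x))"
 proof eventually_elim
  case (elim t)
  show ?case
  proof
   assume "t \<in> {0<..<T}"
   with elim show "ae x. indicator K x*w t x = h (t, x)" by (auto elim!: eventually_mono simp: indicator_def split: if_splits)
  qed
 qed
 thus ?thesis using hm hz by (intro exI[of _ h]) (auto simp: h_def)
qed

lemma L1_L2_rep:
 assumes K: "compact K" and phi: "in_L1_L2 T K phi"
 shows "EX h. bm h & (ALL t x. t \<notin> {0<..<T} | x \<notin> K --> h (t, x) = (0::real)) &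
  (ae t. t \<in> {0<..<T} --> (ae x. indicator K x*phi t x = h (t, x))) &
  (ae t. sql (%x. h (t, x))) & intg (%t. nl (%x. h (t, x)))"
proof -
 have Kb: "K \<in> sets borel" using K by (simp add: borel_compact)
 obtain h where h: "bm h" "!!t x. t \<notin> {0<..<T} | x \<notin> K ==> h (t, x) = (0::real)"
  "ae t. t \<in> {0<..<T} --> (ae x. indicator K x*phi t x = h (t, x))"
  using slab_rep[OF Kb] phi unfolding in_L1_L2_def by meson
 have z: "sql (%x. h (t, x)) & nl (%x. h (t, x)) = 0" if "t \<notin> {0<..<T}" for t
  using h(2)[of t] that by (simp add: nrm_def)
 have "ae t. t \<in> {0<..<T} --> in_L2 K (phi t)" using phi by (simp add: in_L1_L2_def AE_lebesgue_on_iff)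
 with h(3) have s: "ae t. sql (%x. h (t, x)) & indicator {0<..<T} t*L2_norm K (phi t) = nl (%x. h (t, x))"
 proof eventually_elim
  case (elim t)
  show ?case
  proof (cases "t \<in> {0<..<T}")
   case True
   with elim show ?thesis
    using in_L2_on_rep[OF Kb sections_measurable(3)[OF h(1) h(1), of t], of "phi t"] by simp
  qed (use z in simp)
 qed
 have m: "bm (%t. nl (%x. h (t, x)))" by (rule sections_measurable(1)[OF h(1) h(1)])
 have a: "ae t. indicator {0<..<T} t*L2_norm K (phi t) = nl (%x. h (t, x))" using s by eventually_elim simp
 have "integrable lebesgue (%t. indicator {0<..<T} t*L2_norm K (phi t))"
  using phi by (simp add: in_L1_L2_def integrable_restrict_space)
 hence "intg (%t. nl (%x. h (t, x)))" using lebesgue_integral_rep(2)[OF lebesgue_of_AE[OF a m] m a] by simp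
 moreover have "ae t. sql (%x. h (t, x))" using s by eventually_elim simp
 ultimately show ?thesis using h by blast
qed

lemma slab_sqint:
 fixes h :: "real \<times> real => real"
 assumes h: "bm h" "!!t x. t \<notin> {0<..<T} ==> h (t, x) = 0"
  and b: "ae t. t \<in> {0<..<T} --> sql (%x. h (t, x)) & nl (%x. h (t, x)) <= B"
 shows "sqint lborel h" "ae t. sql (%x. h (t, x)) & nl (%x. h (t, x)) <= abs B"
  "intg (%t. nl (%x. h (t, x)))" "nrm lborel h <= sqrt (abs T*B^2)"
proof -
 have z: "sql (%x. h (t, x)) & nl (%x. h (t, x)) = 0" if "t \<notin> {0<..<T}" for t
  using h(2)[of t] that by (simp add: nrm_def)
 have s: "ae t. sql (%x. h (t, x)) & nl (%x. h (t, x)) <= abs B*indicator {0<..<T} t"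
  using b by eventually_elim (use z in "auto simp: indicator_def")
 show "ae t. sql (%x. h (t, x)) & nl (%x. h (t, x)) <= abs B"
 proof -
  have "abs B*indicator {0<..<T} t <= abs B" for t by (cases "t \<in> {0<..<T}") auto
  thus ?thesis by (intro eventually_mono[OF s]) (blast intro: order_trans)
 qed
 have m: "bm (%t. nl (%x. h (t, x)))" by (rule sections_measurable(1)[OF h(1) h(1)])
 have i: "intg (%t. c*indicator {0<..<T} t :: real)" for c by (cases "0 <= T") simp_all
 show "intg (%t. nl (%x. h (t, x)))"
  by (rule int_bound[OF i[of "abs B"]]) (use s m in "auto elim!: eventually_mono")
 have sq: "ae t. (nl (%x. h (t, x)))^2 <= B^2*indicator {0<..<T} t"
  using s
 proof eventually_elim
  case (elim t)
  hence "(nl (%x. h (t, x)))^2 <= (abs B*indicator {0<..<T} t)^2" by (intro power_mono) auto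
  moreover have "(abs B*indicator {0<..<T} t)^2 = B^2*indicator {0<..<T} t" by (cases "t \<in> {0<..<T}") simp_all
  ultimately show ?case by (simp only:)
 qed
 have i2: "intg (%t. (nl (%x. h (t, x)))^2)"
  by (rule int_bound[OF i[of "B^2"]]) (use sq m in "auto elim!: eventually_mono")
 have s1: "ae t. sql (%x. h (t, x))" using s by eventually_elim simp
 show sh: "sqint lborel h" by (rule sqint_product[OF h(1) s1 i2])
 have "(LBINT t. (nl (%x. h (t, x)))^2) <= (LBINT t. B^2*indicator {0<..<T} t)" by (rule integral_mono_AE[OF i2 i sq])
 also have "... <= abs T*B^2" by (cases "0 <= T") (auto simp: mult.commute mult_nonpos_nonneg)
 finally show "nrm lborel h <= sqrt (abs T*B^2)" unfolding nrm_def[of lborel h] sqint_sections(3)[OF sh] by simp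
qed

lemma entropy_shock_measurable [measurable]: "bm (es um up)"
 unfolding entropy_shock_def[abs_def] by measurable

lemma slab_measurable:
 fixes W :: "real => real => real" and X :: "real => real"
 assumes X: "continuous_on {0..T} X" and W: "continuous_on ({0..} \<times> UNIV) (%(t, x). W t x)"
 shows "bm (%z. indicator {0<..<T} (fst z)*W (fst z) (snd z))"
  "bm (%z. indicator {0<..<T} (fst z)*es um up (snd z - sgm*fst z - X (fst z)))"
proof -
 let ?A = "{0<..<T} \<times> (UNIV :: real set)"
 have A: "?A \<in> sets borel" by (intro borel_open open_Times) auto
 have ind: "indicator {0<..<T} (fst z) = (indicator ?A z :: real)" for z by (auto simp: indicator_def mem_Times_iff)
 have "continuous_on ?A (%z. W (fst z) (snd z))"
  by (rule continuous_on_subset[OF W[unfolded case_prod_unfold]]) auto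
 from borel_measurable_continuous_on_indicator[OF A this]
 show "bm (%z. indicator {0<..<T} (fst z)*W (fst z) (snd z))" by (simp add: ind)
 have "continuous_on ?A (%z. snd z - sgm*fst z - X (fst z))"
  by (intro continuous_intros continuous_on_compose2[OF X]) auto
 from borel_measurable_continuous_on_indicator[OF A this]
 have "bm (%z. indicator ?A z*es um up (indicator ?A z *\<^sub>R (snd z - sgm*fst z - X (fst z))))"
  using A by measurable
 also have "(%z. indicator ?A z*es um up (indicator ?A z *\<^sub>R (snd z - sgm*fst z - X (fst z))))
  = (%z. indicator {0<..<T} (fst z)*es um up (snd z - sgm*fst z - X (fst z)))"
  by (auto simp: indicator_def mem_Times_iff)
 finally show "bm (%z. indicator {0<..<T} (fst z)*es um up (snd z - sgm*fst z - X (fst z)))" .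
qed

text \<open>Difference from the shifted shock, extended by 0 beyond the time interval, so that weak
  compactness can be used on the whole plane.\<close>

definition deviation :: "real => real => real => real => (real => real => real) => (real => real) => real \<times> real => real" where
 "deviation um up sgm T W X z = indicator {0<..<T} (fst z)*(W (fst z) (snd z) - es um up (snd z - sgm*fst z - X (fst z)))"

lemma deviation:
 assumes X: "continuous_on {0..T} X" and W: "continuous_on ({0..} \<times> UNIV) (%(t, x). W t x)"
  and b: "!!t. t \<in> {0..T} ==> sql (%x. W t x - es um up (x - sgm*t - X t)) & nl (%x. W t x - es um up (x - sgm*t - X t)) <= e"
 shows "sqint lborel (deviation um up sgm T W X)" "nrm lborel (deviation um up sgm T W X) <= sqrt (abs T*e^2)"
  "t \<in> {0<..<T} ==> sql (%x. deviation um up sgm T W X (t, x)) & nl (%x. deviation um up sgm T W X (t, x)) <= e"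
proof -
 have "bm (deviation um up sgm T W X)"
  using borel_measurable_diff[OF slab_measurable(1)[OF X W] slab_measurable(2)[OF X W, of um up sgm]] by (simp add: deviation_def[abs_def] right_diff_distrib)
 moreover show s: "t \<in> {0<..<T} ==> sql (%x. deviation um up sgm T W X (t, x)) & nl (%x. deviation um up sgm T W X (t, x)) <= e" for t
  using b[of t] by (simp add: deviation_def)
 ultimately show "sqint lborel (deviation um up sgm T W X)" "nrm lborel (deviation um up sgm T W X) <= sqrt (abs T*e^2)"
  using slab_sqint[of "deviation um up sgm T W X" T e] by (auto simp: deviation_def)
qed

lemma test_function_subset: "test_function S phi ==> testf phi" "test_function S phi ==> x \<notin> S ==> phi x = 0"
 unfolding test_function_def using closure_subset[of "{x. phi x ~= 0}"] by auto

text \<open>Integration by parts moves the derivative from the test function to the primitive, and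
  Cauchy-Schwarz bounds the variation by the norm of \<open>p\<close> times that of the indicator of
  \<open>{0..T}\<close>.\<close>

lemma prim_in_BV:
 assumes p: "sql p" and T: "T > 0"
 shows "in_BV T (prim p)"
 unfolding in_BV_def
proof
 have c: "cont (prim p)" by (rule prim_continuous[OF p])
 have s: "{0<..<T} \<inter> space lebesgue \<in> sets lebesgue" by simp
 have "set_integrable lborel {0..T} (prim p)"
  by (rule borel_integrable_atLeastAtMost'[OF continuous_on_subset[OF c]]) simp
 hence "set_integrable lborel {0<..<T} (prim p)" by (rule set_integrable_subset) auto
 hence "integrable lebesgue (%t. indicator {0<..<T} t *\<^sub>R prim p t)"
  unfolding set_integrable_def using c by (subst integrable_completion) (auto intro!: bm_cont)
 thus "integrable (lebesgue_on {0<..<T}) (prim p)" unfolding integrable_restrict_space[OF s] .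
 have "(LINT t:{0<..<T}|lebesgue. prim p t*deriv phi t) <= nl (indicator {0..T})*nl p"
  if phi: "test_function {0<..<T} phi & (ALL t. abs (phi t) <= 1)" for phi
 proof -
  note t = test_function_subset(1)[OF conjunct1[OF phi]]
  have si: "sql (indicator {0..T})" using sql_indicator(1)[of 0 T] T by simp
  have bphi: "abs (phi s) <= abs (indicator {0..T} s)" for s
  proof (cases "s \<in> {0<..<T}")
   case False
   thus ?thesis using test_function_subset(2)[OF conjunct1[OF phi]] by simp
  qed (use phi in simp)
  have sphi: "sql phi" "nl phi <= nl (indicator {0..T})"
   using sqint_bound[OF si _ AE_I2[OF bphi]] test_function_borel[OF t] by auto
  have "(LINT t:{0<..<T}|lebesgue. prim p t*deriv phi t) = (LINT t|lebesgue. prim p t*deriv phi t)"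
   unfolding set_lebesgue_integral_def
   by (intro int_cong refl) (use test_function_deriv_zero[OF conjunct1[OF phi]] in "auto simp: indicator_def")
  also have "... = (LBINT t. prim p t*deriv phi t)"
   using bm_cont[OF c] test_function_borel[OF test_function_deriv[OF t]] by (intro integral_completion) simp
  also have "... = - (LBINT t. p t*phi t)" by (rule prim_weak[OF locint_sql[OF p] c t locint_sql[OF p]])
  also have "... <= nl p*nl phi" using cauchy_schwarz[OF p sphi(1)] by linarith
  also have "... <= nl p*nl (indicator {0..T})" by (intro mult_left_mono sphi) simp
  finally show ?thesis by (simp add: mult.commute)
 qed
 thus "EX V. ALL phi. test_function {0<..<T} phi & (ALL t. abs (phi t) <= 1) --> (LINT t:{0<..<T}|lebesgue. prim p t*deriv phi t) <= V" by blast
qed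

section \<open>Limit of a sequence of solutions\<close>

locale vanishing_sequence =
 fixes um up sgm T e0 c0 :: real and W u :: "nat => real => real => real" and X X' :: "nat => real => real"
  and e c :: "nat => real" and p :: "real => real" and g :: "real \<times> real => real"
 assumes T: "T > 0"
  and W: "!!k. continuous_on ({0..} \<times> UNIV) (%(t, x). W k t x)"
  and u: "!!k t. t \<in> {0<..<T} ==> ae x. u k t x = W k t x"
  and X': "!!k. continuous_on {0..T} (X' k)" "!!k t. t \<in> {0..T} ==> X k t = integral {0..t} (X' k)"
  and c: "!!k. integral {0..T} (%t. (X' k t)^2) <= c k" "c ----> c0"
  and e: "!!k t. t \<in> {0..T} ==> sql (%x. W k t x - es um up (x - sgm*t - X k t)) &
    nl (%x. W k t x - es um up (x - sgm*t - X k t)) <= e k" "e ----> e0"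
  and p: "sql p" "!!h. sql h ==> (%k. LBINT t. h t*(indicator {0..T} t*X' k t)) ----> (LBINT t. h t*p t)"
  and g: "sqint lborel g"
   "!!h. sqint lborel h ==> (%k. \<integral>z. h z*deviation um up sgm T (W k) (X k) z \<partial>lborel) ----> (LINT z|lborel. h z*g z)"
begin

abbreviation "ub == es um up"
abbreviation "Xi == prim p"
text \<open>The candidate limit, put together from the weak limit \<open>g\<close> of the deviations
  and the shock displaced by the limit \<open>Xi\<close> of the shifts.\<close>

definition "w0 t x = g (t, x) + ub (x - sgm*t - Xi t)"

lemma Xc: "continuous_on {0..T} (X k)"
proof -
 have "continuous_on {0..T} (%t. integral {0..t} (X' k))"
  by (rule indefinite_integral_continuous_1[OF integrable_continuous_real[OF X'(1)]])
 thus ?thesis using X'(2) by (subst continuous_on_cong[OF refl]) auto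
qed

lemma X_pairing:
 assumes t: "t \<in> {0..T}"
 shows "X k t = (LBINT s. indicator {0..t} s * (indicator {0..T} s * X' k s))" "abs (X k t) <= sqrt (T*c k)"
proof -
 have i: "set_integrable lborel {0..t} (X' k)"
  by (rule borel_integrable_atLeastAtMost'[OF continuous_on_subset[OF X'(1)]]) (use t in auto)
 have "X k t = (LBINT s. indicator {0..t} s *\<^sub>R X' k s)"
  using X'(2)[OF t] set_borel_integral_eq_integral(2)[OF i] by (simp add: set_lebesgue_integral_def)
 also have "... = (LBINT s. indicator {0..t} s * (indicator {0..T} s * X' k s))"
  by (intro int_cong refl) (use t in "auto simp: indicator_def")
 finally show eq: "X k t = (LBINT s. indicator {0..t} s * (indicator {0..T} s * X' k s))" .
 have s: "sql (%s. indicator {0..T} s * X' k s)" "(nl (%s. indicator {0..T} s * X' k s))^2 <= c k"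
 proof -
  have q: "set_integrable lborel {0..T} (%s. (X' k s)^2)"
   by (rule borel_integrable_atLeastAtMost') (intro continuous_intros X')
  have sq: "(%s. indicator {0..T} s *\<^sub>R (X' k s)^2) = (%s. (indicator {0..T} s * X' k s)^2)" by (auto simp: indicator_def)
  have "bm (%s. indicator {0..T} s *\<^sub>R X' k s)"
   by (rule borel_measurable_continuous_on_indicator[OF _ X'(1)]) simp
  thus "sql (%s. indicator {0..T} s * X' k s)" using q unfolding set_integrable_def sq by (simp add: sqint_def)
  show "(nl (%s. indicator {0..T} s * X' k s))^2 <= c k"
   using set_borel_integral_eq_integral(2)[OF q] c(1)[of k] unfolding set_lebesgue_integral_def sq nrm_sq by simp
 qed
 have "abs (X k t) <= sqrt t*nl (%s. indicator {0..T} s * X' k s)"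
  unfolding eq using cauchy_schwarz[OF sql_indicator(1) s(1), of 0 t] sql_indicator(2)[of 0 t] t by simp
 also have "... <= sqrt T * sqrt (c k)"
  using t s(2) by (intro mult_mono real_le_rsqrt) auto
 finally show "abs (X k t) <= sqrt (T*c k)" by (simp add: real_sqrt_mult)
qed

lemma X_tendsto:
 assumes t: "t \<in> {0..T}" shows "(%k. X k t) ----> Xi t"
proof -
 have "(LBINT s. indicator {0..t} s * p s) = Xi t" using t by (simp add: prim_def mult.commute)
 thus ?thesis unfolding X_pairing(1)[OF t] using p(2)[OF sql_indicator(1), of 0 t] t by simp
qed

lemma Xi_bound: "t \<in> {0..T} ==> abs (Xi t) <= sqrt (T*c0)"
 by (rule LIMSEQ_le[OF tendsto_rabs[OF X_tendsto] tendsto_real_sqrt[OF tendsto_mult[OF tendsto_const c(2)]]])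
  (use X_pairing(2) in auto)

lemma Xi_cont: "cont Xi" by (rule prim_continuous[OF p(1)])

lemma g_meas: "bm g" using g(1) by (simp add: sqint_def)

lemma w0_meas: "bm (%z. w0 (fst z) (snd z))"
proof -
 have "cont (%z::real\<times>real. snd z - sgm*fst z - Xi (fst z))"
  by (intro continuous_intros continuous_on_compose2[OF Xi_cont]) auto
 hence [measurable]: "bm (%z::real\<times>real. snd z - sgm*fst z - Xi (fst z))" by (rule bm_cont)
 have "bm (%z. g z + ub (snd z - sgm*fst z - Xi (fst z)))" using g_meas by measurable
 thus ?thesis by (simp add: w0_def)
qed

lemma g_bound: "ae t. t \<in> {0<..<T} --> sql (%x. g (t, x)) & nl (%x. g (t, x)) <= e0"
proof (rule weak_limit_section_bound[OF _ _ e(2) g(1) g(2) T])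
 show "sqint lborel (deviation um up sgm T (W k) (X k))" for k by (rule deviation(1)[OF Xc W e(1)])
 show "sql (%x. deviation um up sgm T (W k) (X k) (t, x)) & nl (%x. deviation um up sgm T (W k) (X k) (t, x)) <= e k"
  if "t \<in> {0<..<T}" for k t by (rule deviation(3)[OF Xc W e(1) that])
qed

text \<open>The shock is not square integrable on the line; it enters L2 arguments only after
  multiplication with the indicator of a bounded interval.\<close>

lemma shock_local:
 assumes R: "R > 0"
 shows "sql (%x. indicator {-R..R} x*ub (x - d))" "nl (%x. indicator {-R..R} x*ub (x - d)) <= (abs um + abs up) * sqrt (2*R)"
proof -
 have i: "sql (%x. (abs um + abs up)*indicator {-R..R} x)" "nl (%x. (abs um + abs up)*indicator {-R..R} x) = (abs um + abs up) * sqrt (2*R)"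
  using sql_indicator[of "-R" R] R by (simp_all add: sqint_cmult nrm_cmult)
 have "abs (indicator {-R..R} x*ub (x - d)) <= abs ((abs um + abs up)*indicator {-R..R} x)" for x
  by (auto simp: indicator_def entropy_shock_def)
 thus "sql (%x. indicator {-R..R} x*ub (x - d))" "nl (%x. indicator {-R..R} x*ub (x - d)) <= (abs um + abs up) * sqrt (2*R)"
  using sqint_bound[OF i(1), of "%x. indicator {-R..R} x*ub (x - d)"] i(2) by auto
qed

lemma w0_local:
 assumes K: "K \<in> sets borel" "K \<subseteq> {-R..R}" and R: "R > 0"
 shows "ae t. t \<in> {0<..<T} --> sql (%x. indicator K x*w0 t x) & nl (%x. indicator K x*w0 t x) <= e0 + (abs um + abs up) * sqrt (2*R)"
 using g_bound
proof eventually_elim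
 case (elim t)
 show ?case
 proof
  assume "t \<in> {0<..<T}"
  hence G: "sql (%x. g (t, x))" "nl (%x. g (t, x)) <= e0" using elim by auto
  note S = shock_local[OF R, of "sgm*t + Xi t"]
  let ?h = "%x. g (t, x) + indicator {-R..R} x*ub (x - (sgm*t + Xi t))"
  have h: "sql ?h" "nl ?h <= e0 + (abs um + abs up) * sqrt (2*R)"
   using sqint_add[OF G(1) S(1)] nrm_triangle[OF G(1) S(1)] G(2) S(2) by auto
  have m: "bm (%x. indicator K x*w0 t x)"
   using sections_measurable(3)[OF w0_meas w0_meas, of t] K(1) by simp
  have "abs (indicator K x*w0 t x) <= abs (?h x)" for x
   using K(2) by (auto simp: indicator_def w0_def diff_diff_eq)
  thus "sql (%x. indicator K x*w0 t x) & nl (%x. indicator K x*w0 t x) <= e0 + (abs um + abs up) * sqrt (2*R)"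
   using sqint_bound[OF h(1), of "%x. indicator K x*w0 t x"] m h(2) by auto
 qed
qed

lemma compact_symmetric:
 assumes "compact (K :: real set)" obtains R where "R > 0" "K \<subseteq> {-R..R}"
proof -
 obtain a where "!!x. x \<in> K ==> abs x <= a" using compact_imp_bounded[OF assms] by (auto simp: bounded_iff)
 thus ?thesis by (intro that[of "abs a + 1"]) force+
qed

lemma w0_Linf: "in_Linf_L2loc T w0"
 unfolding in_Linf_L2loc_def
proof (intro conjI allI impI)
 show "(%(t, x). w0 t x) \<in> borel_measurable (lebesgue_on ({0<..<T} \<times> UNIV))"
  using w0_meas by (intro measurable_restrict_space1 measurable_completion) (simp add: case_prod_unfold)
 fix K :: "real set" assume K: "compact K"
 hence Kb: "K \<in> sets borel" by (simp add: borel_compact)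
 obtain R where R: "R > 0" "K \<subseteq> {-R..R}" using compact_symmetric[OF K] .
 have "ae t. t \<in> {0<..<T} --> in_L2 K (w0 t) & L2_norm K (w0 t) <= e0 + (abs um + abs up) * sqrt (2*R)"
  using w0_local[OF Kb R(2,1)]
 proof eventually_elim
  case (elim t)
  have m: "bm (%x. indicator K x*w0 t x)"
   using sections_measurable(3)[OF w0_meas w0_meas, of t] Kb by simp
  show ?case using elim in_L2_on_rep[OF Kb m AE_I2[OF refl]] by simp
 qed
 thus "EX B. AE t in lebesgue_on {0<..<T}. in_L2 K (w0 t) & L2_norm K (w0 t) <= B"
  by (auto simp: AE_lebesgue_on_iff)
qed

text \<open>On a bounded space interval \<open>u k\<close> is the deviation, which converges weakly,
  plus the cut-off shock \<open>b k\<close>, which converges strongly. This handles square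
  integrable test functions; uniform slice bounds and \<open>weak_limit_L1_L2\<close> extend it to
  the larger class.\<close>

lemma w0_weak_star: "weak_star_tendsto T u w0"
 unfolding weak_star_tendsto_def
proof (intro allI impI, elim conjE)
 fix K phi assume K: "compact K" and phi: "in_L1_L2 T K phi"
 obtain R where R: "R > 0" "K \<subseteq> {-R..R}" using compact_symmetric[OF K] .
 obtain h where h: "bm h" "!!t x. t \<notin> {0<..<T} | x \<notin> K ==> h (t, x) = (0::real)"
  "ae t. t \<in> {0<..<T} --> (ae x. indicator K x*phi t x = h (t, x))"
  "ae t. sql (%x. h (t, x))" "intg (%t. nl (%x. h (t, x)))"
  using L1_L2_rep[OF K phi] by meson
 define I where "I z = (indicator {0<..<T} (fst z)*indicator {-R..R} (snd z) :: real)" for z :: "real \<times> real"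
 have Im: "bm I"
 proof -
  have "I = indicator ({0<..<T} \<times> {-R..R})" by (auto simp: I_def indicator_def)
  thus ?thesis using borel_Times[of "{0<..<T}" "{-R..R}"] by simp
 qed
 have I: "I (t, x) = indicator {0<..<T} t*indicator {-R..R} x" for t x by (simp add: I_def)
 define b where "b k z = I z*ub (snd z - sgm*fst z - X k (fst z))" for k z
 define b0 where "b0 z = I z*ub (snd z - sgm*fst z - Xi (fst z))" for z
 define F where "F k z = I z*deviation um up sgm T (W k) (X k) z + b k z" for k z
 define G where "G z = I z*g z + b0 z" for z
 have II: "I z*indicator {0<..<T} (fst z) = I z" for z by (simp add: I_def indicator_def)
 have bm: "bm (b k)" for k
 proof -
  have "bm (%z. I z*(indicator {0<..<T} (fst z)*ub (snd z - sgm*fst z - X k (fst z))))"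
   by (rule borel_measurable_times[OF Im slab_measurable(2)[OF Xc W]])
  thus ?thesis unfolding mult.assoc[symmetric] II by (simp add: b_def[abs_def])
 qed
 have b0m: "bm b0"
  using borel_measurable_times[OF Im borel_measurable_diff[OF w0_meas g_meas]] by (simp add: b0_def[abs_def] w0_def)
 define beta where "beta = (abs um + abs up) * sqrt (2*R)"
 have bsec: "sql (%x. b k (t, x)) & nl (%x. b k (t, x)) <= beta" "sql (%x. b0 (t, x)) & nl (%x. b0 (t, x)) <= beta" for k t
 proof -
  have *: "sql (%x. I (t, x)*ub (x - d)) & nl (%x. I (t, x)*ub (x - d)) <= beta" for d
  proof (cases "t \<in> {0<..<T}")
   case True
   thus ?thesis using shock_local[OF R(1), of d] by (simp add: I beta_def)
  next
   case False
   thus ?thesis using R by (simp add: I nrm_def beta_def)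
  qed
  show "sql (%x. b k (t, x)) & nl (%x. b k (t, x)) <= beta" "sql (%x. b0 (t, x)) & nl (%x. b0 (t, x)) <= beta"
   using *[of "sgm*t + X k t"] *[of "sgm*t + Xi t"] by (simp_all add: b_def b0_def diff_diff_eq)
 qed
 have sI: "sqint lborel (%z. (abs um + abs up)*I z)"
 proof (rule slab_sqint(1)[of _ T "(abs um + abs up) * sqrt (2*R)"])
  have "sql (%x. I (t, x)) & nl (%x. I (t, x)) <= sqrt (2*R)" if "t \<in> {0<..<T}" for t
   using sql_indicator[of "-R" R] R that by (simp add: I)
  thus "ae t. t \<in> {0<..<T} --> sql (%x. (abs um + abs up)*I (t, x)) & nl (%x. (abs um + abs up)*I (t, x)) <= (abs um + abs up) * sqrt (2*R)"
   by (intro AE_I2) (auto simp: nrm_cmult sqint_cmult intro!: mult_left_mono)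
 qed (use Im in "auto simp: I")
 have strong: "(%k. nrm lborel (%z. b k z - b0 z)) ----> 0" "sqint lborel b0" "!!k. sqint lborel (b k)"
 proof -
  have dom: "abs (I z*ub y) <= abs ((abs um + abs up)*I z)" for z y by (auto simp: I_def indicator_def entropy_shock_def)
  have 1: "ae z. abs (b k z) <= abs ((abs um + abs up)*I z)" for k
   unfolding b_def by (intro AE_I2 dom)
  \<comment> \<open>The step function is discontinuous only where its argument vanishes, and the
    curve \<open>x = sgm*t + Xi t\<close> is a null set of the plane.\<close>
  have 2: "ae z. (%k. b k z) ----> b0 z"
  proof -
   define y where "y z = snd z - sgm*fst z - Xi (fst z)" for z
   have "cont y" unfolding y_def by (intro continuous_intros continuous_on_compose2[OF Xi_cont]) auto
   hence ym [measurable]: "y \<in> borel_measurable (lborel \<Otimes>\<^sub>M lborel)" by (simp add: lborel_prod bm_cont)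
   have "AE z in (lborel \<Otimes>\<^sub>M lborel). y z ~= 0"
   proof (rule lborel_pair.AE_pair_measure)
    show "{z \<in> space (lborel \<Otimes>\<^sub>M lborel). y z ~= 0} \<in> sets (lborel \<Otimes>\<^sub>M lborel)" by measurable
    show "ae t. ae x. y (t, x) ~= 0"
    proof (rule AE_I2)
     fix t
     show "ae x. y (t, x) ~= 0"
      using AE_lborel_singleton[of "sgm*t + Xi t"] by eventually_elim (simp add: y_def)
    qed
   qed
   hence "ae z. y z ~= 0" unfolding lborel_prod .
   thus ?thesis
   proof eventually_elim
    case (elim z)
    show ?case
    proof (cases "fst z \<in> {0..T}")
     case True
     have l: "(%k. snd z - sgm*fst z - X k (fst z)) ----> y z"
      unfolding y_def by (intro tendsto_intros X_tendsto[OF True])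
     have "\<forall>\<^sub>F k in sequentially. ub (y z) = ub (snd z - sgm*fst z - X k (fst z))"
     proof (cases "y z < 0")
      case True
      show ?thesis by (rule eventually_mono[OF order_tendstoD(2)[OF l True]]) (use True in "simp add: entropy_shock_def")
     next
      case False
      hence "y z > 0" using elim by simp
      show ?thesis by (rule eventually_mono[OF order_tendstoD(1)[OF l \<open>y z > 0\<close>]]) (use False in "simp add: entropy_shock_def")
     qed
     hence "(%k. ub (snd z - sgm*fst z - X k (fst z))) ----> ub (y z)" by (rule Lim_transform_eventually[OF tendsto_const])
     thus ?thesis unfolding b_def b0_def y_def[symmetric] by (intro tendsto_intros)
    qed (auto simp: b_def b0_def I_def)
   qed
  qed
  note D = L2_dominated[OF sI, of b b0, simplified, OF bm b0m 1 2]
  show "(%k. nrm lborel (%z. b k z - b0 z)) ----> 0" "sqint lborel b0" "!!k. sqint lborel (b k)" by (fact D)+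
 qed
 have dev: "sqint lborel (deviation um up sgm T (W k) (X k))" for k by (rule deviation(1)[OF Xc W e(1)])
 have sIf: "sqint lborel (%z. I z*f z)" if "sqint lborel f" for f
 proof (rule sqint_bound(1)[OF that])
  show "(%z. I z*f z) \<in> borel_measurable lborel" using borel_measurable_times[OF Im, of f] sqint_measurable[OF that] by simp
  show "ae z. abs (I z*f z) <= abs (f z)" by (intro AE_I2) (simp add: I_def indicator_def)
 qed
 have sF: "sqint lborel (F k)" and sG: "sqint lborel G" for k
  unfolding F_def[abs_def] G_def[abs_def] by (intro sqint_add sIf dev g strong)+
 obtain E where E: "!!k. e k <= E" using convergent_imp_Bseq[OF convergentI[OF e(2)]] by (auto simp: Bseq_def) (metis abs_le_D1)
 have e0E: "e0 <= E" by (rule LIMSEQ_le_const2[OF e(2)]) (use E in auto)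
 have E0: "E >= 0" using order_trans[OF nrm_nonneg order_trans[OF conjunct2[OF e(1)[of 0 0]] E[of 0]]] T by simp
 have sec: "sql (%x. I (t, x)*f x + b x) & nl (%x. I (t, x)*f x + b x) <= E + beta"
  if "t \<in> {0<..<T} ==> sql f & nl f <= E" "sql b & nl b <= beta" for t f b
 proof -
  have "sql (%x. I (t, x)*f x) & nl (%x. I (t, x)*f x) <= E"
  proof (cases "t \<in> {0<..<T}")
   case True
   hence f: "sql f" "nl f <= E" using that(1) by auto
   have "(%x. I (t, x)*f x) \<in> borel_measurable lborel" using sqint_measurable[OF f(1)] by (simp add: I)
   moreover have "ae x. abs (I (t, x)*f x) <= abs (f x)" by (intro AE_I2) (simp add: I_def indicator_def)
   ultimately show ?thesis using sqint_bound[OF f(1)] f(2) by force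
  qed (use E0 in "simp add: I nrm_def")
  thus ?thesis using that(2) sqint_add[of lborel "%x. I (t, x)*f x" b] nrm_triangle[of lborel "%x. I (t, x)*f x" b] by force
 qed
 have lim: "(%k. LBINT t. LBINT x. F k (t, x)*h (t, x)) ----> (LBINT t. LBINT x. G (t, x)*h (t, x))"
 proof (rule weak_limit_L1_L2[where E="E + beta", OF sF _ sG _ _ h(1,4,5)])
  show "ae t. sql (%x. F k (t, x)) & nl (%x. F k (t, x)) <= E + beta" for k
  proof (rule AE_I2)
   fix t
   show "sql (%x. F k (t, x)) & nl (%x. F k (t, x)) <= E + beta"
    unfolding F_def
   proof (rule sec[OF _ bsec(1)])
    assume t: "t \<in> {0<..<T}"
    note d = deviation(3)[OF Xc[of k] W[of k] e(1)[of _ k] t]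
    show "sql (%x. deviation um up sgm T (W k) (X k) (t, x)) & nl (%x. deviation um up sgm T (W k) (X k) (t, x)) <= E"
     using conjunct1[OF d] order_trans[OF conjunct2[OF d] E] by blast
   qed
  qed
  show "ae t. sql (%x. G (t, x)) & nl (%x. G (t, x)) <= E + beta"
   using g_bound
  proof eventually_elim
   case (elim t)
   show ?case unfolding G_def by (rule sec[OF _ bsec(2)]) (use elim e0E in force)
  qed
  fix f :: "real \<times> real => real" assume f: "sqint lborel f"
  have e1: "(LINT z|lborel. f z*F k z) = (LINT z|lborel. (I z*f z)*deviation um up sgm T (W k) (X k) z) + (LINT z|lborel. f z*b k z)" for k
   using Bochner_Integration.integral_add[OF sqint_mult[OF sIf[OF f] dev[of k]] sqint_mult[OF f strong(3)[of k]]]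
   by (simp add: F_def algebra_simps)
  have e2: "(LINT z|lborel. f z*G z) = (LINT z|lborel. (I z*f z)*g z) + (LINT z|lborel. f z*b0 z)"
   using Bochner_Integration.integral_add[OF sqint_mult[OF sIf[OF f] g(1)] sqint_mult[OF f strong(2)]]
   by (simp add: G_def algebra_simps)
  have "(%k. (LINT z|lborel. f z*b k z) - (LINT z|lborel. f z*b0 z)) ----> 0"
  proof (rule Lim_null_comparison)
   show "\<forall>\<^sub>F k in sequentially. norm ((LINT z|lborel. f z*b k z) - (LINT z|lborel. f z*b0 z)) <= nrm lborel f*nrm lborel (%z. b k z - b0 z)"
   proof (rule always_eventually, rule allI)
    fix k
    have "(LINT z|lborel. f z*b k z) - (LINT z|lborel. f z*b0 z) = (LINT z|lborel. f z*(b k z - b0 z))"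
     using sqint_mult[OF f strong(3)[of k]] sqint_mult[OF f strong(2)] by (simp add: right_diff_distrib)
    thus "norm ((LINT z|lborel. f z*b k z) - (LINT z|lborel. f z*b0 z)) <= nrm lborel f*nrm lborel (%z. b k z - b0 z)"
     using cauchy_schwarz[OF f sqint_diff[OF strong(3)[of k] strong(2)]] by simp
   qed
   show "(%k. nrm lborel f*nrm lborel (%z. b k z - b0 z)) ----> 0" using tendsto_mult[OF tendsto_const strong(1)] by simp
  qed
  hence "(%k. \<integral>z. f z*b k z \<partial>lborel) ----> (LINT z|lborel. f z*b0 z)" by (rule LIM_zero_cancel)
  thus "(%k. \<integral>z. f z*F k z \<partial>lborel) ----> (LINT z|lborel. f z*G z)"
   unfolding e1 e2 by (intro tendsto_add g(2) sIf f)
 qed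
 have rep: "(LINT t:{0<..<T}|lebesgue. LINT x:K|lebesgue. v t x*phi t x) = (LBINT t. LBINT x. H (t, x)*h (t, x))"
  if "bm H" "!!t. t \<in> {0<..<T} ==> ae x. x \<in> K --> v t x = H (t, x)" for v H
 proof (rule double_integral_rep)
  show "bm (%z. H z*h z)" by (intro borel_measurable_times that h)
  show "H (t, x)*h (t, x) = 0" if "t \<notin> {0<..<T} | x \<notin> K" for t x using h(2)[OF that] by simp
  show "ae t. t \<in> {0<..<T} --> (ae x. x \<in> K --> v t x*phi t x = H (t, x)*h (t, x))"
   using h(3)
  proof eventually_elim
   case (elim t)
   show ?case
   proof
    assume t: "t \<in> {0<..<T}"
    show "ae x. x \<in> K --> v t x*phi t x = H (t, x)*h (t, x)"
     using elim[rule_format, OF t] that(2)[OF t] by eventually_elim auto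
   qed
  qed
 qed
 have uF: "(LINT t:{0<..<T}|lebesgue. LINT x:K|lebesgue. u k t x*phi t x) = (LBINT t. LBINT x. F k (t, x)*h (t, x))" for k
 proof (rule rep)
  show "bm (F k)" using sF[of k] by (simp add: sqint_def)
  show "ae x. x \<in> K --> u k t x = F k (t, x)" if "t \<in> {0<..<T}" for t
   using u[OF that, of k]
  proof eventually_elim
   case (elim x)
   thus ?case using that R(2) by (auto simp: F_def I b_def deviation_def)
  qed
 qed
 have w: "(LINT t:{0<..<T}|lebesgue. LINT x:K|lebesgue. w0 t x*phi t x) = (LBINT t. LBINT x. G (t, x)*h (t, x))"
 proof (rule rep)
  show "bm G" using sG by (simp add: sqint_def)
  show "ae x. x \<in> K --> w0 t x = G (t, x)" if "t \<in> {0<..<T}" for t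
   using that R(2) by (intro AE_I2) (auto simp: G_def I b0_def w0_def)
 qed
 show "(%k. LINT t:{0<..<T}|lebesgue. LINT x:K|lebesgue. u k t x*phi t x) ----> (LINT t:{0<..<T}|lebesgue. LINT x:K|lebesgue. w0 t x*phi t x)"
  unfolding uF w by (rule lim)
qed

end

context vanishing_sequence begin

text \<open>The theorem speaks about every weak limit \<open>w\<close>, so each must be identified
  with \<open>w0\<close>. On a slab the difference \<open>d\<close> of the two is square integrable
  and hence an admissible test function; testing with it makes the integral of \<open>d^2\<close>
  vanish.\<close>

lemma limit_unique:
 assumes L: "in_Linf_L2loc T w" and w: "weak_star_tendsto T u w"
 shows "ae t. t \<in> {0<..<T} --> (ae x. w t x = w0 t x)"
proof -
 have loc: "ae t. t \<in> {0<..<T} --> (ae x. x \<in> {-R..R} --> w t x = w0 t x)" if R: "R > 0" for R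
 proof -
  define K where "K = {-R..R}"
  have K: "K \<in> sets borel" "compact K" by (auto simp: K_def)
  have "(%(t, x). w t x) \<in> borel_measurable (lebesgue_on ({0<..<T} \<times> K))"
   using L unfolding in_Linf_L2loc_def by (auto elim: measurable_restrict_mono)
  from slab_rep[OF K(1) this] obtain h where h: "bm h" "!!t x. t \<notin> {0<..<T} | x \<notin> K ==> h (t, x) = (0::real)"
   and hw: "ae t. t \<in> {0<..<T} --> (ae x. indicator K x*w t x = h (t, x))" by meson
  define h0 where "h0 z = indicator ({0<..<T} \<times> K) z*w0 (fst z) (snd z)" for z
  have h0m: "bm h0"
   unfolding h0_def using borel_Times[of "{0<..<T}" K] K(1) w0_meas by (intro borel_measurable_times) auto
  have h0: "h0 (t, x) = 0" if "t \<notin> {0<..<T} | x \<notin> K" for t x using that by (auto simp: h0_def)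
  have h0t: "h0 (t, x) = indicator K x*w0 t x" if "t \<in> {0<..<T}" for t x using that by (simp add: h0_def indicator_def)
  obtain B where B: "ae t. t \<in> {0<..<T} --> in_L2 K (w t) & L2_norm K (w t) <= B"
   using L K(2) unfolding in_Linf_L2loc_def AE_lebesgue_on_iff[OF borel_open[OF open_greaterThanLessThan]] by meson
  have s: "sqint lborel h"
  proof (rule slab_sqint(1)[OF h(1)])
   show "ae t. t \<in> {0<..<T} --> sql (%x. h (t, x)) & nl (%x. h (t, x)) <= B"
    using B hw
   proof eventually_elim
    case (elim t)
    thus ?case using in_L2_on_rep[OF K(1) sections_measurable(3)[OF h(1) h(1)], of "w t" t] by simp
   qed
  qed (use h in auto)
  have s0: "sqint lborel h0"
  proof (rule slab_sqint(1)[OF h0m])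
   show "ae t. t \<in> {0<..<T} --> sql (%x. h0 (t, x)) & nl (%x. h0 (t, x)) <= e0 + (abs um + abs up) * sqrt (2*R)"
    using w0_local[OF K(1) _ R] by (rule AE_mp) (auto simp: K_def h0t[unfolded K_def])
  qed (use h0 in auto)
  define d where "d z = h z - h0 z" for z
  have sd: "sqint lborel d" unfolding d_def by (rule sqint_diff[OF s s0])
  have dm: "bm d" using sd by (simp add: sqint_def)
  have dz: "d (t, x) = 0" if "t \<notin> {0<..<T} | x \<notin> K" for t x using h(2)[OF that] h0[OF that] by (simp add: d_def)
  have dK: "indicator K x*d (t, x) = d (t, x)" for t x using dz[of t x] by (auto simp: indicator_def)
  have ds: "in_L2 K (%x. d (t, x)) \<longleftrightarrow> sql (%x. d (t, x))" "L2_norm K (%x. d (t, x)) = nl (%x. d (t, x))" for t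
   using in_L2_on_rep[OF K(1) sections_measurable(3)[OF dm dm, of t], of "%x. d (t, x)"] dK by auto
  note S = sqint_sections[OF sd]
  have "in_L1_L2 T K (%t x. d (t, x))"
   unfolding in_L1_L2_def ds
  proof (intro conjI)
   have "d \<in> borel_measurable (lebesgue_on ({0<..<T} \<times> K))"
    using dm by (intro measurable_restrict_space1 measurable_completion) simp
   thus "(%(t, x). d (t, x)) \<in> borel_measurable (lebesgue_on ({0<..<T} \<times> K))" by (simp add: case_prod_unfold)
   show "AE t in lebesgue_on {0<..<T}. sql (%x. d (t, x))" using S(1) by (auto simp: AE_lebesgue_on_iff elim: eventually_mono)
   have "intg (%t. indicator {0..T} t*nl (%x. d (t, x)))"
    by (rule sqint_mult[OF sql_indicator(1) S(2)]) (use T in simp)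
   hence "intg (%t. indicator {0<..<T} t*nl (%x. d (t, x)))"
    by (rule int_bound) (use sections_measurable(1)[OF dm dm] in "auto intro!: AE_I2 simp: indicator_def")
   hence "integrable lebesgue (%t. indicator {0<..<T} t*nl (%x. d (t, x)))"
    using sections_measurable(1)[OF dm dm] by (subst integrable_completion) auto
   thus "integrable (lebesgue_on {0<..<T}) (%t. nl (%x. d (t, x)))"
    by (subst integrable_restrict_space) auto
  qed
  hence "(LINT t:{0<..<T}|lebesgue. LINT x:K|lebesgue. w t x*d (t, x)) = (LINT t:{0<..<T}|lebesgue. LINT x:K|lebesgue. w0 t x*d (t, x))"
   using w w0_weak_star K(2) unfolding weak_star_tendsto_def by (blast intro: LIMSEQ_unique)
  moreover have "(LINT t:{0<..<T}|lebesgue. LINT x:K|lebesgue. w t x*d (t, x)) = (LBINT t. LBINT x. h (t, x)*d (t, x))"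
  proof (rule double_integral_rep)
   show "ae t. t \<in> {0<..<T} --> (ae x. x \<in> K --> w t x*d (t, x) = h (t, x)*d (t, x))"
    using hw
   proof eventually_elim
    case (elim t)
    show ?case
    proof
     assume "t \<in> {0<..<T}"
     with elim have "ae x. indicator K x*w t x = h (t, x)" by blast
     thus "ae x. x \<in> K --> w t x*d (t, x) = h (t, x)*d (t, x)" by eventually_elim auto
    qed
   qed
  qed (use h dm dz in auto)
  moreover have "(LINT t:{0<..<T}|lebesgue. LINT x:K|lebesgue. w0 t x*d (t, x)) = (LBINT t. LBINT x. h0 (t, x)*d (t, x))"
   by (rule double_integral_rep) (use h0m dm dz h0t in auto)
  ultimately have "(LINT z|lborel. h z*d z) = (LINT z|lborel. h0 z*d z)"
   by (simp add: product_pairing(1)[OF s sd] product_pairing(1)[OF s0 sd])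
  hence "(LINT z|lborel. h z*d z - h0 z*d z) = 0"
   using sqint_mult[OF s sd] sqint_mult[OF s0 sd] by simp
  moreover have "(%z. h z*d z - h0 z*d z) = (%z. (d z)^2)" by (auto simp: d_def power2_eq_square algebra_simps)
  ultimately have "(LINT z|lborel. (d z)^2) = 0" by simp
  hence "ae z. (d z)^2 = 0" using sd by (subst (asm) integral_nonneg_eq_0_iff_AE) (auto simp: sqint_def)
  from AE_product_sections[OF this] hw show ?thesis
  proof eventually_elim
   case (elim t)
   show ?case
   proof
    assume t: "t \<in> {0<..<T}"
    from elim(2)[rule_format, OF t] elim(1)
    show "ae x. x \<in> {-R..R} --> w t x = w0 t x"
     by eventually_elim (use h0t[OF t] in "auto simp: d_def K_def")
   qed
  qed
 qed
 have "ae t. ALL n::nat. t \<in> {0<..<T} --> (ae x. x \<in> {-real (Suc n)..real (Suc n)} --> w t x = w0 t x)"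
  unfolding AE_all_countable by (intro allI loc) simp
 thus ?thesis
 proof eventually_elim
  case (elim t)
  show ?case
  proof
   assume "t \<in> {0<..<T}"
   with elim have "ae x. ALL n::nat. x \<in> {-real (Suc n)..real (Suc n)} --> w t x = w0 t x"
    unfolding AE_all_countable by blast
   thus "ae x. w t x = w0 t x"
   proof eventually_elim
    case (elim x)
    obtain n :: nat where "abs x <= real n" using real_arch_simple by blast
    hence "x \<in> {-real (Suc n)..real (Suc n)}" by auto
    thus ?case using elim by blast
   qed
  qed
 qed
qed

text \<open>By \<open>limit_unique\<close>, \<open>w\<close> minus the shifted shock is
  \<open>g\<close> on almost every slice, so \<open>g_bound\<close> applies. If the constants are 0,
  then \<open>g\<close> vanishes by \<open>g_bound\<close> and the shift by \<open>Xi_bound\<close>;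
  the Borel representative \<open>h\<close> turns equality on slices into equality almost everywhere
  on the slab.\<close>

lemma limit_estimates:
 assumes L: "in_Linf_L2loc T w" and w: "weak_star_tendsto T u w"
 shows "AE t in lebesgue_on {0<..<T}. in_L2 UNIV (%x. w t x - ub (x - sgm*t - Xi t)) &
   (LINT x|lebesgue. (w t x - ub (x - sgm*t - Xi t))^2) <= e0^2"
  "e0 = 0 ==> c0 = 0 ==> AE (t, x) in lebesgue_on ({0<..<T} \<times> UNIV). w t x = ub (x - sgm*t)"
proof -
 have eq: "ae t. t \<in> {0<..<T} --> (ae x. w t x - ub (x - sgm*t - Xi t) = g (t, x))"
  using limit_unique[OF L w] by eventually_elim (auto elim!: eventually_mono simp: w0_def)
 have "ae t. t \<in> {0<..<T} --> in_L2 UNIV (%x. w t x - ub (x - sgm*t - Xi t)) &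
   (LINT x|lebesgue. (w t x - ub (x - sgm*t - Xi t))^2) <= e0^2"
  using eq g_bound
 proof eventually_elim
  case (elim t)
  show ?case
  proof
   assume t: "t \<in> {0<..<T}"
   let ?f = "%x. w t x - ub (x - sgm*t - Xi t)"
   have ae: "ae x. ?f x = g (t, x)" and G: "sql (%x. g (t, x))" "nl (%x. g (t, x)) <= e0" using elim t by blast+
   have m: "bm (%x. g (t, x))" by (rule sections_measurable(3)[OF g_meas g_meas])
   note r = in_L2_rep[OF lebesgue_of_AE[OF ae m] m ae]
   have "(LINT x|lebesgue. (?f x)^2) = (L2_norm UNIV ?f)^2" by (simp add: L2_norm_def lebesgue_on_UNIV_eq)
   also have "... <= e0^2" unfolding r(2) by (rule power_mono[OF G(2)]) simp
   finally show "in_L2 UNIV ?f & (LINT x|lebesgue. (?f x)^2) <= e0^2" using r(1) G(1) by blast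
  qed
 qed
 thus "AE t in lebesgue_on {0<..<T}. in_L2 UNIV (%x. w t x - ub (x - sgm*t - Xi t)) &
   (LINT x|lebesgue. (w t x - ub (x - sgm*t - Xi t))^2) <= e0^2"
  unfolding AE_lebesgue_on_iff[OF borel_open[OF open_greaterThanLessThan]] .
 assume z: "e0 = 0" "c0 = 0"
 let ?S = "{0<..<T} \<times> (UNIV :: real set)"
 have wm: "(%(t, x). w t x) \<in> borel_measurable (lebesgue_on ?S)" using L by (simp add: in_Linf_L2loc_def)
 obtain h where h: "bm h" "ae z. indicator ?S z*w (fst z) (snd z) = (h z :: real)"
  using slab_rep[OF _ wm] by auto
 define q where "q z = indicator {0<..<T} (fst z)*ub (snd z - sgm*fst z - 0)" for z :: "real \<times> real"
 have qm: "bm q"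
  unfolding q_def by (rule slab_measurable(2)[of T "%_. 0", OF continuous_on_const W[of 0]])
 have "ae t. ae x. h (t, x) = q (t, x)"
  using AE_product_sections[OF h(2)] eq g_bound
 proof eventually_elim
  case (elim t)
  show ?case
  proof (cases "t \<in> {0<..<T}")
   case False
   thus ?thesis using elim(1) by (auto elim!: eventually_mono simp: q_def)
  next
   case True
   have X0: "Xi t = 0" using Xi_bound[of t] True z by simp
   have "sql (%x. g (t, x))" "nl (%x. g (t, x)) = 0" using elim(3) True z order_antisym[OF _ nrm_nonneg] by auto
   hence "ae x. (g (t, x))^2 = 0"
    unfolding nrm_def by (subst (asm) real_sqrt_eq_0_iff, subst (asm) integral_nonneg_eq_0_iff_AE) (auto simp: sqint_def)
   with elim(1) elim(2)[rule_format, OF True] show ?thesis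
    by eventually_elim (use True X0 in "auto simp: q_def")
  qed
 qed
 moreover have "{z \<in> space (lborel \<Otimes>\<^sub>M lborel). h z = q z} \<in> sets (lborel \<Otimes>\<^sub>M lborel)"
  using h(1) qm unfolding lborel_prod by measurable
 ultimately have "AE z in lborel \<Otimes>\<^sub>M lborel. h z = q z" by (intro lborel_pair.AE_pair_measure)
 hence "ae z. h z = q z" unfolding lborel_prod .
 with h(2) have "ae z. z \<in> ?S --> (case z of (t, x) => w t x = ub (x - sgm*t))"
  by eventually_elim (auto simp: q_def)
 thus "AE (t, x) in lebesgue_on ?S. w t x = ub (x - sgm*t)"
  by (subst AE_restrict_space_iff) (auto intro: AE_completion simp: open_Times borel_open)
qed

end

section \<open>Vanishing viscosity and dispersion\<close>

context shock_wave begin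

text \<open>The contraction is used in the locale instance for \<open>nu*eps\<close> and
  \<open>nu^2*delta\<close>, so the shift solves its equation directly at scale \<open>nu\<close>.
  One energy balance bounds both the deviation, by the initial distance \<open>E\<close> to the
  scaled profile, and the squared velocity, by \<open>E/(2*rate)\<close>.\<close>

lemma scaled_follow:
 assumes nu: "nu > 0" and T: "T > 0" and sol: "scaled_solution ul eps delta nu v u"
 defines "E == LINT x|lebesgue. (v x - ut (x / nu))^2"
 shows "EX W X X'. continuous_on ({0..} \<times> UNIV) (%(t, x). W t x) & (ALL t>=0. ae x. u t x = W t x) &
  continuous_on {0..T} X' & (\<forall>t\<in>{0..T}. X t = integral {0..t} X') & integral {0..T} (%t. (X' t)^2) <= E / (2*rate) &
  (\<forall>t\<in>{0..T}. sql (%x. W t x - es um up (x - sgm*t - X t)) &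
   nl (%x. W t x - es um up (x - sgm*t - X t)) <= sqrt E + sqrt nu*nl (%x. ut x - es um up x))"
proof -
 let ?ub = "es um up"
 interpret S: shock_wave "nu*eps" "nu^2*delta" um up sgm M "%x. ut (x / nu)" "%x. u1 (x / nu) / nu" "%x. u2 (x / nu) / nu^2" ul ul1
  by (rule shock_wave_scale[OF shock_wave_axioms nu])
 have G: "global_solution ul (nu*eps) (nu^2*delta) v u" using sol by (simp add: scaled_solution_def)
 obtain W D where W: "trajectory (nu*eps) (nu^2*delta) ul W D" "!!t. t >= 0 ==> ae x. u t x = W t x"
  using trajectory_exists[OF G ul_cont] by metis
 obtain X where X: "S.follows W T X" using S.follows_exists[OF W(1) T] ..
 define X' where "X' s = S.speed W s (X s)" for s
 have X'c: "continuous_on {0..T} X'" unfolding X'_def by (rule S.follows_continuous[OF W(1) X])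
 have Xi: "X t = integral {0..t} X'" if "t \<in> {0..T}" for t using X that by (simp add: S.follows_def X'_def[abs_def])
 have H: "sql (%x. W t x - ut ((x + d) / nu))" if "t >= 0" for t d by (rule H1D(2)[OF S.H1_perturbation(1)[OF W(1) that]])
 have E: "E = (nl (%x. W 0 x - ut (x / nu)))^2"
 proof -
  have "ae x. u 0 x = v x" using G by (simp add: global_solution_def AE_completion_iff)
  hence a: "ae x. (v x - ut (x / nu))^2 = (W 0 x - ut (x / nu))^2"
   using W(2)[OF order_refl] by eventually_elim simp
  have m: "bm (%x. (W 0 x - ut (x / nu))^2)"
   using borel_measurable_power[OF sqint_measurable[OF H[of 0 0]], of 2] by simp
  show ?thesis unfolding E_def nrm_sq by (rule lebesgue_integral_rep(1)[OF lebesgue_of_AE[OF a m] m a])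
 qed
 have C: "(nl (%x. W t x - ut ((x - sgm*t - X t) / nu)))^2 + 2*rate*integral {0..t} (%s. (X' s)^2) <= E"
  if "t \<in> {0..T}" for t
  using S.follows_contraction[OF W(1) X that] unfolding E X'_def .
 have I0: "0 <= 2*rate*integral {0..t} (%s. (X' s)^2)" if "t \<in> {0..T}" for t
 proof -
  have sub: "{0..t} \<subseteq> {0..T}" using that by simp
  have c: "continuous_on {0..t} X'" by (rule continuous_on_subset[OF X'c sub])
  have "continuous_on {0..t} (%s. (X' s)^2)" by (rule continuous_on_power[OF c])
  hence i: "(%s. (X' s)^2) integrable_on {0..t}" by (rule integrable_continuous_real)
  have "0 <= integral {0..t} (%s. (X' s)^2)"
   by (rule Henstock_Kurzweil_Integration.integral_nonneg[OF i]) simp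
  thus ?thesis using rate by simp
 qed
 have "T \<in> {0..T}" using T by simp
 from C[OF this] zero_le_power2[of "nl (%x. W T x - ut ((x - sgm*T - X T) / nu))"]
 have "2*rate*integral {0..T} (%s. (X' s)^2) <= E" by linarith
 hence I: "integral {0..T} (%s. (X' s)^2) <= E / (2*rate)" using rate by (simp add: field_simps)
 have Dv: "sql (%x. W t x - ?ub (x - sgm*t - X t)) & nl (%x. W t x - ?ub (x - sgm*t - X t)) <= sqrt E + sqrt nu*nl (%x. ut x - ?ub x)"
  if t: "t \<in> {0..T}" for t
 proof -
  let ?d = "- sgm*t - X t"
  have a: "x - sgm*t - X t = x + ?d" for x by simp
  have eb: "?ub (1 / nu*x) = ?ub x" for x using nu by (simp add: entropy_shock_def divide_less_0_iff)
  have s: "sql (%x. ut (x / nu) - ?ub x)" "nl (%x. ut (x / nu) - ?ub x) = sqrt nu*nl (%x. ut x - ?ub x)"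
   using sql_scale[OF ut_sq(3), of "1 / nu"] nu unfolding eb by (simp_all add: real_sqrt_divide mult.commute)
  have 1: "sql (%x. W t x - ut ((x + ?d) / nu))" "nl (%x. W t x - ut ((x + ?d) / nu)) <= sqrt E"
   using H[of t ?d] C[OF t] I0[OF t] t unfolding a by (auto intro!: real_le_rsqrt)
  have 2: "sql (%x. ut ((x + ?d) / nu) - ?ub (x + ?d))" "nl (%x. ut ((x + ?d) / nu) - ?ub (x + ?d)) = sqrt nu*nl (%x. ut x - ?ub x)"
   using sql_shift[OF s(1), of ?d] nl_shift[of "%x. ut (x / nu) - ?ub x" ?d] s(2) by simp_all
  show ?thesis unfolding a using sqint_add[OF 1(1) 2(1)] nrm_triangle[OF 1(1) 2(1)] 1(2) 2(2) by simp
 qed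
 show ?thesis
  by (rule exI[of _ W], rule exI[of _ X], rule exI[of _ X'])
   (use trajectory_continuous(1)[OF W(1) ul_cont] W(2) X'c Xi I Dv in blast)
qed

text \<open>Two successive extractions, first for the velocities on the line and then for the
  deviations on the plane. The bounds are uniform because well-preparedness makes the initial
  energies \<open>E k\<close> converge to \<open>E0\<close>.\<close>

lemma vanishing_extract:
 assumes T: "T > 0" and nu: "!!k. nu k > 0" "nu ----> 0"
  and wp: "well_prepared um up ul ut u0 v" and sol: "!!nu. nu > 0 ==> scaled_solution ul eps delta nu (v nu) (u nu)"
  and E0: "E0 = (LINT x|lebesgue. (u0 x - es um up x)^2)"
 shows "EX r W X X' e c p g. strict_mono r &
  vanishing_sequence um up sgm T (sqrt E0) (E0 / (2*rate)) W (%k. u (nu (r k))) X X' e c p g"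
proof -
 let ?ub = "es um up"
 define E where "E k = (LINT x|lebesgue. (v (nu k) x - ut (x / nu k))^2)" for k
 have "filterlim nu (at_right 0) sequentially"
  using nu(2) less_imp_neq[OF nu(1)] nu(1) by (auto simp: filterlim_at intro!: always_eventually)
 moreover have "((%nu. LINT x|lebesgue. (v nu x - ut (x / nu))^2) ---> E0) (at_right 0)"
  using wp unfolding well_prepared_def E0 by blast
 ultimately have El: "E ----> E0" unfolding E_def by (rule filterlim_compose[rotated])
 define e where "e k = sqrt (E k) + sqrt (nu k)*nl (%x. ut x - ?ub x)" for k
 have el: "e ----> sqrt E0"
 proof -
  have "e ----> sqrt E0 + sqrt 0*nl (%x. ut x - ?ub x)" unfolding e_def by (intro tendsto_intros El nu)
  thus ?thesis by simp
 qed
 define c where "c k = E k / (2*rate)" for k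
 have cl: "c ----> E0 / (2*rate)" unfolding c_def using rate by (intro tendsto_intros El) simp
 define Q where "Q k W X X' \<longleftrightarrow> continuous_on ({0..} \<times> UNIV) (%(t, x). W t x) & (ALL t>=0. ae x. u (nu k) t x = W t x) &
  continuous_on {0..T} X' & (\<forall>t\<in>{0..T}. X t = integral {0..t} X') & integral {0..T} (%t. (X' t)^2) <= c k &
  (\<forall>t\<in>{0..T}. sql (%x. W t x - ?ub (x - sgm*t - X t)) & nl (%x. W t x - ?ub (x - sgm*t - X t)) <= e k)"
  for k and W :: "real => real => real" and X X' :: "real => real"
 have "EX W X X'. Q k W X X'" for k
  using scaled_follow[OF nu(1)[of k] T sol[OF nu(1)[of k]]] unfolding Q_def c_def e_def E_def .
 then obtain W X X' where Q: "!!k. Q k (W k) (X k) (X' k)" by metis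
 have cX': "continuous_on {0..T} (X' k)" and Xi: "!!t. t \<in> {0..T} ==> X k t = integral {0..t} (X' k)" for k
  using Q[of k] unfolding Q_def by blast+
 have cW: "continuous_on ({0..} \<times> UNIV) (%(t, x). W k t x)" for k using Q[of k] unfolding Q_def by blast
 have uW: "ae x. u (nu k) t x = W k t x" if "t \<in> {0<..<T}" for k t using Q[of k] that unfolding Q_def by auto
 have cI: "integral {0..T} (%t. (X' k t)^2) <= c k" for k using Q[of k] unfolding Q_def by blast
 have dev: "sql (%x. W k t x - ?ub (x - sgm*t - X k t)) & nl (%x. W k t x - ?ub (x - sgm*t - X k t)) <= e k" if "t \<in> {0..T}" for k t
  using Q[of k] that unfolding Q_def by blast
 have cX: "continuous_on {0..T} (X k)" for k
 proof -
  have "continuous_on {0..T} (%t. integral {0..t} (X' k))" by (rule indefinite_integral_continuous_1[OF integrable_continuous_real[OF cX']])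
  thus ?thesis using Xi by (subst continuous_on_cong[OF refl]) auto
 qed
 have Bd: "EX B. ALL k. abs (f k) <= B" if "f ----> l" for f :: "nat => real" and l
  using convergent_imp_Bseq[OF convergentI[OF that]] by (auto simp: Bseq_def)
 obtain Bc where Bc: "!!k. abs (c k) <= Bc" using Bd[OF cl] by blast
 obtain Be where Be: "!!k. abs (e k) <= Be" using Bd[OF el] by blast
 have dX: "sql (%t. indicator {0..T} t*X' k t) & nl (%t. indicator {0..T} t*X' k t) <= sqrt Bc" for k
 proof -
  have q: "set_integrable lborel {0..T} (%s. (X' k s)^2)"
   by (rule borel_integrable_atLeastAtMost') (intro continuous_intros cX')
  have sq: "(%s. indicator {0..T} s *\<^sub>R (X' k s)^2) = (%s. (indicator {0..T} s * X' k s)^2)" by (auto simp: indicator_def)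
  have m: "bm (%s. indicator {0..T} s *\<^sub>R X' k s)"
   by (rule borel_measurable_continuous_on_indicator[OF _ cX']) simp
  have "(LBINT s. (indicator {0..T} s * X' k s)^2) <= Bc"
   using set_borel_integral_eq_integral(2)[OF q] cI[of k] Bc[of k] unfolding set_lebesgue_integral_def sq by simp
  thus ?thesis using m q unfolding set_integrable_def sq by (simp add: sqint_def nrm_def)
 qed
 have sf: "sigma_finite_measure (lborel :: real measure)" "sigma_finite_measure (lborel :: (real \<times> real) measure)"
  by (rule lborel.sigma_finite_measure_axioms)+
 obtain r1 p where r1: "strict_mono r1" "sql p"
  and p: "!!h. sql h ==> (%k. LBINT t. h t*(indicator {0..T} t*X' (r1 k) t)) ----> (LBINT t. h t*p t)"
  using weak_compactness[OF sf(1), of "%k t. indicator {0..T} t*X' k t" "sqrt Bc"] dX by blast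
 define f where "f k = deviation um up sgm T (W (r1 k)) (X (r1 k))" for k
 have df: "sqint lborel (f k) & nrm lborel (f k) <= sqrt (abs T*Be^2)" for k
 proof -
  have "(e (r1 k))^2 <= Be^2" using power_mono[OF Be[of "r1 k"] abs_ge_zero, of 2] by simp
  hence "sqrt (abs T*(e (r1 k))^2) <= sqrt (abs T*Be^2)" by (intro real_sqrt_le_mono mult_left_mono) auto
  thus ?thesis unfolding f_def using deviation(1,2)[OF cX[of "r1 k"] cW[of "r1 k"] dev[of _ "r1 k"]] by (meson order_trans)
 qed
 obtain r2 g where r2: "strict_mono r2" "sqint lborel g"
  and g: "!!h. sqint lborel h ==> (%k. \<integral>z. h z*f (r2 k) z \<partial>lborel) ----> (LINT z|lborel. h z*g z)"
  using weak_compactness[OF sf(2), of f "sqrt (abs T*Be^2)"] df by blast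
 define r where "r = r1 \<circ> r2"
 have r: "strict_mono r" unfolding r_def by (rule strict_mono_o[OF r1(1) r2(1)])
 have "vanishing_sequence um up sgm T (sqrt E0) (E0 / (2*rate)) (%k. W (r k)) (%k. u (nu (r k))) (%k. X (r k)) (%k. X' (r k)) (%k. e (r k)) (%k. c (r k)) p g"
 proof
  show "(%k. c (r k)) ----> E0 / (2*rate)" "(%k. e (r k)) ----> sqrt E0"
   using LIMSEQ_subseq_LIMSEQ[OF cl r] LIMSEQ_subseq_LIMSEQ[OF el r] by (simp_all add: o_def)
  show "(%k. LBINT t. h t*(indicator {0..T} t*X' (r k) t)) ----> (LBINT t. h t*p t)" if "sql h" for h
   using LIMSEQ_subseq_LIMSEQ[OF p[OF that] r2(1)] by (simp add: o_def r_def)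
  show "(%k. \<integral>z. h z*deviation um up sgm T (W (r k)) (X (r k)) z \<partial>lborel) ----> (LINT z|lborel. h z*g z)" if "sqint lborel h" for h
   using g[OF that] by (simp add: f_def r_def)
 qed (use T cW uW cX' Xi cI dev r1 r2 in auto)
 with r show ?thesis by blast
qed

theorem vanishing_limits:
 assumes T: "T > 0"
 shows "EX C>0. EX C'>0. ALL u0 E0 v u.
     in_L2 UNIV (%x. u0 x - es um up x) &
     E0 = (LINT x|lebesgue. (u0 x - es um up x)^2) &
     well_prepared um up ul ut u0 v &
     (ALL nu>0. scaled_solution ul eps delta nu (v nu) (u nu)) -->
      (EX w. vanishing_limit T u w) &
      (ALL w. vanishing_limit T u w -->
        (EX X. in_BV T X &
         (AE t in lebesgue_on {0<..<T}.
           in_L2 UNIV (%x. w t x - es um up (x - sgm*t - X t)) &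
           1/2*(LINT x|lebesgue.
            (w t x - es um up (x - sgm*t - X t))^2) <= C*E0) &
         (AE t in lebesgue_on {0<..<T}.
           abs (X t) <= C' / (um - up)*(E0 + sqrt E0))) &
        (E0 = 0 -->
         (AE (t, x) in lebesgue_on ({0<..<T} \<times> UNIV).
           w t x = es um up (x - sgm*t))))"
proof -
 \<comment> \<open>\<open>Xi_bound\<close> reads \<open>sqrt (T/(2*rate)) * sqrt E0\<close>; the
   factor \<open>um - up\<close> compensates the denominator in the claim, and adding 1 keeps the
   constant positive.\<close>
 define C' where "C' = (um - up) * sqrt (T / (2*rate)) + 1"
 have C': "C' > 0" unfolding C'_def using um_up T rate by (intro add_nonneg_pos mult_nonneg_nonneg) auto
 show ?thesis
 \<comment> \<open>The slice bound for the squared deviation is \<open>E0\<close> itself, so 1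
   serves as the first constant.\<close>
 proof (rule exI[of _ 1], intro conjI zero_less_one, rule exI[of _ C'], intro conjI C', intro allI impI, elim conjE)
  fix u0 E0 v u
  assume E0: "E0 = (LINT x|lebesgue. (u0 x - es um up x)^2)" and wp: "well_prepared um up ul ut u0 v"
   and sol: "ALL nu>0. scaled_solution ul eps delta nu (v nu) (u nu)"
  have E0n: "E0 >= 0" unfolding E0 by (rule Bochner_Integration.integral_nonneg) simp
  note ext = vanishing_extract[OF T _ _ wp sol[rule_format] E0]
  have ex: "EX w. vanishing_limit T u w"
  proof -
   define nu where "nu k = inverse (real (Suc k))" for k
   have nu: "nu k > 0" "nu ----> 0" for k unfolding nu_def using LIMSEQ_inverse_real_of_nat by auto
   obtain r W X X' e c p g where r: "strict_mono r"
    and V: "vanishing_sequence um up sgm T (sqrt E0) (E0 / (2*rate)) W (%k. u (nu (r k))) X X' e c p g"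
    using ext[OF nu] by blast
   interpret V: vanishing_sequence um up sgm T "sqrt E0" "E0 / (2*rate)" W "%k. u (nu (r k))" X X' e c p g by (rule V)
   have "(%k. nu (r k)) ----> 0" using LIMSEQ_subseq_LIMSEQ[OF nu(2) r] by (simp add: o_def)
   hence "vanishing_limit T u V.w0"
    unfolding vanishing_limit_def using V.w0_Linf V.w0_weak_star nu(1) by (intro conjI exI[of _ "%k. nu (r k)"]) auto
   thus ?thesis by blast
  qed
  have est: "(EX X. in_BV T X &
     (AE t in lebesgue_on {0<..<T}. in_L2 UNIV (%x. w t x - es um up (x - sgm*t - X t)) &
       1/2*(LINT x|lebesgue. (w t x - es um up (x - sgm*t - X t))^2) <= 1*E0) &
     (AE t in lebesgue_on {0<..<T}. abs (X t) <= C' / (um - up)*(E0 + sqrt E0))) &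
    (E0 = 0 --> (AE (t, x) in lebesgue_on ({0<..<T} \<times> UNIV). w t x = es um up (x - sgm*t)))"
   if w: "vanishing_limit T u w" for w
  proof -
   obtain nu where L: "in_Linf_L2loc T w" and nu: "!!k. nu k > 0" "nu ----> 0" and ws: "weak_star_tendsto T (%k. u (nu k)) w"
    using w unfolding vanishing_limit_def by blast
   \<comment> \<open>The extraction is repeated along the sequence that belongs to the given limit;
     passing to a subsequence does not change that limit.\<close>
   obtain r W X X' e c p g where r: "strict_mono r"
    and V: "vanishing_sequence um up sgm T (sqrt E0) (E0 / (2*rate)) W (%k. u (nu (r k))) X X' e c p g"
    using ext[OF nu] by blast
   interpret V: vanishing_sequence um up sgm T "sqrt E0" "E0 / (2*rate)" W "%k. u (nu (r k))" X X' e c p g by (rule V)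
   have ws': "weak_star_tendsto T (%k. u (nu (r k))) w"
    using ws LIMSEQ_subseq_LIMSEQ[OF _ r] unfolding weak_star_tendsto_def o_def by fast
   note est = V.limit_estimates[OF L ws']
   have X: "abs (prim p t) <= C' / (um - up)*(E0 + sqrt E0)" if "t \<in> {0<..<T}" for t
   proof -
    have "abs (prim p t) <= sqrt (T*(E0 / (2*rate)))" using that by (intro V.Xi_bound) auto
    also have "... = sqrt (T / (2*rate)) * sqrt E0" by (simp add: real_sqrt_mult[symmetric])
    also have "... <= C' / (um - up)*(E0 + sqrt E0)"
    proof (rule mult_mono)
     show "sqrt (T / (2*rate)) <= C' / (um - up)" using um_up by (simp add: C'_def pos_le_divide_eq mult.commute)
    qed (use E0n C' um_up in auto)
    finally show ?thesis .
   qed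
   show ?thesis
   proof (intro conjI exI[of _ "prim p"] impI)
    show "in_BV T (prim p)" by (rule prim_in_BV[OF V.p(1) T])
    show "AE t in lebesgue_on {0<..<T}. in_L2 UNIV (%x. w t x - es um up (x - sgm*t - prim p t)) &
       1/2*(LINT x|lebesgue. (w t x - es um up (x - sgm*t - prim p t))^2) <= 1*E0"
     using est(1)
    proof eventually_elim
     case (elim t)
     have "(sqrt E0)^2 = E0" using E0n by simp
     thus ?case using elim E0n by auto
    qed
    show "AE t in lebesgue_on {0<..<T}. abs (prim p t) <= C' / (um - up)*(E0 + sqrt E0)" by (rule AE_I2) (use X in simp)
    show "AE (t, x) in lebesgue_on ({0<..<T} \<times> UNIV). w t x = es um up (x - sgm*t)" if "E0 = 0"
     by (rule est(2)) (use that in simp_all)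
   qed
  qed
  show "(EX w. vanishing_limit T u w) & (ALL w. vanishing_limit T u w -->
        (EX X. in_BV T X &
         (AE t in lebesgue_on {0<..<T}.
           in_L2 UNIV (%x. w t x - es um up (x - sgm*t - X t)) &
           1/2*(LINT x|lebesgue.
            (w t x - es um up (x - sgm*t - X t))^2) <= 1*E0) &
         (AE t in lebesgue_on {0<..<T}.
           abs (X t) <= C' / (um - up)*(E0 + sqrt E0))) &
        (E0 = 0 -->
         (AE (t, x) in lebesgue_on ({0<..<T} \<times> UNIV).
           w t x = es um up (x - sgm*t))))"
   using ex est by blast
 qed
qed

end

theorem theorem1p4:
  fixes \<epsilon> \<delta> um up \<sigma> M :: real and ut ul :: "real \<Rightarrow> real"
  assumes "\<epsilon> > 0" and "\<delta> > 0" and "um > up"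
    and "1/4 < \<delta> * (um - up) / (2 * \<epsilon>\<^sup>2)" and "\<delta> * (um - up) / (2 * \<epsilon>\<^sup>2) < 1/2"
    and "\<sigma> = (um + up) / 2"
    and "viscous_dispersive_shock \<epsilon> \<delta> \<sigma> um up ut"
    and "\<not> mono ut" and "\<not> antimono ut"
    and "ut 0 = (um + up) / 2"
    and "reference_profile um up ul"
    and "M \<ge> 4/3"
  shows
    "(\<forall>u0. in_H 1 (\<lambda>x. u0 x - ut x) \<longrightarrow>
        (\<exists>C>0. \<forall>u X. scaled_solution ul \<epsilon> \<delta> 1 u0 u \<and> shift_function M \<sigma> um up ut u X \<longrightarrow>
           (\<forall>\<nu>>0. \<forall>w. scaled_solution ul \<epsilon> \<delta> \<nu> (\<lambda>x. u0 (x / \<nu>)) w \<longrightarrow>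
              (\<forall>t>0.
                 in_L2 UNIV (\<lambda>x. w t x - entropy_shock um up (x - \<sigma> * t - \<nu> * X (t / \<nu>))) \<and>
                 L2_norm UNIV (\<lambda>x. w t x - entropy_shock um up (x - \<sigma> * t - \<nu> * X (t / \<nu>)))
                   \<le> L2_norm UNIV (\<lambda>x. u0 x - entropy_shock um up x) + C * sqrt \<nu>))))
     \<and> (\<forall>u0. in_L2 UNIV (\<lambda>x. u0 x - entropy_shock um up x) \<longrightarrow>
          (\<exists>v. well_prepared um up ul ut u0 v))
     \<and> (\<forall>T>0. \<exists>C>0. \<exists>C'>0. \<forall>u0 E0 v u.
          in_L2 UNIV (\<lambda>x. u0 x - entropy_shock um up x) \<and>
          E0 = (LINT x|lebesgue. (u0 x - entropy_shock um up x)\<^sup>2) \<and>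
          well_prepared um up ul ut u0 v \<and>
          (\<forall>\<nu>>0. scaled_solution ul \<epsilon> \<delta> \<nu> (v \<nu>) (u \<nu>)) \<longrightarrow>
            (\<exists>w. vanishing_limit T u w) \<and>
            (\<forall>w. vanishing_limit T u w \<longrightarrow>
               (\<exists>X. in_BV T X \<and>
                  (AE t in lebesgue_on {0<..<T}.
                     in_L2 UNIV (\<lambda>x. w t x - entropy_shock um up (x - \<sigma> * t - X t)) \<and>
                     1/2 * (LINT x|lebesgue.
                        (w t x - entropy_shock um up (x - \<sigma> * t - X t))\<^sup>2) \<le> C * E0) \<and>
                  (AE t in lebesgue_on {0<..<T}.
                     \<bar>X t\<bar> \<le> C' / (um - up) * (E0 + sqrt E0))) \<and>
               (E0 = 0 \<longrightarrow>
                  (AE (t, x) in lebesgue_on ({0<..<T} \<times> UNIV).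
                     w t x = entropy_shock um up (x - \<sigma> * t)))))"
proof -
  interpret shock_wave \<epsilon> \<delta> um up \<sigma> M ut "deriv ut" "(deriv ^^ 2) ut" ul "deriv ul"
    by (rule shock_wave_of_shock) fact+
  show ?thesis
    using shock_stability well_prepared_exists[OF assms(11)] vanishing_limits by blast
qed


end
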